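(* Let $G$ be a locally compact group, and let $p\in(1,\infty)$. Let $A$ be a Banach algebra satisfying $PF_p(G)\subseteq A\subseteq CV_p(G)$ (that is, a norm-closed subalgebra of $\mathcal{B}(L^p(G))$ lying between these two). Then the following are equivalent: 1. $A$ is reflexive (as a Banach space) and amenable (as a Banach algebra); 2. $A$ is finite-dimensional; 3. $G$ is finite. In particular, if any such $A$ is reflexive and amenable, then $G$ is finite.
   Context: Fix a left Haar measure on $G$. For $f\in L^1(G)$, $\lambda_p(f)$ is the operator $\xi\mapsto f\ast\xi$ on $L^p(G)$, and $\rho_p(s)(\xi)(t)=\xi(ts)$ for $s,t\in G$. $PF_p(G)$ is the operator-norm closure of $\lambda_p(L^1(G))$ in $\mathcal{B}(L^p(G))$, and $CV_p(G)=\{a\in\mathcal{B}(L^p(G)) : a\rho_p(s)=\rho_p(s)a\text{ for all }s\in G\}$. A Banach algebra $A$ is amenable if, with $\pi\colon A\widehat{\otimes}A\to A$ the multiplication map $\pi(a\otimes b)=ab$, there is $m\in(A\widehat{\otimes}A)^{**}$ such that $am=ma$ and $\pi^{**}(m)a=a$ for all $a\in A$ (for the canonical $A$-bimodule structures). *)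

theory Defs
  imports "HOL-Analysis.Analysis" "HOL-Algebra.Module" "HOL-Library.Poly_Mapping"
begin

section \<open>Complex normed spaces and normed algebras with carriers\<close>

text \<open>
  The space $L^p(G)$ depends on the measure and on the exponent, so it cannot be a HOL type;
  normed spaces are therefore records extending the module records of the algebra library.
  The ring fields \<open>mult\<close> and \<open>one\<close> are meaningful only when the record describes a normed
  algebra (\<open>one\<close> is never used, as algebras need not be unital); otherwise they are
  \<open>undefined\<close>.
\<close>

record 'v nspace = "(complex, 'v) module" +
  nrm :: "'v \<Rightarrow> real"

definition complex_space :: "complex nspace" where
  "complex_space = \<lparr>carrier = UNIV, mult = (*), one = 1, zero = 0, add = (+),
     smult = (*), nrm = cmod\<rparr>"

definition norm_closure :: "'v nspace \<Rightarrow> 'v set \<Rightarrow> 'v set" where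
  "norm_closure X S = {x \<in> carrier X. \<forall>e>0. \<exists>y\<in>S. nrm X (x \<ominus>\<^bsub>X\<^esub> y) < e}"

definition closed_subalgebra :: "'v set \<Rightarrow> 'v nspace \<Rightarrow> bool" where
  "closed_subalgebra S X \<longleftrightarrow>
     submodule S complex_space X \<and> (\<forall>x\<in>S. \<forall>y\<in>S. x \<otimes>\<^bsub>X\<^esub> y \<in> S) \<and> norm_closure X S \<subseteq> S"

definition finite_dimensional :: "'v nspace \<Rightarrow> bool" where
  "finite_dimensional X \<longleftrightarrow>
     (\<exists>S. finite S \<and> S \<subseteq> carrier X \<and>
        (\<forall>x\<in>carrier X. \<exists>c. x = (\<Oplus>\<^bsub>X\<^esub>s\<in>S. c s \<odot>\<^bsub>X\<^esub> s)))"


subsection \<open>Hausdorff quotient and completion of a seminormed space\<close>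

definition null_class :: "'v nspace \<Rightarrow> 'v \<Rightarrow> 'v set" where
  "null_class X x = {y \<in> carrier X. nrm X (x \<ominus>\<^bsub>X\<^esub> y) = 0}"

definition repr :: "'v set \<Rightarrow> 'v" where
  "repr C = (SOME x. x \<in> C)"

definition hausdorff_quotient :: "'v nspace \<Rightarrow> 'v set nspace" where
  "hausdorff_quotient X = \<lparr>carrier = null_class X ` carrier X,
     mult = undefined, one = undefined,
     zero = null_class X \<zero>\<^bsub>X\<^esub>,
     add = (\<lambda>C D. null_class X (repr C \<oplus>\<^bsub>X\<^esub> repr D)),
     smult = (\<lambda>c C. null_class X (c \<odot>\<^bsub>X\<^esub> repr C)),
     nrm = (\<lambda>C. nrm X (repr C))\<rparr>"

definition cauchy_sequences :: "'v nspace \<Rightarrow> (nat \<Rightarrow> 'v) nspace" where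
  "cauchy_sequences X = \<lparr>
     carrier = {u. (\<forall>n. u n \<in> carrier X) \<and>
                   (\<forall>e>0. \<exists>N. \<forall>m\<ge>N. \<forall>n\<ge>N. nrm X (u m \<ominus>\<^bsub>X\<^esub> u n) < e)},
     mult = undefined, one = undefined,
     zero = (\<lambda>n. \<zero>\<^bsub>X\<^esub>),
     add = (\<lambda>u v n. u n \<oplus>\<^bsub>X\<^esub> v n),
     smult = (\<lambda>c u n. c \<odot>\<^bsub>X\<^esub> u n),
     nrm = (\<lambda>u. lim (\<lambda>n. nrm X (u n)))\<rparr>"

definition completion :: "'v nspace \<Rightarrow> (nat \<Rightarrow> 'v) set nspace" where
  "completion X = hausdorff_quotient (cauchy_sequences X)"

definition completion_embedding :: "'v nspace \<Rightarrow> 'v \<Rightarrow> (nat \<Rightarrow> 'v) set" where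
  "completion_embedding X x = null_class (cauchy_sequences X) (\<lambda>n. x)"


subsection \<open>Bounded operators, duals and reflexivity\<close>

text \<open>Operators are extensional functions, so that equality of functions is equality of operators.\<close>

definition bounded_operators :: "'v nspace \<Rightarrow> 'w nspace \<Rightarrow> ('v \<Rightarrow> 'w) nspace" where
  "bounded_operators X Y = \<lparr>
     carrier = {T \<in> carrier X \<rightarrow>\<^sub>E carrier Y.
       (\<forall>x\<in>carrier X. \<forall>y\<in>carrier X. T (x \<oplus>\<^bsub>X\<^esub> y) = T x \<oplus>\<^bsub>Y\<^esub> T y) \<and>
       (\<forall>c. \<forall>x\<in>carrier X. T (c \<odot>\<^bsub>X\<^esub> x) = c \<odot>\<^bsub>Y\<^esub> T x) \<and>
       (\<exists>K. \<forall>x\<in>carrier X. nrm Y (T x) \<le> K * nrm X x)},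
     mult = undefined, one = undefined,
     zero = (\<lambda>x\<in>carrier X. \<zero>\<^bsub>Y\<^esub>),
     add = (\<lambda>S T. \<lambda>x\<in>carrier X. S x \<oplus>\<^bsub>Y\<^esub> T x),
     smult = (\<lambda>c T. \<lambda>x\<in>carrier X. c \<odot>\<^bsub>Y\<^esub> T x),
     nrm = (\<lambda>T. SUP x\<in>{x \<in> carrier X. nrm X x \<le> 1}. nrm Y (T x))\<rparr>"

definition operator_algebra :: "'v nspace \<Rightarrow> ('v \<Rightarrow> 'v) nspace" where
  "operator_algebra X = (bounded_operators X X)
     \<lparr>mult := compose (carrier X), one := (\<lambda>x\<in>carrier X. x)\<rparr>"

definition dual :: "'v nspace \<Rightarrow> ('v \<Rightarrow> complex) nspace" where
  "dual X = bounded_operators X complex_space"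

abbreviation bidual :: "'v nspace \<Rightarrow> (('v \<Rightarrow> complex) \<Rightarrow> complex) nspace" where
  "bidual X \<equiv> dual (dual X)"

definition bidual_embedding :: "'v nspace \<Rightarrow> 'v \<Rightarrow> ('v \<Rightarrow> complex) \<Rightarrow> complex" where
  "bidual_embedding X x = (\<lambda>f\<in>carrier (dual X). f x)"

definition reflexive :: "'v nspace \<Rightarrow> bool" where
  "reflexive X \<longleftrightarrow> bidual_embedding X ` carrier X = carrier (bidual X)"

definition adjoint_map ::
  "'v nspace \<Rightarrow> 'w nspace \<Rightarrow> ('v \<Rightarrow> 'w) \<Rightarrow> ('w \<Rightarrow> complex) \<Rightarrow> 'v \<Rightarrow> complex" where
  "adjoint_map X Y T = (\<lambda>f\<in>carrier (dual Y). compose (carrier X) f T)"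

definition biadjoint_map ::
  "'v nspace \<Rightarrow> 'w nspace \<Rightarrow> ('v \<Rightarrow> 'w) \<Rightarrow>
     (('v \<Rightarrow> complex) \<Rightarrow> complex) \<Rightarrow> ('w \<Rightarrow> complex) \<Rightarrow> complex" where
  "biadjoint_map X Y T = adjoint_map (dual Y) (dual X) (adjoint_map X Y T)"


subsection \<open>The projective tensor product\<close>

text \<open>
  The algebraic tensor product is the space of formal complex combinations of pairs modulo the
  subspace \<open>tensor_relations\<close>.  The projective norm is pulled back to a seminorm on the formal
  combinations; its kernel is \<open>tensor_relations\<close>, and the passage to the quotient takes place in
  the Hausdorff quotient that is part of the completion.
\<close>

type_synonym ('v, 'w) formal_tensor = "'v \<times> 'w \<Rightarrow>\<^sub>0 complex"

abbreviation pure :: "'v \<Rightarrow> 'w \<Rightarrow> ('v, 'w) formal_tensor" where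
  "pure x y \<equiv> Poly_Mapping.single (x, y) 1"

abbreviation scale_tensor ::
  "complex \<Rightarrow> ('v, 'w) formal_tensor \<Rightarrow> ('v, 'w) formal_tensor" where
  "scale_tensor c u \<equiv> Poly_Mapping.map ((*) c) u"

inductive_set tensor_relations :: "'v nspace \<Rightarrow> 'w nspace \<Rightarrow> ('v, 'w) formal_tensor set"
  for X :: "'v nspace" and Y :: "'w nspace" where
  zero: "0 \<in> tensor_relations X Y"
| add: "u \<in> tensor_relations X Y \<Longrightarrow> v \<in> tensor_relations X Y \<Longrightarrow> u + v \<in> tensor_relations X Y"
| scale: "u \<in> tensor_relations X Y \<Longrightarrow> scale_tensor c u \<in> tensor_relations X Y"
| add_left: "x \<in> carrier X \<Longrightarrow> x' \<in> carrier X \<Longrightarrow> y \<in> carrier Y \<Longrightarrow>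
    pure (x \<oplus>\<^bsub>X\<^esub> x') y - pure x y - pure x' y \<in> tensor_relations X Y"
| add_right: "x \<in> carrier X \<Longrightarrow> y \<in> carrier Y \<Longrightarrow> y' \<in> carrier Y \<Longrightarrow>
    pure x (y \<oplus>\<^bsub>Y\<^esub> y') - pure x y - pure x y' \<in> tensor_relations X Y"
| scale_left: "x \<in> carrier X \<Longrightarrow> y \<in> carrier Y \<Longrightarrow>
    pure (c \<odot>\<^bsub>X\<^esub> x) y - scale_tensor c (pure x y) \<in> tensor_relations X Y"
| scale_right: "x \<in> carrier X \<Longrightarrow> y \<in> carrier Y \<Longrightarrow>
    pure x (c \<odot>\<^bsub>Y\<^esub> y) - scale_tensor c (pure x y) \<in> tensor_relations X Y"

definition projective_seminorm ::
  "'v nspace \<Rightarrow> 'w nspace \<Rightarrow> ('v, 'w) formal_tensor \<Rightarrow> real" where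
  "projective_seminorm X Y u =
     Inf {(\<Sum>(x, y)\<leftarrow>ps. nrm X x * nrm Y y) |ps.
            set ps \<subseteq> carrier X \<times> carrier Y \<and>
            u - (\<Sum>(x, y)\<leftarrow>ps. pure x y) \<in> tensor_relations X Y}"

definition formal_tensors :: "'v nspace \<Rightarrow> 'w nspace \<Rightarrow> ('v, 'w) formal_tensor nspace" where
  "formal_tensors X Y = \<lparr>carrier = {u. Poly_Mapping.keys u \<subseteq> carrier X \<times> carrier Y},
     mult = undefined, one = undefined, zero = 0, add = (+),
     smult = scale_tensor, nrm = projective_seminorm X Y\<rparr>"

definition projective_tensor ::
  "'v nspace \<Rightarrow> 'w nspace \<Rightarrow> (nat \<Rightarrow> ('v, 'w) formal_tensor) set nspace" where
  "projective_tensor X Y = completion (formal_tensors X Y)"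

definition elementary_tensor ::
  "'v nspace \<Rightarrow> 'w nspace \<Rightarrow> 'v \<Rightarrow> 'w \<Rightarrow> (nat \<Rightarrow> ('v, 'w) formal_tensor) set" where
  "elementary_tensor X Y x y = completion_embedding (formal_tensors X Y) (pure x y)"

text \<open>
  The linearization of a bounded bilinear map; existence and uniqueness are the universal property
  of the projective tensor product, for a target space that is complete.
\<close>

definition linearize ::
  "'v nspace \<Rightarrow> 'w nspace \<Rightarrow> 'z nspace \<Rightarrow> ('v \<Rightarrow> 'w \<Rightarrow> 'z) \<Rightarrow>
     (nat \<Rightarrow> ('v, 'w) formal_tensor) set \<Rightarrow> 'z" where
  "linearize X Y Z \<phi> =
     (THE T. T \<in> carrier (bounded_operators (projective_tensor X Y) Z) \<and>
        (\<forall>x\<in>carrier X. \<forall>y\<in>carrier Y. T (elementary_tensor X Y x y) = \<phi> x y))"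


subsection \<open>Amenability\<close>

definition multiplication_map ::
  "'a nspace \<Rightarrow> (nat \<Rightarrow> ('a, 'a) formal_tensor) set \<Rightarrow> 'a" where
  "multiplication_map A = linearize A A A (\<lambda>x y. x \<otimes>\<^bsub>A\<^esub> y)"

definition left_action ::
  "'a nspace \<Rightarrow> 'a \<Rightarrow> (nat \<Rightarrow> ('a, 'a) formal_tensor) set \<Rightarrow> (nat \<Rightarrow> ('a, 'a) formal_tensor) set"
  where
  "left_action A a =
     linearize A A (projective_tensor A A) (\<lambda>x y. elementary_tensor A A (a \<otimes>\<^bsub>A\<^esub> x) y)"

definition right_action ::
  "'a nspace \<Rightarrow> 'a \<Rightarrow> (nat \<Rightarrow> ('a, 'a) formal_tensor) set \<Rightarrow> (nat \<Rightarrow> ('a, 'a) formal_tensor) set"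
  where
  "right_action A a =
     linearize A A (projective_tensor A A) (\<lambda>x y. elementary_tensor A A x (y \<otimes>\<^bsub>A\<^esub> a))"

text \<open>
  For an $A$-bimodule $E$, the dual actions are $(f \cdot a)(x) = f(a \cdot x)$ and
  $(a \cdot f)(x) = f(x \cdot a)$.  Applying this twice, left (right) multiplication by $a$ on the
  second dual is the second adjoint of left (right) multiplication by $a$ on $E$.  Both
  defining conditions are stated in this form, the second one in the second dual of $A$, into which
  $A$ is canonically embedded.
\<close>

definition amenable :: "'a nspace \<Rightarrow> bool" where
  "amenable A \<longleftrightarrow>
     (let E = projective_tensor A A in
      \<exists>m\<in>carrier (bidual E). \<forall>a\<in>carrier A.
        biadjoint_map E E (left_action A a) m = biadjoint_map E E (right_action A a) m \<and>
        biadjoint_map A A (\<lambda>x\<in>carrier A. x \<otimes>\<^bsub>A\<^esub> a)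
          (biadjoint_map E A (multiplication_map A) m) = bidual_embedding A a)"


section \<open>Operators on $L^p$ of a locally compact group\<close>

text \<open>
  The class \<open>topological_group_add\<close> does not assume commutativity: $st$ is written \<open>s + t\<close> and
  $s^{-1}$ is written \<open>- s\<close>.  A left Haar measure is a nonzero left-invariant Radon measure on
  the Borel sets (outer regular on Borel sets, inner regular on open sets, finite on
  compact sets).
\<close>

definition left_haar_measure :: "'g::{topological_group_add, t2_space} measure \<Rightarrow> bool" where
  "left_haar_measure \<mu> \<longleftrightarrow>
     sets \<mu> = sets borel \<and>
     emeasure \<mu> UNIV \<noteq> 0 \<and>
     (\<forall>K. compact K \<longrightarrow> emeasure \<mu> K < \<infinity>) \<and>
     (\<forall>B\<in>sets borel. emeasure \<mu> B = (INF U\<in>{U. open U \<and> B \<subseteq> U}. emeasure \<mu> U)) \<and>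
     (\<forall>U. open U \<longrightarrow> emeasure \<mu> U = (SUP K\<in>{K. compact K \<and> K \<subseteq> U}. emeasure \<mu> K)) \<and>
     (\<forall>s. \<forall>B\<in>sets borel. emeasure \<mu> ((+) s ` B) = emeasure \<mu> B)"

definition Lp_functions :: "'g measure \<Rightarrow> real \<Rightarrow> ('g \<Rightarrow> complex) nspace" where
  "Lp_functions \<mu> p = \<lparr>
     carrier = {f \<in> borel_measurable \<mu>. integrable \<mu> (\<lambda>t. cmod (f t) powr p)},
     mult = undefined, one = undefined,
     zero = (\<lambda>t. 0),
     add = (\<lambda>f g t. f t + g t),
     smult = (\<lambda>c f t. c * f t),
     nrm = (\<lambda>f. (\<integral>t. cmod (f t) powr p \<partial>\<mu>) powr (1 / p))\<rparr>"

definition Lp :: "'g measure \<Rightarrow> real \<Rightarrow> ('g \<Rightarrow> complex) set nspace" where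
  "Lp \<mu> p = hausdorff_quotient (Lp_functions \<mu> p)"

definition convolution ::
  "'g::group_add measure \<Rightarrow> ('g \<Rightarrow> complex) \<Rightarrow> ('g \<Rightarrow> complex) \<Rightarrow> 'g \<Rightarrow> complex" where
  "convolution \<mu> f \<xi> t = (\<integral>s. f s * \<xi> (- s + t) \<partial>\<mu>)"

definition left_regular ::
  "'g::group_add measure \<Rightarrow> real \<Rightarrow> ('g \<Rightarrow> complex) \<Rightarrow> ('g \<Rightarrow> complex) set \<Rightarrow> ('g \<Rightarrow> complex) set"
  where
  "left_regular \<mu> p f =
     (\<lambda>C\<in>carrier (Lp \<mu> p). null_class (Lp_functions \<mu> p) (convolution \<mu> f (repr C)))"

definition right_translation ::
  "'g::group_add measure \<Rightarrow> real \<Rightarrow> 'g \<Rightarrow> ('g \<Rightarrow> complex) set \<Rightarrow> ('g \<Rightarrow> complex) set" where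
  "right_translation \<mu> p s =
     (\<lambda>C\<in>carrier (Lp \<mu> p). null_class (Lp_functions \<mu> p) (\<lambda>t. repr C (t + s)))"

definition PF ::
  "'g::group_add measure \<Rightarrow> real \<Rightarrow> (('g \<Rightarrow> complex) set \<Rightarrow> ('g \<Rightarrow> complex) set) set" where
  "PF \<mu> p = norm_closure (operator_algebra (Lp \<mu> p)) (left_regular \<mu> p ` {f. integrable \<mu> f})"

definition CV ::
  "'g::group_add measure \<Rightarrow> real \<Rightarrow> (('g \<Rightarrow> complex) set \<Rightarrow> ('g \<Rightarrow> complex) set) set" where
  "CV \<mu> p = {a \<in> carrier (operator_algebra (Lp \<mu> p)).
     \<forall>s. a \<otimes>\<^bsub>operator_algebra (Lp \<mu> p)\<^esub> right_translation \<mu> p s =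
         right_translation \<mu> p s \<otimes>\<^bsub>operator_algebra (Lp \<mu> p)\<^esub> a}"

end

theory Submission
  imports Defs "HOL-Probability.Giry_Monad"
begin

text \<open>
  If $G$ is not discrete, reflexivity alone is contradictory, by Grothendieck's double limit criterion:
  for the normalized indicator $f_C$ of a compact set $C$ and for a symmetric open set $V$, the numbers
  $\mu(V)^{-1} \langle \lambda_p(f_C) 1_V, 1_V \rangle$ tend to $1$ as $C$ shrinks to the identity and to
  $0$ as $V$ does.

  If $G$ is discrete, a virtual diagonal $m$ gives a translation-invariant functional
  $\Phi(w) = m((x, y) \mapsto \langle x M_w y \delta_e, \delta_e \rangle)$ on the bounded functions, where
  $M_w$ is multiplication by $w$.  It produces almost invariant functions $h \geq 0$ of finite support.  Each
  state $a \mapsto \langle a h^{1/p}, h^{1/q} \rangle / \sum h$ vanishes at $\lambda_p(s)$ for all but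
  finitely many $s$, but these states tend to $1$ at every $\lambda_p(s)$; so the double limit criterion
  rules out that $G$ is infinite.

  A finite-dimensional algebra is reflexive, hence $G$ is discrete, and then $G$ is finite because the
  coefficients of an element of $A$ vanish at infinity while those of the $\lambda_p(s)$ do not do so
  uniformly.  If $G$ is finite, then $A$ is spanned by the $\lambda_p(s)$ and has the diagonal
  $|G|^{-1} \sum_s \lambda_p(s) \otimes \lambda_p(s^{-1})$.
\<close>

section \<open>Seminormed spaces as records\<close>

text \<open>Nothing countable is assumed of G, so filters replace sequences and there is no product
  measure to apply Fubini to: in the non-discrete case only normalized indicators of compact sets
  are convolved with, and their contractivity comes from regularity. The inclusion of
  \<open>PF\<close> supplies the test operators, namely these averages or, on a discrete group, the
  translations. The inclusion in \<open>CV\<close> says that elements of A commute with right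
  translations; this turns the substitution x, y -> \<open>lam g\<close> x, y
  \<open>lam (- g)\<close> into a shift of w in the functional \<Phi>, and it expands A in the
  \<open>lam g\<close> when G is finite. The product of h^(1/p) and h^(1/q) is h, so almost
  invariance in the sum norm passes to the states for every p, through |x - y^(1/p) x^(1/q)| <= |x -
  y|. Weak cluster points need no ultrafilter: Hahn--Banach extends the limit along a filter to all
  bounded functions, and reflexivity turns the result into a point. The multiplication map on the
  tensor square is an extension by continuity and wants A complete; completeness is drawn from
  reflexivity.\<close>

lemma complex_space_simps [simp]:
  "carrier complex_space = UNIV" "zero complex_space = 0" "one complex_space = 1"
  "add complex_space = (+)" "mult complex_space = (*)" "smult complex_space = (*)"
  "nrm complex_space = cmod"
  by (simp_all add: complex_space_def)

lemma cring_complex_space: "cring complex_space"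
proof (rule cringI)
  show "abelian_group complex_space"
  proof (rule abelian_groupI)
    fix x :: complex
    show "\<exists>y\<in>carrier complex_space. y \<oplus>\<^bsub>complex_space\<^esub> x = \<zero>\<^bsub>complex_space\<^esub>"
      by (rule bexI[of _ "- x"]) auto
  qed auto
  show "Group.comm_monoid complex_space"
    by (rule comm_monoidI) auto
qed (auto simp: algebra_simps)

text \<open>Seminorms come first because p-integrable functions, Cauchy sequences, formal tensors
  and bounded functions with an eventual bound carry only seminorms. The first three become normed
  in a Hausdorff quotient; the last is just a domain for Hahn--Banach.\<close>

locale seminormed_space =
  fixes X :: "'v nspace" (structure)
  assumes is_module: "Module.module complex_space X"
    and nrm_nonneg: "x \<in> carrier X \<Longrightarrow> 0 \<le> nrm X x"
    and nrm_smult: "x \<in> carrier X \<Longrightarrow> nrm X (c \<odot> x) = cmod c * nrm X x"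
    and nrm_triangle: "x \<in> carrier X \<Longrightarrow> y \<in> carrier X \<Longrightarrow> nrm X (x \<oplus> y) \<le> nrm X x + nrm X y"
begin

sublocale abelian_group X
  using is_module by (simp add: Module.module_def)

lemma sm_closed [simp, intro]: "x \<in> carrier X \<Longrightarrow> c \<odot> x \<in> carrier X"
  using Module.module.smult_closed[OF is_module] by simp

lemma sm_l_distr: "x \<in> carrier X \<Longrightarrow> (a + b) \<odot> x = a \<odot> x \<oplus> b \<odot> x"
  using Module.module.smult_l_distr[OF is_module] by simp

lemma sm_r_distr: "x \<in> carrier X \<Longrightarrow> y \<in> carrier X \<Longrightarrow> a \<odot> (x \<oplus> y) = a \<odot> x \<oplus> a \<odot> y"
  using Module.module.smult_r_distr[OF is_module] by simp

lemma sm_assoc: "x \<in> carrier X \<Longrightarrow> a \<odot> (b \<odot> x) = (a * b) \<odot> x"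
  using Module.module.smult_assoc1[OF is_module] by simp

lemma sm_one [simp]: "x \<in> carrier X \<Longrightarrow> 1 \<odot> x = x"
  using Module.module.smult_one[OF is_module] by simp

lemma sm_zero_left [simp]: "x \<in> carrier X \<Longrightarrow> 0 \<odot> x = \<zero>"
  using Module.module.smult_l_null[OF is_module] by simp

lemma sm_zero_right [simp]: "a \<odot> \<zero> = \<zero>"
  using Module.module.smult_r_null[OF is_module] by simp

lemma a_inv_eq: "x \<in> carrier X \<Longrightarrow> \<ominus> x = (-1) \<odot> x"
proof (rule minus_equality)
  assume "x \<in> carrier X"
  then show "(-1) \<odot> x \<oplus> x = \<zero>"
    using sm_l_distr[of x "-1" 1] by simp
qed auto

lemma diff_eq: "x \<in> carrier X \<Longrightarrow> y \<in> carrier X \<Longrightarrow> x \<ominus> y = x \<oplus> (-1) \<odot> y"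
  by (simp add: a_minus_def a_inv_eq)

lemma diff_closed [simp, intro]: "x \<in> carrier X \<Longrightarrow> y \<in> carrier X \<Longrightarrow> x \<ominus> y \<in> carrier X"
  by (simp add: a_minus_def)

lemma nrm_zero [simp]: "nrm X \<zero> = 0"
  using nrm_smult[of \<zero> 0] by simp

lemma diff_self [simp]: "x \<in> carrier X \<Longrightarrow> x \<ominus> x = \<zero>"
  by (simp add: a_minus_def r_neg)

lemma diff_zero [simp]: "x \<in> carrier X \<Longrightarrow> x \<ominus> \<zero> = x"
  by (simp add: diff_eq)

lemma nrm_diff_commute: "x \<in> carrier X \<Longrightarrow> y \<in> carrier X \<Longrightarrow> nrm X (x \<ominus> y) = nrm X (y \<ominus> x)"
  using nrm_smult[of "x \<ominus> y" "-1"]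
  by (simp add: diff_eq sm_r_distr sm_assoc a_comm)

lemma diff_add_cancel: "x \<in> carrier X \<Longrightarrow> y \<in> carrier X \<Longrightarrow> (x \<ominus> y) \<oplus> y = x"
  by (simp add: a_minus_def a_assoc l_neg)

lemma add_diff_cancel: "x \<in> carrier X \<Longrightarrow> y \<in> carrier X \<Longrightarrow> (x \<oplus> y) \<ominus> y = x"
  by (simp add: a_minus_def a_assoc r_neg)

lemma diff_add_diff:
  "x \<in> carrier X \<Longrightarrow> y \<in> carrier X \<Longrightarrow> z \<in> carrier X \<Longrightarrow> (x \<ominus> y) \<oplus> (y \<ominus> z) = x \<ominus> z"
  using a_assoc[of "x \<ominus> y" y "\<ominus> z"] by (simp add: a_minus_def a_assoc r_neg2 l_neg) 

lemma nrm_diff_triangle: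
  "x \<in> carrier X \<Longrightarrow> y \<in> carrier X \<Longrightarrow> z \<in> carrier X
    \<Longrightarrow> nrm X (x \<ominus> z) \<le> nrm X (x \<ominus> y) + nrm X (y \<ominus> z)"
  using nrm_triangle[of "x \<ominus> y" "y \<ominus> z"] by (simp add: diff_add_diff)

lemma nrm_triangle_rev:
  "x \<in> carrier X \<Longrightarrow> y \<in> carrier X \<Longrightarrow> \<bar>nrm X x - nrm X y\<bar> \<le> nrm X (x \<ominus> y)"
  using nrm_triangle[of "x \<ominus> y" y] nrm_triangle[of "y \<ominus> x" x] nrm_diff_commute[of x y]
  by (simp add: diff_add_cancel abs_le_iff)

lemma add_diff_add:
  assumes "x \<in> carrier X" "y \<in> carrier X" "x' \<in> carrier X" "y' \<in> carrier X"
  shows "(x \<oplus> y) \<ominus> (x' \<oplus> y') = (x \<ominus> x') \<oplus> (y \<ominus> y')"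
  using assms by (simp add: diff_eq sm_r_distr a_ac)

lemma sm_diff: "x \<in> carrier X \<Longrightarrow> y \<in> carrier X \<Longrightarrow> c \<odot> (x \<ominus> y) = c \<odot> x \<ominus> c \<odot> y"
  by (simp add: diff_eq sm_r_distr sm_assoc)

end

locale normed_space = seminormed_space +
  assumes nrm_eq_zero: "x \<in> carrier X \<Longrightarrow> nrm X x = 0 \<Longrightarrow> x = \<zero>"
begin

lemma eq_iff_nrm_diff: "x \<in> carrier X \<Longrightarrow> y \<in> carrier X \<Longrightarrow> x = y \<longleftrightarrow> nrm X (x \<ominus> y) = 0"
  using nrm_eq_zero[of "x \<ominus> y"] diff_add_cancel[of x y] by auto

end

text \<open>Additive inverses are absent from the premises: (-1) x serves, since (-1 + 1) x = 0 x =
  0.\<close>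

lemma seminormed_spaceI:
  fixes X :: "'v nspace" (structure)
  assumes "\<zero> \<in> carrier X"
    and "\<And>x y. x \<in> carrier X \<Longrightarrow> y \<in> carrier X \<Longrightarrow> x \<oplus> y \<in> carrier X"
    and sm: "\<And>c x. x \<in> carrier X \<Longrightarrow> c \<odot> x \<in> carrier X"
    and "\<And>x y z. x \<in> carrier X \<Longrightarrow> y \<in> carrier X \<Longrightarrow> z \<in> carrier X \<Longrightarrow> (x \<oplus> y) \<oplus> z = x \<oplus> (y \<oplus> z)"
    and "\<And>x y. x \<in> carrier X \<Longrightarrow> y \<in> carrier X \<Longrightarrow> x \<oplus> y = y \<oplus> x"
    and "\<And>x. x \<in> carrier X \<Longrightarrow> \<zero> \<oplus> x = x"
    and distl: "\<And>a b x. x \<in> carrier X \<Longrightarrow> (a + b) \<odot> x = a \<odot> x \<oplus> b \<odot> x"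
    and "\<And>a x y. x \<in> carrier X \<Longrightarrow> y \<in> carrier X \<Longrightarrow> a \<odot> (x \<oplus> y) = a \<odot> x \<oplus> a \<odot> y"
    and "\<And>a b x. x \<in> carrier X \<Longrightarrow> (a * b) \<odot> x = a \<odot> (b \<odot> x)"
    and one: "\<And>x. x \<in> carrier X \<Longrightarrow> 1 \<odot> x = x"
    and zero: "\<And>x. x \<in> carrier X \<Longrightarrow> 0 \<odot> x = \<zero>"
    and "\<And>x. x \<in> carrier X \<Longrightarrow> 0 \<le> nrm X x"
    and "\<And>c x. x \<in> carrier X \<Longrightarrow> nrm X (c \<odot> x) = cmod c * nrm X x"
    and "\<And>x y. x \<in> carrier X \<Longrightarrow> y \<in> carrier X \<Longrightarrow> nrm X (x \<oplus> y) \<le> nrm X x + nrm X y"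
  shows "seminormed_space X"
proof (rule seminormed_space.intro)
  show "Module.module complex_space X"
  proof (rule moduleI[OF cring_complex_space])
    show "abelian_group X"
    proof (rule abelian_groupI)
      fix x assume x: "x \<in> carrier X"
      show "\<exists>y\<in>carrier X. y \<oplus> x = \<zero>"
        using distl[OF x, of "-1" 1] sm[OF x] one[OF x] zero[OF x] by (intro bexI[of _ "(-1) \<odot> x"]) auto
    qed (use assms in auto)
  qed (use assms in auto)
qed (use assms in auto)

lemma normed_complex_space: "normed_space complex_space"
proof -
  have "seminormed_space complex_space"
    by (rule seminormed_spaceI) (auto simp: algebra_simps norm_mult norm_triangle_ineq)
  then show ?thesis
    unfolding normed_space_def normed_space_axioms_def by simp
qed

lemma complex_space_minus [simp]: "a_minus complex_space x y = x - y"
proof -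
  interpret normed_space complex_space by (rule normed_complex_space)
  show ?thesis by (simp add: diff_eq)
qed

definition complete_space :: "'v nspace \<Rightarrow> bool" where
  "complete_space X \<longleftrightarrow> (\<forall>u \<in> carrier (cauchy_sequences X).
     \<exists>x \<in> carrier X. (\<lambda>n. nrm X (u n \<ominus>\<^bsub>X\<^esub> x)) \<longlonglongrightarrow> 0)"

lemma complete_complex_space: "complete_space complex_space"
  unfolding complete_space_def
proof
  fix u assume "u \<in> carrier (cauchy_sequences complex_space)"
  then have "Cauchy u" by (simp add: cauchy_sequences_def Cauchy_iff)
  then obtain l where "u \<longlonglongrightarrow> l" using Cauchy_convergent_iff convergent_def by metis
  then show "\<exists>x\<in>carrier complex_space. (\<lambda>n. nrm complex_space (u n \<ominus>\<^bsub>complex_space\<^esub> x)) \<longlonglongrightarrow> 0"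
    by (intro bexI[of _ l]) (auto intro: tendsto_norm_zero simp: LIM_zero_iff)
qed

subsection \<open>Linear maps and bounded operators\<close>

definition linear_map :: "'v nspace \<Rightarrow> 'w nspace \<Rightarrow> ('v \<Rightarrow> 'w) \<Rightarrow> bool" where
  "linear_map X Y T \<longleftrightarrow> T \<in> carrier X \<rightarrow> carrier Y \<and>
     (\<forall>x\<in>carrier X. \<forall>y\<in>carrier X. T (x \<oplus>\<^bsub>X\<^esub> y) = T x \<oplus>\<^bsub>Y\<^esub> T y) \<and>
     (\<forall>c. \<forall>x\<in>carrier X. T (c \<odot>\<^bsub>X\<^esub> x) = c \<odot>\<^bsub>Y\<^esub> T x)"

text \<open>An element of \<open>bounded_operators\<close> hides its bound and must be extensional.
  Here the bound is visible and T is arbitrary off the carrier, so that maps given by a formula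
  qualify. K may be negative, whence the occasional passage to its absolute value.\<close>

definition bounded_map :: "'v nspace \<Rightarrow> 'w nspace \<Rightarrow> real \<Rightarrow> ('v \<Rightarrow> 'w) \<Rightarrow> bool" where
  "bounded_map X Y K T \<longleftrightarrow> linear_map X Y T \<and> (\<forall>x\<in>carrier X. nrm Y (T x) \<le> K * nrm X x)"

lemma bounded_mapD:
  assumes "bounded_map X Y K T"
  shows "x \<in> carrier X \<Longrightarrow> T x \<in> carrier Y"
    and "x \<in> carrier X \<Longrightarrow> y \<in> carrier X \<Longrightarrow> T (x \<oplus>\<^bsub>X\<^esub> y) = T x \<oplus>\<^bsub>Y\<^esub> T y"
    and "x \<in> carrier X \<Longrightarrow> T (c \<odot>\<^bsub>X\<^esub> x) = c \<odot>\<^bsub>Y\<^esub> T x"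
    and "x \<in> carrier X \<Longrightarrow> nrm Y (T x) \<le> K * nrm X x"
  using assms by (auto simp: bounded_map_def linear_map_def)

lemma bounded_mapI:
  assumes "\<And>x. x \<in> carrier X \<Longrightarrow> T x \<in> carrier Y"
    and "\<And>x y. x \<in> carrier X \<Longrightarrow> y \<in> carrier X \<Longrightarrow> T (x \<oplus>\<^bsub>X\<^esub> y) = T x \<oplus>\<^bsub>Y\<^esub> T y"
    and "\<And>c x. x \<in> carrier X \<Longrightarrow> T (c \<odot>\<^bsub>X\<^esub> x) = c \<odot>\<^bsub>Y\<^esub> T x"
    and "\<And>x. x \<in> carrier X \<Longrightarrow> nrm Y (T x) \<le> K * nrm X x"
  shows "bounded_map X Y K T"
  using assms by (auto simp: bounded_map_def linear_map_def)

lemma bounded_operators_iff: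
  "T \<in> carrier (bounded_operators X Y) \<longleftrightarrow> T \<in> extensional (carrier X) \<and> (\<exists>K. bounded_map X Y K T)"
  by (auto simp: bounded_operators_def bounded_map_def linear_map_def PiE_def)

lemma bounded_map_cong:
  assumes "seminormed_space X" "\<And>x. x \<in> carrier X \<Longrightarrow> T x = T' x"
  shows "bounded_map X Y K T \<longleftrightarrow> bounded_map X Y K T'"
proof -
  interpret seminormed_space X by fact
  show ?thesis using assms(2) by (auto simp: bounded_map_def linear_map_def Pi_def)
qed

lemma restrict_bounded_operators:
  assumes "seminormed_space X" "bounded_map X Y K T"
  shows "restrict T (carrier X) \<in> carrier (bounded_operators X Y)"
  using assms bounded_map_cong[OF assms(1), of T "restrict T (carrier X)"]
  by (auto simp: bounded_operators_iff)

lemma bounded_operators_simps: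
  "zero (bounded_operators X Y) = (\<lambda>x\<in>carrier X. \<zero>\<^bsub>Y\<^esub>)"
  "add (bounded_operators X Y) = (\<lambda>S T. \<lambda>x\<in>carrier X. S x \<oplus>\<^bsub>Y\<^esub> T x)"
  "smult (bounded_operators X Y) = (\<lambda>c T. \<lambda>x\<in>carrier X. c \<odot>\<^bsub>Y\<^esub> T x)"
  "nrm (bounded_operators X Y) = (\<lambda>T. SUP x\<in>{x \<in> carrier X. nrm X x \<le> 1}. nrm Y (T x))"
  by (simp_all add: bounded_operators_def)

lemma bounded_operatorsE:
  assumes "T \<in> carrier (bounded_operators X Y)"
  obtains K where "bounded_map X Y K T"
  using assms by (auto simp: bounded_operators_iff)

lemma bounded_map_mono:
  assumes "seminormed_space X" "bounded_map X Y K T" "K \<le> L"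
  shows "bounded_map X Y L T"
proof -
  interpret seminormed_space X by fact
  show ?thesis using assms(2) mult_right_mono[OF assms(3) nrm_nonneg]
    by (force simp: bounded_map_def intro: order_trans)
qed

lemma linear_map_zero:
  assumes "seminormed_space X" "seminormed_space Y" "linear_map X Y T"
  shows "T \<zero>\<^bsub>X\<^esub> = \<zero>\<^bsub>Y\<^esub>"
proof -
  interpret X: seminormed_space X by fact
  interpret Y: seminormed_space Y by fact
  have "T (0 \<odot>\<^bsub>X\<^esub> \<zero>\<^bsub>X\<^esub>) = 0 \<odot>\<^bsub>Y\<^esub> T \<zero>\<^bsub>X\<^esub>" "T \<zero>\<^bsub>X\<^esub> \<in> carrier Y"
    using assms(3) X.zero_closed unfolding linear_map_def by blast+
  then show ?thesis by simp
qed

lemma linear_map_diff: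
  assumes "seminormed_space X" "seminormed_space Y" "linear_map X Y T"
    "x \<in> carrier X" "y \<in> carrier X"
  shows "T (x \<ominus>\<^bsub>X\<^esub> y) = T x \<ominus>\<^bsub>Y\<^esub> T y"
proof -
  interpret X: seminormed_space X by fact
  interpret Y: seminormed_space Y by fact
  have "T x \<in> carrier Y" "T y \<in> carrier Y" using assms(3-) unfolding linear_map_def by blast+
  moreover have "T (x \<oplus>\<^bsub>X\<^esub> (-1) \<odot>\<^bsub>X\<^esub> y) = T x \<oplus>\<^bsub>Y\<^esub> (-1) \<odot>\<^bsub>Y\<^esub> T y"
    using assms(3-) unfolding linear_map_def by simp
  ultimately show ?thesis using assms(4-) by (simp add: X.diff_eq Y.diff_eq)
qed

context
  fixes X :: "'v nspace" and Y :: "'w nspace"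
  assumes X: "seminormed_space X" and Y: "normed_space Y"
begin

interpretation X: seminormed_space X by (rule X)
interpretation Y: normed_space Y by (rule Y)

lemma opnorm_upper:
  assumes "bounded_map X Y K T" "x \<in> carrier X" "nrm X x \<le> 1"
  shows "nrm Y (T x) \<le> nrm (bounded_operators X Y) T"
proof -
  have "bdd_above ((\<lambda>x. nrm Y (T x)) ` {x \<in> carrier X. nrm X x \<le> 1})"
  \<comment> \<open>The real \<open>SUP\<close> in the operator norm says nothing unless its set is
    bounded; K may be negative, hence its absolute value.\<close>
  proof (rule bdd_aboveI2)
    fix x assume "x \<in> {x \<in> carrier X. nrm X x \<le> 1}"
    then have "nrm Y (T x) \<le> K * nrm X x" "0 \<le> nrm X x" "nrm X x \<le> 1"
      using assms(1) X.nrm_nonneg by (auto simp: bounded_map_def)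
    then show "nrm Y (T x) \<le> \<bar>K\<bar>"
      by (smt (verit) mult_left_le mult_right_mono)
  qed
  then show ?thesis
    using assms(2,3) unfolding bounded_operators_simps by (intro cSUP_upper) auto
qed

lemma opnorm_le:
  assumes "T \<in> carrier (bounded_operators X Y)" "x \<in> carrier X"
  shows "nrm Y (T x) \<le> nrm (bounded_operators X Y) T * nrm X x"
proof -
  obtain K where K: "bounded_map X Y K T" using assms(1) by (rule bounded_operatorsE)
  note T = bounded_mapD[OF K]
  show ?thesis
  proof (cases "nrm X x = 0")
    \<comment> \<open>x cannot be normalized, but any bound K already forces T x to have norm
      0.\<close>
    case True
    then show ?thesis using T(4)[OF assms(2)] by simp
  next
    case False
    define r where "r = nrm X x"
    have r: "r > 0" using False X.nrm_nonneg[OF assms(2)] by (simp add: r_def)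
    define y where "y = complex_of_real (1 / r) \<odot>\<^bsub>X\<^esub> x"
    have "nrm X y = 1" using r assms(2) by (simp add: y_def X.nrm_smult norm_divide flip: r_def)
    then have "nrm Y (T y) \<le> nrm (bounded_operators X Y) T"
      using assms(2) by (intro opnorm_upper[OF K]) (auto simp: y_def)
    moreover have "nrm Y (T y) = (1 / r) * nrm Y (T x)"
      using r assms(2) T(1)[OF assms(2)] by (simp add: y_def T(3) Y.nrm_smult norm_divide)
    ultimately show ?thesis using r by (simp add: field_simps r_def)
  qed
qed

lemma opnorm_bound:
  assumes "0 \<le> K" "\<And>x. x \<in> carrier X \<Longrightarrow> nrm Y (T x) \<le> K * nrm X x"
  shows "nrm (bounded_operators X Y) T \<le> K"
  unfolding bounded_operators_simps
proof (rule cSUP_least)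
  show "{x \<in> carrier X. nrm X x \<le> 1} \<noteq> {}"
    using X.zero_closed X.nrm_zero by force
  fix x assume "x \<in> {x \<in> carrier X. nrm X x \<le> 1}"
  then show "nrm Y (T x) \<le> K"
    using assms(2)[of x] mult_left_mono[of "nrm X x" 1 K] assms(1) by simp
qed

lemma opnorm_nonneg:
  assumes "T \<in> carrier (bounded_operators X Y)"
  shows "0 \<le> nrm (bounded_operators X Y) T"
proof -
  obtain K where K: "bounded_map X Y K T" using assms(1) by (rule bounded_operatorsE)
  have "nrm Y (T \<zero>\<^bsub>X\<^esub>) \<le> nrm (bounded_operators X Y) T"
    by (rule opnorm_upper[OF K]) auto
  moreover have "T \<zero>\<^bsub>X\<^esub> \<in> carrier Y" using bounded_mapD(1)[OF K] by simp
  ultimately show ?thesis using Y.nrm_nonneg by force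
qed

lemma bounded_operators_eqI:
  assumes "S \<in> carrier (bounded_operators X Y)" "T \<in> carrier (bounded_operators X Y)"
    "\<And>x. x \<in> carrier X \<Longrightarrow> S x = T x"
  shows "S = T"
  using assms by (auto simp: bounded_operators_iff intro: extensionalityI)

lemma bounded_map_opnorm:
  assumes "T \<in> carrier (bounded_operators X Y)"
  shows "bounded_map X Y (nrm (bounded_operators X Y) T) T"
  using assms opnorm_le[OF assms] by (auto simp: bounded_operators_iff bounded_map_def)

lemma bounded_map_add:
  assumes "bounded_map X Y K S" "bounded_map X Y L T"
  shows "bounded_map X Y (K + L) (\<lambda>x. S x \<oplus>\<^bsub>Y\<^esub> T x)"
proof -
  note S = bounded_mapD[OF assms(1)] and T = bounded_mapD[OF assms(2)]
  show ?thesis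
  proof (rule bounded_mapI)
    fix x assume x: "x \<in> carrier X"
    show "nrm Y (S x \<oplus>\<^bsub>Y\<^esub> T x) \<le> (K + L) * nrm X x"
      using Y.nrm_triangle[OF S(1)[OF x] T(1)[OF x]] S(4)[OF x] T(4)[OF x]
      by (simp add: algebra_simps)
  qed (simp_all add: S T Y.sm_r_distr Y.a_ac)
qed

lemma bounded_map_smult:
  assumes "bounded_map X Y K T"
  shows "bounded_map X Y (cmod c * K) (\<lambda>x. c \<odot>\<^bsub>Y\<^esub> T x)"
proof -
  note T = bounded_mapD[OF assms(1)]
  show ?thesis
    by (rule bounded_mapI)
      (simp_all add: T Y.sm_r_distr Y.sm_assoc Y.nrm_smult mult_left_mono mult.assoc, simp add: mult.commute)
qed

lemma bounded_map_zero: "bounded_map X Y 0 (\<lambda>x. \<zero>\<^bsub>Y\<^esub>)"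
  by (rule bounded_mapI) auto

lemma normed_bounded_operators: "normed_space (bounded_operators X Y)"
proof -
  let ?B = "bounded_operators X Y"
  have D: "\<And>T x. T \<in> carrier ?B \<Longrightarrow> x \<in> carrier X \<Longrightarrow> T x \<in> carrier Y"
    by (auto simp: bounded_operators_iff dest: bounded_mapD(1))
  have E: "\<And>T. T \<in> carrier ?B \<Longrightarrow> T \<in> extensional (carrier X)"
    by (simp add: bounded_operators_iff)
  note ext = extensionalityI[where A = "carrier X"]
  have add: "S \<oplus>\<^bsub>?B\<^esub> T \<in> carrier ?B" if "S \<in> carrier ?B" "T \<in> carrier ?B" for S T
    using bounded_map_add[OF bounded_map_opnorm[OF that(1)] bounded_map_opnorm[OF that(2)]]
    unfolding bounded_operators_simps by (rule restrict_bounded_operators[OF X])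
  have sm: "c \<odot>\<^bsub>?B\<^esub> T \<in> carrier ?B" if "T \<in> carrier ?B" for c T
    using bounded_map_smult[OF bounded_map_opnorm[OF that(1)]]
    unfolding bounded_operators_simps by (rule restrict_bounded_operators[OF X])
  have sm_le: "nrm ?B (c \<odot>\<^bsub>?B\<^esub> T) \<le> cmod c * nrm ?B T" if "T \<in> carrier ?B" for c T
    by (rule opnorm_bound)
      (use bounded_map_smult[OF bounded_map_opnorm[OF that(1)]] opnorm_nonneg[OF that] in
        \<open>auto simp: bounded_operators_simps bounded_map_def\<close>)
  have "seminormed_space ?B"
  proof (rule seminormed_spaceI)
    show "\<zero>\<^bsub>?B\<^esub> \<in> carrier ?B"
      using bounded_map_zero unfolding bounded_operators_simps by (rule restrict_bounded_operators[OF X])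
    show "nrm ?B (S \<oplus>\<^bsub>?B\<^esub> T) \<le> nrm ?B S + nrm ?B T"
      if "S \<in> carrier ?B" "T \<in> carrier ?B" for S T
      by (rule opnorm_bound)
        (use bounded_map_add[OF bounded_map_opnorm[OF that(1)] bounded_map_opnorm[OF that(2)]]
          opnorm_nonneg that in \<open>auto simp: bounded_operators_simps bounded_map_def\<close>)
    show "nrm ?B (c \<odot>\<^bsub>?B\<^esub> T) = cmod c * nrm ?B T" if T: "T \<in> carrier ?B" for c T
    proof (cases "c = 0")
      case True
      then show ?thesis using sm_le[OF T, of c] opnorm_nonneg[OF sm[OF T, of c]] by simp
    next
      case False
      \<comment> \<open>The bound \<open>sm_le\<close> is applied once more, to c T and 1/c, which
        gives the reverse inequality.\<close>
      have "(1 / c) \<odot>\<^bsub>?B\<^esub> (c \<odot>\<^bsub>?B\<^esub> T) = T"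
        using False D[OF T] E[OF T] by (intro ext) (auto simp: bounded_operators_simps Y.sm_assoc)
      then have "nrm ?B T \<le> cmod (1 / c) * nrm ?B (c \<odot>\<^bsub>?B\<^esub> T)"
        using sm_le[OF sm[OF T], of "1 / c" c] by simp
      then show ?thesis using sm_le[OF T, of c] False by (simp add: field_simps norm_divide)
    qed
    show "0 \<odot>\<^bsub>?B\<^esub> T = \<zero>\<^bsub>?B\<^esub>" if "T \<in> carrier ?B" for T
      using D[OF that] by (auto simp: bounded_operators_simps fun_eq_iff)
    show "1 \<odot>\<^bsub>?B\<^esub> T = T" "\<zero>\<^bsub>?B\<^esub> \<oplus>\<^bsub>?B\<^esub> T = T" if "T \<in> carrier ?B" for T
      by (rule ext; use D[OF that] E[OF that] in \<open>simp add: bounded_operators_simps\<close>)+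
    show "(a + b) \<odot>\<^bsub>?B\<^esub> T = a \<odot>\<^bsub>?B\<^esub> T \<oplus>\<^bsub>?B\<^esub> b \<odot>\<^bsub>?B\<^esub> T"
      "(a * b) \<odot>\<^bsub>?B\<^esub> T = a \<odot>\<^bsub>?B\<^esub> (b \<odot>\<^bsub>?B\<^esub> T)" if "T \<in> carrier ?B" for T a b
      using D[OF that] by (auto simp: bounded_operators_simps fun_eq_iff Y.sm_l_distr Y.sm_assoc)
    show "a \<odot>\<^bsub>?B\<^esub> (S \<oplus>\<^bsub>?B\<^esub> T) = a \<odot>\<^bsub>?B\<^esub> S \<oplus>\<^bsub>?B\<^esub> a \<odot>\<^bsub>?B\<^esub> T" "S \<oplus>\<^bsub>?B\<^esub> T = T \<oplus>\<^bsub>?B\<^esub> S"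
      if "S \<in> carrier ?B" "T \<in> carrier ?B" for S T a
      using D[OF that(1)] D[OF that(2)]
      by (auto simp: bounded_operators_simps fun_eq_iff Y.sm_r_distr Y.a_comm)
    show "S \<oplus>\<^bsub>?B\<^esub> T \<oplus>\<^bsub>?B\<^esub> U = S \<oplus>\<^bsub>?B\<^esub> (T \<oplus>\<^bsub>?B\<^esub> U)"
      if "S \<in> carrier ?B" "T \<in> carrier ?B" "U \<in> carrier ?B" for S T U
      using D[OF that(1)] D[OF that(2)] D[OF that(3)]
      by (auto simp: bounded_operators_simps fun_eq_iff Y.a_assoc)
  qed (use add sm opnorm_nonneg in auto)
  then interpret B: seminormed_space ?B .
  show ?thesis
  proof
    fix T assume T: "T \<in> carrier ?B" "nrm ?B T = 0"
    have "T x = \<zero>\<^bsub>Y\<^esub>" if "x \<in> carrier X" for x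
      using opnorm_le[OF T(1) that] T(2) D[OF T(1) that] Y.nrm_nonneg Y.nrm_eq_zero by force
    then show "T = \<zero>\<^bsub>?B\<^esub>"
      using E[OF T(1)] by (intro ext) (auto simp: bounded_operators_simps)
  qed
qed

end

section \<open>Convergence of sequences in seminormed spaces\<close>

definition tends_to :: "'v nspace \<Rightarrow> (nat \<Rightarrow> 'v) \<Rightarrow> 'v \<Rightarrow> bool" where
  "tends_to X u x \<longleftrightarrow> (\<forall>n. u n \<in> carrier X) \<and> x \<in> carrier X \<and> (\<lambda>n. nrm X (u n \<ominus>\<^bsub>X\<^esub> x)) \<longlonglongrightarrow> 0"

lemma (in seminormed_space) tends_to_const: "x \<in> carrier X \<Longrightarrow> tends_to X (\<lambda>n. x) x"
  by (simp add: tends_to_def)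

lemma (in seminormed_space) tends_to_add:
  assumes "tends_to X u x" "tends_to X v y"
  shows "tends_to X (\<lambda>n. u n \<oplus> v n) (x \<oplus> y)"
proof -
  have c: "\<And>n. u n \<in> carrier X" "\<And>n. v n \<in> carrier X" "x \<in> carrier X" "y \<in> carrier X"
    using assms by (auto simp: tends_to_def)
  have "(\<lambda>n. nrm X ((u n \<oplus> v n) \<ominus> (x \<oplus> y))) \<longlonglongrightarrow> 0"
  proof (rule tendsto_sandwich[OF _ _ tendsto_const])
    show "(\<lambda>n. nrm X (u n \<ominus> x) + nrm X (v n \<ominus> y)) \<longlonglongrightarrow> 0"
      using assms by (auto simp: tends_to_def intro: tendsto_add_zero)
  qed (use c nrm_triangle nrm_nonneg in \<open>auto simp: add_diff_add\<close>)
  then show ?thesis using c by (simp add: tends_to_def)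
qed

lemma (in seminormed_space) tends_to_smult:
  assumes "tends_to X u x"
  shows "tends_to X (\<lambda>n. c \<odot> u n) (c \<odot> x)"
  using assms tendsto_mult_right_zero[of "\<lambda>n. nrm X (u n \<ominus> x)" _ "cmod c"]
  by (auto simp: tends_to_def nrm_smult simp flip: sm_diff)

lemma (in seminormed_space) tends_to_nrm:
  assumes "tends_to X u x"
  shows "(\<lambda>n. nrm X (u n)) \<longlonglongrightarrow> nrm X x"
proof -
  have "(\<lambda>n. nrm X (u n) - nrm X x) \<longlonglongrightarrow> 0"
    by (rule Lim_null_comparison[of _ "\<lambda>n. nrm X (u n \<ominus> x)"])
      (use assms nrm_triangle_rev in \<open>auto simp: tends_to_def\<close>)
  then show ?thesis by (simp add: LIM_zero_iff)
qed

lemma (in normed_space) tends_to_unique: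
  assumes "tends_to X u x" "tends_to X u y"
  shows "x = y"
proof -
  have c: "\<And>n. u n \<in> carrier X" "x \<in> carrier X" "y \<in> carrier X"
    using assms by (auto simp: tends_to_def)
  have "(\<lambda>n. nrm X (u n \<ominus> x) + nrm X (u n \<ominus> y)) \<longlonglongrightarrow> 0"
    using assms by (auto simp: tends_to_def intro: tendsto_add_zero)
  moreover have "nrm X (x \<ominus> y) \<le> nrm X (u n \<ominus> x) + nrm X (u n \<ominus> y)" for n
    using nrm_diff_triangle[of x "u n" y] nrm_diff_commute[of x "u n"] c by simp
  ultimately have "nrm X (x \<ominus> y) \<le> 0"
    by (intro LIMSEQ_le_const) auto
  then show ?thesis using nrm_nonneg[of "x \<ominus> y"] c by (simp add: eq_iff_nrm_diff)
qed

lemma bounded_map_tends_to: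
  assumes "seminormed_space X" "seminormed_space Y" "bounded_map X Y K T" "tends_to X u x"
  shows "tends_to Y (\<lambda>n. T (u n)) (T x)"
proof -
  interpret X: seminormed_space X by fact
  interpret Y: seminormed_space Y by fact
  note T = bounded_mapD[OF assms(3)]
  have c: "\<And>n. u n \<in> carrier X" "x \<in> carrier X"
    using assms(4) by (auto simp: tends_to_def)
  have lin: "linear_map X Y T" using assms(3) by (simp add: bounded_map_def)
  have "(\<lambda>n. nrm Y (T (u n) \<ominus>\<^bsub>Y\<^esub> T x)) \<longlonglongrightarrow> 0"
  proof (rule tendsto_sandwich[OF _ _ tendsto_const])
    show "(\<lambda>n. K * nrm X (u n \<ominus>\<^bsub>X\<^esub> x)) \<longlonglongrightarrow> 0"
      using assms(4) by (auto simp: tends_to_def intro: tendsto_mult_right_zero)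
    show "\<forall>\<^sub>F n in sequentially. nrm Y (T (u n) \<ominus>\<^bsub>Y\<^esub> T x) \<le> K * nrm X (u n \<ominus>\<^bsub>X\<^esub> x)"
      using T(4)[of "u _ \<ominus>\<^bsub>X\<^esub> x"] c linear_map_diff[OF assms(1,2) lin] by auto
  qed (use T(1) c Y.nrm_nonneg in auto)
  then show ?thesis using T(1) c by (simp add: tends_to_def)
qed

subsection \<open>The Hausdorff quotient and the completion\<close>

context seminormed_space
begin

lemma null_class_eq_iff:
  assumes "x \<in> carrier X" "y \<in> carrier X"
  shows "null_class X x = null_class X y \<longleftrightarrow> nrm X (x \<ominus> y) = 0"
proof
  assume "null_class X x = null_class X y"
  then have "y \<in> null_class X x" using assms by (simp add: null_class_def)
  then show "nrm X (x \<ominus> y) = 0" by (simp add: null_class_def)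
next
  assume "nrm X (x \<ominus> y) = 0"
  then have "nrm X (x \<ominus> z) = 0 \<longleftrightarrow> nrm X (y \<ominus> z) = 0" if "z \<in> carrier X" for z
    using assms that nrm_diff_triangle[of x y z] nrm_diff_triangle[of y x z]
      nrm_diff_commute[of x y] nrm_nonneg[of "x \<ominus> z"] nrm_nonneg[of "y \<ominus> z"]
    by force
  then show "null_class X x = null_class X y" by (auto simp: null_class_def)
qed

lemma repr_null_class:
  assumes "x \<in> carrier X"
  shows "repr (null_class X x) \<in> carrier X" "nrm X (x \<ominus> repr (null_class X x)) = 0"
    "null_class X (repr (null_class X x)) = null_class X x"
proof -
  have "x \<in> null_class X x" using assms by (simp add: null_class_def)
  then have "repr (null_class X x) \<in> null_class X x" unfolding repr_def by (rule someI)
  then show *: "repr (null_class X x) \<in> carrier X" "nrm X (x \<ominus> repr (null_class X x)) = 0"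
    by (auto simp: null_class_def)
  then show "null_class X (repr (null_class X x)) = null_class X x"
    using assms null_class_eq_iff by metis
qed

text \<open>The quotient operations act on representatives picked by \<open>repr\<close>; these
  congruences make the choice harmless.\<close>

lemma null_class_congs:
  assumes "null_class X x = null_class X x'" "null_class X y = null_class X y'"
    and c: "x \<in> carrier X" "y \<in> carrier X" "x' \<in> carrier X" "y' \<in> carrier X"
  shows "null_class X (x \<oplus> y) = null_class X (x' \<oplus> y')" "nrm X x = nrm X x'"
    "null_class X (a \<odot> x) = null_class X (a \<odot> x')"
proof -
  have *: "nrm X (x \<ominus> x') = 0" "nrm X (y \<ominus> y') = 0"
    using assms null_class_eq_iff by blast+
  then have "nrm X ((x \<oplus> y) \<ominus> (x' \<oplus> y')) \<le> 0"
    using c nrm_triangle[of "x \<ominus> x'" "y \<ominus> y'"] by (simp add: add_diff_add)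
  then have "nrm X ((x \<oplus> y) \<ominus> (x' \<oplus> y')) = 0"
    using c nrm_nonneg by (meson add.m_closed antisym diff_closed)
  then show "null_class X (x \<oplus> y) = null_class X (x' \<oplus> y')"
    using c null_class_eq_iff by blast
  show "nrm X x = nrm X x'" using * c nrm_triangle_rev[of x x'] by simp
  show "null_class X (a \<odot> x) = null_class X (a \<odot> x')"
    using * c null_class_eq_iff nrm_smult[of "x \<ominus> x'" a] by (simp add: sm_diff)
qed

abbreviation (input) "Q \<equiv> hausdorff_quotient X"

lemma quotient_simps:
  "carrier Q = null_class X ` carrier X" "\<zero>\<^bsub>Q\<^esub> = null_class X \<zero>"
  "x \<in> carrier X \<Longrightarrow> y \<in> carrier X \<Longrightarrow> null_class X x \<oplus>\<^bsub>Q\<^esub> null_class X y = null_class X (x \<oplus> y)"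
  "x \<in> carrier X \<Longrightarrow> c \<odot>\<^bsub>Q\<^esub> null_class X x = null_class X (c \<odot> x)"
  "x \<in> carrier X \<Longrightarrow> nrm Q (null_class X x) = nrm X x"
proof -
  show "carrier Q = null_class X ` carrier X" "\<zero>\<^bsub>Q\<^esub> = null_class X \<zero>"
    by (simp_all add: hausdorff_quotient_def)
next
  assume x: "x \<in> carrier X"
  note r = repr_null_class[OF x]
  show "c \<odot>\<^bsub>Q\<^esub> null_class X x = null_class X (c \<odot> x)"
    using null_class_congs(3)[OF r(3) r(3) r(1) r(1) x x] by (simp add: hausdorff_quotient_def)
  show "nrm Q (null_class X x) = nrm X x"
    using null_class_congs(2)[OF r(3) r(3) r(1) r(1) x x] by (simp add: hausdorff_quotient_def)
  assume y: "y \<in> carrier X"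
  note r' = repr_null_class[OF y]
  show "null_class X x \<oplus>\<^bsub>Q\<^esub> null_class X y = null_class X (x \<oplus> y)"
    using null_class_congs(1)[OF r(3) r'(3) r(1) r'(1) x y] by (simp add: hausdorff_quotient_def)
qed

lemma normed_hausdorff_quotient: "normed_space Q"
proof -
  have "seminormed_space Q"
    by (rule seminormed_spaceI)
      (auto simp: quotient_simps sm_l_distr sm_r_distr sm_assoc nrm_nonneg nrm_smult nrm_triangle
        a_ac)
  then interpret Q: seminormed_space Q .
  show ?thesis
  proof
    fix z assume "z \<in> carrier Q" and z0: "nrm Q z = 0"
    then obtain x where x: "x \<in> carrier X" "z = null_class X x"
      unfolding quotient_simps(1) by blast
    then show "z = \<zero>\<^bsub>Q\<^esub>"
      using z0 null_class_eq_iff[OF x(1) zero_closed] quotient_simps(2,5) by simp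
  qed
qed

lemma quotient_minus:
  assumes "x \<in> carrier X" "y \<in> carrier X"
  shows "null_class X x \<ominus>\<^bsub>Q\<^esub> null_class X y = null_class X (x \<ominus> y)"
proof -
  interpret Q: normed_space Q by (rule normed_hausdorff_quotient)
  have "null_class X x \<ominus>\<^bsub>Q\<^esub> null_class X y = null_class X x \<oplus>\<^bsub>Q\<^esub> (-1) \<odot>\<^bsub>Q\<^esub> null_class X y"
    using assms by (intro Q.diff_eq) (auto simp: quotient_simps)
  then show ?thesis using assms by (simp add: quotient_simps diff_eq)
qed

abbreviation (input) "CS \<equiv> cauchy_sequences X"

lemma cauchy_sequences_simps:
  "zero CS = (\<lambda>n. \<zero>)" "add CS = (\<lambda>u v n. u n \<oplus> v n)" "smult CS = (\<lambda>c u n. c \<odot> u n)"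
  "nrm CS = (\<lambda>u. lim (\<lambda>n. nrm X (u n)))"
  by (simp_all add: cauchy_sequences_def)

lemma cauchy_sequencesD:
  assumes "u \<in> carrier CS"
  shows "u n \<in> carrier X" "0 < e \<Longrightarrow> \<exists>N. \<forall>m\<ge>N. \<forall>n\<ge>N. nrm X (u m \<ominus> u n) < e"
  using assms by (auto simp: cauchy_sequences_def)

lemma cauchy_sequencesI:
  assumes "\<And>n. u n \<in> carrier X" "\<And>e. 0 < e \<Longrightarrow> \<exists>N. \<forall>m\<ge>N. \<forall>n\<ge>N. nrm X (u m \<ominus> u n) < e"
  shows "u \<in> carrier CS"
  using assms by (auto simp: cauchy_sequences_def)

lemma cauchy_nrm_tendsto:
  assumes "u \<in> carrier CS"
  shows "(\<lambda>n. nrm X (u n)) \<longlonglongrightarrow> nrm CS u"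
proof -
  have "Cauchy (\<lambda>n. nrm X (u n))"
    unfolding Cauchy_iff
  proof (intro allI impI)
    fix e :: real assume "e > 0"
    then obtain N where "\<forall>m\<ge>N. \<forall>n\<ge>N. nrm X (u m \<ominus> u n) < e"
      using cauchy_sequencesD(2)[OF assms] by blast
    moreover have "\<bar>nrm X (u m) - nrm X (u n)\<bar> \<le> nrm X (u m \<ominus> u n)" for m n
      by (rule nrm_triangle_rev; rule cauchy_sequencesD(1)[OF assms])
    ultimately show "\<exists>M. \<forall>m\<ge>M. \<forall>n\<ge>M. norm (nrm X (u m) - nrm X (u n)) < e"
      by (metis le_less_trans real_norm_def)
  qed
  then show ?thesis
    by (simp add: cauchy_sequences_simps Cauchy_convergent_iff convergent_LIMSEQ_iff)
qed

lemma cauchy_const: "x \<in> carrier X \<Longrightarrow> (\<lambda>n. x) \<in> carrier CS"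
  by (rule cauchy_sequencesI) auto

lemma cauchy_add:
  assumes "u \<in> carrier CS" "v \<in> carrier CS"
  shows "(\<lambda>n. u n \<oplus> v n) \<in> carrier CS"
proof (rule cauchy_sequencesI)
  fix e :: real assume "e > 0"
  then obtain N M where N: "\<forall>m\<ge>N. \<forall>n\<ge>N. nrm X (u m \<ominus> u n) < e/2"
    and M: "\<forall>m\<ge>M. \<forall>n\<ge>M. nrm X (v m \<ominus> v n) < e/2"
    using cauchy_sequencesD(2)[OF assms(1), of "e/2"] cauchy_sequencesD(2)[OF assms(2), of "e/2"]
    by auto
  have "nrm X ((u m \<oplus> v m) \<ominus> (u n \<oplus> v n)) \<le> nrm X (u m \<ominus> u n) + nrm X (v m \<ominus> v n)" for m n
    using nrm_triangle[of "u m \<ominus> u n" "v m \<ominus> v n"] cauchy_sequencesD(1)[OF assms(1)]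
      cauchy_sequencesD(1)[OF assms(2)] by (simp add: add_diff_add)
  then have "\<forall>m\<ge>max N M. \<forall>n\<ge>max N M. nrm X ((u m \<oplus> v m) \<ominus> (u n \<oplus> v n)) < e"
    using N M by (smt (verit) field_sum_of_halves max.bounded_iff)
  then show "\<exists>N. \<forall>m\<ge>N. \<forall>n\<ge>N. nrm X ((u m \<oplus> v m) \<ominus> (u n \<oplus> v n)) < e" by blast
qed (use cauchy_sequencesD(1)[OF assms(1)] cauchy_sequencesD(1)[OF assms(2)] in auto)

lemma cauchy_smult:
  assumes "u \<in> carrier CS"
  shows "(\<lambda>n. c \<odot> u n) \<in> carrier CS"
proof (rule cauchy_sequencesI)
  fix e :: real assume "e > 0"
  then have "e / (cmod c + 1) > 0" by (simp add: add_nonneg_pos)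
  then obtain N where N: "\<forall>m\<ge>N. \<forall>n\<ge>N. nrm X (u m \<ominus> u n) < e / (cmod c + 1)"
    using cauchy_sequencesD(2)[OF assms(1)] by blast
  have "nrm X (c \<odot> u m \<ominus> c \<odot> u n) < e" if "m \<ge> N" "n \<ge> N" for m n
  proof -
    have c: "u m \<in> carrier X" "u n \<in> carrier X" using cauchy_sequencesD(1)[OF assms] by auto
    have "nrm X (c \<odot> u m \<ominus> c \<odot> u n) = cmod c * nrm X (u m \<ominus> u n)"
      using c by (simp add: nrm_smult flip: sm_diff)
    also have "\<dots> \<le> (cmod c + 1) * nrm X (u m \<ominus> u n)"
      using c nrm_nonneg[of "u m \<ominus> u n"] by (simp add: algebra_simps)
    also have "\<dots> < e"
      using N that \<open>e / (cmod c + 1) > 0\<close> by (simp add: pos_less_divide_eq mult.commute add_nonneg_pos)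
    finally show ?thesis .
  qed
  then show "\<exists>N. \<forall>m\<ge>N. \<forall>n\<ge>N. nrm X (c \<odot> u m \<ominus> c \<odot> u n) < e" by blast
qed (use cauchy_sequencesD(1)[OF assms(1)] in auto)

lemma seminormed_cauchy_sequences: "seminormed_space CS"
proof (rule seminormed_spaceI)
  fix u v c assume u: "u \<in> carrier CS"
  note D = cauchy_sequencesD(1)[OF u]
  show "0 \<le> nrm CS u"
    by (rule LIMSEQ_le_const[OF cauchy_nrm_tendsto[OF u]]) (use nrm_nonneg D in auto)
  have "(\<lambda>n. nrm X (c \<odot> u n)) \<longlonglongrightarrow> cmod c * nrm CS u"
    using tendsto_mult_left[OF cauchy_nrm_tendsto[OF u], of "cmod c"] D by (simp add: nrm_smult)
  then show "nrm CS (c \<odot>\<^bsub>CS\<^esub> u) = cmod c * nrm CS u"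
    by (simp add: cauchy_sequences_simps limI)
  assume v: "v \<in> carrier CS"
  show "nrm CS (u \<oplus>\<^bsub>CS\<^esub> v) \<le> nrm CS u + nrm CS v"
  proof (rule LIMSEQ_le[OF cauchy_nrm_tendsto])
    show "u \<oplus>\<^bsub>CS\<^esub> v \<in> carrier CS" using cauchy_add[OF u v] by (simp add: cauchy_sequences_simps)
    show "(\<lambda>n. nrm X (u n) + nrm X (v n)) \<longlonglongrightarrow> nrm CS u + nrm CS v"
      by (intro tendsto_add cauchy_nrm_tendsto u v)
  qed (use nrm_triangle D cauchy_sequencesD(1)[OF v] in \<open>auto simp: cauchy_sequences_simps\<close>)
next
  have pw: "\<forall>n. u n \<in> carrier X" if "u \<in> carrier CS" for u
    using cauchy_sequencesD(1)[OF that] by blast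
  fix u v w a b
  assume u: "u \<in> carrier CS"
  show "(a + b) \<odot>\<^bsub>CS\<^esub> u = a \<odot>\<^bsub>CS\<^esub> u \<oplus>\<^bsub>CS\<^esub> b \<odot>\<^bsub>CS\<^esub> u" "(a * b) \<odot>\<^bsub>CS\<^esub> u = a \<odot>\<^bsub>CS\<^esub> (b \<odot>\<^bsub>CS\<^esub> u)"
    "1 \<odot>\<^bsub>CS\<^esub> u = u" "0 \<odot>\<^bsub>CS\<^esub> u = \<zero>\<^bsub>CS\<^esub>" "\<zero>\<^bsub>CS\<^esub> \<oplus>\<^bsub>CS\<^esub> u = u"
    using pw[OF u] by (simp_all add: cauchy_sequences_simps sm_l_distr sm_assoc)
  assume v: "v \<in> carrier CS"
  show "u \<oplus>\<^bsub>CS\<^esub> v = v \<oplus>\<^bsub>CS\<^esub> u" "a \<odot>\<^bsub>CS\<^esub> (u \<oplus>\<^bsub>CS\<^esub> v) = a \<odot>\<^bsub>CS\<^esub> u \<oplus>\<^bsub>CS\<^esub> a \<odot>\<^bsub>CS\<^esub> v"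
    using pw[OF u] pw[OF v] by (simp_all add: cauchy_sequences_simps sm_r_distr a_comm)
  assume w: "w \<in> carrier CS"
  show "u \<oplus>\<^bsub>CS\<^esub> v \<oplus>\<^bsub>CS\<^esub> w = u \<oplus>\<^bsub>CS\<^esub> (v \<oplus>\<^bsub>CS\<^esub> w)"
    using pw[OF u] pw[OF v] pw[OF w] by (simp add: cauchy_sequences_simps a_assoc)
qed (use cauchy_const cauchy_add cauchy_smult in \<open>simp_all add: cauchy_sequences_simps\<close>)

abbreviation (input) "C \<equiv> completion X"
abbreviation (input) "emb \<equiv> completion_embedding X"

lemma normed_completion: "normed_space C"
  unfolding completion_def
  by (rule seminormed_space.normed_hausdorff_quotient[OF seminormed_cauchy_sequences])

lemma completion_embedding_simps:
  "x \<in> carrier X \<Longrightarrow> emb x \<in> carrier C" "\<zero>\<^bsub>C\<^esub> = emb \<zero>"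
  "x \<in> carrier X \<Longrightarrow> y \<in> carrier X \<Longrightarrow> emb x \<oplus>\<^bsub>C\<^esub> emb y = emb (x \<oplus> y)"
  "x \<in> carrier X \<Longrightarrow> c \<odot>\<^bsub>C\<^esub> emb x = emb (c \<odot> x)"
  "x \<in> carrier X \<Longrightarrow> nrm C (emb x) = nrm X x"
  using cauchy_const seminormed_space.quotient_simps[OF seminormed_cauchy_sequences]
  by (auto simp: completion_def completion_embedding_def cauchy_sequences_simps)

lemma bounded_map_completion_embedding: "bounded_map X C 1 emb"
  by (rule bounded_mapI) (simp_all add: completion_embedding_simps)

lemma completion_carrierE:
  assumes "z \<in> carrier C"
  obtains u where "u \<in> carrier CS" "z = null_class CS u"
  using assms seminormed_space.quotient_simps(1)[OF seminormed_cauchy_sequences]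
  by (auto simp: completion_def)

text \<open>The distance of the constant sequence u n from u is the limit over m of the norm of u n
  - u m, which the Cauchy condition makes small for large n.\<close>

lemma embedding_tends_to:
  assumes u: "u \<in> carrier CS"
  shows "tends_to C (\<lambda>n. emb (u n)) (null_class CS u)"
proof -
  interpret CS: seminormed_space CS by (rule seminormed_cauchy_sequences)
  interpret C: normed_space C by (rule normed_completion)
  have c: "u n \<in> carrier X" for n using cauchy_sequencesD(1)[OF u] .
  have eq: "nrm C (emb (u n) \<ominus>\<^bsub>C\<^esub> null_class CS u) = lim (\<lambda>m. nrm X (u n \<ominus> u m))"
    and lim: "(\<lambda>m. nrm X (u n \<ominus> u m)) \<longlonglongrightarrow> lim (\<lambda>m. nrm X (u n \<ominus> u m))" for n
  proof -
    have *: "(\<lambda>m. u n) \<ominus>\<^bsub>CS\<^esub> u = (\<lambda>m. u n \<ominus> u m)"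
      using c cauchy_const[OF c] u by (simp add: CS.diff_eq diff_eq) (simp add: cauchy_sequences_simps)
    then show "nrm C (emb (u n) \<ominus>\<^bsub>C\<^esub> null_class CS u) = lim (\<lambda>m. nrm X (u n \<ominus> u m))"
      using cauchy_const[OF c] u CS.quotient_simps(5)[OF CS.diff_closed[OF cauchy_const[OF c[of n]] u]]
      by (simp add: completion_def completion_embedding_def CS.quotient_minus cauchy_sequences_simps)
    show "(\<lambda>m. nrm X (u n \<ominus> u m)) \<longlonglongrightarrow> lim (\<lambda>m. nrm X (u n \<ominus> u m))"
      using cauchy_nrm_tendsto[OF CS.diff_closed[OF cauchy_const[OF c[of n]] u]] 
      unfolding * by (simp add: cauchy_sequences_simps)
  qed
  have "(\<lambda>n. nrm C (emb (u n) \<ominus>\<^bsub>C\<^esub> null_class CS u)) \<longlonglongrightarrow> 0"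
    unfolding eq
  proof (rule LIMSEQ_I)
    fix e :: real assume "e > 0"
    then obtain N where N: "\<forall>m\<ge>N. \<forall>n\<ge>N. nrm X (u m \<ominus> u n) < e/2"
      using cauchy_sequencesD(2)[OF u, of "e/2"] by auto
    have "norm (lim (\<lambda>m. nrm X (u n \<ominus> u m)) - 0) < e" if "n \<ge> N" for n
    proof -
      have "lim (\<lambda>m. nrm X (u n \<ominus> u m)) \<le> e/2"
        by (rule LIMSEQ_le_const2[OF lim]) (use N that in \<open>auto intro!: exI[of _ N] less_imp_le\<close>)
      moreover have "0 \<le> lim (\<lambda>m. nrm X (u n \<ominus> u m))"
        by (rule LIMSEQ_le_const[OF lim]) (use c nrm_nonneg in auto)
      ultimately show ?thesis using \<open>e > 0\<close> by simp
    qed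
    then show "\<exists>N. \<forall>n\<ge>N. norm (lim (\<lambda>m. nrm X (u n \<ominus> u m)) - 0) < e" by blast
  qed
  moreover have "null_class CS u \<in> carrier C"
    using u by (simp add: completion_def CS.quotient_simps)
  ultimately show ?thesis using c by (simp add: tends_to_def completion_embedding_simps)
qed

lemma completion_dense:
  assumes "z \<in> carrier C"
  obtains u where "u \<in> carrier CS" "tends_to C (\<lambda>n. emb (u n)) z"
  using completion_carrierE[OF assms] embedding_tends_to by metis

lemma completion_eqI:
  assumes "normed_space Y" "bounded_map C Y K S" "bounded_map C Y L T"
    and "\<And>x. x \<in> carrier X \<Longrightarrow> S (emb x) = T (emb x)" "z \<in> carrier C"
  shows "S z = T z"
proof -
  interpret Y: normed_space Y by fact
  interpret C: normed_space C by (rule normed_completion)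
  obtain u where u: "u \<in> carrier CS" "tends_to C (\<lambda>n. emb (u n)) z"
    using completion_dense[OF assms(5)] .
  have "tends_to Y (\<lambda>n. S (emb (u n))) (S z)" "tends_to Y (\<lambda>n. T (emb (u n))) (T z)"
    using bounded_map_tends_to[OF C.seminormed_space_axioms Y.seminormed_space_axioms] assms(2,3) u(2)
    by blast+
  then show ?thesis
    using assms(4) cauchy_sequencesD(1)[OF u(1)] Y.tends_to_unique by simp
qed

text \<open>Density replaces the k-th term of a Cauchy sequence of the completion by an element of X
  within 1/(k + 1). These elements form a Cauchy sequence of X, and its class is the limit.\<close>

lemma complete_completion: "complete_space C"
  unfolding complete_space_def
proof
  interpret C: normed_space C by (rule normed_completion)
  fix w assume "w \<in> carrier (cauchy_sequences C)"
  note w = C.cauchy_sequencesD[OF this]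
  have "\<exists>x\<in>carrier X. nrm C (w k \<ominus>\<^bsub>C\<^esub> emb x) < 1 / Suc k" for k
  proof -
    obtain u where u: "u \<in> carrier CS" "tends_to C (\<lambda>n. emb (u n)) (w k)"
      using completion_dense[OF w(1)] .
    then have "\<forall>\<^sub>F n in sequentially. nrm C (emb (u n) \<ominus>\<^bsub>C\<^esub> w k) < 1 / Suc k"
      by (intro order_tendstoD(2)) (auto simp: tends_to_def)
    then obtain n where n: "nrm C (emb (u n) \<ominus>\<^bsub>C\<^esub> w k) < 1 / Suc k"
      by (auto simp: eventually_sequentially)
    have "u n \<in> carrier X" using cauchy_sequencesD(1)[OF u(1)] .
    then show ?thesis
      using n C.nrm_diff_commute[of "emb (u n)" "w k"] w(1) by (auto simp: completion_embedding_simps)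
  qed
  then obtain x where x: "\<And>k. x k \<in> carrier X" "\<And>k. nrm C (w k \<ominus>\<^bsub>C\<^esub> emb (x k)) < 1 / Suc k"
    by metis
  have ex: "emb (x k) \<in> carrier C" for k using x(1) by (simp add: completion_embedding_simps)
  have emb_diff: "nrm C (emb a \<ominus>\<^bsub>C\<^esub> emb b) = nrm X (a \<ominus> b)" if "a \<in> carrier X" "b \<in> carrier X" for a b
  proof -
    have "emb a \<ominus>\<^bsub>C\<^esub> emb b = emb (a \<ominus> b)"
      using that by (simp add: C.diff_eq diff_eq completion_embedding_simps)
    then show ?thesis using that by (simp add: completion_embedding_simps)
  qed
  have xc: "x \<in> carrier CS"
  proof (rule cauchy_sequencesI)
    fix e :: real assume "e > 0"
    then obtain N where N: "\<forall>m\<ge>N. \<forall>n\<ge>N. nrm C (w m \<ominus>\<^bsub>C\<^esub> w n) < e/3"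
      using w(2)[of "e/3"] by auto
    obtain M where M: "1 / Suc M < e/3" using \<open>e > 0\<close> nat_approx_posE by (metis zero_less_divide_iff zero_less_numeral)
    have "nrm X (x m \<ominus> x n) < e" if "m \<ge> max N M" "n \<ge> max N M" for m n
    proof -
      have "1 / Suc m \<le> 1 / Suc M" "1 / Suc n \<le> 1 / Suc M"
        using that by (auto intro!: divide_left_mono)
      moreover have "nrm X (x m \<ominus> x n) \<le> nrm C (emb (x m) \<ominus>\<^bsub>C\<^esub> w m) + nrm C (w m \<ominus>\<^bsub>C\<^esub> emb (x n))"
        using C.nrm_diff_triangle[OF ex w(1) ex] emb_diff[OF x(1) x(1)] by metis
      moreover have "nrm C (w m \<ominus>\<^bsub>C\<^esub> emb (x n)) \<le> nrm C (w m \<ominus>\<^bsub>C\<^esub> w n) + nrm C (w n \<ominus>\<^bsub>C\<^esub> emb (x n))"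
        using C.nrm_diff_triangle[OF w(1) w(1) ex] by metis
      moreover have "nrm C (w m \<ominus>\<^bsub>C\<^esub> w n) < e/3" using N that by simp
      ultimately show ?thesis
        using x(2)[of m] x(2)[of n] M C.nrm_diff_commute[OF w(1) ex, of m m] by linarith
    qed
    then show "\<exists>N. \<forall>m\<ge>N. \<forall>n\<ge>N. nrm X (x m \<ominus> x n) < e" by blast
  qed (use x in auto)
  let ?z = "null_class CS x"
  have z: "tends_to C (\<lambda>n. emb (x n)) ?z" by (rule embedding_tends_to[OF xc])
  then have zc: "?z \<in> carrier C" by (simp add: tends_to_def)
  have "(\<lambda>n. nrm C (w n \<ominus>\<^bsub>C\<^esub> ?z)) \<longlonglongrightarrow> 0"
  proof (rule tendsto_sandwich[OF _ _ tendsto_const])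
    show "(\<lambda>n. 1 / Suc n + nrm C (emb (x n) \<ominus>\<^bsub>C\<^esub> ?z)) \<longlonglongrightarrow> 0"
      using z lim_1_over_n by (intro tendsto_add_zero LIMSEQ_Suc[OF lim_1_over_n]) (auto simp: tends_to_def)
    show "\<forall>\<^sub>F n in sequentially. nrm C (w n \<ominus>\<^bsub>C\<^esub> ?z) \<le> 1 / Suc n + nrm C (emb (x n) \<ominus>\<^bsub>C\<^esub> ?z)"
      using C.nrm_diff_triangle[OF w(1) ex zc] x(2)
      by (intro always_eventually allI) (smt (verit))
  qed (use w(1) zc C.nrm_nonneg in auto)
  then show "\<exists>x\<in>carrier C. (\<lambda>n. nrm C (w n \<ominus>\<^bsub>C\<^esub> x)) \<longlonglongrightarrow> 0" using zc by blast
qed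

lemma completion_extend:
  assumes Y: "normed_space Y" "complete_space Y" and L: "bounded_map X Y K L"
  obtains T where "T \<in> carrier (bounded_operators C Y)" "\<And>x. x \<in> carrier X \<Longrightarrow> T (emb x) = L x"
    "\<And>z. z \<in> carrier C \<Longrightarrow> nrm Y (T z) \<le> K * nrm C z"
proof -
  interpret Y: normed_space Y by fact
  interpret CS: seminormed_space CS by (rule seminormed_cauchy_sequences)
  interpret C: normed_space C by (rule normed_completion)
  note LD = bounded_mapD[OF L]
  have lin: "linear_map X Y L" using L by (simp add: bounded_map_def)
  have ex: "\<exists>y. tends_to Y (\<lambda>n. L (u n)) y" if u: "u \<in> carrier CS" for u
  proof -
    have c: "u n \<in> carrier X" for n using cauchy_sequencesD(1)[OF u] .
    have Lb: "bounded_map X Y (\<bar>K\<bar> + 1) L"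
      using bounded_map_mono[OF seminormed_space_axioms L, of "\<bar>K\<bar> + 1"] by simp
    have "(\<lambda>n. L (u n)) \<in> carrier (cauchy_sequences Y)"
    proof (rule Y.cauchy_sequencesI)
      fix e :: real assume "e > 0"
      then obtain N where N: "\<forall>m\<ge>N. \<forall>n\<ge>N. nrm X (u m \<ominus> u n) < e / (\<bar>K\<bar> + 1)"
        using cauchy_sequencesD(2)[OF u, of "e / (\<bar>K\<bar> + 1)"] by auto
      have "nrm Y (L (u m) \<ominus>\<^bsub>Y\<^esub> L (u n)) < e" if "m \<ge> N" "n \<ge> N" for m n
      proof -
        have "nrm Y (L (u m) \<ominus>\<^bsub>Y\<^esub> L (u n)) \<le> (\<bar>K\<bar> + 1) * nrm X (u m \<ominus> u n)"
          using bounded_mapD(4)[OF Lb, of "u m \<ominus> u n"] c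
            linear_map_diff[OF seminormed_space_axioms Y.seminormed_space_axioms lin] by simp
        also have "\<dots> < e"
          using N that pos_less_divide_eq[of "\<bar>K\<bar> + 1"] by (simp add: mult.commute)
        finally show ?thesis .
      qed
      then show "\<exists>N. \<forall>m\<ge>N. \<forall>n\<ge>N. nrm Y (L (u m) \<ominus>\<^bsub>Y\<^esub> L (u n)) < e" by blast
    qed (use LD c in auto)
    from bspec[OF Y(2)[unfolded complete_space_def] this]
    obtain y where "y \<in> carrier Y" "(\<lambda>n. nrm Y (L (u n) \<ominus>\<^bsub>Y\<^esub> y)) \<longlonglongrightarrow> 0"
      by auto
    then show ?thesis
      using LD(1) c by (auto simp: tends_to_def)
  qed
  \<comment> \<open>\<open>T\<close> goes through the chosen representative of a class; the next
    fact shows that every other representative leads to the same limit.\<close>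
  define T where "T z = (SOME y. tends_to Y (\<lambda>n. L (repr z n)) y)" for z
  have T: "tends_to Y (\<lambda>n. L (u n)) (T (null_class CS u))" if u: "u \<in> carrier CS" for u
  proof -
    let ?v = "repr (null_class CS u)"
    have v: "?v \<in> carrier CS" "nrm CS (u \<ominus>\<^bsub>CS\<^esub> ?v) = 0"
      using CS.repr_null_class[OF u] by auto
    have c: "u n \<in> carrier X" "?v n \<in> carrier X" for n
      using cauchy_sequencesD(1)[OF u] cauchy_sequencesD(1)[OF v(1)] by auto
    have Tv: "tends_to Y (\<lambda>n. L (?v n)) (T (null_class CS u))"
      unfolding T_def by (rule someI_ex[OF ex[OF v(1)]])
    have eq: "u \<ominus>\<^bsub>CS\<^esub> ?v = (\<lambda>n. u n \<ominus> ?v n)"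
      using c v u by (simp add: CS.diff_eq diff_eq) (simp add: cauchy_sequences_simps)
    \<comment> \<open>Equivalent Cauchy sequences differ by a null sequence, and boundedness of
      \<open>L\<close> keeps it null.\<close>
    have "(\<lambda>n. nrm X (u n \<ominus> ?v n)) \<longlonglongrightarrow> 0"
      using cauchy_nrm_tendsto[OF CS.diff_closed[OF u v(1)]] v(2) by (simp add: eq)
    then have "(\<lambda>n. K * nrm X (u n \<ominus> ?v n)) \<longlonglongrightarrow> 0"
      by (rule tendsto_mult_right_zero)
    then have "(\<lambda>n. nrm Y (L (u n \<ominus> ?v n))) \<longlonglongrightarrow> 0"
      by (rule tendsto_sandwich[OF _ _ tendsto_const, rotated 2]) (use LD c Y.nrm_nonneg in auto)
    then have "tends_to Y (\<lambda>n. L (u n \<ominus> ?v n)) \<zero>\<^bsub>Y\<^esub>"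
      using LD(1) c by (simp add: tends_to_def)
    from Y.tends_to_add[OF this Tv] show ?thesis
      using LD(1) c Tv linear_map_diff[OF seminormed_space_axioms Y.seminormed_space_axioms lin]
      by (simp add: Y.diff_add_cancel tends_to_def)
  qed
  have Cc: "\<And>z. z \<in> carrier C \<longleftrightarrow> (\<exists>u\<in>carrier CS. z = null_class CS u)"
    by (auto simp: completion_def CS.quotient_simps)
  have bT: "bounded_map C Y K T"
  proof (rule bounded_mapI)
    fix z assume "z \<in> carrier C"
    then obtain u where u: "u \<in> carrier CS" "z = null_class CS u" using Cc by blast
    have c: "u n \<in> carrier X" for n using cauchy_sequencesD(1)[OF u(1)] .
    show "T z \<in> carrier Y" using T[OF u(1)] u(2) by (simp add: tends_to_def)
    show "nrm Y (T z) \<le> K * nrm C z"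
    proof (rule LIMSEQ_le)
      show "(\<lambda>n. nrm Y (L (u n))) \<longlonglongrightarrow> nrm Y (T z)"
        using T[OF u(1)] u(2) Y.tends_to_nrm by simp
      show "(\<lambda>n. K * nrm X (u n)) \<longlonglongrightarrow> K * nrm C z"
        using cauchy_nrm_tendsto[OF u(1)] u CS.quotient_simps(5)[OF u(1)]
        by (intro tendsto_mult_left) (simp add: completion_def)
    qed (use LD c in auto)
    have "tends_to Y (\<lambda>n. L (c \<odot> u n)) (T (c \<odot>\<^bsub>C\<^esub> z))" for c
      using T[OF cauchy_smult[OF u(1)]] u CS.quotient_simps(4)[OF u(1), of c]
      by (simp add: completion_def cauchy_sequences_simps(3))
    moreover have "tends_to Y (\<lambda>n. L (c \<odot> u n)) (c \<odot>\<^bsub>Y\<^esub> T z)" for c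
      using Y.tends_to_smult[OF T[OF u(1)]] LD(3) u cauchy_sequencesD(1)[OF u(1)] by simp
    ultimately show "T (c \<odot>\<^bsub>C\<^esub> z) = c \<odot>\<^bsub>Y\<^esub> T z" for c using Y.tends_to_unique by blast
    fix z' assume "z' \<in> carrier C"
    then obtain v where v: "v \<in> carrier CS" "z' = null_class CS v" using Cc by blast
    have "tends_to Y (\<lambda>n. L (u n \<oplus> v n)) (T (z \<oplus>\<^bsub>C\<^esub> z'))"
      using T[OF cauchy_add[OF u(1) v(1)]] u v CS.quotient_simps(3)[OF u(1) v(1)]
      by (simp add: completion_def cauchy_sequences_simps(2))
    moreover have "tends_to Y (\<lambda>n. L (u n \<oplus> v n)) (T z \<oplus>\<^bsub>Y\<^esub> T z')"
      using Y.tends_to_add[OF T[OF u(1)] T[OF v(1)]] LD(2) u v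
        cauchy_sequencesD(1)[OF u(1)] cauchy_sequencesD(1)[OF v(1)] by simp
    ultimately show "T (z \<oplus>\<^bsub>C\<^esub> z') = T z \<oplus>\<^bsub>Y\<^esub> T z'" using Y.tends_to_unique by blast
  qed
  show ?thesis
  proof
    show "restrict T (carrier C) \<in> carrier (bounded_operators C Y)"
      by (rule restrict_bounded_operators[OF C.seminormed_space_axioms bT])
    show "nrm Y (restrict T (carrier C) z) \<le> K * nrm C z" if "z \<in> carrier C" for z
      using bounded_mapD(4)[OF bT that] that by simp
    fix x assume x: "x \<in> carrier X"
    have "tends_to Y (\<lambda>n. L x) (T (emb x))"
      using T[OF cauchy_const[OF x]] by (simp add: completion_embedding_def)
    then have "T (emb x) = L x"
      using Y.tends_to_unique Y.tends_to_const LD(1)[OF x] by blast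
    then show "restrict T (carrier C) (emb x) = L x" using x by (simp add: completion_embedding_simps)
  qed
qed

end

subsection \<open>The projective tensor product\<close>

lemma lookup_scale_tensor [simp]:
  "Poly_Mapping.lookup (scale_tensor c u) k = c * Poly_Mapping.lookup u k"
  by (simp add: Poly_Mapping.map.rep_eq when_def)

lemma scale_tensor_simps:
  "scale_tensor c (u + v) = scale_tensor c u + scale_tensor c v"
  "scale_tensor c (u - v) = scale_tensor c u - scale_tensor c v"
  "scale_tensor (a + b) u = scale_tensor a u + scale_tensor b u"
  "scale_tensor a (scale_tensor b u) = scale_tensor (a * b) u"
  "scale_tensor 0 u = 0" "scale_tensor 1 u = u" "scale_tensor (-1) u = - u"
  "scale_tensor c 0 = 0" "scale_tensor c (Poly_Mapping.single k d) = Poly_Mapping.single k (c * d)"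
  by (rule poly_mapping_eqI; simp add: lookup_add lookup_minus lookup_single when_def algebra_simps)+

lemma poly_mapping_sum_monomials:
  "(\<Sum>k\<in>Poly_Mapping.keys u. Poly_Mapping.single k (Poly_Mapping.lookup u k)) = u"
  by (rule poly_mapping_eqI)
    (auto simp: lookup_sum lookup_single when_def in_keys_iff if_distrib cong: if_cong)

lemma keys_scale_tensor: "Poly_Mapping.keys (scale_tensor c u) \<subseteq> Poly_Mapping.keys u"
  by (auto simp: in_keys_iff)

lemma uminus_in_tensor_relations:
  "u \<in> tensor_relations X Y \<Longrightarrow> - u \<in> tensor_relations X Y"
  using tensor_relations.scale[of u X Y "-1"] by (simp add: scale_tensor_simps)

lemma diff_in_tensor_relations:
  "u \<in> tensor_relations X Y \<Longrightarrow> v \<in> tensor_relations X Y \<Longrightarrow> u - v \<in> tensor_relations X Y"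
  using tensor_relations.add[OF _ uminus_in_tensor_relations, of u X Y v] by simp

definition tensor_sum :: "('v \<times> 'w) list \<Rightarrow> ('v, 'w) formal_tensor" where
  "tensor_sum ps = (\<Sum>(x, y)\<leftarrow>ps. pure x y)"

definition tensor_cost :: "'v nspace \<Rightarrow> 'w nspace \<Rightarrow> ('v \<times> 'w) list \<Rightarrow> real" where
  "tensor_cost X Y ps = (\<Sum>(x, y)\<leftarrow>ps. nrm X x * nrm Y y)"

definition represents :: "'v nspace \<Rightarrow> 'w nspace \<Rightarrow> ('v \<times> 'w) list \<Rightarrow> ('v, 'w) formal_tensor \<Rightarrow> bool" where
  "represents X Y ps u \<longleftrightarrow> set ps \<subseteq> carrier X \<times> carrier Y \<and> u - tensor_sum ps \<in> tensor_relations X Y"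

lemma projective_seminorm_alt:
  "projective_seminorm X Y u = Inf {tensor_cost X Y ps |ps. represents X Y ps u}"
  by (simp add: projective_seminorm_def tensor_cost_def represents_def tensor_sum_def)

lemma formal_tensors_simps:
  "carrier (formal_tensors X Y) = {u. Poly_Mapping.keys u \<subseteq> carrier X \<times> carrier Y}"
  "zero (formal_tensors X Y) = 0" "add (formal_tensors X Y) = (+)"
  "smult (formal_tensors X Y) = scale_tensor"
  "nrm (formal_tensors X Y) = projective_seminorm X Y"
  by (simp_all add: formal_tensors_def)

text \<open>Phrased through the slices, each bounded by a multiple of the norm of the fixed
  argument, so that facts on \<open>bounded_map\<close> apply to them directly.\<close>

definition bilinear_map :: "'v nspace \<Rightarrow> 'w nspace \<Rightarrow> 'z nspace \<Rightarrow> real \<Rightarrow> ('v \<Rightarrow> 'w \<Rightarrow> 'z) \<Rightarrow> bool" where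
  "bilinear_map X Y Z K \<phi> \<longleftrightarrow>
     (\<forall>x\<in>carrier X. bounded_map Y Z (K * nrm X x) (\<phi> x)) \<and>
     (\<forall>y\<in>carrier Y. bounded_map X Z (K * nrm Y y) (\<lambda>x. \<phi> x y))"

lemma bilinear_mapD:
  assumes "bilinear_map X Y Z K \<phi>" "x \<in> carrier X" "y \<in> carrier Y"
  shows "\<phi> x y \<in> carrier Z" "nrm Z (\<phi> x y) \<le> K * nrm X x * nrm Y y"
    and "x' \<in> carrier X \<Longrightarrow> \<phi> (x \<oplus>\<^bsub>X\<^esub> x') y = \<phi> x y \<oplus>\<^bsub>Z\<^esub> \<phi> x' y"
    and "y' \<in> carrier Y \<Longrightarrow> \<phi> x (y \<oplus>\<^bsub>Y\<^esub> y') = \<phi> x y \<oplus>\<^bsub>Z\<^esub> \<phi> x y'"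
    and "\<phi> (c \<odot>\<^bsub>X\<^esub> x) y = c \<odot>\<^bsub>Z\<^esub> \<phi> x y" "\<phi> x (c \<odot>\<^bsub>Y\<^esub> y) = c \<odot>\<^bsub>Z\<^esub> \<phi> x y"
proof -
  have b: "bounded_map Y Z (K * nrm X x) (\<phi> x)" "bounded_map X Z (K * nrm Y y) (\<lambda>x. \<phi> x y)"
    using assms by (auto simp: bilinear_map_def)
  show "\<phi> x y \<in> carrier Z" "nrm Z (\<phi> x y) \<le> K * nrm X x * nrm Y y"
    "x' \<in> carrier X \<Longrightarrow> \<phi> (x \<oplus>\<^bsub>X\<^esub> x') y = \<phi> x y \<oplus>\<^bsub>Z\<^esub> \<phi> x' y"
    "y' \<in> carrier Y \<Longrightarrow> \<phi> x (y \<oplus>\<^bsub>Y\<^esub> y') = \<phi> x y \<oplus>\<^bsub>Z\<^esub> \<phi> x y'"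
    "\<phi> (c \<odot>\<^bsub>X\<^esub> x) y = c \<odot>\<^bsub>Z\<^esub> \<phi> x y" "\<phi> x (c \<odot>\<^bsub>Y\<^esub> y) = c \<odot>\<^bsub>Z\<^esub> \<phi> x y"
    using bounded_mapD[OF b(1)] bounded_mapD[OF b(2)] assms(2,3) by auto
qed

lemma bilinear_mapI:
  assumes "\<And>x y. x \<in> carrier X \<Longrightarrow> y \<in> carrier Y \<Longrightarrow> \<phi> x y \<in> carrier Z"
    and "\<And>x y. x \<in> carrier X \<Longrightarrow> y \<in> carrier Y \<Longrightarrow> nrm Z (\<phi> x y) \<le> K * nrm X x * nrm Y y"
    and "\<And>x x' y. x \<in> carrier X \<Longrightarrow> x' \<in> carrier X \<Longrightarrow> y \<in> carrier Y \<Longrightarrow> \<phi> (x \<oplus>\<^bsub>X\<^esub> x') y = \<phi> x y \<oplus>\<^bsub>Z\<^esub> \<phi> x' y"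
    and "\<And>x y y'. x \<in> carrier X \<Longrightarrow> y \<in> carrier Y \<Longrightarrow> y' \<in> carrier Y \<Longrightarrow> \<phi> x (y \<oplus>\<^bsub>Y\<^esub> y') = \<phi> x y \<oplus>\<^bsub>Z\<^esub> \<phi> x y'"
    and "\<And>c x y. x \<in> carrier X \<Longrightarrow> y \<in> carrier Y \<Longrightarrow> \<phi> (c \<odot>\<^bsub>X\<^esub> x) y = c \<odot>\<^bsub>Z\<^esub> \<phi> x y"
    and "\<And>c x y. x \<in> carrier X \<Longrightarrow> y \<in> carrier Y \<Longrightarrow> \<phi> x (c \<odot>\<^bsub>Y\<^esub> y) = c \<odot>\<^bsub>Z\<^esub> \<phi> x y"
  shows "bilinear_map X Y Z K \<phi>"
  unfolding bilinear_map_def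
proof (intro conjI ballI bounded_mapI)
  fix x y assume "x \<in> carrier X" "y \<in> carrier Y"
  then show "nrm Z (\<phi> x y) \<le> K * nrm Y y * nrm X x"
    using assms(2)[of x y] by (simp add: mult.assoc mult.commute[of "nrm X x"])
qed (use assms in auto)

locale tensor_pair = X: seminormed_space X + Y: seminormed_space Y
  for X :: "'v nspace" and Y :: "'w nspace"
begin

abbreviation (input) "FT \<equiv> formal_tensors X Y"
abbreviation (input) "PT \<equiv> projective_tensor X Y"
abbreviation (input) "et \<equiv> elementary_tensor X Y"

lemma tensor_cost_nonneg: "set ps \<subseteq> carrier X \<times> carrier Y \<Longrightarrow> 0 \<le> tensor_cost X Y ps"
  unfolding tensor_cost_def
  by (rule sum_list_nonneg) (auto intro!: mult_nonneg_nonneg X.nrm_nonneg Y.nrm_nonneg)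

lemma seminorm_le: "represents X Y ps u \<Longrightarrow> projective_seminorm X Y u \<le> tensor_cost X Y ps"
  unfolding projective_seminorm_alt
  by (rule cInf_lower) (auto intro!: bdd_belowI[of _ 0] tensor_cost_nonneg simp: represents_def)

lemma represents_append:
  "represents X Y ps u \<Longrightarrow> represents X Y qs v \<Longrightarrow> represents X Y (ps @ qs) (u + v)"
  using tensor_relations.add[of "u - tensor_sum ps" X Y "v - tensor_sum qs"]
  by (auto simp: represents_def tensor_sum_def algebra_simps)

lemma represents_scale:
  assumes "represents X Y ps u"
  shows "represents X Y (map (\<lambda>(x, y). (c \<odot>\<^bsub>X\<^esub> x, y)) ps) (scale_tensor c u)"
proof -
  have "set ps \<subseteq> carrier X \<times> carrier Y" using assms by (simp add: represents_def)
  then have "scale_tensor c (tensor_sum ps) - tensor_sum (map (\<lambda>(x, y). (c \<odot>\<^bsub>X\<^esub> x, y)) ps)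
      \<in> tensor_relations X Y"
  proof (induction ps)
    case Nil
    then show ?case using tensor_relations.zero by (simp add: tensor_sum_def scale_tensor_simps)
  next
    case (Cons p ps)
    obtain x y where p: "p = (x, y)" by (cases p)
    have *: "pure (c \<odot>\<^bsub>X\<^esub> x) y - scale_tensor c (pure x y) \<in> tensor_relations X Y"
      using Cons.prems p by (intro tensor_relations.scale_left) auto
    have aux: "a - b - (q - s) = (s + a) - (q + b)" for a b q s :: "('v, 'w) formal_tensor"
      by (simp add: algebra_simps)
    have "(scale_tensor c (tensor_sum ps) - tensor_sum (map (\<lambda>(x, y). (c \<odot>\<^bsub>X\<^esub> x, y)) ps))
      - (pure (c \<odot>\<^bsub>X\<^esub> x) y - scale_tensor c (pure x y)) \<in> tensor_relations X Y"
      by (rule diff_in_tensor_relations[OF _ *]) (use Cons in auto)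
    then have "(scale_tensor c (pure x y) + scale_tensor c (tensor_sum ps))
      - (pure (c \<odot>\<^bsub>X\<^esub> x) y + tensor_sum (map (\<lambda>(x, y). (c \<odot>\<^bsub>X\<^esub> x, y)) ps)) \<in> tensor_relations X Y"
      by (simp only: aux)
    then show ?case unfolding scale_tensor_simps(1)[symmetric] by (simp add: p tensor_sum_def)
  qed
  from tensor_relations.add[OF this tensor_relations.scale]
  have "(scale_tensor c (tensor_sum ps) - tensor_sum (map (\<lambda>(x, y). (c \<odot>\<^bsub>X\<^esub> x, y)) ps))
      + scale_tensor c (u - tensor_sum ps) \<in> tensor_relations X Y"
    using assms by (simp add: represents_def)
  then show ?thesis
    using assms by (auto simp: represents_def scale_tensor_simps(2))
qed

lemma tensor_cost_scale:
  assumes "set ps \<subseteq> carrier X \<times> carrier Y"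
  shows "tensor_cost X Y (map (\<lambda>(x, y). (c \<odot>\<^bsub>X\<^esub> x, y)) ps) = cmod c * tensor_cost X Y ps"
  using assms by (induction ps) (auto simp: tensor_cost_def X.nrm_smult algebra_simps)

lemma represents_pure: "x \<in> carrier X \<Longrightarrow> y \<in> carrier Y \<Longrightarrow> represents X Y [(x, y)] (pure x y)"
  using tensor_relations.zero by (simp add: represents_def tensor_sum_def)

text \<open>Guarantees that the infimum in \<open>projective_seminorm\<close> is over a nonempty
  set. The coefficient of a pair is absorbed into its left factor.\<close>

lemma represents_exists:
  assumes "u \<in> carrier FT"
  obtains ps where "represents X Y ps u"
proof -
  have "\<exists>ps. represents X Y ps (\<Sum>k\<in>F. Poly_Mapping.single k (Poly_Mapping.lookup u k))"
    if "finite F" "F \<subseteq> carrier X \<times> carrier Y" for F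
    using that
  proof (induction F)
    case empty
    then show ?case using tensor_relations.zero by (intro exI[of _ "[]"]) (simp add: represents_def tensor_sum_def)
  next
    case (insert k F)
    obtain x y where k: "k = (x, y)" by (cases k)
    obtain ps where ps: "represents X Y ps (\<Sum>k\<in>F. Poly_Mapping.single k (Poly_Mapping.lookup u k))"
      using insert by auto
    have "represents X Y [(x, y)] (pure x y)"
      using insert.prems k by (intro represents_pure) auto
    from represents_append[OF represents_scale[OF this] ps]
    show ?case using insert.hyps by (auto simp: scale_tensor_simps k)
  qed
  from this[of "Poly_Mapping.keys u"] show ?thesis
    using assms that by (auto simp: formal_tensors_simps poly_mapping_sum_monomials)
qed

lemma seminorm_greatest:
  assumes "u \<in> carrier FT" "\<And>ps. represents X Y ps u \<Longrightarrow> b \<le> tensor_cost X Y ps"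
  shows "b \<le> projective_seminorm X Y u"
proof -
  obtain ps where "represents X Y ps u" using represents_exists[OF assms(1)] .
  then show ?thesis
    unfolding projective_seminorm_alt by (intro cInf_greatest) (use assms(2) in auto)
qed

lemma seminormed_formal_tensors: "seminormed_space FT"
proof (rule seminormed_spaceI)
  have keys_add: "Poly_Mapping.keys (u + v) \<subseteq> K" if "Poly_Mapping.keys u \<subseteq> K" "Poly_Mapping.keys v \<subseteq> K" for u v :: "('v,'w) formal_tensor" and K
    using Poly_Mapping.keys_add[of u v] that by blast
  have keys_scale: "Poly_Mapping.keys (scale_tensor c u) \<subseteq> K" if "Poly_Mapping.keys u \<subseteq> K" for u :: "('v,'w) formal_tensor" and c K
    using keys_scale_tensor[of c u] that by blast
  show "\<zero>\<^bsub>FT\<^esub> \<in> carrier FT" by (simp add: formal_tensors_simps)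
  fix u v c assume u: "u \<in> carrier FT"
  show cu: "c \<odot>\<^bsub>FT\<^esub> u \<in> carrier FT" for c
    using u keys_scale by (simp add: formal_tensors_simps)
  show "0 \<le> nrm FT u"
    unfolding formal_tensors_simps
    by (rule seminorm_greatest[OF u]) (use tensor_cost_nonneg in \<open>auto simp: represents_def\<close>)
  have le: "projective_seminorm X Y (scale_tensor c u) \<le> cmod c * projective_seminorm X Y u"
    if u: "u \<in> carrier FT" for c u
  proof (cases "c = 0")
    case True
    have "represents X Y [] 0"
      using tensor_relations.zero by (simp add: represents_def tensor_sum_def)
    from seminorm_le[OF this] show ?thesis
      using True by (simp add: scale_tensor_simps tensor_cost_def)
  next
    case False
    have "projective_seminorm X Y (scale_tensor c u) / cmod c \<le> projective_seminorm X Y u"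
    proof (rule seminorm_greatest[OF u])
      fix ps assume ps: "represents X Y ps u"
      then have "projective_seminorm X Y (scale_tensor c u) \<le> cmod c * tensor_cost X Y ps"
        using seminorm_le[OF represents_scale[OF ps, of c]] tensor_cost_scale[of ps c]
        by (simp add: represents_def)
      then show "projective_seminorm X Y (scale_tensor c u) / cmod c \<le> tensor_cost X Y ps"
        using False by (simp add: field_simps)
    qed
    then show ?thesis using False by (simp add: field_simps)
  qed
  show "nrm FT (c \<odot>\<^bsub>FT\<^esub> u) = cmod c * nrm FT u"
  proof (cases "c = 0")
    case True
    have "represents X Y [] 0"
      using tensor_relations.zero by (simp add: represents_def tensor_sum_def)
    from seminorm_le[OF this] have "projective_seminorm X Y (0 :: ('v,'w) formal_tensor) \<le> 0"
      by (simp add: tensor_cost_def)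
    moreover have "0 \<le> projective_seminorm X Y (0 :: ('v,'w) formal_tensor)"
      by (rule seminorm_greatest) (use tensor_cost_nonneg in \<open>auto simp: represents_def formal_tensors_simps\<close>)
    ultimately show ?thesis
      using True by (simp add: formal_tensors_simps scale_tensor_simps)
  next
    case False
    have "projective_seminorm X Y u \<le> cmod (1 / c) * projective_seminorm X Y (scale_tensor c u)"
      using le[OF cu[of c], of "1 / c"] False
      by (simp add: scale_tensor_simps formal_tensors_simps)
    then show ?thesis using le[OF u, of c] False
      by (simp add: formal_tensors_simps norm_divide field_simps)
  qed
  assume v: "v \<in> carrier FT"
  show "u \<oplus>\<^bsub>FT\<^esub> v \<in> carrier FT"
    using u v keys_add by (simp add: formal_tensors_simps)
  \<comment> \<open>The two infima are taken one at a time: the decomposition of u is held fixed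
    while the one of v varies.\<close>
  have "projective_seminorm X Y (u + v) - projective_seminorm X Y v \<le> projective_seminorm X Y u"
  proof (rule seminorm_greatest[OF u])
    fix ps assume ps: "represents X Y ps u"
    have "projective_seminorm X Y (u + v) - tensor_cost X Y ps \<le> projective_seminorm X Y v"
    proof (rule seminorm_greatest[OF v])
      fix qs assume qs: "represents X Y qs v"
      show "projective_seminorm X Y (u + v) - tensor_cost X Y ps \<le> tensor_cost X Y qs"
        using seminorm_le[OF represents_append[OF ps qs]] by (simp add: tensor_cost_def)
    qed
    then show "projective_seminorm X Y (u + v) - projective_seminorm X Y v \<le> tensor_cost X Y ps"
      by simp
  qed
  then show "nrm FT (u \<oplus>\<^bsub>FT\<^esub> v) \<le> nrm FT u + nrm FT v"
    by (simp add: formal_tensors_simps)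
qed (simp_all add: formal_tensors_simps scale_tensor_simps algebra_simps)

sublocale FT: seminormed_space "formal_tensors X Y"
  by (rule seminormed_formal_tensors)

sublocale PT: normed_space "projective_tensor X Y"
  unfolding projective_tensor_def by (rule FT.normed_completion)

lemma complete_projective_tensor: "complete_space PT"
  unfolding projective_tensor_def by (rule FT.complete_completion)

lemma pure_closed: "x \<in> carrier X \<Longrightarrow> y \<in> carrier Y \<Longrightarrow> pure x y \<in> carrier FT"
  by (simp add: formal_tensors_simps)

lemma formal_minus: "u \<in> carrier FT \<Longrightarrow> v \<in> carrier FT \<Longrightarrow> u \<ominus>\<^bsub>FT\<^esub> v = u - v"
  by (simp add: FT.diff_eq) (simp add: formal_tensors_simps scale_tensor_simps)

text \<open>The empty list represents a relation at cost 0, so u - v has seminorm 0 and vanishes in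
  the Hausdorff quotient.\<close>

lemma emb_eqI:
  assumes "u \<in> carrier FT" "v \<in> carrier FT" "u - v \<in> tensor_relations X Y"
  shows "completion_embedding FT u = completion_embedding FT v"
proof -
  have "represents X Y [] (u - v)" using assms(3) by (simp add: represents_def tensor_sum_def)
  from seminorm_le[OF this] have "nrm FT (u \<ominus>\<^bsub>FT\<^esub> v) \<le> 0"
    using formal_minus[OF assms(1,2)] by (simp add: tensor_cost_def formal_tensors_simps)
  then have "nrm FT (u \<ominus>\<^bsub>FT\<^esub> v) = 0"
    using FT.nrm_nonneg[OF FT.diff_closed[OF assms(1,2)]] by simp
  then have *: "nrm PT (completion_embedding FT (u \<ominus>\<^bsub>FT\<^esub> v)) = 0"
    using assms by (simp add: projective_tensor_def FT.completion_embedding_simps)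
  have "completion_embedding FT (u \<ominus>\<^bsub>FT\<^esub> v) = completion_embedding FT u \<ominus>\<^bsub>PT\<^esub> completion_embedding FT v"
    unfolding projective_tensor_def
    by (rule linear_map_diff[OF FT.seminormed_space_axioms])
      (use FT.bounded_map_completion_embedding assms PT.seminormed_space_axioms in
        \<open>auto simp: bounded_map_def projective_tensor_def\<close>)
  then show ?thesis
    using * assms PT.eq_iff_nrm_diff[of "completion_embedding FT u" "completion_embedding FT v"]
    by (simp add: projective_tensor_def FT.completion_embedding_simps)
qed

lemma et_closed: "x \<in> carrier X \<Longrightarrow> y \<in> carrier Y \<Longrightarrow> et x y \<in> carrier PT"
  using FT.completion_embedding_simps(1)[OF pure_closed]
  by (simp add: elementary_tensor_def projective_tensor_def)

lemma bilinear_elementary_tensor: "bilinear_map X Y PT 1 et"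
proof (rule bilinear_mapI)
  have emb_add: "completion_embedding FT u \<oplus>\<^bsub>PT\<^esub> completion_embedding FT v = completion_embedding FT (u + v)"
    if "u \<in> carrier FT" "v \<in> carrier FT" for u v
    using FT.completion_embedding_simps(3)[OF that] by (simp add: projective_tensor_def formal_tensors_simps(3))
  have emb_sm: "c \<odot>\<^bsub>PT\<^esub> completion_embedding FT u = completion_embedding FT (scale_tensor c u)"
    if "u \<in> carrier FT" for u c
    using FT.completion_embedding_simps(4)[OF that] by (simp add: projective_tensor_def formal_tensors_simps(4))
  have add: "u + v \<in> carrier FT" if "u \<in> carrier FT" "v \<in> carrier FT" for u v
    using FT.a_closed[OF that] by (simp add: formal_tensors_simps(3))
  have sm: "scale_tensor c u \<in> carrier FT" if "u \<in> carrier FT" for u c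
    using FT.sm_closed[OF that] by (simp add: formal_tensors_simps(4))
  fix x y assume xy: "x \<in> carrier X" "y \<in> carrier Y"
  note p = pure_closed[OF xy]
  show "et x y \<in> carrier PT" using et_closed[OF xy] .
  show "nrm PT (et x y) \<le> 1 * nrm X x * nrm Y y"
    using seminorm_le[OF represents_pure[OF xy]] FT.completion_embedding_simps(5)[OF p]
    by (simp add: elementary_tensor_def projective_tensor_def tensor_cost_def formal_tensors_simps(5))
  show "et (c \<odot>\<^bsub>X\<^esub> x) y = c \<odot>\<^bsub>PT\<^esub> et x y" "et x (c \<odot>\<^bsub>Y\<^esub> y) = c \<odot>\<^bsub>PT\<^esub> et x y" for c
    unfolding elementary_tensor_def emb_sm[OF p]
    using xy by (intro emb_eqI sm pure_closed tensor_relations.scale_left tensor_relations.scale_right; simp)+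
  show "et (x \<oplus>\<^bsub>X\<^esub> x') y = et x y \<oplus>\<^bsub>PT\<^esub> et x' y" if x': "x' \<in> carrier X" for x'
  proof -
    have "pure (x \<oplus>\<^bsub>X\<^esub> x') y - (pure x y + pure x' y) \<in> tensor_relations X Y"
      using tensor_relations.add_left[OF xy(1) x' xy(2)] by (simp add: algebra_simps)
    then show ?thesis
      using xy x' p pure_closed unfolding elementary_tensor_def
      by (simp add: emb_add) (intro emb_eqI add, auto)
  qed
  show "et x (y \<oplus>\<^bsub>Y\<^esub> y') = et x y \<oplus>\<^bsub>PT\<^esub> et x y'" if y': "y' \<in> carrier Y" for y'
  proof -
    have "pure x (y \<oplus>\<^bsub>Y\<^esub> y') - (pure x y + pure x y') \<in> tensor_relations X Y"
      using tensor_relations.add_right[OF xy y'] by (simp add: algebra_simps)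
    then show ?thesis
      using xy y' p pure_closed unfolding elementary_tensor_def
      by (simp add: emb_add) (intro emb_eqI add, auto)
  qed
qed

lemma formal_linear_unique:
  assumes "seminormed_space Z" "linear_map FT Z L" "linear_map FT Z M"
    and "\<And>x y. x \<in> carrier X \<Longrightarrow> y \<in> carrier Y \<Longrightarrow> L (pure x y) = M (pure x y)"
    and "u \<in> carrier FT"
  shows "L u = M u"
proof -
  interpret Z: seminormed_space Z by fact
  have "(\<Sum>k\<in>F. Poly_Mapping.single k (c k)) \<in> carrier FT \<and>
      L (\<Sum>k\<in>F. Poly_Mapping.single k (c k)) = M (\<Sum>k\<in>F. Poly_Mapping.single k (c k))"
    if "finite F" "F \<subseteq> carrier X \<times> carrier Y" for F c
    using that
  proof (induction F)
    case empty
    have "0 \<in> carrier FT" using FT.zero_closed by (simp add: formal_tensors_simps)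
    moreover have "L 0 = M 0"
      using linear_map_zero[OF FT.seminormed_space_axioms assms(1)] assms(2,3)
      by (metis formal_tensors_simps(2))
    ultimately show ?case by simp
  next
    case (insert k F)
    obtain x y where k: "k = (x, y)" and xy: "x \<in> carrier X" "y \<in> carrier Y"
      using insert.prems by (cases k) auto
    let ?s = "\<Sum>k\<in>F. Poly_Mapping.single k (c k)"
    have s: "?s \<in> carrier FT" "L ?s = M ?s" using insert by auto
    have p: "pure x y \<in> carrier FT" by (rule pure_closed[OF xy])
    have sk: "Poly_Mapping.single k (c k) = c k \<odot>\<^bsub>FT\<^esub> pure x y"
      by (simp add: formal_tensors_simps scale_tensor_simps k)
    have "L (c k \<odot>\<^bsub>FT\<^esub> pure x y) = M (c k \<odot>\<^bsub>FT\<^esub> pure x y)"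
      using assms(2,3) p assms(4)[OF xy] by (simp add: linear_map_def)
    then have "L (c k \<odot>\<^bsub>FT\<^esub> pure x y \<oplus>\<^bsub>FT\<^esub> ?s) = M (c k \<odot>\<^bsub>FT\<^esub> pure x y \<oplus>\<^bsub>FT\<^esub> ?s)"
      using assms(2,3) s p by (simp add: linear_map_def)
    moreover have "c k \<odot>\<^bsub>FT\<^esub> pure x y \<oplus>\<^bsub>FT\<^esub> ?s \<in> carrier FT" using s p by simp
    ultimately show ?case
      using insert.hyps sk by (simp add: formal_tensors_simps(3))
  qed
  from this[of "Poly_Mapping.keys u" "Poly_Mapping.lookup u"] show ?thesis
    using assms(5) by (simp add: formal_tensors_simps poly_mapping_sum_monomials)
qed

lemma projective_tensor_unique:
  assumes "normed_space Z" "bounded_map PT Z K S" "bounded_map PT Z L T"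
    and "\<And>x y. x \<in> carrier X \<Longrightarrow> y \<in> carrier Y \<Longrightarrow> S (et x y) = T (et x y)"
    and "z \<in> carrier PT"
  shows "S z = T z"
proof -
  interpret Z: normed_space Z by fact
  have lin: "linear_map FT Z (\<lambda>u. U (completion_embedding FT u))" if "bounded_map PT Z K U" for U K
    using bounded_mapD[OF that] bounded_mapD[OF FT.bounded_map_completion_embedding]
    by (auto simp: linear_map_def projective_tensor_def)
  show ?thesis
  proof (rule FT.completion_eqI[OF assms(1)])
    show "bounded_map (completion FT) Z K S" "bounded_map (completion FT) Z L T" "z \<in> carrier (completion FT)"
      using assms(2,3,5) by (simp_all add: projective_tensor_def)
    show "S (completion_embedding FT u) = T (completion_embedding FT u)" if "u \<in> carrier FT" for u
      by (rule formal_linear_unique[OF Z.seminormed_space_axioms lin[OF assms(2)] lin[OF assms(3)] _ that])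
        (use assms(4) in \<open>simp add: elementary_tensor_def\<close>)
  qed
qed

lemma formal_linearization:
  assumes "seminormed_space Z" and \<phi>: "bilinear_map X Y Z K \<phi>"
  obtains L where "linear_map FT Z L"
    "\<And>x y. x \<in> carrier X \<Longrightarrow> y \<in> carrier Y \<Longrightarrow> L (pure x y) = \<phi> x y"
proof -
  interpret Z: seminormed_space Z by fact
  define f where "f u k = Poly_Mapping.lookup u k \<odot>\<^bsub>Z\<^esub> case_prod \<phi> k" for u k
  define L where "L u = (\<Oplus>\<^bsub>Z\<^esub>k\<in>Poly_Mapping.keys u. f u k)" for u
  have \<phi>c: "case_prod \<phi> k \<in> carrier Z" if "k \<in> carrier X \<times> carrier Y" for k
    using that bilinear_mapD(1)[OF \<phi>] by auto
  have fc: "f u k \<in> carrier Z" if "k \<in> carrier X \<times> carrier Y" for u k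
    using \<phi>c[OF that] by (simp add: f_def)
  \<comment> \<open>Coefficients off the support are 0, so any larger finite set of pairs may index
    the sum; additivity uses the union of two supports.\<close>
  have L_sup: "L u = (\<Oplus>\<^bsub>Z\<^esub>k\<in>F. f u k)"
    if "finite F" "Poly_Mapping.keys u \<subseteq> F" "F \<subseteq> carrier X \<times> carrier Y" for u F
    unfolding L_def
  proof (rule Z.add.finprod_mono_neutral_cong_left[OF that(1,2)])
    show "f u i = \<zero>\<^bsub>Z\<^esub>" if "i \<in> F - Poly_Mapping.keys u" for i
      using that \<open>F \<subseteq> carrier X \<times> carrier Y\<close> \<phi>c[of i] by (auto simp: f_def in_keys_iff)
  qed (use that fc in auto)
  have sub: "F \<subseteq> carrier X \<times> carrier Y \<Longrightarrow> f u \<in> F \<rightarrow> carrier Z" for F u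
    using fc by blast
  have "linear_map FT Z L"
    unfolding linear_map_def
  proof (intro conjI ballI allI)
    show "L \<in> carrier FT \<rightarrow> carrier Z"
      unfolding L_def by (auto intro!: Z.finsum_closed fc simp: formal_tensors_simps)
    fix u assume "u \<in> carrier FT"
    then have u: "Poly_Mapping.keys u \<subseteq> carrier X \<times> carrier Y" by (simp add: formal_tensors_simps)
    show "L (c \<odot>\<^bsub>FT\<^esub> u) = c \<odot>\<^bsub>Z\<^esub> L u" for c
    proof -
      have "L (scale_tensor c u) = (\<Oplus>\<^bsub>Z\<^esub>k\<in>Poly_Mapping.keys u. f (scale_tensor c u) k)"
        using u keys_scale_tensor[of c u] by (intro L_sup) auto
      also have "\<dots> = (\<Oplus>\<^bsub>Z\<^esub>k\<in>Poly_Mapping.keys u. c \<odot>\<^bsub>Z\<^esub> f u k)"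
        using u \<phi>c by (intro Z.finsum_cong') (auto simp: f_def Z.sm_assoc intro!: Z.sm_closed)
      also have "\<dots> = c \<odot>\<^bsub>Z\<^esub> L u"
        using Module.module.finsum_smult_ldistr[OF Z.is_module, of "Poly_Mapping.keys u" c "f u"] sub[OF u]
        by (simp add: L_def)
      finally show ?thesis by (simp add: formal_tensors_simps)
    qed
    fix v assume "v \<in> carrier FT"
    then have v: "Poly_Mapping.keys v \<subseteq> carrier X \<times> carrier Y" by (simp add: formal_tensors_simps)
    let ?F = "Poly_Mapping.keys u \<union> Poly_Mapping.keys v"
    have F: "finite ?F" "?F \<subseteq> carrier X \<times> carrier Y" using u v by auto
    have "L (u + v) = (\<Oplus>\<^bsub>Z\<^esub>k\<in>?F. f (u + v) k)"
      using F Poly_Mapping.keys_add[of u v] by (intro L_sup) auto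
    also have "\<dots> = (\<Oplus>\<^bsub>Z\<^esub>k\<in>?F. f u k \<oplus>\<^bsub>Z\<^esub> f v k)"
      using F(2) \<phi>c fc by (intro Z.finsum_cong') (auto simp: f_def lookup_add Z.sm_l_distr)
    also have "\<dots> = L u \<oplus>\<^bsub>Z\<^esub> L v"
      using sub[OF F(2)] F by (simp add: Z.finsum_addf L_sup[of ?F])
    finally show "L (u \<oplus>\<^bsub>FT\<^esub> v) = L u \<oplus>\<^bsub>Z\<^esub> L v" by (simp add: formal_tensors_simps)
  qed
  moreover have "L (pure x y) = \<phi> x y" if "x \<in> carrier X" "y \<in> carrier Y" for x y
    using \<phi>c[of "(x, y)"] that by (simp add: L_def f_def)
  ultimately show ?thesis using that by blast
qed

text \<open>The relations express bilinearity, so the image of each generator cancels. This is why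
  all decompositions of a tensor compute the same value.\<close>

lemma linear_kills_relations:
  assumes "seminormed_space Z" "bilinear_map X Y Z K \<phi>" "linear_map FT Z L"
    and L: "\<And>x y. x \<in> carrier X \<Longrightarrow> y \<in> carrier Y \<Longrightarrow> L (pure x y) = \<phi> x y"
    and "u \<in> tensor_relations X Y"
  shows "u \<in> carrier FT \<and> L u = \<zero>\<^bsub>Z\<^esub>"
proof -
  interpret Z: seminormed_space Z by fact
  note \<phi> = bilinear_mapD[OF assms(2)]
  have add: "u + v \<in> carrier FT" "L (u + v) = L u \<oplus>\<^bsub>Z\<^esub> L v"
    if "u \<in> carrier FT" "v \<in> carrier FT" for u v
    using FT.a_closed[OF that] that assms(3) by (auto simp: formal_tensors_simps(3) linear_map_def)
  have sm: "scale_tensor c u \<in> carrier FT" "L (scale_tensor c u) = c \<odot>\<^bsub>Z\<^esub> L u"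
    if "u \<in> carrier FT" for u c
    using FT.sm_closed[OF that] that assms(3) by (auto simp: formal_tensors_simps(4) linear_map_def)
  have diff: "u - v \<in> carrier FT" "L (u - v) = L u \<ominus>\<^bsub>Z\<^esub> L v"
    if "u \<in> carrier FT" "v \<in> carrier FT" for u v
    using formal_minus[OF that] FT.diff_closed[OF that]
      linear_map_diff[OF FT.seminormed_space_axioms assms(1,3) that] by auto
  have cancel: "(a \<oplus>\<^bsub>Z\<^esub> b) \<ominus>\<^bsub>Z\<^esub> a \<ominus>\<^bsub>Z\<^esub> b = \<zero>\<^bsub>Z\<^esub>" if "a \<in> carrier Z" "b \<in> carrier Z" for a b
    using Z.add_diff_cancel[of b a] Z.a_comm[of a b] that by simp
  show ?thesis
    using assms(5)
  proof induction
    case zero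
    then show ?case
      using linear_map_zero[OF FT.seminormed_space_axioms assms(1,3)] FT.zero_closed
      by (simp add: formal_tensors_simps)
  next
    case (scale_left x y c)
    then show ?case
      using sm[OF pure_closed, of x y c] L \<phi> by (simp add: diff pure_closed scale_tensor_simps)
  next
    case (scale_right x y c)
    then show ?case
      using sm[OF pure_closed, of x y c] L \<phi> by (simp add: diff pure_closed scale_tensor_simps)
  qed (auto simp: add sm diff pure_closed L \<phi> cancel)
qed

text \<open>Relations are killed, so L u is the sum of \<phi> over any decomposition of u, and its
  norm is at most a constant times the cost of that decomposition. The infimum of the costs bounds L
  by the seminorm, and L extends to the completion.\<close>

theorem linearize_exists:
  assumes Z: "normed_space Z" "complete_space Z" and \<phi>: "bilinear_map X Y Z K \<phi>"
  obtains T where "T \<in> carrier (bounded_operators PT Z)"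
    "\<And>x y. x \<in> carrier X \<Longrightarrow> y \<in> carrier Y \<Longrightarrow> T (et x y) = \<phi> x y"
proof -
  interpret Z: normed_space Z by fact
  obtain L where lin: "linear_map FT Z L"
    and L: "\<And>x y. x \<in> carrier X \<Longrightarrow> y \<in> carrier Y \<Longrightarrow> L (pure x y) = \<phi> x y"
    using formal_linearization[OF Z.seminormed_space_axioms \<phi>] by metis
  \<comment> \<open>At least K, and strictly positive because it is divided by below.\<close>
  define K' where "K' = \<bar>K\<bar> + 1"
  have K': "K' > 0" by (simp add: K'_def)
  have \<phi>K: "nrm Z (\<phi> x y) \<le> K' * (nrm X x * nrm Y y)" if "x \<in> carrier X" "y \<in> carrier Y" for x y
  proof -
    have "K * (nrm X x * nrm Y y) \<le> K' * (nrm X x * nrm Y y)"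
      using X.nrm_nonneg[OF that(1)] Y.nrm_nonneg[OF that(2)]
      by (intro mult_right_mono) (auto simp: K'_def)
    then show ?thesis using bilinear_mapD(2)[OF \<phi> that] by (simp add: mult.assoc)
  qed
  have sum: "tensor_sum ps \<in> carrier FT \<and> nrm Z (L (tensor_sum ps)) \<le> K' * tensor_cost X Y ps"
    if "set ps \<subseteq> carrier X \<times> carrier Y" for ps
    using that
  proof (induction ps)
    case Nil
    then show ?case
      using linear_map_zero[OF FT.seminormed_space_axioms Z.seminormed_space_axioms lin] FT.zero_closed
      by (simp add: formal_tensors_simps tensor_sum_def tensor_cost_def)
  next
    case (Cons p ps)
    obtain x y where p: "p = (x, y)" and xy: "x \<in> carrier X" "y \<in> carrier Y"
      using Cons.prems by (cases p) auto
    have s: "tensor_sum (p # ps) = pure x y \<oplus>\<^bsub>FT\<^esub> tensor_sum ps"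
      by (simp add: tensor_sum_def p formal_tensors_simps)
    have t: "tensor_sum ps \<in> carrier FT" using Cons by auto
    have c: "L (pure x y) \<in> carrier Z" "L (tensor_sum ps) \<in> carrier Z"
      using lin t pure_closed[OF xy] by (auto simp: linear_map_def)
    have "L (tensor_sum (p # ps)) = L (pure x y) \<oplus>\<^bsub>Z\<^esub> L (tensor_sum ps)"
      using lin t pure_closed[OF xy] by (simp add: s linear_map_def)
    then show ?case
      using Z.nrm_triangle[OF c] Cons \<phi>K[OF xy] t pure_closed[OF xy] L[OF xy]
      by (simp add: s) (simp add: tensor_cost_def p algebra_simps)
  qed
  have "nrm Z (L u) \<le> K' * projective_seminorm X Y u" if u: "u \<in> carrier FT" for u
  proof -
    have "nrm Z (L u) / K' \<le> projective_seminorm X Y u"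
    proof (rule seminorm_greatest[OF u])
      fix ps assume ps: "represents X Y ps u"
      have t: "tensor_sum ps \<in> carrier FT" "nrm Z (L (tensor_sum ps)) \<le> K' * tensor_cost X Y ps"
        using sum ps by (auto simp: represents_def)
      have "L (u - tensor_sum ps) = \<zero>\<^bsub>Z\<^esub>"
        using linear_kills_relations[OF Z.seminormed_space_axioms \<phi> lin L] ps by (auto simp: represents_def)
      then have "L u \<ominus>\<^bsub>Z\<^esub> L (tensor_sum ps) = \<zero>\<^bsub>Z\<^esub>"
        using linear_map_diff[OF FT.seminormed_space_axioms Z.seminormed_space_axioms lin u t(1)]
          formal_minus[OF u t(1)] by simp
      then have "L u = L (tensor_sum ps)"
        using lin u t(1) Z.eq_iff_nrm_diff[of "L u" "L (tensor_sum ps)"] Z.nrm_zero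
        by (auto simp: linear_map_def)
      then show "nrm Z (L u) / K' \<le> tensor_cost X Y ps"
        using t(2) K' by (simp add: pos_divide_le_eq mult.commute)
    qed
    then show ?thesis using K' by (simp add: pos_divide_le_eq mult.commute)
  qed
  then have "bounded_map FT Z K' L"
    using lin by (simp add: bounded_map_def formal_tensors_simps(5))
  from FT.completion_extend[OF Z this] obtain T where
    T: "T \<in> carrier (bounded_operators (completion FT) Z)"
      "\<And>x. x \<in> carrier FT \<Longrightarrow> T (completion_embedding FT x) = L x" by metis
  show ?thesis
    using that[of T] T pure_closed L by (simp add: projective_tensor_def elementary_tensor_def)
qed

text \<open>Bounded maps that agree on elementary tensors agree on the completed tensor product by
  density, so the \<open>THE\<close> in \<open>linearize\<close> denotes the map just
  constructed.\<close>

theorem linearize_spec: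
  assumes Z: "normed_space Z" "complete_space Z" and \<phi>: "bilinear_map X Y Z K \<phi>"
  shows "linearize X Y Z \<phi> \<in> carrier (bounded_operators PT Z)" (is ?A)
    and "x \<in> carrier X \<Longrightarrow> y \<in> carrier Y \<Longrightarrow> linearize X Y Z \<phi> (et x y) = \<phi> x y"
proof -
  interpret Z: normed_space Z by fact
  obtain T where T: "T \<in> carrier (bounded_operators PT Z)"
    "\<And>x y. x \<in> carrier X \<Longrightarrow> y \<in> carrier Y \<Longrightarrow> T (et x y) = \<phi> x y"
    using linearize_exists[OF assms] by metis
  have "\<exists>!T. T \<in> carrier (bounded_operators PT Z) \<and>
        (\<forall>x\<in>carrier X. \<forall>y\<in>carrier Y. T (et x y) = \<phi> x y)"
  proof (rule ex1I[of _ T])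
    fix T' assume T': "T' \<in> carrier (bounded_operators PT Z) \<and>
        (\<forall>x\<in>carrier X. \<forall>y\<in>carrier Y. T' (et x y) = \<phi> x y)"
    obtain K' K'' where K: "bounded_map PT Z K' T" "bounded_map PT Z K'' T'"
      using T(1) T' by (auto elim!: bounded_operatorsE)
    show "T' = T"
    proof (rule bounded_operators_eqI[OF PT.seminormed_space_axioms Z.normed_space_axioms])
      show "T' z = T z" if "z \<in> carrier PT" for z
        by (rule projective_tensor_unique[OF Z.normed_space_axioms K(2,1) _ that]) (use T T' in auto)
    qed (use T T' in auto)
  qed (use T in auto)
  from theI'[OF this] show ?A "x \<in> carrier X \<Longrightarrow> y \<in> carrier Y \<Longrightarrow> linearize X Y Z \<phi> (et x y) = \<phi> x y"
    unfolding linearize_def by auto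
qed

end

subsection \<open>Adjoints and amenability\<close>

lemma compose_bounded_map:
  assumes "bounded_map X Y K T" "bounded_map Y Z L S" "0 \<le> L" "seminormed_space X"
  shows "bounded_map X Z (L * K) (compose (carrier X) S T)"
proof -
  interpret X: seminormed_space X by fact
  note T = bounded_mapD[OF assms(1)] and S = bounded_mapD[OF assms(2)]
  show ?thesis
  proof (rule bounded_mapI)
    fix x assume x: "x \<in> carrier X"
    have "nrm Z (S (T x)) \<le> L * nrm Y (T x)" using S(4) T(1) x by blast
    also have "\<dots> \<le> L * (K * nrm X x)" using T(4)[OF x] assms(3) by (rule mult_left_mono)
    finally show "nrm Z (compose (carrier X) S T x) \<le> L * K * nrm X x"
      using x by (simp add: compose_def mult.assoc)
  qed (use T S in \<open>auto simp: compose_def\<close>)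
qed

lemma compose_bounded_operators:
  assumes "T \<in> carrier (bounded_operators X Y)" "S \<in> carrier (bounded_operators Y Z)"
    "seminormed_space X" "normed_space Y" "normed_space Z"
  shows "compose (carrier X) S T \<in> carrier (bounded_operators X Z)"
proof -
  interpret X: seminormed_space X by fact
  interpret Y: normed_space Y by fact
  show ?thesis
    using compose_bounded_map[OF bounded_map_opnorm[OF assms(3,4,1)]
        bounded_map_opnorm[OF Y.seminormed_space_axioms assms(5,2)]]
      opnorm_nonneg[OF Y.seminormed_space_axioms assms(5,2)] assms(3)
    by (auto simp: bounded_operators_iff compose_def)
qed

lemma normed_dual: "seminormed_space X \<Longrightarrow> normed_space (dual X)"
  unfolding dual_def by (rule normed_bounded_operators[OF _ normed_complex_space])

lemma dual_iff: "\<kappa> \<in> carrier (dual X) \<longleftrightarrow> \<kappa> \<in> extensional (carrier X) \<and> (\<exists>K. bounded_map X complex_space K \<kappa>)"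
  unfolding dual_def bounded_operators_iff ..

lemma dual_bounded_map:
  assumes "seminormed_space X" "\<kappa> \<in> carrier (dual X)"
  shows "bounded_map X complex_space (nrm (dual X) \<kappa>) \<kappa>"
  using bounded_map_opnorm[OF assms(1) normed_complex_space] assms(2) by (simp add: dual_def)

lemma dualD:
  assumes "seminormed_space X" "\<kappa> \<in> carrier (dual X)"
  shows "x \<in> carrier X \<Longrightarrow> y \<in> carrier X \<Longrightarrow> \<kappa> (x \<oplus>\<^bsub>X\<^esub> y) = \<kappa> x + \<kappa> y"
    and "x \<in> carrier X \<Longrightarrow> \<kappa> (c \<odot>\<^bsub>X\<^esub> x) = c * \<kappa> x"
    and "x \<in> carrier X \<Longrightarrow> cmod (\<kappa> x) \<le> nrm (dual X) \<kappa> * nrm X x"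
  using bounded_mapD[OF dual_bounded_map[OF assms]] by auto

lemma dual_simps:
  "zero (dual X) = (\<lambda>x\<in>carrier X. 0)" "add (dual X) = (\<lambda>\<kappa> \<psi>. \<lambda>x\<in>carrier X. \<kappa> x + \<psi> x)"
  "smult (dual X) = (\<lambda>c \<kappa>. \<lambda>x\<in>carrier X. c * \<kappa> x)"
  by (simp_all add: dual_def bounded_operators_simps)

lemma dual_nrm_nonneg: "seminormed_space X \<Longrightarrow> \<kappa> \<in> carrier (dual X) \<Longrightarrow> 0 \<le> nrm (dual X) \<kappa>"
  using opnorm_nonneg[OF _ normed_complex_space] by (simp add: dual_def)

lemma restrict_dual:
  "seminormed_space X \<Longrightarrow> bounded_map X complex_space K \<kappa> \<Longrightarrow> restrict \<kappa> (carrier X) \<in> carrier (dual X)"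
  unfolding dual_def by (rule restrict_bounded_operators)

lemma dual_nrm_le:
  assumes "seminormed_space X" "bounded_map X complex_space K \<kappa>" "0 \<le> K"
  shows "nrm (dual X) (restrict \<kappa> (carrier X)) \<le> K"
  unfolding dual_def using bounded_mapD(4)[OF assms(2)]
  by (intro opnorm_bound[OF assms(1) normed_complex_space assms(3)]) auto

lemma bidual_embedding_closed:
  assumes "seminormed_space X" "x \<in> carrier X"
  shows "bidual_embedding X x \<in> carrier (bidual X)"
  unfolding bidual_embedding_def
proof (rule restrict_dual)
  interpret X: seminormed_space X by fact
  show "seminormed_space (dual X)" using normed_dual[OF assms(1)] by (simp add: normed_space_def)
  show "bounded_map (dual X) complex_space (nrm X x) (\<lambda>f. f x)"
    using dualD(3)[OF assms(1) _ assms(2)] assms(2)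
    by (intro bounded_mapI) (auto simp: dual_simps mult.commute)
qed

lemma adjoint_map_bounded:
  assumes "T \<in> carrier (bounded_operators X Y)" "seminormed_space X" "normed_space Y"
  shows "adjoint_map X Y T \<in> carrier (bounded_operators (dual Y) (dual X))"
proof -
  interpret X: seminormed_space X by fact
  interpret Y: normed_space Y by fact
  interpret DY: normed_space "dual Y" by (rule normed_dual) (rule Y.seminormed_space_axioms)
  interpret DX: normed_space "dual X" by (rule normed_dual) (rule X.seminormed_space_axioms)
  let ?K = "nrm (bounded_operators X Y) T"
  have bT: "bounded_map X Y ?K T" by (rule bounded_map_opnorm[OF assms(2,3,1)])
  have T: "\<And>x. x \<in> carrier X \<Longrightarrow> T x \<in> carrier Y" using bounded_mapD(1)[OF bT] .
  have "bounded_map (dual Y) (dual X) ?K (\<lambda>f. compose (carrier X) f T)"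
  proof (rule bounded_mapI)
    fix f assume f: "f \<in> carrier (dual Y)"
    show "compose (carrier X) f T \<in> carrier (dual X)"
      using compose_bounded_operators[OF assms(1) _ assms(2,3) normed_complex_space, of f] f
      by (simp add: dual_def)
    have *: "bounded_map X complex_space (nrm (dual Y) f * ?K) (compose (carrier X) f T)"
      by (rule compose_bounded_map[OF bT dual_bounded_map[OF Y.seminormed_space_axioms f] _ assms(2)])
        (rule DY.nrm_nonneg[OF f])
    have "0 \<le> nrm (dual Y) f * ?K"
      using DY.nrm_nonneg[OF f] opnorm_nonneg[OF assms(2,3,1)] by simp
    from dual_nrm_le[OF assms(2) * this]
    show "nrm (dual X) (compose (carrier X) f T) \<le> ?K * nrm (dual Y) f"
      by (simp add: compose_def mult.commute)
  qed (use T in \<open>auto simp: dual_simps compose_def fun_eq_iff\<close>)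
  then show ?thesis
    unfolding adjoint_map_def by (rule restrict_bounded_operators[OF DY.seminormed_space_axioms])
qed

lemma biadjoint_map_closed:
  assumes "T \<in> carrier (bounded_operators X Y)" "seminormed_space X" "normed_space Y"
    "m \<in> carrier (bidual X)"
  shows "biadjoint_map X Y T m \<in> carrier (bidual Y)"
proof -
  have "normed_space (dual X)" "normed_space (dual Y)"
    using normed_dual assms(2,3) by (auto simp: normed_space_def)
  then show ?thesis
    using adjoint_map_bounded[OF adjoint_map_bounded[OF assms(1-3)]] assms(4)
      bounded_operators_iff bounded_mapD(1)
    unfolding biadjoint_map_def dual_def[symmetric]
    by (metis dual_def normed_space_def)
qed

lemma biadjoint_map_apply:
  assumes "m \<in> carrier (bidual X)" "f \<in> carrier (dual Y)"
  shows "biadjoint_map X Y T m f = m (compose (carrier X) f T)"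
  using assms by (simp add: biadjoint_map_def adjoint_map_def compose_def)

locale normed_algebra = normed_space A for A :: "'a nspace" (structure) +
  assumes bilinear_mult: "bilinear_map A A A 1 (\<otimes>)"
begin

lemmas mult_closed' = bilinear_mapD(1)[OF bilinear_mult]

sublocale tensor_pair A A ..

abbreviation (input) "E \<equiv> projective_tensor A A"

context
  assumes complete: "complete_space A"
begin

lemma right_mult_bounded:
  "a \<in> carrier A \<Longrightarrow> (\<lambda>x\<in>carrier A. x \<otimes> a) \<in> carrier (bounded_operators A A)"
  using restrict_bounded_operators[OF seminormed_space_axioms] bilinear_mult
  unfolding bilinear_map_def by blast

lemma multiplication_map_spec:
  "multiplication_map A \<in> carrier (bounded_operators E A)"
  "x \<in> carrier A \<Longrightarrow> y \<in> carrier A \<Longrightarrow> multiplication_map A (elementary_tensor A A x y) = x \<otimes> y"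
  unfolding multiplication_map_def
  using linearize_spec[OF normed_space_axioms complete bilinear_mult] by auto

lemma bilinear_left: "a \<in> carrier A \<Longrightarrow> bilinear_map A A E (nrm A a) (\<lambda>x y. elementary_tensor A A (a \<otimes> x) y)"
  and bilinear_right: "a \<in> carrier A \<Longrightarrow> bilinear_map A A E (nrm A a) (\<lambda>x y. elementary_tensor A A x (y \<otimes> a))"
proof -
  assume a: "a \<in> carrier A"
  note mult = bilinear_mapD[OF bilinear_mult] and et = bilinear_mapD[OF bilinear_elementary_tensor]
  have m1: "nrm A (a \<otimes> x) * nrm A y \<le> nrm A a * nrm A x * nrm A y"
    "nrm A x * nrm A (y \<otimes> a) \<le> nrm A a * nrm A x * nrm A y" if "x \<in> carrier A" "y \<in> carrier A" for x y
    using mult_right_mono[OF mult(2)[OF a that(1)] nrm_nonneg[OF that(2)]]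
      mult_left_mono[OF mult(2)[OF that(2) a] nrm_nonneg[OF that(1)]]
    by (simp_all add: mult_ac)
  show "bilinear_map A A E (nrm A a) (\<lambda>x y. elementary_tensor A A (a \<otimes> x) y)"
    using order_trans[OF et(2)] mult_closed' m1 a
    by (intro bilinear_mapI) (auto simp: et mult)
  show "bilinear_map A A E (nrm A a) (\<lambda>x y. elementary_tensor A A x (y \<otimes> a))"
    using order_trans[OF et(2)] mult_closed' m1 a
    by (intro bilinear_mapI) (auto simp: et mult)
qed

lemma left_action_spec:
  assumes "a \<in> carrier A"
  shows "left_action A a \<in> carrier (bounded_operators E E)"
    "x \<in> carrier A \<Longrightarrow> y \<in> carrier A \<Longrightarrow>
      left_action A a (elementary_tensor A A x y) = elementary_tensor A A (a \<otimes> x) y"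
  unfolding left_action_def
  using linearize_spec[OF PT.normed_space_axioms complete_projective_tensor bilinear_left[OF assms]] by auto

lemma right_action_spec:
  assumes "a \<in> carrier A"
  shows "right_action A a \<in> carrier (bounded_operators E E)"
    "x \<in> carrier A \<Longrightarrow> y \<in> carrier A \<Longrightarrow>
      right_action A a (elementary_tensor A A x y) = elementary_tensor A A x (y \<otimes> a)"
  unfolding right_action_def
  using linearize_spec[OF PT.normed_space_axioms complete_projective_tensor bilinear_right[OF assms]] by auto

text \<open>All maps compared are extensional on a dual space, so the two conditions can be tested
  functional by functional; there a second adjoint just evaluates m at a composite.\<close>

lemma amenable_iff:
  "amenable A \<longleftrightarrow> (\<exists>m\<in>carrier (bidual E). \<forall>a\<in>carrier A.
     (\<forall>f\<in>carrier (dual E). m (compose (carrier E) f (left_action A a)) =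
        m (compose (carrier E) f (right_action A a))) \<and>
     (\<forall>\<kappa>\<in>carrier (dual A). m (compose (carrier E) (compose (carrier A) \<kappa> (\<lambda>x\<in>carrier A. x \<otimes> a))
        (multiplication_map A)) = \<kappa> a))"
proof -
  have "biadjoint_map E E (left_action A a) m = biadjoint_map E E (right_action A a) m \<longleftrightarrow>
     (\<forall>f\<in>carrier (dual E). m (compose (carrier E) f (left_action A a)) =
        m (compose (carrier E) f (right_action A a)))"
    if "m \<in> carrier (bidual E)" "a \<in> carrier A" for m a
  proof -
    have "biadjoint_map E E (left_action A a) m \<in> extensional (carrier (dual E))"
      "biadjoint_map E E (right_action A a) m \<in> extensional (carrier (dual E))"
      using biadjoint_map_closed[OF _ PT.seminormed_space_axioms PT.normed_space_axioms that(1)]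
        left_action_spec(1)[OF that(2)] right_action_spec(1)[OF that(2)] by (auto simp: dual_iff)
    then have "biadjoint_map E E (left_action A a) m = biadjoint_map E E (right_action A a) m \<longleftrightarrow>
       (\<forall>f\<in>carrier (dual E). biadjoint_map E E (left_action A a) m f = biadjoint_map E E (right_action A a) m f)"
      by (auto intro: extensionalityI)
    also have "\<dots> \<longleftrightarrow> (\<forall>f\<in>carrier (dual E). m (compose (carrier E) f (left_action A a)) =
        m (compose (carrier E) f (right_action A a)))"
      by (rule ball_cong[OF refl]) (simp only: biadjoint_map_apply[OF that(1)])
    finally show ?thesis .
  qed
  moreover have "biadjoint_map A A (\<lambda>x\<in>carrier A. x \<otimes> a) (biadjoint_map E A (multiplication_map A) m) =
      bidual_embedding A a \<longleftrightarrow>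
      (\<forall>\<kappa>\<in>carrier (dual A). m (compose (carrier E) (compose (carrier A) \<kappa> (\<lambda>x\<in>carrier A. x \<otimes> a))
        (multiplication_map A)) = \<kappa> a)"
    if "m \<in> carrier (bidual E)" "a \<in> carrier A" for m a
  proof -
    let ?R = "\<lambda>x\<in>carrier A. x \<otimes> a" and ?n = "biadjoint_map E A (multiplication_map A) m"
    have n: "?n \<in> carrier (bidual A)"
      by (rule biadjoint_map_closed[OF multiplication_map_spec(1) PT.seminormed_space_axioms normed_space_axioms that(1)])
    have "biadjoint_map A A ?R ?n \<in> extensional (carrier (dual A))"
      "bidual_embedding A a \<in> extensional (carrier (dual A))"
      using biadjoint_map_closed[OF right_mult_bounded[OF that(2)] seminormed_space_axioms normed_space_axioms n]
      by (auto simp: dual_iff bidual_embedding_def)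
    then have eq: "biadjoint_map A A ?R ?n = bidual_embedding A a \<longleftrightarrow>
       (\<forall>\<kappa>\<in>carrier (dual A). biadjoint_map A A ?R ?n \<kappa> = bidual_embedding A a \<kappa>)"
      by (auto intro: extensionalityI)
    have comp: "compose (carrier A) \<kappa> ?R \<in> carrier (dual A)" if "\<kappa> \<in> carrier (dual A)" for \<kappa>
      using compose_bounded_operators[OF right_mult_bounded[OF \<open>a \<in> carrier A\<close>] _ seminormed_space_axioms
          normed_space_axioms normed_complex_space, of \<kappa>] that by (simp add: dual_def)
    have "biadjoint_map A A ?R ?n \<kappa> = m (compose (carrier E) (compose (carrier A) \<kappa> ?R) (multiplication_map A))"
      "bidual_embedding A a \<kappa> = \<kappa> a" if "\<kappa> \<in> carrier (dual A)" for \<kappa>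
      using biadjoint_map_apply[OF n that] that
        biadjoint_map_apply[OF \<open>m \<in> carrier (bidual E)\<close> comp[OF that]] by (simp_all add: bidual_embedding_def)
    then show ?thesis unfolding eq by (intro ball_cong[OF refl]) (simp only:)
  qed
  ultimately show ?thesis
    unfolding amenable_def Let_def
    by (intro bex_cong[OF refl] ball_cong[OF refl] arg_cong2[where f = "(\<and>)"])
qed

text \<open>Functionals on the projective tensor square are the bounded bilinear forms, so a virtual
  diagonal can be used as a linear map M on such forms, and consequences of amenability need no
  tensors. The first property is there because a form is constrained only on the carrier.\<close>

lemma virtual_diagonal_form:
  assumes "amenable A"
  obtains M :: "('a \<Rightarrow> 'a \<Rightarrow> complex) \<Rightarrow> complex" where
    "\<And>B B' K. bilinear_map A A complex_space K B \<Longrightarrow>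
      (\<And>x y. x \<in> carrier A \<Longrightarrow> y \<in> carrier A \<Longrightarrow> B x y = B' x y) \<Longrightarrow> M B = M B'"
    "\<And>B B' K L. bilinear_map A A complex_space K B \<Longrightarrow> bilinear_map A A complex_space L B' \<Longrightarrow>
      M (\<lambda>x y. B x y + B' x y) = M B + M B'"
    "\<And>B K c. bilinear_map A A complex_space K B \<Longrightarrow> M (\<lambda>x y. c * B x y) = c * M B"
    "\<And>B K a. bilinear_map A A complex_space K B \<Longrightarrow> a \<in> carrier A \<Longrightarrow>
      M (\<lambda>x y. B (a \<otimes> x) y) = M (\<lambda>x y. B x (y \<otimes> a))"
    "\<And>\<kappa> a. \<kappa> \<in> carrier (dual A) \<Longrightarrow> a \<in> carrier A \<Longrightarrow> M (\<lambda>x y. \<kappa> ((x \<otimes> y) \<otimes> a)) = \<kappa> a"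
proof -
  obtain m where m: "m \<in> carrier (bidual E)" and inv: "\<And>a f. a \<in> carrier A \<Longrightarrow> f \<in> carrier (dual E) \<Longrightarrow>
      m (compose (carrier E) f (left_action A a)) = m (compose (carrier E) f (right_action A a))"
    and id: "\<And>a \<kappa>. a \<in> carrier A \<Longrightarrow> \<kappa> \<in> carrier (dual A) \<Longrightarrow>
      m (compose (carrier E) (compose (carrier A) \<kappa> (\<lambda>x\<in>carrier A. x \<otimes> a)) (multiplication_map A)) = \<kappa> a"
    using assms unfolding amenable_iff by blast
  define lin where "lin B = linearize A A complex_space B" for B
  have lin: "lin B \<in> carrier (dual E)"
      "\<And>x y. x \<in> carrier A \<Longrightarrow> y \<in> carrier A \<Longrightarrow> lin B (elementary_tensor A A x y) = B x y"
    if "bilinear_map A A complex_space K B" for B K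
    unfolding lin_def dual_def using linearize_spec[OF normed_complex_space complete_complex_space that] by auto
  \<comment> \<open>Uniqueness of the linearization. Each rule for M comes from recognizing the
    linearization of the new form among known functionals.\<close>
  have lin_eq: "lin B = f" if "bilinear_map A A complex_space K B" "f \<in> carrier (dual E)"
    "\<And>x y. x \<in> carrier A \<Longrightarrow> y \<in> carrier A \<Longrightarrow> f (elementary_tensor A A x y) = B x y" for B f K
  proof (rule bounded_operators_eqI[OF PT.seminormed_space_axioms normed_complex_space])
    show "lin B \<in> carrier (bounded_operators E complex_space)" "f \<in> carrier (bounded_operators E complex_space)"
      using lin(1)[OF that(1)] that(2) by (simp_all add: dual_def)
    then obtain K L where KL: "bounded_map E complex_space K (lin B)" "bounded_map E complex_space L f"
      by (auto elim!: bounded_operatorsE)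
    show "lin B z = f z" if "z \<in> carrier E" for z
      by (rule projective_tensor_unique[OF normed_complex_space KL _ that])
        (use lin(2) that in \<open>auto simp: lin(2)[OF \<open>bilinear_map A A complex_space _ B\<close>]
          \<open>\<And>x y. x \<in> carrier A \<Longrightarrow> y \<in> carrier A \<Longrightarrow> f (elementary_tensor A A x y) = B x y\<close>\<close>)
  qed
  interpret DE: normed_space "dual E" by (rule normed_dual) (rule PT.seminormed_space_axioms)
  note mD = dualD[OF DE.seminormed_space_axioms m]
  have comp: "compose (carrier E) f T \<in> carrier (dual E)" if "f \<in> carrier (dual E)" "T \<in> carrier (bounded_operators E E)" for f T
    using compose_bounded_operators[OF that(2) _ PT.seminormed_space_axioms PT.normed_space_axioms normed_complex_space, of f]
      that(1) by (simp add: dual_def)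
  have eta: "(\<lambda>x y. B x y) = B" for B :: "'a \<Rightarrow> 'a \<Rightarrow> complex" by simp
  have bil_cong: "bilinear_map A A complex_space K B'" if "bilinear_map A A complex_space K B"
    "\<And>x y. x \<in> carrier A \<Longrightarrow> y \<in> carrier A \<Longrightarrow> B x y = B' x y" for B B' K
    using bilinear_mapD[OF that(1)] that(2) by (intro bilinear_mapI) auto
  show ?thesis
  proof (rule that[of "\<lambda>B. m (lin B)"])
    fix B B' K assume "bilinear_map A A complex_space K B"
      "\<And>x y. x \<in> carrier A \<Longrightarrow> y \<in> carrier A \<Longrightarrow> B x y = B' x y"
    then show "m (lin B) = m (lin B')"
      using lin[OF bil_cong, of K B B'] by (subst lin_eq[of K B "lin B'"]) auto
  next
    fix B B' K L assume B: "bilinear_map A A complex_space K B" "bilinear_map A A complex_space L B'"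
    have "bilinear_map A A complex_space (K + L) (\<lambda>x y. B x y + B' x y)"
    proof (rule bilinear_mapI)
      fix x y assume "x \<in> carrier A" "y \<in> carrier A"
      then show "nrm complex_space (B x y + B' x y) \<le> (K + L) * nrm A x * nrm A y"
        using bilinear_mapD(2)[OF B(1), of x y] bilinear_mapD(2)[OF B(2), of x y]
          norm_triangle_ineq[of "B x y" "B' x y"] by (simp add: algebra_simps)
    qed (use bilinear_mapD[OF B(1)] bilinear_mapD[OF B(2)] in \<open>auto simp: algebra_simps\<close>)
    then have "lin (\<lambda>x y. B x y + B' x y) = lin B \<oplus>\<^bsub>dual E\<^esub> lin B'"
      using lin(2)[OF B(1)] lin(2)[OF B(2)] et_closed
      by (intro lin_eq DE.a_closed lin(1)[OF B(1)] lin(1)[OF B(2)]) (auto simp: dual_simps)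
    then show "m (lin (\<lambda>x y. B x y + B' x y)) = m (lin B) + m (lin B')"
      using mD(1)[OF lin(1)[OF B(1)] lin(1)[OF B(2)]] by simp
  next
    fix B K c assume B: "bilinear_map A A complex_space K B"
    have "bilinear_map A A complex_space (cmod c * K) (\<lambda>x y. c * B x y)"
    proof (rule bilinear_mapI)
      fix x y assume "x \<in> carrier A" "y \<in> carrier A"
      then show "nrm complex_space (c * B x y) \<le> cmod c * K * nrm A x * nrm A y"
        using mult_left_mono[OF bilinear_mapD(2)[OF B, of x y], of "cmod c"] by (simp add: norm_mult mult.assoc)
    qed (use bilinear_mapD[OF B] in \<open>auto simp: algebra_simps\<close>)
    then have "lin (\<lambda>x y. c * B x y) = c \<odot>\<^bsub>dual E\<^esub> lin B"
      using lin(2)[OF B] et_closed by (intro lin_eq DE.sm_closed lin(1)[OF B]) (auto simp: dual_simps)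
    then show "m (lin (\<lambda>x y. c * B x y)) = c * m (lin B)"
      using mD(2)[OF lin(1)[OF B]] by simp
  next
    fix B K a assume B: "bilinear_map A A complex_space K B" and a: "a \<in> carrier A"
    note f = lin[OF B]
    have "bilinear_map A A complex_space (\<bar>K\<bar> * nrm A a) (\<lambda>x y. B (a \<otimes> x) y)"
    proof (rule bilinear_mapI)
      fix x y assume xy: "x \<in> carrier A" "y \<in> carrier A"
      have "cmod (B (a \<otimes> x) y) \<le> K * nrm A (a \<otimes> x) * nrm A y"
        using bilinear_mapD(2)[OF B mult_closed'[OF a xy(1)] xy(2)] by simp
      also have "\<dots> \<le> \<bar>K\<bar> * (nrm A a * nrm A x) * nrm A y"
        using bilinear_mapD(2)[OF bilinear_mult a xy(1)] nrm_nonneg xy a mult_closed'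
        by (intro mult_right_mono mult_mono) auto
      finally show "nrm complex_space (B (a \<otimes> x) y) \<le> \<bar>K\<bar> * nrm A a * nrm A x * nrm A y" by (simp add: mult.assoc)
    qed (use bilinear_mapD[OF B] bilinear_mapD[OF bilinear_mult] mult_closed' a in auto)
    then have 1: "lin (\<lambda>x y. B (a \<otimes> x) y) = compose (carrier E) (lin B) (left_action A a)"
      using left_action_spec[OF a] comp f et_closed a mult_closed'
      by (intro lin_eq) (auto simp: compose_def)
    have "bilinear_map A A complex_space (\<bar>K\<bar> * nrm A a) (\<lambda>x y. B x (y \<otimes> a))"
    proof (rule bilinear_mapI)
      fix x y assume xy: "x \<in> carrier A" "y \<in> carrier A"
      have "cmod (B x (y \<otimes> a)) \<le> K * nrm A x * nrm A (y \<otimes> a)"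
        using bilinear_mapD(2)[OF B xy(1) mult_closed'[OF xy(2) a]] by simp
      also have "\<dots> \<le> \<bar>K\<bar> * nrm A x * (nrm A y * nrm A a)"
        using bilinear_mapD(2)[OF bilinear_mult xy(2) a] nrm_nonneg xy a mult_closed'
        by (intro mult_mono) auto
      finally show "nrm complex_space (B x (y \<otimes> a)) \<le> \<bar>K\<bar> * nrm A a * nrm A x * nrm A y" by (simp add: mult_ac)
    qed (use bilinear_mapD[OF B] bilinear_mapD[OF bilinear_mult] mult_closed' a in auto)
    then have 2: "lin (\<lambda>x y. B x (y \<otimes> a)) = compose (carrier E) (lin B) (right_action A a)"
      using right_action_spec[OF a] comp f et_closed a mult_closed'
      by (intro lin_eq) (auto simp: compose_def)
    show "m (lin (\<lambda>x y. B (a \<otimes> x) y)) = m (lin (\<lambda>x y. B x (y \<otimes> a)))"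
      unfolding 1 2 by (rule inv[OF a f(1)])
  next
    fix \<kappa> a assume \<kappa>: "\<kappa> \<in> carrier (dual A)" and a: "a \<in> carrier A"
    let ?f = "compose (carrier E) (compose (carrier A) \<kappa> (\<lambda>x\<in>carrier A. x \<otimes> a)) (multiplication_map A)"
    have 1: "compose (carrier A) \<kappa> (\<lambda>x\<in>carrier A. x \<otimes> a) \<in> carrier (dual A)"
      using compose_bounded_operators[OF right_mult_bounded[OF a] _ seminormed_space_axioms
          normed_space_axioms normed_complex_space, of \<kappa>] \<kappa> by (simp add: dual_def)
    have 2: "?f \<in> carrier (dual E)"
      using compose_bounded_operators[OF multiplication_map_spec(1) _ PT.seminormed_space_axioms
          normed_space_axioms normed_complex_space] 1 by (simp add: dual_def)
    have 3: "?f (elementary_tensor A A x y) = \<kappa> ((x \<otimes> y) \<otimes> a)" if "x \<in> carrier A" "y \<in> carrier A" for x y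
      using that et_closed multiplication_map_spec(2) mult_closed' by (simp add: compose_def)
    have "bilinear_map A A complex_space (nrm (dual A) \<kappa> * nrm A a) (\<lambda>x y. \<kappa> ((x \<otimes> y) \<otimes> a))"
    proof (rule bilinear_mapI)
      fix x y assume xy: "x \<in> carrier A" "y \<in> carrier A"
      have "cmod (\<kappa> ((x \<otimes> y) \<otimes> a)) \<le> nrm (dual A) \<kappa> * nrm A ((x \<otimes> y) \<otimes> a)"
        using dualD(3)[OF seminormed_space_axioms \<kappa>] mult_closed' xy a by auto
      also have "\<dots> \<le> nrm (dual A) \<kappa> * (nrm A x * nrm A y * nrm A a)"
      proof (rule mult_left_mono)
        have "nrm A ((x \<otimes> y) \<otimes> a) \<le> nrm A (x \<otimes> y) * nrm A a"
          using bilinear_mapD(2)[OF bilinear_mult mult_closed'[OF xy] a] by simp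
        also have "\<dots> \<le> nrm A x * nrm A y * nrm A a"
          using bilinear_mapD(2)[OF bilinear_mult xy] nrm_nonneg[OF a] by (intro mult_right_mono) auto
        finally show "nrm A ((x \<otimes> y) \<otimes> a) \<le> nrm A x * nrm A y * nrm A a" .
      qed (rule dual_nrm_nonneg[OF seminormed_space_axioms \<kappa>])
      finally show "nrm complex_space (\<kappa> ((x \<otimes> y) \<otimes> a)) \<le> nrm (dual A) \<kappa> * nrm A a * nrm A x * nrm A y"
        by (simp add: mult_ac)
    qed (use dualD[OF seminormed_space_axioms \<kappa>] bilinear_mapD[OF bilinear_mult] mult_closed' a in auto)
    then have "lin (\<lambda>x y. \<kappa> ((x \<otimes> y) \<otimes> a)) = ?f"
      using 2 3 by (rule lin_eq)
    then show "m (lin (\<lambda>x y. \<kappa> ((x \<otimes> y) \<otimes> a))) = \<kappa> a" using id[OF a \<kappa>] by simp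
  qed
qed

text \<open>Here the diagonal is a genuine tensor, c times the sum of the u i \<otimes> v i, acting
  on functionals by evaluation. Commutation with a is tested on all bounded bilinear forms because
  these are the functionals on the tensor square.\<close>

lemma amenable_if_finite_diagonal:
  fixes I :: "'i set"
  assumes "finite I" and xy: "\<And>i. i \<in> I \<Longrightarrow> u i \<in> carrier A" "\<And>i. i \<in> I \<Longrightarrow> v i \<in> carrier A"
    and inv: "\<And>B K a. bilinear_map A A complex_space K B \<Longrightarrow> a \<in> carrier A \<Longrightarrow>
      (\<Sum>i\<in>I. B (a \<otimes> u i) (v i)) = (\<Sum>i\<in>I. B (u i) (v i \<otimes> a))"
    and id: "\<And>\<kappa> a. \<kappa> \<in> carrier (dual A) \<Longrightarrow> a \<in> carrier A \<Longrightarrow>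
      c * (\<Sum>i\<in>I. \<kappa> ((u i \<otimes> v i) \<otimes> a)) = \<kappa> a"
  shows "amenable A"
  unfolding amenable_iff
proof (rule bexI[of _ "\<lambda>f\<in>carrier (dual E). c * (\<Sum>i\<in>I. f (elementary_tensor A A (u i) (v i)))"], intro ballI conjI)
  interpret DE: normed_space "dual E" by (rule normed_dual) (rule PT.seminormed_space_axioms)
  let ?K = "cmod c * (\<Sum>i\<in>I. nrm E (elementary_tensor A A (u i) (v i)))"
  note t = et_closed[OF xy]
  show "(\<lambda>f\<in>carrier (dual E). c * (\<Sum>i\<in>I. f (elementary_tensor A A (u i) (v i)))) \<in> carrier (bidual E)"
  proof (rule restrict_dual[OF DE.seminormed_space_axioms, of ?K], rule bounded_mapI)
    fix f assume f: "f \<in> carrier (dual E)"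
    have "cmod (\<Sum>i\<in>I. f (elementary_tensor A A (u i) (v i))) \<le>
        (\<Sum>i\<in>I. nrm (dual E) f * nrm E (elementary_tensor A A (u i) (v i)))"
      by (rule sum_norm_le) (use dualD(3)[OF PT.seminormed_space_axioms f] t in auto)
    then show "nrm complex_space (c * (\<Sum>i\<in>I. f (elementary_tensor A A (u i) (v i)))) \<le> ?K * nrm (dual E) f"
      by (simp add: norm_mult mult_left_mono mult.assoc flip: sum_distrib_left)
        (simp add: mult.commute mult_left_mono)
  qed (use t in \<open>auto simp: dual_simps sum.distrib algebra_simps sum_distrib_left\<close>)
  fix a assume a: "a \<in> carrier A"
  have comp: "compose (carrier E) f T \<in> carrier (dual E)" if "f \<in> carrier (dual E)" "T \<in> carrier (bounded_operators E E)" for f T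
    using compose_bounded_operators[OF that(2) _ PT.seminormed_space_axioms PT.normed_space_axioms normed_complex_space, of f]
      that(1) by (simp add: dual_def)
  show "(\<lambda>f\<in>carrier (dual E). c * (\<Sum>i\<in>I. f (elementary_tensor A A (u i) (v i)))) (compose (carrier E) f (left_action A a)) =
     (\<lambda>f\<in>carrier (dual E). c * (\<Sum>i\<in>I. f (elementary_tensor A A (u i) (v i)))) (compose (carrier E) f (right_action A a))"
    if f: "f \<in> carrier (dual E)" for f
  proof -
    have "bilinear_map A A complex_space (nrm (dual E) f) (\<lambda>x y. f (elementary_tensor A A x y))"
    proof (rule bilinear_mapI)
      fix x y assume xy: "x \<in> carrier A" "y \<in> carrier A"
      have "cmod (f (elementary_tensor A A x y)) \<le> nrm (dual E) f * nrm E (elementary_tensor A A x y)"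
        using dualD(3)[OF PT.seminormed_space_axioms f et_closed[OF xy]] .
      also have "\<dots> \<le> nrm (dual E) f * (nrm A x * nrm A y)"
        using bilinear_mapD(2)[OF bilinear_elementary_tensor xy] dual_nrm_nonneg[OF PT.seminormed_space_axioms f]
        by (intro mult_left_mono) auto
      finally show "nrm complex_space (f (elementary_tensor A A x y)) \<le> nrm (dual E) f * nrm A x * nrm A y"
        by (simp add: mult.assoc)
    qed (use dualD[OF PT.seminormed_space_axioms f] bilinear_mapD[OF bilinear_elementary_tensor] et_closed in auto)
    from inv[OF this a] show ?thesis
      using comp[OF f left_action_spec(1)[OF a]] comp[OF f right_action_spec(1)[OF a]] t
        left_action_spec(2)[OF a] right_action_spec(2)[OF a] xy
      by (simp add: compose_def)
  qed
  show "(\<lambda>f\<in>carrier (dual E). c * (\<Sum>i\<in>I. f (elementary_tensor A A (u i) (v i))))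
      (compose (carrier E) (compose (carrier A) \<kappa> (\<lambda>x\<in>carrier A. x \<otimes> a)) (multiplication_map A)) = \<kappa> a"
    if \<kappa>: "\<kappa> \<in> carrier (dual A)" for \<kappa>
  proof -
    have 1: "compose (carrier A) \<kappa> (\<lambda>x\<in>carrier A. x \<otimes> a) \<in> carrier (dual A)"
      using compose_bounded_operators[OF right_mult_bounded[OF a] _ seminormed_space_axioms
          normed_space_axioms normed_complex_space, of \<kappa>] \<kappa> by (simp add: dual_def)
    have 2: "compose (carrier E) (compose (carrier A) \<kappa> (\<lambda>x\<in>carrier A. x \<otimes> a)) (multiplication_map A) \<in> carrier (dual E)"
      using compose_bounded_operators[OF multiplication_map_spec(1) _ PT.seminormed_space_axioms
          normed_space_axioms normed_complex_space] 1 by (simp add: dual_def)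
    show ?thesis
      using id[OF \<kappa> a] 2 t xy mult_closed' multiplication_map_spec(2) by (simp add: compose_def)
  qed
qed

end

end

section \<open>The Hahn--Banach theorem and reflexivity\<close>

context seminormed_space
begin

text \<open>A dominated real-linear functional on a real subspace is represented by its graph; the
  domination makes such a graph single-valued.\<close>

definition dominated_graph :: "real \<Rightarrow> ('v \<times> real) set \<Rightarrow> bool" where
  "dominated_graph K G \<longleftrightarrow> (\<forall>(x, a)\<in>G. x \<in> carrier X \<and> a \<le> K * nrm X x) \<and>
     (\<forall>(x, a)\<in>G. \<forall>(y, b)\<in>G. (x \<oplus> y, a + b) \<in> G) \<and>
     (\<forall>(x, a)\<in>G. \<forall>c::real. (complex_of_real c \<odot> x, c * a) \<in> G)"

lemma dominated_graphD:
  assumes "dominated_graph K G" "(x, a) \<in> G"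
  shows "x \<in> carrier X" "a \<le> K * nrm X x" "(y, b) \<in> G \<Longrightarrow> (x \<oplus> y, a + b) \<in> G"
    "(complex_of_real c \<odot> x, c * a) \<in> G"
  using assms unfolding dominated_graph_def by blast+

lemma dominated_graphI:
  assumes "\<And>x a. (x, a) \<in> G \<Longrightarrow> x \<in> carrier X" "\<And>x a. (x, a) \<in> G \<Longrightarrow> a \<le> K * nrm X x"
    "\<And>x a y b. (x, a) \<in> G \<Longrightarrow> (y, b) \<in> G \<Longrightarrow> (x \<oplus> y, a + b) \<in> G"
    "\<And>c x a. (x, a) \<in> G \<Longrightarrow> (complex_of_real c \<odot> x, c * a) \<in> G"
  shows "dominated_graph K G"
  using assms unfolding dominated_graph_def by auto

text \<open>Subtraction puts (0, a - b) into the graph, and domination gives a - b <= 0; exchanging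
  a and b gives equality.\<close>

lemma dominated_graph_unique:
  assumes G: "dominated_graph K G" and "(x, a) \<in> G" "(x, b) \<in> G"
  shows "a = b"
proof -
  have le: "a \<le> b" if "(x, a) \<in> G" "(x, b) \<in> G" for a b
  proof -
    note x = dominated_graphD(1)[OF G that(1)]
    have "(complex_of_real (-1) \<odot> x, -1 * b) \<in> G" by (rule dominated_graphD(4)[OF G that(2)])
    from dominated_graphD(3)[OF G that(1) this]
    have "(x \<oplus> (-1) \<odot> x, a - b) \<in> G" by simp
    moreover have "x \<oplus> (-1) \<odot> x = \<zero>" using diff_self[OF x] unfolding diff_eq[OF x x] .
    ultimately show ?thesis using dominated_graphD(2)[OF G, of \<zero> "a - b"] by simp
  qed
  show ?thesis using le[OF assms(2,3)] le[OF assms(3,2)] by simp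
qed

text \<open>With |.| the seminorm, the value r at z has to satisfy a - K |x - z| <= r <= K |y + z| -
  b for all points (x, a), (y, b) of the graph. The triangle inequality puts every left side below
  every right side.\<close>

lemma dominated_graph_extend:
  assumes K: "0 \<le> K" and G: "dominated_graph K G" and ne: "G \<noteq> {}" and z: "z \<in> carrier X"
  obtains r where "dominated_graph K {(x \<oplus> complex_of_real t \<odot> z, a + t * r) |x a t. (x, a) \<in> G}"
proof -
  note D = dominated_graphD[OF G]
  define low where "low = (\<lambda>(x, a). a - K * nrm X (x \<ominus> z)) ` G"
  have le: "a - K * nrm X (x \<ominus> z) \<le> K * nrm X (y \<oplus> z) - b" if "(x, a) \<in> G" "(y, b) \<in> G" for x a y b
  proof -
    have c: "x \<in> carrier X" "y \<in> carrier X" using D(1) that by auto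
    have "x \<oplus> y = (x \<ominus> z) \<oplus> (y \<oplus> z)"
      using c z diff_add_cancel[OF c(1) z] a_assoc[of "x \<ominus> z" z y] a_comm[of y z] by simp
    then have "nrm X (x \<oplus> y) \<le> nrm X (x \<ominus> z) + nrm X (y \<oplus> z)"
      using nrm_triangle[of "x \<ominus> z" "y \<oplus> z"] c z by simp
    then have "K * nrm X (x \<oplus> y) \<le> K * (nrm X (x \<ominus> z) + nrm X (y \<oplus> z))"
      using K by (rule mult_left_mono)
    moreover have "a + b \<le> K * nrm X (x \<oplus> y)" using D(2)[OF D(3)[OF that]] .
    ultimately show ?thesis by (simp add: algebra_simps)
  qed
  obtain y0 b0 where yb0: "(y0, b0) \<in> G" using ne by auto
  have bdd: "bdd_above low" and ne': "low \<noteq> {}"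
    using le[OF _ yb0] yb0 by (auto simp: low_def intro!: bdd_aboveI)
  define r where "r = Sup low"
  have r1: "a - K * nrm X (x \<ominus> z) \<le> r" if "(x, a) \<in> G" for x a
    unfolding r_def by (rule cSup_upper[OF _ bdd]) (use that in \<open>force simp: low_def\<close>)
  have r2: "r \<le> K * nrm X (y \<oplus> z) - b" if "(y, b) \<in> G" for y b
    unfolding r_def by (rule cSup_least[OF ne']) (use le[OF _ that] in \<open>auto simp: low_def\<close>)
  let ?H = "{(x \<oplus> complex_of_real t \<odot> z, a + t * r) |x a t. (x, a) \<in> G}"
  have dom: "a + t * r \<le> K * nrm X (x \<oplus> complex_of_real t \<odot> z)" if xa: "(x, a) \<in> G" for x a t
  proof -
    have x: "x \<in> carrier X" using D(1)[OF xa] .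
    consider "t = 0" | "t > 0" | "t < 0" by linarith
    then show ?thesis
    proof cases
      case 1
      then show ?thesis using D(2)[OF xa] x z by simp
    next
      \<comment> \<open>For t > 0 the point is scaled by 1/t and the upper bound on r applies; for t
        < 0 it is scaled by -1/t and the lower bound applies.\<close>
      case 2
      let ?x = "complex_of_real (1 / t) \<odot> x"
      have "r \<le> K * nrm X (?x \<oplus> z) - 1 / t * a" by (rule r2[OF D(4)[OF xa]])
      then have "t * r \<le> t * (K * nrm X (?x \<oplus> z) - 1 / t * a)"
        using 2 by (intro mult_left_mono) auto
      also have "\<dots> = K * (t * nrm X (?x \<oplus> z)) - a" using 2 by (simp add: algebra_simps)
      also have "t * nrm X (?x \<oplus> z) = nrm X (complex_of_real t \<odot> (?x \<oplus> z))"
        using 2 x z by (simp add: nrm_smult)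
      also have "complex_of_real t \<odot> (?x \<oplus> z) = x \<oplus> complex_of_real t \<odot> z"
        using 2 x z by (simp add: sm_r_distr sm_assoc flip: of_real_mult)
      finally show ?thesis by simp
    next
      case 3
      let ?x = "complex_of_real (- 1 / t) \<odot> x"
      have "- 1 / t * a - K * nrm X (?x \<ominus> z) \<le> r" by (rule r1[OF D(4)[OF xa]])
      then have "t * r \<le> t * (- 1 / t * a - K * nrm X (?x \<ominus> z))"
        using 3 by (intro mult_left_mono_neg) auto
      also have "\<dots> = K * (- t * nrm X (?x \<ominus> z)) - a" using 3 by (simp add: algebra_simps)
      also have "- t * nrm X (?x \<ominus> z) = nrm X (complex_of_real (- t) \<odot> (?x \<ominus> z))"
        using 3 x z by (simp add: nrm_smult)
      also have "complex_of_real (- t) \<odot> (?x \<ominus> z) = x \<oplus> complex_of_real t \<odot> z"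
        using 3 x z by (simp add: diff_eq sm_r_distr sm_assoc flip: of_real_mult)
      finally show ?thesis by simp
    qed
  qed
  have "dominated_graph K ?H"
  proof (rule dominated_graphI)
    fix u p assume "(u, p) \<in> ?H"
    then obtain x a t where u: "u = x \<oplus> complex_of_real t \<odot> z" "p = a + t * r" and xa: "(x, a) \<in> G"
      by blast
    note x = D(1)[OF xa]
    show "u \<in> carrier X" using u x z by simp
    show "p \<le> K * nrm X u" using u dom[OF xa] by simp
    fix c
    have "complex_of_real c \<odot> u = complex_of_real c \<odot> x \<oplus> complex_of_real (c * t) \<odot> z"
      "c * p = c * a + (c * t) * r"
      using u x z by (simp_all add: sm_r_distr sm_assoc algebra_simps)
    then show "(complex_of_real c \<odot> u, c * p) \<in> ?H" using D(4)[OF xa, of c] by blast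
    fix v q assume "(v, q) \<in> ?H"
    then obtain y b s where v: "v = y \<oplus> complex_of_real s \<odot> z" "q = b + s * r" and yb: "(y, b) \<in> G"
      by blast
    have "u \<oplus> v = (x \<oplus> y) \<oplus> complex_of_real (t + s) \<odot> z" "p + q = (a + b) + (t + s) * r"
      using u v x D(1)[OF yb] z by (simp_all add: sm_l_distr a_ac algebra_simps)
    then show "(u \<oplus> v, p + q) \<in> ?H" using D(3)[OF xa yb] by blast
  qed
  then show ?thesis using that by blast
qed

lemma dominated_graph_total:
  assumes K: "0 \<le> K" and G: "dominated_graph K G" and ne: "G \<noteq> {}"
  obtains H where "dominated_graph K H" "G \<subseteq> H" "fst ` H = carrier X"
proof -
  let ?A = "{H. dominated_graph K H \<and> G \<subseteq> H}"
  have "\<exists>M\<in>?A. \<forall>H\<in>?A. M \<subseteq> H \<longrightarrow> H = M"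
  proof (rule subset_Zorn_nonempty)
    show "?A \<noteq> {}" using G by blast
    fix \<C> assume C: "\<C> \<noteq> {}" "subset.chain ?A \<C>"
    then have ch: "\<And>H. H \<in> \<C> \<Longrightarrow> dominated_graph K H \<and> G \<subseteq> H"
      "\<And>H H'. H \<in> \<C> \<Longrightarrow> H' \<in> \<C> \<Longrightarrow> H \<subseteq> H' \<or> H' \<subseteq> H"
      by (auto simp: subset_chain_def)
    have "dominated_graph K (\<Union>\<C>)"
    proof (rule dominated_graphI)
      fix x a assume "(x, a) \<in> \<Union>\<C>"
      then obtain H where H: "H \<in> \<C>" "(x, a) \<in> H" by blast
      note D = dominated_graphD[OF conjunct1[OF ch(1)[OF H(1)]] H(2)]
      show "x \<in> carrier X" "a \<le> K * nrm X x" using D by simp_all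
      show "(complex_of_real c \<odot> x, c * a) \<in> \<Union>\<C>" for c using H(1) D(4) by blast
      fix y b assume "(y, b) \<in> \<Union>\<C>"
      then obtain H' where H': "H' \<in> \<C>" "(y, b) \<in> H'" by blast
      show "(x \<oplus> y, a + b) \<in> \<Union>\<C>"
        using ch(2)[OF H(1) H'(1)]
      proof
        assume "H \<subseteq> H'"
        then show ?thesis using H' H dominated_graphD(3)[OF conjunct1[OF ch(1)[OF H'(1)]] _ H'(2)] by blast
      next
        assume "H' \<subseteq> H"
        then show ?thesis using H H' dominated_graphD(3)[OF conjunct1[OF ch(1)[OF H(1)]] H(2)] by blast
      qed
    qed
    then show "\<Union>\<C> \<in> ?A" using C(1) ch(1) by blast
  qed
  then obtain M where M: "dominated_graph K M" "G \<subseteq> M"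
    and max: "\<And>H. dominated_graph K H \<Longrightarrow> G \<subseteq> H \<Longrightarrow> M \<subseteq> H \<Longrightarrow> H = M" by auto
  have "z \<in> fst ` M" if z: "z \<in> carrier X" for z
  proof -
    have "M \<noteq> {}" using M(2) ne by blast
    then obtain r where H: "dominated_graph K {(x \<oplus> complex_of_real t \<odot> z, a + t * r) |x a t. (x, a) \<in> M}"
      (is "dominated_graph K ?H")
      using dominated_graph_extend[OF K M(1) _ z] by blast
    have "M \<subseteq> ?H"
    proof clarify
      fix x a assume xa: "(x, a) \<in> M"
      then have "x = x \<oplus> complex_of_real 0 \<odot> z" "a = a + 0 * r"
        using dominated_graphD(1)[OF M(1)] z by auto
      then show "\<exists>x' a' t. (x, a) = (x' \<oplus> complex_of_real t \<odot> z, a' + t * r) \<and> (x', a') \<in> M"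
        using xa by blast
    qed
    then have eq: "?H = M" using max H M(2) by blast
    obtain x a where xa: "(x, a) \<in> M" using \<open>M \<noteq> {}\<close> by auto
    \<comment> \<open>Multiplying by 0 puts the origin into the graph, so the extension contains (z,
      r) itself; maximality then puts this point into M.\<close>
    then have "(complex_of_real 0 \<odot> x, 0 * a) \<in> M" by (rule dominated_graphD(4)[OF M(1)])
    then have "(\<zero> \<oplus> complex_of_real 1 \<odot> z, 0 + 1 * r) \<in> ?H"
      using dominated_graphD(1)[OF M(1) xa] by (intro CollectI exI) auto
    then have "(z, r) \<in> M" unfolding eq using z by simp
    then show ?thesis by force
  qed
  then have "fst ` M = carrier X" using dominated_graphD(1)[OF M(1)] by auto
  then show ?thesis using M that by blast
qed

theorem hahn_banach:
  assumes K: "0 \<le> K" and U: "U \<subseteq> carrier X" "U \<noteq> {}"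
    "\<And>x y. x \<in> U \<Longrightarrow> y \<in> U \<Longrightarrow> x \<oplus> y \<in> U" "\<And>c x. x \<in> U \<Longrightarrow> c \<odot> x \<in> U"
    and L: "\<And>x y. x \<in> U \<Longrightarrow> y \<in> U \<Longrightarrow> L (x \<oplus> y) = L x + L y" "\<And>c x. x \<in> U \<Longrightarrow> L (c \<odot> x) = c * L x"
    "\<And>x. x \<in> U \<Longrightarrow> cmod (L x) \<le> K * nrm X x"
  obtains F where "bounded_map X complex_space K F" "\<And>x. x \<in> U \<Longrightarrow> F x = L x"
proof -
  define G where "G = (\<lambda>x. (x, Re (L x))) ` U"
  have "Re (L x) \<le> K * nrm X x" if "x \<in> U" for x
    using L(3)[OF that] complex_Re_le_cmod[of "L x"] by linarith
  then have "dominated_graph K G"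
    using U L(1,2) unfolding dominated_graph_def by (auto simp: G_def image_iff)
  then obtain H where H: "dominated_graph K H" "G \<subseteq> H" "fst ` H = carrier X"
    using dominated_graph_total[OF K, of G] U(2) by (auto simp: G_def)
  note D = dominated_graphD[OF H(1)]
  define f where "f x = (THE a. (x, a) \<in> H)" for x
  have f_eq: "f x = a" if "(x, a) \<in> H" for x a
    unfolding f_def using that dominated_graph_unique[OF H(1)] by blast
  have f: "(x, f x) \<in> H" if "x \<in> carrier X" for x
  proof -
    have "x \<in> fst ` H" using that H(3) by simp
    then obtain a where "(x, a) \<in> H" by auto
    then show ?thesis using f_eq by blast
  qed
  have f_add: "f (x \<oplus> y) = f x + f y" if "x \<in> carrier X" "y \<in> carrier X" for x y
    by (rule f_eq[OF D(3)[OF f[OF that(1)] f[OF that(2)]]])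
  have f_sm: "f (complex_of_real c \<odot> x) = c * f x" if "x \<in> carrier X" for x c
    by (rule f_eq[OF D(4)[OF f[OF that]]])
  have f_le: "f x \<le> K * nrm X x" if "x \<in> carrier X" for x by (rule D(2)[OF f[OF that]])
  \<comment> \<open>A complex-linear functional is determined by its real part f through F x = f x -
    i f(i x).\<close>
  define F where "F x = Complex (f x) (- f (\<i> \<odot> x))" for x
  have F_add: "F (x \<oplus> y) = F x + F y" if "x \<in> carrier X" "y \<in> carrier X" for x y
    using that by (simp add: F_def f_add sm_r_distr complex_eq_iff)
  have F_sm: "F (c \<odot> x) = c * F x" if x: "x \<in> carrier X" for c x
  proof -
    have *: "f (c \<odot> x) = Re c * f x + Im c * f (\<i> \<odot> x)" if "x \<in> carrier X" for c x
    proof -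
      have "c \<odot> x = complex_of_real (Re c) \<odot> x \<oplus> complex_of_real (Im c) \<odot> (\<i> \<odot> x)"
        using that by (simp add: sm_assoc flip: sm_l_distr) (simp add: mult.commute flip: complex_eq)
      then show ?thesis using that by (simp add: f_add f_sm)
    qed
    have "f (\<i> \<odot> (\<i> \<odot> x)) = - f x" using f_sm[OF x, of "-1"] x by (simp add: sm_assoc)
    moreover have "\<i> \<odot> (c \<odot> x) = c \<odot> (\<i> \<odot> x)" using x by (simp add: sm_assoc mult.commute)
    ultimately have "f (\<i> \<odot> (c \<odot> x)) = Re c * f (\<i> \<odot> x) - Im c * f x"
      using *[of "\<i> \<odot> x" c] x by (simp only: sm_closed mult_minus_right diff_conv_add_uminus)
    then show ?thesis using *[OF x, of c] by (simp add: F_def complex_eq_iff)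
  qed
  have F_le: "cmod (F x) \<le> K * nrm X x" if x: "x \<in> carrier X" for x
  proof (cases "F x = 0")
    case True
    then show ?thesis using K nrm_nonneg[OF x] by simp
  next
    case False
    \<comment> \<open>Rotation by a unimodular c makes F(c x) real and equal to |F x|, so the bound
      on the real part bounds the modulus.\<close>
    define c where "c = complex_of_real (cmod (F x)) / F x"
    have c: "cmod c = 1" using False by (simp add: c_def norm_divide)
    have "F (c \<odot> x) = complex_of_real (cmod (F x))" using False x by (simp add: F_sm c_def)
    then have "f (c \<odot> x) = cmod (F x)" by (simp add: F_def complex_eq_iff)
    then show ?thesis using f_le[of "c \<odot> x"] x c by (simp add: nrm_smult)
  qed
  have F_U: "F x = L x" if "x \<in> U" for x
  proof -
    have "f y = Re (L y)" if "y \<in> U" for y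
      using H(2) that by (intro f_eq) (auto simp: G_def)
    then show ?thesis using U(4)[OF that, of \<i>] that L(2)[OF that, of \<i>] by (simp add: F_def complex_eq_iff)
  qed
  have "bounded_map X complex_space K F"
    by (rule bounded_mapI) (auto simp: F_add F_sm F_le)
  then show ?thesis using that F_U by blast
qed

lemma norming_functional:
  assumes x: "x \<in> carrier X"
  obtains F where "bounded_map X complex_space 1 F" "F x = complex_of_real (nrm X x)"
proof -
  let ?U = "range (\<lambda>c. c \<odot> x)"
  \<comment> \<open>If c x = d x, then |c - d| times the norm of x is 0. So the chosen multiple does
    not affect the product with the norm, even for x of norm 0.\<close>
  define L where "L u = (SOME c. u = c \<odot> x) * complex_of_real (nrm X x)" for u
  have L: "L (c \<odot> x) = c * complex_of_real (nrm X x)" for c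
  proof -
    define d where "d = (SOME d. c \<odot> x = d \<odot> x)"
    have "c \<odot> x = d \<odot> x" unfolding d_def by (rule someI[of _ c]) simp
    moreover have "(c - d) \<odot> x = c \<odot> x \<ominus> d \<odot> x"
      using sm_l_distr[OF x, of c "- d"] x by (simp add: diff_eq sm_assoc)
    ultimately have "(c - d) \<odot> x = \<zero>" using x by simp
    then have "cmod (c - d) * nrm X x = 0" using nrm_smult[OF x, of "c - d"] by simp
    then show ?thesis by (auto simp: L_def d_def)
  qed
  show ?thesis
  proof (rule hahn_banach[of 1 ?U L])
    show "u \<in> ?U \<Longrightarrow> cmod (L u) \<le> 1 * nrm X u" for u using x by (auto simp: L norm_mult nrm_smult nrm_nonneg)
    show "u \<in> ?U \<Longrightarrow> v \<in> ?U \<Longrightarrow> L (u \<oplus> v) = L u + L v" for u v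
      using x by (auto simp: L algebra_simps simp flip: sm_l_distr)
    show "u \<in> ?U \<Longrightarrow> v \<in> ?U \<Longrightarrow> u \<oplus> v \<in> ?U" for u v using x by (auto simp flip: sm_l_distr)
    show "u \<in> ?U \<Longrightarrow> c \<odot> u \<in> ?U" "u \<in> ?U \<Longrightarrow> L (c \<odot> u) = c * L u" for u c
      using x by (auto simp: sm_assoc L)
    fix F assume "bounded_map X complex_space 1 F" "\<And>u. u \<in> ?U \<Longrightarrow> F u = L u"
    then show thesis using that L[of 1] x by (metis mult_1 rangeI sm_one)
  qed (use x in auto)
qed

lemma nrm_le_if_dual_le:
  assumes x: "x \<in> carrier X"
    and le: "\<And>\<kappa>. \<kappa> \<in> carrier (dual X) \<Longrightarrow> cmod (\<kappa> x) \<le> r * nrm (dual X) \<kappa>" and r: "0 \<le> r"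
  shows "nrm X x \<le> r"
proof -
  obtain F where F: "bounded_map X complex_space 1 F" "F x = complex_of_real (nrm X x)"
    using norming_functional[OF x] .
  have "cmod (F x) \<le> r * nrm (dual X) (restrict F (carrier X))"
    using le[OF restrict_dual[OF seminormed_space_axioms F(1)]] x by simp
  also have "\<dots> \<le> r * 1"
    using dual_nrm_le[OF seminormed_space_axioms F(1)] r by (intro mult_left_mono) auto
  finally show ?thesis using F(2) nrm_nonneg[OF x] by simp
qed

end

subsection \<open>Generalized limits\<close>

definition bounded_fun :: "('i \<Rightarrow> complex) \<Rightarrow> bool" where
  "bounded_fun f \<longleftrightarrow> (\<exists>K. \<forall>i. cmod (f i) \<le> K)"

lemma bounded_fun_const: "bounded_fun (\<lambda>i. c)"
  by (auto simp: bounded_fun_def)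

lemma bounded_fun_add: "bounded_fun f \<Longrightarrow> bounded_fun g \<Longrightarrow> bounded_fun (\<lambda>i. f i + g i)"
  unfolding bounded_fun_def by (metis add_mono norm_triangle_ineq order_trans)

lemma bounded_fun_mult: "bounded_fun f \<Longrightarrow> bounded_fun (\<lambda>i. c * f i)"
  unfolding bounded_fun_def by (metis mult_left_mono norm_ge_zero norm_mult)

text \<open>For bounded f this is the limit superior of |f| along \<open>F\<close>. Restricting to
  nonnegative bounds keeps the set bounded below.\<close>

definition eventual_sup :: "'i filter \<Rightarrow> ('i \<Rightarrow> complex) \<Rightarrow> real" where
  "eventual_sup F f = Inf {K. 0 \<le> K \<and> (\<forall>\<^sub>F i in F. cmod (f i) \<le> K)}"

definition bounded_functions :: "'i filter \<Rightarrow> ('i \<Rightarrow> complex) nspace" where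
  "bounded_functions F = \<lparr>carrier = Collect bounded_fun, mult = undefined, one = undefined,
     zero = (\<lambda>i. 0), add = (\<lambda>f g i. f i + g i), smult = (\<lambda>c f i. c * f i), nrm = eventual_sup F\<rparr>"

lemma eventual_sup_le: "0 \<le> K \<Longrightarrow> \<forall>\<^sub>F i in F. cmod (f i) \<le> K \<Longrightarrow> eventual_sup F f \<le> K"
  unfolding eventual_sup_def by (rule cInf_lower) (auto intro: bdd_belowI[of _ 0])

lemma eventual_sup_ge:
  assumes "bounded_fun f" "\<And>K. 0 \<le> K \<Longrightarrow> \<forall>\<^sub>F i in F. cmod (f i) \<le> K \<Longrightarrow> b \<le> K"
  shows "b \<le> eventual_sup F f"
proof -
  obtain K where "\<forall>i. cmod (f i) \<le> K" using assms(1) by (auto simp: bounded_fun_def)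
  moreover then have "0 \<le> K" by (meson norm_ge_zero order_trans)
  ultimately show ?thesis
    unfolding eventual_sup_def by (intro cInf_greatest) (use assms(2) in \<open>auto intro!: exI[of _ K]\<close>)
qed

lemma seminormed_bounded_functions: "seminormed_space (bounded_functions F)"
proof (rule seminormed_spaceI)
  let ?B = "bounded_functions F"
  fix f g c assume "f \<in> carrier ?B"
  then have f: "bounded_fun f" by (simp add: bounded_functions_def)
  show "0 \<le> nrm ?B f"
    using eventual_sup_ge[OF f, of F 0] by (simp add: bounded_functions_def)
  have le: "eventual_sup F (\<lambda>i. c * f i) \<le> cmod c * eventual_sup F f" if f: "bounded_fun f" for c f
  proof (cases "c = 0")
    case True
    then show ?thesis using eventual_sup_le[of 0 "\<lambda>i. c * f i" F] by simp
  next
    case False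
    have "eventual_sup F (\<lambda>i. c * f i) / cmod c \<le> eventual_sup F f"
    proof (rule eventual_sup_ge[OF f])
      fix K assume K: "0 \<le> K" "\<forall>\<^sub>F i in F. cmod (f i) \<le> K"
      have "eventual_sup F (\<lambda>i. c * f i) \<le> cmod c * K"
        using K by (intro eventual_sup_le) (auto simp: norm_mult mult_left_mono elim: eventually_mono)
      then show "eventual_sup F (\<lambda>i. c * f i) / cmod c \<le> K" using False by (simp add: field_simps)
    qed
    then show ?thesis using False by (simp add: field_simps)
  qed
  show "nrm ?B (c \<odot>\<^bsub>?B\<^esub> f) = cmod c * nrm ?B f"
  proof (cases "c = 0")
    case True
    then show ?thesis
      using le[OF f, of 0] eventual_sup_ge[OF bounded_fun_const[of 0], where F = F and b = 0] by (simp add: bounded_functions_def)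
  next
    case False
    have "eventual_sup F f \<le> cmod (1 / c) * eventual_sup F (\<lambda>i. c * f i)"
      using le[OF bounded_fun_mult[OF f, of c], of "1 / c"] False by simp
    then show ?thesis
      using le[OF f, of c] False by (simp add: bounded_functions_def norm_divide field_simps)
  qed
  assume "g \<in> carrier ?B"
  then have g: "bounded_fun g" by (simp add: bounded_functions_def)
  have "eventual_sup F (\<lambda>i. f i + g i) - eventual_sup F g \<le> eventual_sup F f"
  proof (rule eventual_sup_ge[OF f])
    fix K assume K: "0 \<le> K" "\<forall>\<^sub>F i in F. cmod (f i) \<le> K"
    have "eventual_sup F (\<lambda>i. f i + g i) - K \<le> eventual_sup F g"
    proof (rule eventual_sup_ge[OF g])
      fix L assume L: "0 \<le> L" "\<forall>\<^sub>F i in F. cmod (g i) \<le> L"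
      have "eventual_sup F (\<lambda>i. f i + g i) \<le> K + L"
      proof (rule eventual_sup_le)
        show "\<forall>\<^sub>F i in F. cmod (f i + g i) \<le> K + L"
          using K(2) L(2) by eventually_elim (meson add_mono norm_triangle_ineq order_trans)
      qed (use K L in simp)
      then show "eventual_sup F (\<lambda>i. f i + g i) - K \<le> L" by simp
    qed
    then show "eventual_sup F (\<lambda>i. f i + g i) - eventual_sup F g \<le> K" by simp
  qed
  then show "nrm ?B (f \<oplus>\<^bsub>?B\<^esub> g) \<le> nrm ?B f + nrm ?B g" by (simp add: bounded_functions_def)
qed (auto simp: bounded_functions_def bounded_fun_const bounded_fun_add bounded_fun_mult algebra_simps)

text \<open>The limit is a linear functional on the bounded functions that converge along
  \<open>F\<close>, dominated there by \<open>eventual_sup\<close>; Hahn--Banach extends it. The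
  extension stands in for the limit along a finer ultrafilter.\<close>

theorem generalized_limit:
  fixes F :: "'i filter"
  assumes "F \<noteq> bot"
  obtains GL :: "('i \<Rightarrow> complex) \<Rightarrow> complex" where
    "\<And>f g. bounded_fun f \<Longrightarrow> bounded_fun g \<Longrightarrow> GL (\<lambda>i. f i + g i) = GL f + GL g"
    "\<And>c f. bounded_fun f \<Longrightarrow> GL (\<lambda>i. c * f i) = c * GL f"
    "\<And>f l. bounded_fun f \<Longrightarrow> (f \<longlongrightarrow> l) F \<Longrightarrow> GL f = l"
    "\<And>f K. (\<And>i. cmod (f i) \<le> K) \<Longrightarrow> cmod (GL f) \<le> K"
proof -
  interpret B: seminormed_space "bounded_functions F" by (rule seminormed_bounded_functions)
  let ?B = "bounded_functions F"
  let ?U = "{f. bounded_fun f \<and> (\<exists>l. (f \<longlongrightarrow> l) F)}"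
  have lim: "Topological_Spaces.Lim F f = l" if "(f \<longlongrightarrow> l) F" for f and l :: complex
    using tendsto_Lim[OF assms that] .
  have B: "carrier ?B = Collect bounded_fun" "add ?B = (\<lambda>f g i. f i + g i)"
    "smult ?B = (\<lambda>c f i. c * f i)" "nrm ?B = eventual_sup F"
    by (simp_all add: bounded_functions_def)
  obtain GL where GL: "bounded_map ?B complex_space 1 GL" "\<And>f. f \<in> ?U \<Longrightarrow> GL f = Topological_Spaces.Lim F f"
  proof (rule B.hahn_banach[of 1 ?U "Topological_Spaces.Lim F"])
    show "?U \<noteq> {}" using bounded_fun_const[of 0] by blast
    show "f \<in> ?U \<Longrightarrow> c \<odot>\<^bsub>?B\<^esub> f \<in> ?U" "f \<in> ?U \<Longrightarrow> Topological_Spaces.Lim F (c \<odot>\<^bsub>?B\<^esub> f) = c * Topological_Spaces.Lim F f" for c f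
      by (auto simp: B bounded_fun_mult lim intro!: tendsto_mult_left tendsto_mult lim)
    show "f \<in> ?U \<Longrightarrow> g \<in> ?U \<Longrightarrow> f \<oplus>\<^bsub>?B\<^esub> g \<in> ?U"
      "f \<in> ?U \<Longrightarrow> g \<in> ?U \<Longrightarrow> Topological_Spaces.Lim F (f \<oplus>\<^bsub>?B\<^esub> g) = Topological_Spaces.Lim F f + Topological_Spaces.Lim F g" for f g
      by (auto simp: B bounded_fun_add lim intro!: tendsto_add lim)
    fix f assume "f \<in> ?U"
    then obtain l where f: "bounded_fun f" and l: "(f \<longlongrightarrow> l) F" by blast
    \<comment> \<open>A limit obeys every eventual bound, as \<open>F\<close> is not
      trivial.\<close>
    have "cmod l \<le> eventual_sup F f"
      by (rule eventual_sup_ge[OF f]) (use tendsto_upperbound[OF tendsto_norm[OF l] _ assms] in blast)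
    then show "cmod (Topological_Spaces.Lim F f) \<le> 1 * nrm ?B f" using lim[OF l] by (simp add: B)
  qed (auto simp: B)
  note D = bounded_mapD[OF GL(1), unfolded B]
  show ?thesis
  proof (rule that[of GL])
    show "GL f = l" if "bounded_fun f" "(f \<longlongrightarrow> l) F" for f l
      using GL(2)[of f] that lim by auto
    fix f :: "'i \<Rightarrow> complex" and K assume K: "\<And>i. cmod (f i) \<le> K"
    then have f: "bounded_fun f" by (auto simp: bounded_fun_def)
    have "0 \<le> K" using K norm_ge_zero order_trans by blast
    then have "eventual_sup F f \<le> K" using K by (intro eventual_sup_le) auto
    then show "cmod (GL f) \<le> K" using D(4)[of f] f by simp
  qed (use D in auto)
qed

subsection \<open>Reflexive spaces\<close>

text \<open>The generalized limits of the values \<kappa>(x i) form a bounded functional of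
  \<kappa>, that is, an element of the bidual; reflexivity realizes it by a point of X. This is weak
  compactness of balls in the form used below.\<close>

lemma reflexive_cluster_point:
  assumes X: "normed_space X" "reflexive X" and F: "F \<noteq> bot"
    and x: "\<And>i. x i \<in> carrier X" "\<And>i. nrm X (x i) \<le> C"
  obtains a where "a \<in> carrier X"
    "\<And>\<kappa> l. \<kappa> \<in> carrier (dual X) \<Longrightarrow> ((\<lambda>i. \<kappa> (x i)) \<longlongrightarrow> l) F \<Longrightarrow> \<kappa> a = l"
proof -
  interpret X: normed_space X by fact
  interpret DX: normed_space "dual X" by (rule normed_dual) (rule X.seminormed_space_axioms)
  obtain GL where GL: 
    "\<And>f g. bounded_fun f \<Longrightarrow> bounded_fun g \<Longrightarrow> GL (\<lambda>i. f i + g i) = GL f + GL g"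
    "\<And>c f. bounded_fun f \<Longrightarrow> GL (\<lambda>i. c * f i) = c * GL f"
    "\<And>f l. bounded_fun f \<Longrightarrow> (f \<longlongrightarrow> l) F \<Longrightarrow> GL f = l"
    "\<And>f K. (\<And>i. cmod (f i) \<le> K) \<Longrightarrow> cmod (GL f) \<le> K"
    by (rule generalized_limit[OF F]) blast
  have le: "cmod (\<kappa> (x i)) \<le> C * nrm (dual X) \<kappa>" if "\<kappa> \<in> carrier (dual X)" for \<kappa> i
    using dualD(3)[OF X.seminormed_space_axioms that x(1)[of i]]
      mult_left_mono[OF x(2)[of i] DX.nrm_nonneg[OF that]] by (simp add: mult.commute)
  then have bf: "bounded_fun (\<lambda>i. \<kappa> (x i))" if "\<kappa> \<in> carrier (dual X)" for \<kappa>
    using that unfolding bounded_fun_def by blast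
  have "bounded_map (dual X) complex_space C (\<lambda>\<kappa>. GL (\<lambda>i. \<kappa> (x i)))"
    by (rule bounded_mapI) (use GL le bf x(1) in \<open>auto simp: dual_simps\<close>)
  then have "(\<lambda>\<kappa>\<in>carrier (dual X). GL (\<lambda>i. \<kappa> (x i))) \<in> carrier (bidual X)"
    by (rule restrict_dual[OF DX.seminormed_space_axioms])
  then obtain a where a: "a \<in> carrier X" "bidual_embedding X a = (\<lambda>\<kappa>\<in>carrier (dual X). GL (\<lambda>i. \<kappa> (x i)))"
    using X(2) unfolding reflexive_def by (metis imageE)
  have "\<kappa> a = GL (\<lambda>i. \<kappa> (x i))" if "\<kappa> \<in> carrier (dual X)" for \<kappa>
    using fun_cong[OF a(2), of \<kappa>] that by (simp add: bidual_embedding_def)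
  then show ?thesis using that[OF a(1)] GL(3) bf by metis
qed

text \<open>A pointwise generalized limit of uniformly bounded functionals is again a bounded
  functional: weak-star compactness in the same form.\<close>

lemma dual_cluster_point:
  assumes X: "seminormed_space X" and F: "F \<noteq> bot"
    and k: "\<And>i. bounded_map X complex_space C (k i)"
  obtains \<kappa> where "\<kappa> \<in> carrier (dual X)"
    "\<And>x l. x \<in> carrier X \<Longrightarrow> ((\<lambda>i. k i x) \<longlongrightarrow> l) F \<Longrightarrow> \<kappa> x = l"
proof -
  interpret X: seminormed_space X by fact
  obtain GL where GL: 
    "\<And>f g. bounded_fun f \<Longrightarrow> bounded_fun g \<Longrightarrow> GL (\<lambda>i. f i + g i) = GL f + GL g"
    "\<And>c f. bounded_fun f \<Longrightarrow> GL (\<lambda>i. c * f i) = c * GL f"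
    "\<And>f l. bounded_fun f \<Longrightarrow> (f \<longlongrightarrow> l) F \<Longrightarrow> GL f = l"
    "\<And>f K. (\<And>i. cmod (f i) \<le> K) \<Longrightarrow> cmod (GL f) \<le> K"
    by (rule generalized_limit[OF F]) blast
  note D = bounded_mapD[OF k]
  have bf: "bounded_fun (\<lambda>i. k i x)" if "x \<in> carrier X" for x
    using D(4)[OF that] unfolding bounded_fun_def by auto
  have "bounded_map X complex_space C (\<lambda>x. GL (\<lambda>i. k i x))"
    by (rule bounded_mapI) (use GL D bf in auto)
  then have "(\<lambda>x\<in>carrier X. GL (\<lambda>i. k i x)) \<in> carrier (dual X)"
    by (rule restrict_dual[OF X])
  then show ?thesis by (rule that) (use GL(3) bf in auto)
qed

text \<open>A weak cluster point y of the x i is paired with a weak-star cluster point \<kappa> of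
  the k j. Since k j y = \<alpha> for every j, also \<kappa> y = \<alpha>; since \<kappa>(x i) =
  \<beta> for every i, also \<kappa> y = \<beta>.\<close>

theorem reflexive_double_limit:
  assumes X: "normed_space X" "reflexive X" and F: "F \<noteq> bot" and G: "G \<noteq> bot"
    and x: "\<And>i. x i \<in> carrier X" "\<And>i. nrm X (x i) \<le> C"
    and k: "\<And>j. bounded_map X complex_space D (k j)"
    and a: "\<And>j. ((\<lambda>i. k j (x i)) \<longlongrightarrow> \<alpha>) F" and b: "\<And>i. ((\<lambda>j. k j (x i)) \<longlongrightarrow> \<beta>) G"
  shows "\<alpha> = \<beta>"
proof -
  interpret X: normed_space X by fact
  obtain y where y: "y \<in> carrier X" "\<And>\<kappa> l. \<kappa> \<in> carrier (dual X) \<Longrightarrow> ((\<lambda>i. \<kappa> (x i)) \<longlongrightarrow> l) F \<Longrightarrow> \<kappa> y = l"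
    by (rule reflexive_cluster_point[OF X F, of x C, OF x]) blast
  obtain \<kappa> where \<kappa>: "\<kappa> \<in> carrier (dual X)" "\<And>x l. x \<in> carrier X \<Longrightarrow> ((\<lambda>j. k j x) \<longlongrightarrow> l) G \<Longrightarrow> \<kappa> x = l"
    by (rule dual_cluster_point[OF X.seminormed_space_axioms G, of D k, OF k]) blast
  have "k j y = \<alpha>" for j
    using y(2)[OF restrict_dual[OF X.seminormed_space_axioms k], of j \<alpha>] a x(1) y(1) by simp
  then have "\<kappa> y = \<alpha>" using \<kappa>(2)[OF y(1), of \<alpha>] by simp
  moreover have "\<kappa> (x i) = \<beta>" for i using \<kappa>(2)[OF x(1) b] .
  then have "\<kappa> y = \<beta>" using y(2)[OF \<kappa>(1), of \<beta>] by simp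
  ultimately show ?thesis by simp
qed

text \<open>A Cauchy sequence has a weak cluster point a. By Hahn--Banach the norm of u n - a can be
  tested on functionals; along each of them the whole sequence converges to the value at a, so the
  Cauchy estimate survives the limit.\<close>

lemma reflexive_imp_complete:
  assumes X: "normed_space X" "reflexive X"
  shows "complete_space X"
  unfolding complete_space_def
proof
  interpret X: normed_space X by fact
  fix u assume "u \<in> carrier (cauchy_sequences X)"
  note u = X.cauchy_sequencesD[OF this] and lim = X.cauchy_nrm_tendsto[OF this]
  from lim have "Bseq (\<lambda>n. nrm X (u n))" by (meson convergentI convergent_imp_Bseq)
  then obtain C where C: "\<And>n. nrm X (u n) \<le> C" by (auto simp: Bseq_def abs_le_iff)
  obtain a where a: "a \<in> carrier X"
    "\<And>\<kappa> l. \<kappa> \<in> carrier (dual X) \<Longrightarrow> (\<lambda>i. \<kappa> (u i)) \<longlonglongrightarrow> l \<Longrightarrow> \<kappa> a = l"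
    by (rule reflexive_cluster_point[OF X sequentially_bot, of u C, OF u(1) C]) blast
  have "(\<lambda>n. nrm X (u n \<ominus>\<^bsub>X\<^esub> a)) \<longlonglongrightarrow> 0"
  proof (rule LIMSEQ_I)
    fix e :: real assume e: "e > 0"
    then obtain N where N: "\<And>m n. m \<ge> N \<Longrightarrow> n \<ge> N \<Longrightarrow> nrm X (u m \<ominus>\<^bsub>X\<^esub> u n) < e/2"
      using u(2)[of "e/2"] by auto
    have "nrm X (u n \<ominus>\<^bsub>X\<^esub> a) \<le> e/2" if n: "n \<ge> N" for n
    proof (rule X.nrm_le_if_dual_le)
      fix \<kappa> assume \<kappa>: "\<kappa> \<in> carrier (dual X)"
      note b = dual_bounded_map[OF X.seminormed_space_axioms \<kappa>]
      then have lin: "linear_map X complex_space \<kappa>" by (simp add: bounded_map_def)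
      have diff: "\<kappa> (x \<ominus>\<^bsub>X\<^esub> y) = \<kappa> x - \<kappa> y" if "x \<in> carrier X" "y \<in> carrier X" for x y
        using linear_map_diff[OF X.seminormed_space_axioms _ lin that] normed_complex_space
        by (simp add: normed_space_def)
      have le: "cmod (\<kappa> (u m) - \<kappa> (u k)) \<le> nrm (dual X) \<kappa> * nrm X (u m \<ominus>\<^bsub>X\<^esub> u k)" for m k
        using dualD(3)[OF X.seminormed_space_axioms \<kappa> X.diff_closed[OF u(1) u(1)]] diff[OF u(1) u(1)] by simp
      have "Cauchy (\<lambda>n. \<kappa> (u n))"
        unfolding Cauchy_iff
      proof (intro allI impI)
        fix d :: real assume d: "d > 0"
        have pos: "nrm (dual X) \<kappa> + 1 > 0"
          using dual_nrm_nonneg[OF X.seminormed_space_axioms \<kappa>] by simp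
        then obtain M where M: "\<forall>m\<ge>M. \<forall>n\<ge>M. nrm X (u m \<ominus>\<^bsub>X\<^esub> u n) < d / (nrm (dual X) \<kappa> + 1)"
          using u(2)[of "d / (nrm (dual X) \<kappa> + 1)"] d by auto
        have "cmod (\<kappa> (u m) - \<kappa> (u k)) < d" if "m \<ge> M" "k \<ge> M" for m k
        proof -
          have "cmod (\<kappa> (u m) - \<kappa> (u k)) \<le> (nrm (dual X) \<kappa> + 1) * nrm X (u m \<ominus>\<^bsub>X\<^esub> u k)"
            using le[of m k] X.nrm_nonneg[OF X.diff_closed[OF u(1) u(1)], of m k] by (simp add: algebra_simps)
          also have "\<dots> < d" using M that pos by (simp add: pos_less_divide_eq mult.commute)
          finally show ?thesis .
        qed
        then show "\<exists>M. \<forall>m\<ge>M. \<forall>n\<ge>M. norm (\<kappa> (u m) - \<kappa> (u n)) < d" by blast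
      qed
      then obtain l where l: "(\<lambda>n. \<kappa> (u n)) \<longlonglongrightarrow> l" using Cauchy_convergent_iff convergent_def by metis
      then have "\<kappa> a = l" using a(2)[OF \<kappa>] by blast
      then have "(\<lambda>m. cmod (\<kappa> (u n) - \<kappa> (u m))) \<longlonglongrightarrow> cmod (\<kappa> (u n) - \<kappa> a)"
        using l by (intro tendsto_intros) auto
      then have "cmod (\<kappa> (u n) - \<kappa> a) \<le> e/2 * nrm (dual X) \<kappa>"
      proof (rule LIMSEQ_le_const2)
        show "\<exists>M. \<forall>m\<ge>M. cmod (\<kappa> (u n) - \<kappa> (u m)) \<le> e/2 * nrm (dual X) \<kappa>"
        proof (intro exI[of _ N] allI impI)
          fix m assume "m \<ge> N"
          then have "nrm (dual X) \<kappa> * nrm X (u n \<ominus>\<^bsub>X\<^esub> u m) \<le> nrm (dual X) \<kappa> * (e/2)"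
            using N[OF n, of m] dual_nrm_nonneg[OF X.seminormed_space_axioms \<kappa>] by (intro mult_left_mono) auto
          then show "cmod (\<kappa> (u n) - \<kappa> (u m)) \<le> e/2 * nrm (dual X) \<kappa>"
            using le[of n m] by (simp add: mult.commute)
        qed
      qed
      then show "cmod (\<kappa> (u n \<ominus>\<^bsub>X\<^esub> a)) \<le> e/2 * nrm (dual X) \<kappa>" using diff[OF u(1) a(1)] by simp
    qed (use u(1) a(1) e in auto)
    then have "norm (nrm X (u n \<ominus>\<^bsub>X\<^esub> a) - 0) < e" if "n \<ge> N" for n
      using that e X.nrm_nonneg[OF X.diff_closed[OF u(1) a(1)], of n] by fastforce
    then show "\<exists>N. \<forall>n\<ge>N. norm (nrm X (u n \<ominus>\<^bsub>X\<^esub> a) - 0) < e" by blast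
  qed
  then show "\<exists>x\<in>carrier X. (\<lambda>n. nrm X (u n \<ominus>\<^bsub>X\<^esub> x)) \<longlonglongrightarrow> 0" using a(1) by blast
qed

subsection \<open>Finite-dimensional spaces\<close>

lemma linear_map_finsum:
  assumes "seminormed_space X" "seminormed_space Y" "linear_map X Y T" "finite I"
    "\<And>i. i \<in> I \<Longrightarrow> x i \<in> carrier X"
  shows "T (\<Oplus>\<^bsub>X\<^esub>i\<in>I. x i) = (\<Oplus>\<^bsub>Y\<^esub>i\<in>I. T (x i))"
proof -
  interpret X: seminormed_space X by fact
  interpret Y: seminormed_space Y by fact
  show ?thesis
    using assms(4,5)
  proof (induction I)
    case empty
    then show ?case using linear_map_zero[OF assms(1-3)] by simp
  next
    case (insert i I)
    have c: "x \<in> I \<rightarrow> carrier X" "x i \<in> carrier X" using insert by auto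
    moreover have "(\<lambda>i. T (x i)) \<in> I \<rightarrow> carrier Y" "T (x i) \<in> carrier Y"
      using c assms(3) by (auto simp: linear_map_def)
    ultimately show ?case
      using insert assms(3) X.finsum_closed[OF c(1)] by (simp add: linear_map_def)
  qed
qed

lemma finsum_complex_space [simp]: "finite I \<Longrightarrow> (\<Oplus>\<^bsub>complex_space\<^esub>i\<in>I. f i) = sum f I"
proof (induction I rule: finite_induct)
  interpret normed_space complex_space by (rule normed_complex_space)
  case empty
  show ?case by simp
next
  interpret normed_space complex_space by (rule normed_complex_space)
  case (insert i I)
  then show ?case by simp
qed

lemma dual_finsum:
  assumes "seminormed_space X" "\<kappa> \<in> carrier (dual X)" "finite I" "\<And>i. i \<in> I \<Longrightarrow> x i \<in> carrier X"
  shows "\<kappa> (\<Oplus>\<^bsub>X\<^esub>i\<in>I. x i) = (\<Sum>i\<in>I. \<kappa> (x i))"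
  using linear_map_finsum[OF assms(1) _ _ assms(3,4), of complex_space \<kappa>] normed_complex_space
    dual_bounded_map[OF assms(1,2)] assms(3) by (simp add: bounded_map_def normed_space_def)

text \<open>If the identity agrees with a finite sum $P$ of rank-one operators on a finite set, a functional
  that does not vanish on the residual $s - Ps$ of a further vector $s$ corrects $P$ at $s$.\<close>

lemma finite_rank_on_finite_set:
  assumes X: "normed_space X" and "finite T" "T \<subseteq> carrier X"
  shows "\<exists>(n::nat) b k. (\<forall>i<n. b i \<in> carrier X \<and> k i \<in> carrier (dual X)) \<and>
    (\<forall>x\<in>T. x = (\<Oplus>\<^bsub>X\<^esub>i\<in>{..<n}. k i x \<odot>\<^bsub>X\<^esub> b i))"
  using assms(2,3)
proof (induction T)
  case empty
  then show ?case by (intro exI[of _ 0]) auto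
next
  case (insert s T)
  interpret X: normed_space X by fact
  obtain n b k where bk: "\<And>i. i < n \<Longrightarrow> b i \<in> carrier X" "\<And>i. i < n \<Longrightarrow> k i \<in> carrier (dual X)"
    and T: "\<And>x. x \<in> T \<Longrightarrow> x = (\<Oplus>\<^bsub>X\<^esub>i\<in>{..<n::nat}. k i x \<odot>\<^bsub>X\<^esub> b i)"
    using insert by auto blast
  define P where "P x = (\<Oplus>\<^bsub>X\<^esub>i\<in>{..<n}. k i x \<odot>\<^bsub>X\<^esub> b i)" for x
  have Pc: "P x \<in> carrier X" for x unfolding P_def using bk by (intro X.finsum_closed) auto
  have s: "s \<in> carrier X" and Tc: "T \<subseteq> carrier X" using insert by auto
  define r where "r = s \<ominus>\<^bsub>X\<^esub> P s"
  have r: "r \<in> carrier X" using s Pc by (simp add: r_def)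
  show ?case
  proof (cases "nrm X r = 0")
    case True
    then have "s = P s" using X.eq_iff_nrm_diff[OF s Pc] by (simp add: r_def)
    then show ?thesis using bk T unfolding P_def by (intro exI[of _ n] exI[of _ b] exI[of _ k]) auto
  next
    case False
    obtain F where F: "bounded_map X complex_space 1 F" "F r = complex_of_real (nrm X r)"
      using X.norming_functional[OF r] .
    define f where "f = (\<lambda>x\<in>carrier X. F x / complex_of_real (nrm X r))"
    define c where "c = cmod (1 / complex_of_real (nrm X r))"
    have "bounded_map X complex_space (c * 1) (\<lambda>x. (1 / complex_of_real (nrm X r)) * F x)"
      unfolding c_def using bounded_map_smult[OF X.seminormed_space_axioms normed_complex_space F(1),
          of "1 / complex_of_real (nrm X r)"] by simp
    from restrict_dual[OF X.seminormed_space_axioms this]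
    have f: "f \<in> carrier (dual X)" by (simp add: f_def)
    have fr: "f r = 1" using F(2) False r by (simp add: f_def)
    note fD = dualD[OF X.seminormed_space_axioms f]
    \<comment> \<open>This is f composed with 1 - P, spelled out so that its boundedness is visible.
      It is 1 at s and vanishes on T, where P is already the identity.\<close>
    define g where "g = (\<lambda>x\<in>carrier X. f x - (\<Sum>i<n. k i x * f (b i)))"
    have kb: "cmod (\<Sum>i<n. k i x * f (b i)) \<le> (\<Sum>i<n. nrm (dual X) (k i) * cmod (f (b i))) * nrm X x"
      if "x \<in> carrier X" for x
    proof -
      have "cmod (\<Sum>i<n. k i x * f (b i)) \<le> (\<Sum>i<n. (nrm (dual X) (k i) * nrm X x) * cmod (f (b i)))"
        by (rule sum_norm_le)
          (use dualD(3)[OF X.seminormed_space_axioms bk(2) that] in \<open>auto simp: norm_mult intro!: mult_right_mono\<close>)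
      then show ?thesis by (simp add: sum_distrib_left sum_distrib_right mult_ac)
    qed
    have "bounded_map X complex_space (nrm (dual X) f + (\<Sum>i<n. nrm (dual X) (k i) * cmod (f (b i))))
        (\<lambda>x. f x - (\<Sum>i<n. k i x * f (b i)))"
    proof (rule bounded_mapI)
      fix x assume x: "x \<in> carrier X"
      show "nrm complex_space (f x - (\<Sum>i<n. k i x * f (b i))) \<le>
          (nrm (dual X) f + (\<Sum>i<n. nrm (dual X) (k i) * cmod (f (b i)))) * nrm X x"
        using norm_triangle_ineq4[of "f x" "\<Sum>i<n. k i x * f (b i)"] fD(3)[OF x] kb[OF x]
        by (simp add: distrib_right)
    qed (use fD dualD[OF X.seminormed_space_axioms bk(2)] in
        \<open>auto simp: algebra_simps sum.distrib sum_distrib_left\<close>)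
    from restrict_dual[OF X.seminormed_space_axioms this]
    have g: "g \<in> carrier (dual X)" by (simp add: g_def)
    have g_eq: "g x = f (x \<ominus>\<^bsub>X\<^esub> P x)" if x: "x \<in> carrier X" for x
    proof -
      have "f (P x) = (\<Sum>i<n. k i x * f (b i))"
        unfolding P_def using dual_finsum[OF X.seminormed_space_axioms f, of "{..<n}" "\<lambda>i. k i x \<odot>\<^bsub>X\<^esub> b i"] bk(1) fD(2)
        by auto
      moreover have "f (x \<ominus>\<^bsub>X\<^esub> P x) = f x - f (P x)"
        using fD(1)[of x "(-1) \<odot>\<^bsub>X\<^esub> P x"] fD(2)[OF Pc, of "-1"] x Pc by (simp add: X.diff_eq)
      ultimately show ?thesis using x by (simp add: g_def)
    qed
    define b' k' where "b' i = (if i = n then r else b i)" and "k' i = (if i = n then g else k i)" for i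
    have sum: "(\<Oplus>\<^bsub>X\<^esub>i\<in>{..<Suc n}. k' i x \<odot>\<^bsub>X\<^esub> b' i) = g x \<odot>\<^bsub>X\<^esub> r \<oplus>\<^bsub>X\<^esub> P x" for x
    proof -
      have "(\<Oplus>\<^bsub>X\<^esub>i\<in>{..<n}. k' i x \<odot>\<^bsub>X\<^esub> b' i) = P x"
        unfolding P_def using bk(1) by (intro X.finsum_cong') (auto simp: b'_def k'_def)
      then show ?thesis
        using bk(1) r by (simp add: lessThan_Suc b'_def k'_def)
    qed
    have "x = (\<Oplus>\<^bsub>X\<^esub>i\<in>{..<Suc n}. k' i x \<odot>\<^bsub>X\<^esub> b' i)" if "x \<in> insert s T" for x
    proof (cases "x = s")
      case True
      then show ?thesis
        unfolding sum using g_eq[OF s] fr r s Pc X.diff_add_cancel[OF s Pc] by (simp add: r_def)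
    next
      case False
      then have x: "x \<in> T" "x \<in> carrier X" using that Tc by auto
      then have Px: "P x = x" using T by (simp add: P_def)
      then have "g x = 0" using g_eq[OF x(2)] fD(2)[OF X.zero_closed, of 0] x(2) by simp
      then show ?thesis unfolding sum using Px r x by simp
    qed
    moreover have "\<forall>i<Suc n. b' i \<in> carrier X \<and> k' i \<in> carrier (dual X)"
      using bk r g by (simp add: b'_def k'_def)
    ultimately show ?thesis by blast
  qed
qed

text \<open>Coordinates come as bounded functionals, without choosing a basis: a linear P that fixes
  a spanning set is the identity.\<close>

lemma finite_dimensional_expansion:
  assumes X: "normed_space X" "finite_dimensional X"
  obtains n :: nat and b k where "\<And>i. i < n \<Longrightarrow> b i \<in> carrier X" "\<And>i. i < n \<Longrightarrow> k i \<in> carrier (dual X)"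
    "\<And>x. x \<in> carrier X \<Longrightarrow> x = (\<Oplus>\<^bsub>X\<^esub>i\<in>{..<n}. k i x \<odot>\<^bsub>X\<^esub> b i)"
proof -
  interpret X: normed_space X by fact
  obtain S where S: "finite S" "S \<subseteq> carrier X"
    "\<And>x. x \<in> carrier X \<Longrightarrow> \<exists>c. x = (\<Oplus>\<^bsub>X\<^esub>s\<in>S. c s \<odot>\<^bsub>X\<^esub> s)"
    using X(2) unfolding finite_dimensional_def by blast
  obtain n :: nat and b k where bk: "\<And>i. i < n \<Longrightarrow> b i \<in> carrier X" "\<And>i. i < n \<Longrightarrow> k i \<in> carrier (dual X)"
    and eq: "\<And>x. x \<in> S \<Longrightarrow> x = (\<Oplus>\<^bsub>X\<^esub>i\<in>{..<n}. k i x \<odot>\<^bsub>X\<^esub> b i)"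
    using finite_rank_on_finite_set[OF X(1) S(1,2)] by blast
  define P where "P x = (\<Oplus>\<^bsub>X\<^esub>i\<in>{..<n}. k i x \<odot>\<^bsub>X\<^esub> b i)" for x
  note kD = dualD[OF X.seminormed_space_axioms bk(2)]
  have lin: "linear_map X X P"
    unfolding linear_map_def
  proof (intro conjI ballI allI)
    show "P \<in> carrier X \<rightarrow> carrier X"
      using bk(1) by (auto simp: P_def intro!: X.finsum_closed)
    fix x y c assume x: "x \<in> carrier X"
    have "P (c \<odot>\<^bsub>X\<^esub> x) = (\<Oplus>\<^bsub>X\<^esub>i\<in>{..<n}. c \<odot>\<^bsub>X\<^esub> (k i x \<odot>\<^bsub>X\<^esub> b i))"
      unfolding P_def using bk(1) kD(2) x by (intro X.finsum_cong') (auto simp: X.sm_assoc)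
    then show "P (c \<odot>\<^bsub>X\<^esub> x) = c \<odot>\<^bsub>X\<^esub> P x"
      using Module.module.finsum_smult_ldistr[OF X.is_module, of "{..<n}" c "\<lambda>i. k i x \<odot>\<^bsub>X\<^esub> b i"] bk(1)
      by (auto simp: P_def)
    assume y: "y \<in> carrier X"
    have "P (x \<oplus>\<^bsub>X\<^esub> y) = (\<Oplus>\<^bsub>X\<^esub>i\<in>{..<n}. k i x \<odot>\<^bsub>X\<^esub> b i \<oplus>\<^bsub>X\<^esub> k i y \<odot>\<^bsub>X\<^esub> b i)"
      unfolding P_def using bk(1) kD(1) x y by (intro X.finsum_cong') (auto simp: X.sm_l_distr)
    then show "P (x \<oplus>\<^bsub>X\<^esub> y) = P x \<oplus>\<^bsub>X\<^esub> P y"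
      using bk(1) by (auto simp: P_def X.finsum_addf)
  qed
  have "P x = x" if x: "x \<in> carrier X" for x
  proof -
    obtain c where c: "x = (\<Oplus>\<^bsub>X\<^esub>s\<in>S. c s \<odot>\<^bsub>X\<^esub> s)" using S(3)[OF x] by blast
    have "P x = (\<Oplus>\<^bsub>X\<^esub>s\<in>S. P (c s \<odot>\<^bsub>X\<^esub> s))"
      unfolding c using S by (intro linear_map_finsum[OF X.seminormed_space_axioms X.seminormed_space_axioms lin]) auto
    also have "\<dots> = (\<Oplus>\<^bsub>X\<^esub>s\<in>S. c s \<odot>\<^bsub>X\<^esub> s)"
      using lin eq S(2) by (intro X.finsum_cong') (auto simp: linear_map_def P_def subset_iff)
    finally show ?thesis using c by simp
  qed
  then show ?thesis using that[OF bk] unfolding P_def by simp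
qed

text \<open>Every functional \<kappa> is the sum of the \<kappa>(b i) k i, so a functional \<Phi> on
  the dual is evaluation at the sum of the \<Phi>(k i) b i.\<close>

theorem finite_dimensional_imp_reflexive:
  assumes X: "normed_space X" "finite_dimensional X"
  shows "reflexive X"
proof -
  interpret X: normed_space X by fact
  interpret DX: normed_space "dual X" by (rule normed_dual) (rule X.seminormed_space_axioms)
  interpret DDX: normed_space "bidual X" by (rule normed_dual) (rule DX.seminormed_space_axioms)
  obtain n :: nat and b k where bk: "\<And>i. i < n \<Longrightarrow> b i \<in> carrier X" "\<And>i. i < n \<Longrightarrow> k i \<in> carrier (dual X)"
    and eq: "\<And>x. x \<in> carrier X \<Longrightarrow> x = (\<Oplus>\<^bsub>X\<^esub>i\<in>{..<n}. k i x \<odot>\<^bsub>X\<^esub> b i)"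
    by (rule finite_dimensional_expansion[OF X]) blast
  have "\<Phi> \<in> bidual_embedding X ` carrier X" if \<Phi>: "\<Phi> \<in> carrier (bidual X)" for \<Phi>
  proof
    let ?a = "\<Oplus>\<^bsub>X\<^esub>i\<in>{..<n}. \<Phi> (k i) \<odot>\<^bsub>X\<^esub> b i"
    show a: "?a \<in> carrier X" using bk(1) by (auto intro!: X.finsum_closed)
    have *: "\<kappa> (\<Oplus>\<^bsub>X\<^esub>i\<in>{..<n}. c i \<odot>\<^bsub>X\<^esub> b i) = (\<Sum>i<n. c i * \<kappa> (b i))" if "\<kappa> \<in> carrier (dual X)" for \<kappa> c
      using dual_finsum[OF X.seminormed_space_axioms that, of "{..<n}" "\<lambda>i. c i \<odot>\<^bsub>X\<^esub> b i"] bk(1)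
        dualD(2)[OF X.seminormed_space_axioms that] by auto
    have "\<Phi> \<kappa> = \<kappa> ?a" if \<kappa>: "\<kappa> \<in> carrier (dual X)" for \<kappa>
    proof -
      let ?s = "\<Oplus>\<^bsub>dual X\<^esub>i\<in>{..<n}. \<kappa> (b i) \<odot>\<^bsub>dual X\<^esub> k i"
      have s: "?s \<in> carrier (dual X)" using bk(2) by (auto intro!: DX.finsum_closed)
      have ev: "?s x = (\<Sum>i<n. \<kappa> (b i) * k i x)" if x: "x \<in> carrier X" for x
        using dual_finsum[OF DX.seminormed_space_axioms bidual_embedding_closed[OF X.seminormed_space_axioms x],
            of "{..<n}" "\<lambda>i. \<kappa> (b i) \<odot>\<^bsub>dual X\<^esub> k i"] s bk(2) x
        by (auto simp: bidual_embedding_def) (auto simp: dual_simps)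
      have "\<kappa> = ?s"
      proof (rule extensionalityI)
        show "\<kappa> \<in> extensional (carrier X)" "?s \<in> extensional (carrier X)"
          using \<kappa> s by (auto simp: dual_iff)
        show "\<kappa> x = ?s x" if x: "x \<in> carrier X" for x
          using *[OF \<kappa>, of "\<lambda>i. k i x"] ev[OF x] eq[OF x] by (simp add: mult.commute)
      qed
      then have "\<Phi> \<kappa> = (\<Sum>i<n. \<kappa> (b i) * \<Phi> (k i))"
        using dual_finsum[OF DX.seminormed_space_axioms \<Phi>, of "{..<n}" "\<lambda>i. \<kappa> (b i) \<odot>\<^bsub>dual X\<^esub> k i"] bk(2)
          dualD(2)[OF DX.seminormed_space_axioms \<Phi>] by auto
      then show ?thesis using *[OF \<kappa>, of "\<lambda>i. \<Phi> (k i)"] by (simp add: mult.commute)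
    qed
    then show "\<Phi> = bidual_embedding X ?a"
      using \<Phi> by (intro extensionalityI[of _ "carrier (dual X)"]) (auto simp: bidual_embedding_def dual_iff)
  qed
  then show ?thesis
    unfolding reflexive_def using bidual_embedding_closed[OF X.seminormed_space_axioms] by blast
qed

section \<open>The spaces $L^p$ and their operators\<close>

lemma powr_convex_comb:
  fixes a b s t p :: real
  assumes "1 \<le> p" "0 \<le> a" "0 \<le> b" "0 < s" "0 < t" "s + t = 1"
  shows "(s * a + t * b) powr p \<le> s * a powr p + t * b powr p"
proof -
  have flip_s: "1 - t = s" using assms by simp
  have small: "r powr p \<le> r" if "0 < r" "r \<le> 1" for r
    using powr_mono'[of 1 p r] assms(1) that by simp
  show ?thesis
  proof (cases "a = 0 \<or> b = 0")
    \<comment> \<open>With one point equal to 0 the claim reduces to s^p <= s, or the same for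
      t.\<close>
    case True
    then show ?thesis
      using assms small[of s] small[of t] by (auto simp: powr_mult mult_right_mono)
  next
    case False
    then show ?thesis
      using convex_onD[OF powr_convex[OF assms(1)], of t a b] assms
      by (simp add: flip_s)
  qed
qed

text \<open>A crude bound that makes the p-integrable functions closed under sums; the sharp
  triangle inequality comes from convexity in \<open>LF_triangle\<close>.\<close>

lemma powr_add_le:
  fixes a b p :: real
  assumes "1 \<le> p" "0 \<le> a" "0 \<le> b"
  shows "(a + b) powr p \<le> 2 powr p * (a powr p + b powr p)"
proof -
  have "(a + b) powr p = 2 powr p * (1/2 * a + 1/2 * b) powr p"
    using assms by (simp flip: powr_mult add: algebra_simps)
  also have "(1/2 * a + 1/2 * b) powr p \<le> 1/2 * a powr p + 1/2 * b powr p"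
    by (rule powr_convex_comb) (use assms in auto)
  also have "\<dots> \<le> a powr p + b powr p"
    using powr_ge_zero[of a p] powr_ge_zero[of b p] by linarith
  finally show ?thesis by simp
qed

text \<open>Young's inequality, integrated after both functions are scaled to norm 1. If one norm is
  0, scaling is impossible, but the product vanishes almost everywhere.\<close>

lemma holder:
  fixes f g :: "'a \<Rightarrow> complex" and p q :: real
  assumes pq: "1 < p" "1 < q" "1/p + 1/q = 1"
    and f [measurable]: "f \<in> borel_measurable M" and fp: "integrable M (\<lambda>x. cmod (f x) powr p)"
    and g [measurable]: "g \<in> borel_measurable M" and gq: "integrable M (\<lambda>x. cmod (g x) powr q)"
  shows "integrable M (\<lambda>x. f x * g x)"
    and "(\<integral>x. cmod (f x * g x) \<partial>M) \<le>
      (\<integral>x. cmod (f x) powr p \<partial>M) powr (1/p) * (\<integral>x. cmod (g x) powr q \<partial>M) powr (1/q)"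
proof -
  let ?A = "\<integral>x. cmod (f x) powr p \<partial>M" and ?B = "\<integral>x. cmod (g x) powr q \<partial>M"
  have young: "cmod (f x * g x) \<le> cmod (f x) powr p / p + cmod (g x) powr q / q" for x
    using Youngs_inequality[OF pq, of "cmod (f x)" "cmod (g x)"] by (simp add: norm_mult)
  show int: "integrable M (\<lambda>x. f x * g x)"
    by (rule Bochner_Integration.integrable_bound[of M "\<lambda>x. cmod (f x) powr p / p + cmod (g x) powr q / q"])
      (use fp gq young in \<open>auto intro!: Bochner_Integration.integrable_add AE_I2 intro: order_trans[OF young]\<close>)
  have AB: "0 \<le> ?A" "0 \<le> ?B" by simp_all
  show "(\<integral>x. cmod (f x * g x) \<partial>M) \<le> ?A powr (1/p) * ?B powr (1/q)"
  proof (cases "?A = 0 \<or> ?B = 0")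
    case True
    then have "AE x in M. cmod (f x * g x) = 0"
      using integral_nonneg_eq_0_iff_AE[OF fp] integral_nonneg_eq_0_iff_AE[OF gq] pq
      by (auto elim: eventually_mono)
    then have "(\<integral>x. cmod (f x * g x) \<partial>M) = 0"
      using integral_cong_AE[of "\<lambda>x. cmod (f x * g x)" M "\<lambda>x. 0"] by simp
    then show ?thesis by simp
  next
    case False
    define a b where "a = ?A powr (1/p)" and "b = ?B powr (1/q)"
    have ab: "a > 0" "b > 0" using False AB by (auto simp: a_def b_def)
    have pa: "a powr p = ?A" "b powr q = ?B"
      using AB pq by (simp_all add: a_def b_def powr_powr)
    have "cmod (f x * g x) / (a * b) \<le> cmod (f x) powr p / ?A / p + cmod (g x) powr q / ?B / q" for x
      using Youngs_inequality[OF pq, of "cmod (f x) / a" "cmod (g x) / b"] ab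
      by (simp add: powr_divide pa norm_mult)
    then have "(\<integral>x. cmod (f x * g x) / (a * b) \<partial>M) \<le>
        (\<integral>x. cmod (f x) powr p / ?A / p + cmod (g x) powr q / ?B / q \<partial>M)"
      using int fp gq by (intro integral_mono) auto
    also have "\<dots> = 1 / p + 1 / q"
      using fp gq False by (simp add: Bochner_Integration.integral_add)
    finally show ?thesis using ab pq(3) by (simp add: a_def b_def field_simps)
  qed
qed

locale Lp_setting =
  fixes \<mu> :: "'g measure" and p :: real
  assumes p_gt_1: "1 < p"
begin

abbreviation "LF \<equiv> Lp_functions \<mu> p"
abbreviation "LS \<equiv> Lp \<mu> p"
abbreviation "cls \<equiv> null_class (Lp_functions \<mu> p)"

definition "q = p / (p - 1)"

lemma q: "1 < q" "1/p + 1/q = 1"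
  using p_gt_1 by (simp_all add: q_def field_simps)

lemma Lp_functions_simps:
  "carrier LF = {f \<in> borel_measurable \<mu>. integrable \<mu> (\<lambda>t. cmod (f t) powr p)}"
  "zero LF = (\<lambda>t. 0)" "add LF = (\<lambda>f g t. f t + g t)" "smult LF = (\<lambda>c f t. c * f t)"
  "nrm LF = (\<lambda>f. (\<integral>t. cmod (f t) powr p \<partial>\<mu>) powr (1 / p))"
  by (simp_all add: Lp_functions_def)

lemma LF_I: "f \<in> borel_measurable \<mu> \<Longrightarrow> integrable \<mu> (\<lambda>t. cmod (f t) powr p) \<Longrightarrow> f \<in> carrier LF"
  by (simp add: Lp_functions_simps)

lemma LF_D:
  assumes "f \<in> carrier LF"
  shows "f \<in> borel_measurable \<mu>" "integrable \<mu> (\<lambda>t. cmod (f t) powr p)"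
  using assms by (auto simp: Lp_functions_simps)

lemma nrm_LF_powr: "f \<in> carrier LF \<Longrightarrow> nrm LF f powr p = (\<integral>t. cmod (f t) powr p \<partial>\<mu>)"
  using p_gt_1 by (simp add: Lp_functions_simps powr_powr)

lemma nrm_LF_le:
  assumes "f \<in> carrier LF" "(\<integral>t. cmod (f t) powr p \<partial>\<mu>) \<le> K powr p" "0 \<le> K"
  shows "nrm LF f \<le> K"
proof -
  have "nrm LF f \<le> (K powr p) powr (1/p)"
    unfolding Lp_functions_simps using assms p_gt_1 by (intro powr_mono2) auto
  then show ?thesis using assms p_gt_1 by (simp add: powr_powr)
qed

lemma LF_add:
  assumes "f \<in> carrier LF" "g \<in> carrier LF"
  shows "(\<lambda>t. f t + g t) \<in> carrier LF"
proof (rule LF_I)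
  note [measurable] = LF_D(1)[OF assms(1)] LF_D(1)[OF assms(2)]
  show "(\<lambda>t. f t + g t) \<in> borel_measurable \<mu>" by measurable
  have "cmod (f t + g t) powr p \<le> 2 powr p * (cmod (f t) powr p + cmod (g t) powr p)" for t
    using powr_mono2[of p "cmod (f t + g t)" "cmod (f t) + cmod (g t)"] norm_triangle_ineq[of "f t" "g t"]
      powr_add_le[of p "cmod (f t)" "cmod (g t)"] p_gt_1 by simp
  then have le: "AE t in \<mu>. norm (cmod (f t + g t) powr p) \<le> norm (2 powr p * (cmod (f t) powr p + cmod (g t) powr p))"
    by (intro AE_I2) (auto intro: order_trans)
  show "integrable \<mu> (\<lambda>t. cmod (f t + g t) powr p)"
  proof (rule Bochner_Integration.integrable_bound[OF _ _ le])
    show "integrable \<mu> (\<lambda>t. 2 powr p * (cmod (f t) powr p + cmod (g t) powr p))"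
      by (intro integrable_mult_right Bochner_Integration.integrable_add LF_D(2)[OF assms(1)] LF_D(2)[OF assms(2)])
  qed measurable
qed

lemma LF_smult:
  assumes "f \<in> carrier LF"
  shows "(\<lambda>t. c * f t) \<in> carrier LF" "nrm LF (\<lambda>t. c * f t) = cmod c * nrm LF f"
proof -
  note [measurable] = LF_D(1)[OF assms(1)]
  have eq: "cmod (c * f t) powr p = cmod c powr p * cmod (f t) powr p" for t
    by (simp add: norm_mult powr_mult)
  show "(\<lambda>t. c * f t) \<in> carrier LF"
    using LF_D(2)[OF assms] by (intro LF_I) (simp_all add: eq)
  show "nrm LF (\<lambda>t. c * f t) = cmod c * nrm LF f"
    using p_gt_1 by (simp add: Lp_functions_simps eq powr_mult powr_powr)
qed

lemma LF_nrm_eq_0_iff: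
  assumes "f \<in> carrier LF"
  shows "nrm LF f = 0 \<longleftrightarrow> (AE t in \<mu>. f t = 0)"
  using integral_nonneg_eq_0_iff_AE[OF LF_D(2)[OF assms]] p_gt_1
  by (simp add: Lp_functions_simps)

lemma LF_nrm_cong_AE:
  assumes "f \<in> carrier LF" "g \<in> carrier LF" "AE t in \<mu>. f t = g t"
  shows "nrm LF f = nrm LF g"
proof -
  note [measurable] = LF_D(1)[OF assms(1)] LF_D(1)[OF assms(2)]
  have "(\<integral>t. cmod (f t) powr p \<partial>\<mu>) = (\<integral>t. cmod (g t) powr p \<partial>\<mu>)"
    using assms(3) by (intro integral_cong_AE) auto
  then show ?thesis by (simp add: Lp_functions_simps)
qed

text \<open>With a and b the two norms, f + g is a + b times the convex combination of f/a and g/b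
  with weights a/(a + b) and b/(a + b). Convexity of the p-th power and integration give (a +
  b)^p.\<close>

lemma LF_triangle:
  assumes f: "f \<in> carrier LF" and g: "g \<in> carrier LF"
  shows "nrm LF (\<lambda>t. f t + g t) \<le> nrm LF f + nrm LF g"
proof (cases "nrm LF f = 0 \<or> nrm LF g = 0")
  case True
  then show ?thesis
  proof
    assume *: "nrm LF f = 0"
    then have "AE t in \<mu>. f t + g t = g t" using LF_nrm_eq_0_iff[OF f] by auto
    then show ?thesis using LF_nrm_cong_AE[OF LF_add[OF f g] g] * by simp
  next
    assume *: "nrm LF g = 0"
    then have "AE t in \<mu>. f t + g t = f t" using LF_nrm_eq_0_iff[OF g] by auto
    then show ?thesis using LF_nrm_cong_AE[OF LF_add[OF f g] f] * by simp
  qed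
next
  case False
  define a b where "a = nrm LF f" and "b = nrm LF g"
  have "0 \<le> a" "0 \<le> b" by (simp_all add: a_def b_def Lp_functions_simps)
  then have ab: "a > 0" "b > 0" using False by (auto simp: a_def b_def)
  note fg = LF_D(2)[OF f] LF_D(2)[OF g] LF_D(2)[OF LF_add[OF f g]]
  have "cmod (f t + g t) powr p \<le> (a + b) powr p *
      (a / (a + b) * (cmod (f t) powr p / a powr p) + b / (a + b) * (cmod (g t) powr p / b powr p))" for t
  proof -
    have "cmod (f t + g t) \<le> (a + b) * (a / (a + b) * (cmod (f t) / a) + b / (a + b) * (cmod (g t) / b))"
    proof -
      have "(a + b) * (a / (a + b) * (cmod (f t) / a) + b / (a + b) * (cmod (g t) / b)) = cmod (f t) + cmod (g t)"
        using ab by (simp flip: add_divide_distrib)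
      then show ?thesis using norm_triangle_ineq[of "f t" "g t"] by simp
    qed
    then have "cmod (f t + g t) powr p \<le>
        ((a + b) * (a / (a + b) * (cmod (f t) / a) + b / (a + b) * (cmod (g t) / b))) powr p"
      using p_gt_1 by (intro powr_mono2) auto
    also have "\<dots> = (a + b) powr p * (a / (a + b) * (cmod (f t) / a) + b / (a + b) * (cmod (g t) / b)) powr p"
      using ab by (simp add: powr_mult)
    also have "\<dots> \<le> (a + b) powr p * (a / (a + b) * (cmod (f t) / a) powr p + b / (a + b) * (cmod (g t) / b) powr p)"
      using ab p_gt_1 by (intro mult_left_mono powr_convex_comb) (auto simp flip: add_divide_distrib)
    finally show ?thesis using ab by (simp add: powr_divide)
  qed
  then have "(\<integral>t. cmod (f t + g t) powr p \<partial>\<mu>) \<le> (\<integral>t. (a + b) powr p *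
      (a / (a + b) * (cmod (f t) powr p / a powr p) + b / (a + b) * (cmod (g t) powr p / b powr p)) \<partial>\<mu>)"
    using fg by (intro integral_mono) auto
  also have "\<dots> = (a + b) powr p * (a / (a + b) * ((\<integral>t. cmod (f t) powr p \<partial>\<mu>) / a powr p)
      + b / (a + b) * ((\<integral>t. cmod (g t) powr p \<partial>\<mu>) / b powr p))"
    using fg by simp
  also have "\<dots> = (a + b) powr p * (a / (a + b) + b / (a + b))"
    using ab nrm_LF_powr[OF f, symmetric] nrm_LF_powr[OF g, symmetric] by (simp add: a_def b_def)
  also have "\<dots> = (a + b) powr p" using ab by (simp flip: add_divide_distrib)
  finally show ?thesis
    using nrm_LF_le[OF LF_add[OF f g], of "a + b"] ab by (simp add: a_def b_def)
qed

lemma seminormed_LF: "seminormed_space LF"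
proof (rule seminormed_spaceI)
  show "\<zero>\<^bsub>LF\<^esub> \<in> carrier LF" by (simp add: Lp_functions_simps)
  show "0 \<le> nrm LF f" for f by (simp add: Lp_functions_simps)
  show "nrm LF (c \<odot>\<^bsub>LF\<^esub> f) = cmod c * nrm LF f" "c \<odot>\<^bsub>LF\<^esub> f \<in> carrier LF" if "f \<in> carrier LF" for c f
    using LF_smult[OF that] by (simp_all add: Lp_functions_simps(4))
  show "nrm LF (f \<oplus>\<^bsub>LF\<^esub> g) \<le> nrm LF f + nrm LF g" "f \<oplus>\<^bsub>LF\<^esub> g \<in> carrier LF"
    if "f \<in> carrier LF" "g \<in> carrier LF" for f g
    using LF_triangle[OF that] LF_add[OF that] by (simp_all add: Lp_functions_simps(3))
qed (simp_all add: Lp_functions_simps algebra_simps)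

sublocale LF: seminormed_space "Lp_functions \<mu> p" by (rule seminormed_LF)

sublocale LS: normed_space "Lp \<mu> p" unfolding Lp_def by (rule LF.normed_hausdorff_quotient)

lemmas LS_simps = LF.quotient_simps[folded Lp_def]

lemma LF_diff: "f \<in> carrier LF \<Longrightarrow> g \<in> carrier LF \<Longrightarrow> f \<ominus>\<^bsub>LF\<^esub> g = (\<lambda>t. f t - g t)"
  by (simp add: LF.diff_eq) (simp add: Lp_functions_simps)

lemma cls_eq_iff:
  assumes "f \<in> carrier LF" "g \<in> carrier LF"
  shows "cls f = cls g \<longleftrightarrow> (AE t in \<mu>. f t = g t)"
  using LF_nrm_eq_0_iff[OF LF.diff_closed[OF assms]]
  by (simp add: LF.null_class_eq_iff[OF assms] LF_diff[OF assms])

lemma cls_closed: "f \<in> carrier LF \<Longrightarrow> cls f \<in> carrier LS"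
  by (simp add: LS_simps)

lemma repr_cls:
  assumes "f \<in> carrier LF"
  shows "repr (cls f) \<in> carrier LF" "AE t in \<mu>. repr (cls f) t = f t"
  using LF.repr_null_class[OF assms] cls_eq_iff[of "repr (cls f)" f] assms by auto

lemma cls_repr: "z \<in> carrier LS \<Longrightarrow> cls (repr z) = z"
  using LF.repr_null_class by (auto simp: LS_simps)

text \<open>Kept at the level of functions rather than classes, since its elements only serve to
  define functionals by integration.\<close>

definition Lq :: "('g \<Rightarrow> complex) set" where
  "Lq = {h \<in> borel_measurable \<mu>. integrable \<mu> (\<lambda>t. cmod (h t) powr q)}"

definition nrm_q :: "('g \<Rightarrow> complex) \<Rightarrow> real" where
  "nrm_q h = (\<integral>t. cmod (h t) powr q \<partial>\<mu>) powr (1/q)"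

definition pairing :: "('g \<Rightarrow> complex) \<Rightarrow> ('g \<Rightarrow> complex) set \<Rightarrow> complex" where
  "pairing h z = (\<integral>t. repr z t * h t \<partial>\<mu>)"

lemma pairing_cls:
  assumes h: "h \<in> Lq" and f: "f \<in> carrier LF"
  shows "pairing h (cls f) = (\<integral>t. f t * h t \<partial>\<mu>)"
proof -
  note [measurable] = LF_D(1)[OF f] LF_D(1)[OF repr_cls(1)[OF f]]
  have [measurable]: "h \<in> borel_measurable \<mu>" using h by (simp add: Lq_def)
  show ?thesis
    unfolding pairing_def using repr_cls(2)[OF f] by (intro integral_cong_AE) auto
qed

lemma pairing_bounded:
  assumes h: "h \<in> Lq"
  shows "bounded_map LS complex_space (nrm_q h) (pairing h)"
proof (rule bounded_mapI)
  have hD: "h \<in> borel_measurable \<mu>" "integrable \<mu> (\<lambda>t. cmod (h t) powr q)" using h by (auto simp: Lq_def)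
  note H = holder[OF p_gt_1 q LF_D hD]
  fix x assume "x \<in> carrier LS"
  then obtain f where f: "f \<in> carrier LF" "x = cls f" unfolding LS_simps by blast
  have "cmod (\<integral>t. f t * h t \<partial>\<mu>) \<le> (\<integral>t. cmod (f t * h t) \<partial>\<mu>)" by simp
  also have "\<dots> \<le> nrm LF f * nrm_q h"
    using H(2)[OF f(1) f(1)] by (simp add: Lp_functions_simps nrm_q_def)
  finally show "nrm complex_space (pairing h x) \<le> nrm_q h * nrm LS x"
    using f pairing_cls[OF h f(1)] by (simp add: LS_simps mult.commute)
  show "pairing h (c \<odot>\<^bsub>LS\<^esub> x) = c \<odot>\<^bsub>complex_space\<^esub> pairing h x" for c
    using f pairing_cls[OF h] LF.sm_closed[OF f(1), of c] by (simp add: LS_simps Lp_functions_simps(4) mult.assoc)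
  fix y assume "y \<in> carrier LS"
  then obtain g where g: "g \<in> carrier LF" "y = cls g" unfolding LS_simps by blast
  have "pairing h (x \<oplus>\<^bsub>LS\<^esub> y) = (\<integral>t. (f t + g t) * h t \<partial>\<mu>)"
    using f g pairing_cls[OF h LF_add[OF f(1) g(1)]] by (simp add: LS_simps) (simp add: Lp_functions_simps)
  also have "\<dots> = (\<integral>t. f t * h t \<partial>\<mu>) + (\<integral>t. g t * h t \<partial>\<mu>)"
    using H(1)[OF f(1) f(1)] H(1)[OF g(1) g(1)] by (simp add: distrib_right)
  finally show "pairing h (x \<oplus>\<^bsub>LS\<^esub> y) = pairing h x \<oplus>\<^bsub>complex_space\<^esub> pairing h y"
    using f g pairing_cls[OF h] by simp
qed simp

end

subsection \<open>Subalgebras of the algebra of bounded operators\<close>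

lemma operator_algebra_simps:
  "carrier (operator_algebra X) = carrier (bounded_operators X X)"
  "zero (operator_algebra X) = zero (bounded_operators X X)"
  "add (operator_algebra X) = add (bounded_operators X X)"
  "smult (operator_algebra X) = smult (bounded_operators X X)"
  "nrm (operator_algebra X) = nrm (bounded_operators X X)"
  "mult (operator_algebra X) = compose (carrier X)"
  by (simp_all add: operator_algebra_def)

locale operator_subalgebra = X: normed_space X for X :: "'v nspace" +
  fixes S :: "('v \<Rightarrow> 'v) set" and A :: "('v \<Rightarrow> 'v) nspace"
  assumes closed_subalgebra: "closed_subalgebra S (operator_algebra X)"
    and A_def: "A = (operator_algebra X)\<lparr>carrier := S\<rparr>"
begin

abbreviation (input) "BX \<equiv> bounded_operators X X"

sublocale BX: normed_space "bounded_operators X X"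
  by (rule normed_bounded_operators[OF X.seminormed_space_axioms X.normed_space_axioms])

lemma A_simps:
  "carrier A = S" "zero A = zero BX" "add A = add BX" "smult A = smult BX" "nrm A = nrm BX"
  "mult A = compose (carrier X)"
  by (simp_all add: A_def operator_algebra_simps)

lemma normed_OA: "normed_space (operator_algebra X)"
proof -
  let ?O = "operator_algebra X"
  have "seminormed_space ?O"
    by (rule seminormed_spaceI)
      (simp_all add: operator_algebra_simps BX.sm_l_distr BX.sm_r_distr BX.sm_assoc BX.nrm_nonneg
        BX.nrm_smult BX.nrm_triangle BX.a_assoc, simp add: BX.a_comm)
  then show ?thesis
    unfolding normed_space_def normed_space_axioms_def
    by (simp add: operator_algebra_simps BX.nrm_eq_zero)
qed

lemma S_closed:
  "S \<subseteq> carrier BX" "\<zero>\<^bsub>BX\<^esub> \<in> S" "a \<in> S \<Longrightarrow> b \<in> S \<Longrightarrow> a \<oplus>\<^bsub>BX\<^esub> b \<in> S" "a \<in> S \<Longrightarrow> c \<odot>\<^bsub>BX\<^esub> a \<in> S"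
  "a \<in> S \<Longrightarrow> b \<in> S \<Longrightarrow> compose (carrier X) a b \<in> S"
proof -
  interpret O: normed_space "operator_algebra X" by (rule normed_OA)
  have sub: "submodule S complex_space (operator_algebra X)"
    and m: "\<forall>x\<in>S. \<forall>y\<in>S. x \<otimes>\<^bsub>operator_algebra X\<^esub> y \<in> S"
    using closed_subalgebra by (auto simp: closed_subalgebra_def)
  note E = Module.module.submoduleE[OF O.is_module sub]
  show "S \<subseteq> carrier BX" "a \<in> S \<Longrightarrow> b \<in> S \<Longrightarrow> a \<oplus>\<^bsub>BX\<^esub> b \<in> S" and sm: "a \<in> S \<Longrightarrow> c \<odot>\<^bsub>BX\<^esub> a \<in> S" for a c
    using E by (auto simp: operator_algebra_simps)
  show "a \<in> S \<Longrightarrow> b \<in> S \<Longrightarrow> compose (carrier X) a b \<in> S"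
    using m by (simp add: operator_algebra_simps)
  obtain s where "s \<in> S" using E(2) by blast
  then show "\<zero>\<^bsub>BX\<^esub> \<in> S" using sm[of s 0] E(1) by (auto simp: operator_algebra_simps)
qed

lemma OA_apply_le:
  assumes "a \<in> S" "x \<in> carrier X"
  shows "a x \<in> carrier X" "nrm X (a x) \<le> nrm A a * nrm X x"
  using bounded_mapD(1,4)[OF bounded_map_opnorm[OF X.seminormed_space_axioms X.normed_space_axioms]]
    assms S_closed(1) by (auto simp: A_simps)

lemma S_linear:
  assumes "a \<in> S"
  shows "x \<in> carrier X \<Longrightarrow> y \<in> carrier X \<Longrightarrow> a (x \<oplus>\<^bsub>X\<^esub> y) = a x \<oplus>\<^bsub>X\<^esub> a y"
    and "x \<in> carrier X \<Longrightarrow> a (c \<odot>\<^bsub>X\<^esub> x) = c \<odot>\<^bsub>X\<^esub> a x"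
  using bounded_mapD(2,3)[OF bounded_map_opnorm[OF X.seminormed_space_axioms X.normed_space_axioms]]
    assms S_closed(1) by auto

lemma A_apply:
  assumes "x \<in> carrier X"
  shows "(a \<oplus>\<^bsub>A\<^esub> b) x = a x \<oplus>\<^bsub>X\<^esub> b x" "(c \<odot>\<^bsub>A\<^esub> a) x = c \<odot>\<^bsub>X\<^esub> a x" "(a \<otimes>\<^bsub>A\<^esub> b) x = a (b x)"
  using assms by (simp_all add: A_simps bounded_operators_simps compose_def)

lemma A_eqI:
  assumes "a \<in> S" "b \<in> S" "\<And>x. x \<in> carrier X \<Longrightarrow> a x = b x"
  shows "a = b"
  by (rule bounded_operators_eqI[OF X.seminormed_space_axioms X.normed_space_axioms])
    (use assms S_closed(1) in auto)

sublocale A: normed_algebra A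
proof -
  have "seminormed_space A"
    by (rule seminormed_spaceI)
      (use S_closed subsetD[OF S_closed(1)] in \<open>simp_all add: A_simps BX.sm_l_distr BX.sm_r_distr BX.sm_assoc
         BX.nrm_nonneg BX.nrm_smult BX.nrm_triangle BX.a_assoc\<close>, simp add: BX.a_comm)
  then have n: "normed_space A"
    unfolding normed_space_def normed_space_axioms_def
    using S_closed(1) by (auto simp: A_simps BX.nrm_eq_zero)
  have "bilinear_map A A A 1 (mult A)"
  proof (rule bilinear_mapI)
    fix a b assume "a \<in> carrier A" "b \<in> carrier A"
    then have ab: "a \<in> S" "b \<in> S" by (simp_all add: A_simps)
    note A = OA_apply_le[OF ab(1)] and B = OA_apply_le[OF ab(2)]
    have nn: "0 \<le> nrm A a" "0 \<le> nrm A b"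
      using ab S_closed(1) BX.nrm_nonneg by (auto simp: A_simps)
    show "a \<otimes>\<^bsub>A\<^esub> b \<in> carrier A" using S_closed ab by (simp add: A_simps)
    have "nrm BX (a \<otimes>\<^bsub>A\<^esub> b) \<le> nrm A a * nrm A b"
    proof (rule opnorm_bound[OF X.seminormed_space_axioms X.normed_space_axioms])
      fix x assume x: "x \<in> carrier X"
      have "nrm X (a (b x)) \<le> nrm A a * nrm X (b x)" using A(2) B(1) x by blast
      also have "\<dots> \<le> nrm A a * (nrm A b * nrm X x)" using B(2)[OF x] nn by (intro mult_left_mono)
      finally show "nrm X ((a \<otimes>\<^bsub>A\<^esub> b) x) \<le> nrm A a * nrm A b * nrm X x"
        using x by (simp add: A_apply mult.assoc)
    qed (use nn in simp)
    then show "nrm A (a \<otimes>\<^bsub>A\<^esub> b) \<le> 1 * nrm A a * nrm A b" by (simp add: A_simps)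
    show "(c \<odot>\<^bsub>A\<^esub> a) \<otimes>\<^bsub>A\<^esub> b = c \<odot>\<^bsub>A\<^esub> (a \<otimes>\<^bsub>A\<^esub> b)" for c
      using B by (auto simp: A_simps bounded_operators_simps compose_def)
    show "a \<otimes>\<^bsub>A\<^esub> (c \<odot>\<^bsub>A\<^esub> b) = c \<odot>\<^bsub>A\<^esub> (a \<otimes>\<^bsub>A\<^esub> b)" for c
      using B S_linear[OF ab(1)] by (auto simp: A_simps bounded_operators_simps compose_def)
    fix d assume "d \<in> carrier A"
    then have d: "d \<in> S" by (simp add: A_simps)
    show "(a \<oplus>\<^bsub>A\<^esub> d) \<otimes>\<^bsub>A\<^esub> b = a \<otimes>\<^bsub>A\<^esub> b \<oplus>\<^bsub>A\<^esub> d \<otimes>\<^bsub>A\<^esub> b"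
      using B by (auto simp: A_simps bounded_operators_simps compose_def)
    show "a \<otimes>\<^bsub>A\<^esub> (b \<oplus>\<^bsub>A\<^esub> d) = a \<otimes>\<^bsub>A\<^esub> b \<oplus>\<^bsub>A\<^esub> a \<otimes>\<^bsub>A\<^esub> d"
      using B OA_apply_le[OF d] S_linear[OF ab(1)] by (auto simp: A_simps bounded_operators_simps compose_def)
  qed
  then show "normed_algebra A"
    using n by (simp add: normed_algebra_def normed_algebra_axioms_def)
qed

text \<open>The source of functionals on \<open>A\<close>: averages, coefficients and vector states
  are all built from it.\<close>

lemma coefficient_functional:
  assumes f: "bounded_map X complex_space K f" "0 \<le> K" and x: "x \<in> carrier X"
  shows "bounded_map A complex_space (K * nrm X x) (\<lambda>a. f (a x))"
proof (rule bounded_mapI)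
  note fD = bounded_mapD[OF f(1)]
  fix a assume "a \<in> carrier A"
  then have a: "a \<in> S" by (simp add: A_simps)
  note ax = OA_apply_le[OF a x]
  have "cmod (f (a x)) \<le> K * nrm X (a x)" using fD(4)[OF ax(1)] by simp
  also have "\<dots> \<le> K * (nrm A a * nrm X x)" using ax(2) f(2) by (rule mult_left_mono)
  finally show "nrm complex_space (f (a x)) \<le> K * nrm X x * nrm A a" by (simp add: mult_ac)
  show "f ((c \<odot>\<^bsub>A\<^esub> a) x) = c \<odot>\<^bsub>complex_space\<^esub> f (a x)" for c
    using fD(3)[OF ax(1)] x by (simp add: A_apply)
  fix b assume "b \<in> carrier A"
  then have b: "b \<in> S" by (simp add: A_simps)
  show "f ((a \<oplus>\<^bsub>A\<^esub> b) x) = f (a x) \<oplus>\<^bsub>complex_space\<^esub> f (b x)"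
    using fD(2)[OF ax(1) OA_apply_le(1)[OF b x]] x by (simp add: A_apply)
qed simp

end

section \<open>Haar measure\<close>

lemma continuous_group_shifts [continuous_intros]:
  fixes A :: "'g::topological_group_add set"
  shows "continuous_on A (\<lambda>s. t + s)" "continuous_on A (\<lambda>s. s + t)" "continuous_on A (\<lambda>s. - s + t)"
    "continuous_on A uminus"
  unfolding continuous_on_def by (auto intro!: tendsto_intros)

lemma open_shift_vimage:
  fixes U :: "'g::topological_group_add set"
  assumes "open U"
  shows "open {s. t + s \<in> U}" "open {s. s + t \<in> U}" "open {s. - s + t \<in> U}" "open {s. - t + s \<in> U}" "open {s. - s \<in> U}"
proof -
  have *: "open (f -` U)" if "continuous_on UNIV f" for f :: "'g \<Rightarrow> 'g"
    using open_vimage[OF assms that] .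
  show "open {s. t + s \<in> U}" "open {s. s + t \<in> U}" "open {s. - s + t \<in> U}" "open {s. - t + s \<in> U}" "open {s. - s \<in> U}"
    using *[OF continuous_group_shifts(1)[of UNIV t]] *[OF continuous_group_shifts(2)[of UNIV t]]
      *[OF continuous_group_shifts(3)[of UNIV t]] *[OF continuous_group_shifts(1)[of UNIV "- t"]]
      *[OF continuous_group_shifts(4)] by (simp_all add: vimage_def)
qed

section \<open>Neighbourhoods of the identity that work uniformly along a compact set\<close>

lemma compact_nbhd_left:
  fixes C :: "'g::topological_group_add set"
  assumes "compact C" "open U" "C \<subseteq> U"
  obtains V where "open V" "0 \<in> V" "\<And>v c. v \<in> V \<Longrightarrow> c \<in> C \<Longrightarrow> v + c \<in> U"
proof -
  have o: "open ((\<lambda>(v, c). v + c) -` U :: ('g \<times> 'g) set)"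
    by (rule open_vimage[OF assms(2)]) (auto simp: split_beta intro!: continuous_intros)
  have "{0} \<times> C \<subseteq> (\<lambda>(v, c). v + c) -` U" using assms(3) by auto
  from Elementary_Topology.tube_lemma[OF assms(1) o this]
  obtain V where V: "0 \<in> V" "open V" "V \<times> C \<subseteq> (\<lambda>(v, c). v + c) -` U" by blast
  show ?thesis by (rule that[OF V(2,1)]) (use V(3) in auto)
qed

lemma compact_nbhd_right:
  fixes C :: "'g::topological_group_add set"
  assumes "compact C" "open U" "C \<subseteq> U"
  obtains V where "open V" "0 \<in> V" "\<And>v c. v \<in> V \<Longrightarrow> c \<in> C \<Longrightarrow> c + v \<in> U"
proof -
  have o: "open ((\<lambda>(v, c). c + v) -` U :: ('g \<times> 'g) set)"
    by (rule open_vimage[OF assms(2)]) (auto simp: split_beta intro!: continuous_intros)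
  have "{0} \<times> C \<subseteq> (\<lambda>(v, c). c + v) -` U" using assms(3) by auto
  from Elementary_Topology.tube_lemma[OF assms(1) o this]
  obtain V where V: "0 \<in> V" "open V" "V \<times> C \<subseteq> (\<lambda>(v, c). c + v) -` U" by blast
  show ?thesis by (rule that[OF V(2,1)]) (use V(3) in auto)
qed

lemma symmetric_nbhd:
  fixes U :: "'g::topological_group_add set"
  assumes "open U" "0 \<in> U"
  obtains V where "open V" "0 \<in> V" "V \<subseteq> U" "\<And>v. v \<in> V \<Longrightarrow> - v \<in> V"
  using that[of "U \<inter> {s. - s \<in> U}"] assms open_shift_vimage(5)[OF assms(1)] by auto

text \<open>Two summands from V, because the Fubini estimate moves a point twice: from t to one of
  finitely many sample points and back. The two directions also call for a symmetric V.\<close>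

lemma compact_nbhd_right2:
  fixes C :: "'g::topological_group_add set"
  assumes "compact C" "open U" "C \<subseteq> U"
  obtains V where "open V" "0 \<in> V" "\<And>v. v \<in> V \<Longrightarrow> - v \<in> V"
    "\<And>v w c. v \<in> V \<Longrightarrow> w \<in> V \<Longrightarrow> c \<in> C \<Longrightarrow> c + v + w \<in> U"
proof -
  obtain W where W: "open W" "0 \<in> W" "\<And>v c. v \<in> W \<Longrightarrow> c \<in> C \<Longrightarrow> c + v \<in> U"
    using compact_nbhd_right[OF assms] by blast
  obtain W' where W': "open W'" "0 \<in> W'" "\<And>v c. v \<in> W' \<Longrightarrow> c \<in> {0} \<Longrightarrow> v + c \<in> W"
    using compact_nbhd_left[of "{0}" W] W(1,2) by auto
  have "open ((\<lambda>(v, w). v + w) -` W :: ('g \<times> 'g) set)"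
    by (rule open_vimage[OF W(1)]) (auto simp: split_beta intro!: continuous_intros)
  moreover have "(0, 0) \<in> (\<lambda>(v, w). v + w) -` W" using W by simp
  ultimately obtain A B where AB: "open A" "open B" "0 \<in> A" "0 \<in> B" "A \<times> B \<subseteq> (\<lambda>(v, w). v + w) -` W"
    by (auto elim!: open_prod_elim simp: mem_Times_iff)
  obtain V where V: "open V" "0 \<in> V" "V \<subseteq> A \<inter> B" "\<And>v. v \<in> V \<Longrightarrow> - v \<in> V"
    using symmetric_nbhd[of "A \<inter> B"] AB by auto
  show ?thesis
  proof (rule that[OF V(1,2,4)])
    fix v w c assume "v \<in> V" "w \<in> V" "c \<in> C"
    then have "(v, w) \<in> A \<times> B" using V(3) by blast
    then have "v + w \<in> W" using AB(5) by auto
    then show "c + v + w \<in> U" using W(3) \<open>c \<in> C\<close> by (simp add: add.assoc)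
  qed
qed

section \<open>Positivity and regularity of Haar measure\<close>

locale haar =
  fixes \<mu> :: "'g::{topological_group_add, t2_space} measure"
  assumes locally_compact: "locally_compact_space (euclidean :: 'g topology)"
    and left_haar: "left_haar_measure \<mu>"
begin

lemma sets_\<mu> [simp, measurable_cong]: "sets \<mu> = sets borel"
  using left_haar by (simp add: left_haar_measure_def)

lemma space_\<mu> [simp]: "space \<mu> = UNIV"
  using sets_eq_imp_space_eq[OF sets_\<mu>] by simp

lemma nontrivial: "emeasure \<mu> UNIV \<noteq> 0"
  and finite_compact: "compact K \<Longrightarrow> emeasure \<mu> K < \<infinity>"
  and outer_regular: "B \<in> sets borel \<Longrightarrow> emeasure \<mu> B = (INF U\<in>{U. open U \<and> B \<subseteq> U}. emeasure \<mu> U)"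
  and inner_regular: "open U \<Longrightarrow> emeasure \<mu> U = (SUP K\<in>{K. compact K \<and> K \<subseteq> U}. emeasure \<mu> K)"
  and left_invariant: "B \<in> sets borel \<Longrightarrow> emeasure \<mu> ((+) s ` B) = emeasure \<mu> B"
  using left_haar unfolding left_haar_measure_def by auto

lemma compact_borel [measurable]: "compact K \<Longrightarrow> K \<in> sets (borel :: 'g measure)"
  by (intro borel_closed compact_imp_closed)

lemma borel_shift [measurable]:
  "(\<lambda>s. t + s) \<in> borel_measurable (borel :: 'g measure)" "(\<lambda>s. s + t) \<in> borel_measurable (borel :: 'g measure)"
  "(\<lambda>s. - s + t) \<in> borel_measurable (borel :: 'g measure)" "uminus \<in> borel_measurable (borel :: 'g measure)"
  by (auto intro!: borel_measurable_continuous_onI continuous_intros)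

lemma vimage_borel:
  assumes "B \<in> sets (borel :: 'g measure)"
  shows "{s. t + s \<in> B} \<in> sets borel" "{s. s + t \<in> B} \<in> sets borel" "{s. - s + t \<in> B} \<in> sets borel" "{s. - s \<in> B} \<in> sets borel"
  using measurable_sets[OF borel_shift(1) assms, of t] measurable_sets[OF borel_shift(2) assms, of t]
    measurable_sets[OF borel_shift(3) assms, of t] measurable_sets[OF borel_shift(4) assms]
  by (auto simp: vimage_def)

lemma emeasure_shift:
  assumes "B \<in> sets borel"
  shows "emeasure \<mu> {s. t + s \<in> B} = emeasure \<mu> B"
proof -
  have "(+) t ` {s. t + s \<in> B} = B"
  proof safe
    fix b assume "b \<in> B"
    then show "b \<in> (+) t ` {s. t + s \<in> B}" by (intro image_eqI[of _ _ "- t + b"]) (auto simp: add.assoc[symmetric])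
  qed
  then show ?thesis using left_invariant[OF vimage_borel(1)[OF assms], of t t] by simp
qed

lemma compact_nbhd_exists:
  obtains U K :: "'g set" where "open U" "compact K" "0 \<in> U" "U \<subseteq> K"
proof -
  have "\<exists>U K. open U \<and> compact K \<and> (0::'g) \<in> U \<and> U \<subseteq> K"
    using locally_compact unfolding locally_compact_space_def by simp
  then show ?thesis using that by blast
qed

text \<open>Finitely many translates of U cover a compact set, so a null U makes every compact set
  null, and inner regularity on the whole group contradicts nontriviality.\<close>

lemma emeasure_open_pos:
  assumes U: "open U" "U \<noteq> {}"
  shows "emeasure \<mu> U > 0"
proof (rule ccontr)
  assume "\<not> emeasure \<mu> U > 0"
  then have U0: "emeasure \<mu> U = 0" by simp
  obtain u where u: "u \<in> U" using U by blast
  have K0: "emeasure \<mu> K = 0" if K: "compact K" for K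
  proof -
    let ?V = "\<lambda>t. {s. (u + - t) + s \<in> U}"
    have "K \<subseteq> (\<Union>t\<in>K. ?V t)" using u by (auto simp: add.assoc)
    then obtain T where T: "T \<subseteq> K" "finite T" "K \<subseteq> (\<Union>t\<in>T. ?V t)"
      using compactE_image[OF K, of K ?V] open_shift_vimage(1)[OF U(1)] by metis
    have "emeasure \<mu> K \<le> emeasure \<mu> (\<Union>t\<in>T. ?V t)"
      using T U(1) open_shift_vimage(1)[OF U(1)] by (intro emeasure_mono) auto
    also have "\<dots> \<le> (\<Sum>t\<in>T. emeasure \<mu> (?V t))"
      using T(2) open_shift_vimage(1)[OF U(1)] by (intro emeasure_subadditive_finite) auto
    also have "\<dots> = 0" using emeasure_shift[of U] U U0 by simp
    finally show ?thesis by simp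
  qed
  have "emeasure \<mu> UNIV = 0"
    using K0 by (subst inner_regular) (auto simp: SUP_eq_iff intro!: SUP_eqI)
  then show False using nontrivial by simp
qed

lemma outer_open:
  assumes "B \<in> sets borel" "emeasure \<mu> B < c"
  obtains U where "open U" "B \<subseteq> U" "emeasure \<mu> U < c"
  using assms(2) unfolding outer_regular[OF assms(1)] INF_less_iff by blast

lemma inner_compact:
  assumes "open U" "c < emeasure \<mu> U"
  obtains K where "compact K" "K \<subseteq> U" "c < emeasure \<mu> K"
  using assms(2) unfolding inner_regular[OF assms(1)] less_SUP_iff by blast

lemma inner_compact_finite:
  assumes U: "open U" "emeasure \<mu> U < \<infinity>" and e: "0 < (e::real)"
  obtains K where "compact K" "K \<subseteq> U" "emeasure \<mu> (U - K) < ennreal e"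
proof (cases "emeasure \<mu> U = 0")
  case True
  then show ?thesis using that[of "{}"] e by simp
next
  case False
  then have "emeasure \<mu> U - ennreal e < emeasure \<mu> U"
    using U(2) e by (intro ennreal_between) (auto simp: zero_less_iff_neq_zero)
  then obtain K where K: "compact K" "K \<subseteq> U" "emeasure \<mu> U - ennreal e < emeasure \<mu> K"
    using inner_compact[OF U(1)] by metis
  obtain r where r: "emeasure \<mu> U = ennreal r" "0 \<le> r" using U(2) by (cases "emeasure \<mu> U") auto
  obtain k where k: "emeasure \<mu> K = ennreal k" "0 \<le> k"
    using finite_compact[OF K(1)] by (cases "emeasure \<mu> K") auto
  have kr: "k \<le> r" using emeasure_mono[OF K(2), of \<mu>] U(1) by (simp add: r k ennreal_le_iff)
  have "r - e < k"
  proof (rule ccontr)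
    assume "\<not> r - e < k"
    then have "ennreal k \<le> ennreal (r - e)" by (intro ennreal_leI) simp
    then show False using K(3) e by (simp add: r k ennreal_minus)
  qed
  have "emeasure \<mu> (U - K) = emeasure \<mu> U - emeasure \<mu> K"
    using K U finite_compact[OF K(1)] by (intro emeasure_Diff) (auto simp: compact_borel)
  also have "\<dots> = ennreal (r - k)" using k by (simp add: r(1) k(1) ennreal_minus)
  also have "\<dots> < ennreal e" using kr \<open>r - e < k\<close> by (simp add: ennreal_less_iff)
  finally show ?thesis using that K by blast
qed

end

text \<open>The kernel $K_t$ represents convolution with the normalized indicator of a compact
  neighbourhood $C$: $(f_C * \xi)(t) = \int \xi \, dK_t$.  Since no countability is assumed of the
  group, its measurability does not come from a product space but from the continuity of
  $t \mapsto \mu(C \cap tE^{-1})$, which holds for every Borel set $E$.\<close>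

locale haar_kernel = haar \<mu> for \<mu> :: "'g::{topological_group_add, t2_space} measure" +
  fixes C :: "'g set"
  assumes compact_C: "compact C" and pos_C: "emeasure \<mu> C > 0"
begin

lemma C_borel [measurable]: "C \<in> sets borel" using compact_C by simp

lemma C_finite: "emeasure \<mu> C \<noteq> 0" "emeasure \<mu> C \<noteq> \<infinity>"
  using pos_C finite_compact[OF compact_C] by auto

abbreviation "m \<equiv> measure \<mu> C"

lemma m_pos: "m > 0"
  using C_finite by (simp add: measure_def enn2real_positive_iff less_top zero_less_iff_neq_zero)

lemma C_fmeasurable: "C \<in> fmeasurable \<mu>"
  using C_finite by (auto simp: fmeasurable_def less_top)

text \<open>Left invariance moves the dependence on t from D to C. Outer regularity gives an open U
  around C with at most e more mass, and V is chosen so that V + C stays in U. The bound is uniform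
  in D because D enters only as an intersection.\<close>

lemma overlap_diff:
  assumes e: "0 < (e::real)"
  obtains V where "open V" "0 \<in> V"
    "\<And>D t t'. D \<in> sets borel \<Longrightarrow> t' + - t \<in> V \<Longrightarrow> t + - t' \<in> V \<Longrightarrow>
      \<bar>measure \<mu> (C \<inter> {s. - t + s \<in> D}) - measure \<mu> (C \<inter> {s. - t' + s \<in> D})\<bar> \<le> e"
proof -
  have "emeasure \<mu> C < emeasure \<mu> C + ennreal e"
    using C_finite(2) e by (cases "emeasure \<mu> C") (auto simp: ennreal_less_iff simp flip: ennreal_plus)
  then obtain U where U: "open U" "C \<subseteq> U" "emeasure \<mu> U < emeasure \<mu> C + ennreal e"
    using outer_open[OF C_borel] by metis
  have Ufin: "U \<in> fmeasurable \<mu>" using U C_finite by (auto simp: fmeasurable_def ennreal_add_less_top top.not_eq_extremum less_top intro: less_trans)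
  have UC: "measure \<mu> U \<le> m + e"
    using U(3) C_finite Ufin e by (simp add: emeasure_eq_measure2 fmeasurableD2 C_fmeasurable ennreal_less_iff flip: ennreal_plus)
  obtain V where V: "open V" "0 \<in> V" "\<And>v c. v \<in> V \<Longrightarrow> c \<in> C \<Longrightarrow> v + c \<in> U"
    by (rule compact_nbhd_left[OF compact_C U(1,2)]) blast
  have half: "measure \<mu> (C \<inter> {s. - t + s \<in> D}) - measure \<mu> (C \<inter> {s. - t' + s \<in> D}) \<le> e"
    if D: "D \<in> sets borel" and v: "t + - t' \<in> V" for D t t'
  proof -
    have shift: "measure \<mu> (C \<inter> {s. - t + s \<in> D}) = measure \<mu> ({s. t + s \<in> C} \<inter> D)" for t
    proof -
      have "C \<inter> {s. - t + s \<in> D} \<in> sets borel" using vimage_borel(1)[OF D] by auto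
      then have "emeasure \<mu> {s. t + s \<in> C \<inter> {s. - t + s \<in> D}} = emeasure \<mu> (C \<inter> {s. - t + s \<in> D})"
        by (rule emeasure_shift)
      also have "{s. t + s \<in> C \<inter> {s. - t + s \<in> D}} = {s. t + s \<in> C} \<inter> D"
        by (auto simp: add.assoc[symmetric])
      finally show ?thesis by (simp add: measure_def)
    qed
    let ?A = "{s. t + s \<in> C}" and ?B = "{s. t' + s \<in> C}" and ?U = "{s. t + s \<in> U}"
    have fin: "{s. t + s \<in> E} \<in> fmeasurable \<mu>" "measure \<mu> {s. t + s \<in> E} = measure \<mu> E"
      if "E \<in> fmeasurable \<mu>" for t E
      using that emeasure_shift[of E t] vimage_borel(1)[of E t] by (auto simp: fmeasurable_def measure_def)
    have BU: "?B \<subseteq> ?U"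
    proof safe
      fix s assume "t' + s \<in> C"
      from V(3)[OF v this] show "t + s \<in> U" by (simp add: add.assoc[symmetric])
    qed
    have AU: "?A \<subseteq> ?U" using U(2) by auto
    note fA = fin[OF C_fmeasurable, of t] and fB = fin[OF C_fmeasurable, of t'] and fU = fin[OF Ufin, of t]
    have sD: "X \<inter> D \<in> fmeasurable \<mu>" if "X \<in> fmeasurable \<mu>" for X
      by (rule fmeasurable_Int_fmeasurable[OF that]) (use D in simp)
    have "measure \<mu> (?A \<inter> D) \<le> measure \<mu> ((?B \<inter> D) \<union> (?U - ?B))"
      using AU fB fU D sD[OF fB(1)] by (intro measure_mono_fmeasurable) (auto intro!: fmeasurable.Un fmeasurable.Diff)
    also have "\<dots> \<le> measure \<mu> (?B \<inter> D) + measure \<mu> (?U - ?B)"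
      using sD[OF fB(1)] fB fU by (intro measure_Un_le) auto
    also have "measure \<mu> (?U - ?B) = measure \<mu> U - m"
      using BU fB fU by (subst measurable_measure_Diff) auto
    finally show ?thesis using UC shift[of t] shift[of t'] by simp
  qed
  show ?thesis
    using that[OF V(1,2)] half by (smt (verit))
qed

definition K :: "'g \<Rightarrow> 'g measure" where
  "K t = distr (uniform_measure \<mu> C) borel (\<lambda>s. - s + t)"

lemma prob_uniform: "prob_space (uniform_measure \<mu> C)"
  by (rule prob_space_uniform_measure) (use C_finite in auto)

lemma prob_K: "prob_space (K t)"
  unfolding K_def by (rule prob_space.prob_space_distr[OF prob_uniform]) simp

lemma sets_K [simp, measurable_cong]: "sets (K t) = sets borel" by (simp add: K_def)

lemma space_K [simp]: "space (K t) = UNIV" by (simp add: K_def)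

lemma measure_K:
  assumes "E \<in> sets borel"
  shows "measure (K t) E = measure \<mu> (C \<inter> {s. - s + t \<in> E}) / m"
proof -
  have "measure (K t) E = measure (uniform_measure \<mu> C) ((\<lambda>s. - s + t) -` E \<inter> space (uniform_measure \<mu> C))"
    unfolding K_def using assms by (intro measure_distr) auto
  also have "(\<lambda>s. - s + t) -` E \<inter> space (uniform_measure \<mu> C) = {s. - s + t \<in> E}" by auto
  finally show ?thesis
    using measure_uniform_measure[OF C_finite, of "{s. - s + t \<in> E}"] vimage_borel(3)[OF assms] by simp
qed

lemma emeasure_K: "emeasure (K t) E = ennreal (measure (K t) E)"
  by (rule finite_measure.emeasure_eq_measure) (rule prob_space.finite_measure[OF prob_K])

text \<open>Moves the inversion from s to the set, so that \<open>overlap_diff\<close>, which is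
  about left translates, controls \<open>K t\<close>.\<close>

lemma vimage_inv_eq: fixes t :: 'g shows "{s. - s + t \<in> E} = {s. - t + s \<in> {s. - s \<in> E}}"
  by (simp add: group_add_class.minus_add)

lemma continuous_K:
  assumes E: "E \<in> sets borel"
  shows "continuous_on UNIV (\<lambda>t. measure (K t) E)"
proof (rule continuous_at_imp_continuous_on, rule ballI)
  fix t :: 'g
  show "isCont (\<lambda>t. measure (K t) E) t"
    unfolding isCont_def tendsto_iff
  proof (intro allI impI)
    fix e :: real assume e: "e > 0"
    then have e2: "e * m / 2 > 0" using m_pos by simp
    obtain V where V: "open V" "0 \<in> V"
      "\<And>D t t'. D \<in> sets borel \<Longrightarrow> t' + - t \<in> V \<Longrightarrow> t + - t' \<in> V \<Longrightarrow>
        \<bar>measure \<mu> (C \<inter> {s. - t + s \<in> D}) - measure \<mu> (C \<inter> {s. - t' + s \<in> D})\<bar> \<le> e * m / 2"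
      using overlap_diff[OF e2] by blast
    have "isCont (\<lambda>t'. t' + - t) t" "isCont (\<lambda>t'. t + - t') t"
      by (auto intro!: continuous_intros)
    then have "\<forall>\<^sub>F t' in at t. t' + - t \<in> V" "\<forall>\<^sub>F t' in at t. t + - t' \<in> V"
      using V(1,2) by (auto simp: isCont_def intro!: topological_tendstoD)
    then show "\<forall>\<^sub>F t' in at t. dist (measure (K t') E) (measure (K t) E) < e"
    proof eventually_elim
      case (elim t')
      have "\<bar>measure \<mu> (C \<inter> {s. - s + t \<in> E}) - measure \<mu> (C \<inter> {s. - s + t' \<in> E})\<bar> \<le> e * m / 2"
        using V(3)[of "{s. - s \<in> E}" t' t] elim vimage_borel(4)[OF E] unfolding vimage_inv_eq by blast
      then have "\<bar>measure (K t') E - measure (K t) E\<bar> \<le> e / 2"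
        using m_pos by (simp add: measure_K[OF E] abs_minus_commute pos_divide_le_eq field_simps flip: diff_divide_distrib)
      then show ?case using e by (simp add: dist_real_def)
    qed
  qed
qed

lemma measurable_K [measurable]: "K \<in> measurable \<mu> (subprob_algebra borel)"
proof (rule measurable_subprob_algebra)
  show "subprob_space (K t)" for t using prob_K by (rule prob_space_imp_subprob_space)
  fix E :: "'g set" assume "E \<in> sets borel"
  then have "(\<lambda>t. measure (K t) E) \<in> borel_measurable borel"
    by (intro borel_measurable_continuous_onI continuous_K)
  then show "(\<lambda>t. emeasure (K t) E) \<in> borel_measurable \<mu>"
    unfolding emeasure_K by simp
qed simp

lemma emeasure_K_measurable [measurable]: "E \<in> sets borel \<Longrightarrow> (\<lambda>t. emeasure (K t) E) \<in> borel_measurable borel"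
  unfolding emeasure_K by (intro measurable_compose[OF _ measurable_ennreal] borel_measurable_continuous_onI continuous_K)

text \<open>Fubini for the indicator of the compact set $D$, up to the error allowed by
  $D + V + V \subseteq E$: replace $t$ by one of finitely many $t_i$.\<close>

lemma K_integral_compact:
  assumes L: "compact L" and D: "compact D" and E: "open E" "D \<subseteq> E"
  shows "(\<integral>\<^sup>+t. emeasure (K t) D * indicator L t \<partial>\<mu>) \<le> emeasure \<mu> E"
proof -
  obtain V where V: "open V" "0 \<in> V" "\<And>v. v \<in> V \<Longrightarrow> - v \<in> V"
    "\<And>v w c. v \<in> V \<Longrightarrow> w \<in> V \<Longrightarrow> c \<in> D \<Longrightarrow> c + v + w \<in> E"
    using compact_nbhd_right2[OF D E] by blast
  \<comment> \<open>This is D + V: it absorbs the replacement of t by a sample point, and the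
    inclusion of W + V in E absorbs the way back.\<close>
  define W where "W = (\<Union>c\<in>D. {s. - c + s \<in> V})"
  have W: "open W" unfolding W_def using open_shift_vimage(4)[OF V(1)] by auto
  have WI: "c + v \<in> W" if "c \<in> D" "v \<in> V" for c v
    unfolding W_def using that by (auto simp: add.assoc[symmetric] intro!: bexI[of _ c])
  have WE: "w + v \<in> E" if w: "w \<in> W" and v: "v \<in> V" for w v
  proof -
    obtain c where c: "c \<in> D" "- c + w \<in> V" using w by (auto simp: W_def)
    from V(4)[OF c(2) v c(1)] show ?thesis by (simp add: add.assoc[symmetric])
  qed
  obtain T where T: "finite T" "L \<subseteq> (\<Union>x\<in>T. {t. - x + t \<in> V})"
  proof (rule compactE_image[OF L, of L "\<lambda>x. {t. - x + t \<in> V}"])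
    show "L \<subseteq> (\<Union>x\<in>L. {t. - x + t \<in> V})" using V(2) by auto
  qed (use open_shift_vimage(4)[OF V(1)] in auto)
  obtain x :: "nat \<Rightarrow> 'g" and n where x: "T = x ` {..<n}"
    using finite_imp_nat_seg_image_inj_on[OF T(1)] by (metis lessThan_def)
  define A where "A i = L \<inter> {t. - x i + t \<in> V}" for i
  \<comment> \<open>Disjoint Borel pieces of L; every t in B i is close to the sample point x
    i.\<close>
  define B where "B = disjointed A"
  have Ab: "range A \<subseteq> sets borel"
    using L open_shift_vimage(4)[OF V(1)] by (auto simp: A_def)
  have Bb [measurable]: "B i \<in> sets borel" for i
    using sets.range_disjointed_sets[OF Ab] by (auto simp: B_def)
  have BA: "B i \<subseteq> A i" for i unfolding B_def by (rule disjointed_subset)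
  have dis: "disjoint_family B" unfolding B_def by (rule disjoint_family_disjointed)
  have LB: "L = (\<Union>i<n. B i)"
  proof -
    have "(\<Union>i<n. B i) = (\<Union>i<n. A i)"
      using finite_UN_disjointed_eq[of A n] by (simp add: B_def atLeast0LessThan)
    also have "\<dots> = L" using T(2) by (auto simp: A_def x)
    finally show ?thesis by simp
  qed
  have KW: "emeasure (K t) D \<le> emeasure (K (x i)) W" if "t \<in> B i" for t i
  proof -
    have v: "- x i + t \<in> V" using that BA by (auto simp: A_def)
    then have v': "- t + x i \<in> V" using V(3)[OF v] by (simp add: group_add_class.minus_add)
    have "C \<inter> {s. - s + t \<in> D} \<subseteq> C \<inter> {s. - s + x i \<in> W}"
    proof safe
      fix s assume "- s + t \<in> D"
      from WI[OF this v'] show "- s + x i \<in> W" by (simp add: add.assoc[symmetric])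
    qed
    then have "measure \<mu> (C \<inter> {s. - s + t \<in> D}) \<le> measure \<mu> (C \<inter> {s. - s + x i \<in> W})"
      using vimage_borel(3)[of D t] vimage_borel(3)[of W "x i"] D W C_fmeasurable
      by (intro measure_mono_fmeasurable) (auto intro!: fmeasurable_Int_fmeasurable)
    then show ?thesis
      using m_pos D W by (simp add: emeasure_K measure_K divide_right_mono)
  qed
  let ?P = "uniform_measure \<mu> C"
  have ind: "emeasure (K t) D * indicator L t \<le> (\<Sum>i<n. emeasure (K (x i)) W * indicator (B i) t)" for t
  proof (cases "t \<in> L")
    case True
    then obtain i where i: "i < n" "t \<in> B i" using LB by auto
    have "emeasure (K t) D \<le> emeasure (K (x i)) W * indicator (B i) t" using KW i by simp
    also have "\<dots> \<le> (\<Sum>i<n. emeasure (K (x i)) W * indicator (B i) t)"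
      using i by (intro member_le_sum) auto
    finally show ?thesis using True by simp
  qed simp
  have "(\<integral>\<^sup>+t. emeasure (K t) D * indicator L t \<partial>\<mu>) \<le> (\<integral>\<^sup>+t. (\<Sum>i<n. emeasure (K (x i)) W * indicator (B i) t) \<partial>\<mu>)"
    by (intro nn_integral_mono ind)
  also have "\<dots> = (\<Sum>i<n. emeasure (K (x i)) W * emeasure \<mu> (B i))"
    by (subst nn_integral_sum) (auto simp: nn_integral_cmult_indicator)
  also have "\<dots> = (\<Sum>i<n. \<integral>\<^sup>+s. emeasure \<mu> (B i) * indicator {s. - s + x i \<in> W} s \<partial>?P)"
  proof (rule sum.cong[OF refl])
    fix i
    have "emeasure (K (x i)) W = emeasure ?P {s. - s + x i \<in> W}"
      unfolding K_def using W by (subst emeasure_distr) (auto simp: vimage_def)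
    then show "emeasure (K (x i)) W * emeasure \<mu> (B i) = (\<integral>\<^sup>+s. emeasure \<mu> (B i) * indicator {s. - s + x i \<in> W} s \<partial>?P)"
      using vimage_borel(3)[of W "x i"] W by (subst nn_integral_cmult_indicator) (auto simp: mult.commute)
  qed
  \<comment> \<open>After the discretization, exchanging the order of integration is exchanging a
    finite sum with an integral.\<close>
  also have "\<dots> = (\<integral>\<^sup>+s. (\<Sum>i<n. emeasure \<mu> (B i) * indicator {s. - s + x i \<in> W} s) \<partial>?P)"
    using vimage_borel(3)[of W] W by (subst nn_integral_sum) auto
  also have "\<dots> \<le> (\<integral>\<^sup>+s. emeasure \<mu> E \<partial>?P)"
  proof (rule nn_integral_mono)
    fix s
    let ?J = "{i. i < n \<and> - s + x i \<in> W}"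
    have "(\<Sum>i<n. emeasure \<mu> (B i) * indicator {s. - s + x i \<in> W} s) = (\<Sum>i\<in>?J. emeasure \<mu> (B i))"
      by (rule sum.mono_neutral_cong_right) auto
    also have "\<dots> = emeasure \<mu> (\<Union>i\<in>?J. B i)"
      by (rule sum_emeasure) (use dis in \<open>auto simp: disjoint_family_on_def\<close>)
    \<comment> \<open>For fixed s the selected pieces lie in the translate s + E, which has the mass
      of E by left invariance.\<close>
    also have "\<dots> \<le> emeasure \<mu> {t. - s + t \<in> E}"
    proof (rule emeasure_mono)
      show "(\<Union>i\<in>?J. B i) \<subseteq> {t. - s + t \<in> E}"
      proof safe
        fix i t assume i: "- s + x i \<in> W" and t: "t \<in> B i"
        then have "- x i + t \<in> V" using BA by (auto simp: A_def)
        from WE[OF i this] show "- s + t \<in> E" by (simp add: add.assoc[symmetric])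
      qed
    qed (use vimage_borel(1)[of E "- s"] E in auto)
    also have "\<dots> = emeasure \<mu> E" using emeasure_shift[of E "- s"] E by simp
    finally show "(\<Sum>i<n. emeasure \<mu> (B i) * indicator {s. - s + x i \<in> W} s) \<le> emeasure \<mu> E" .
  qed
  also have "\<dots> = emeasure \<mu> E"
    using prob_space.emeasure_space_1[OF prob_uniform] by simp
  finally show ?thesis .
qed

text \<open>Inner regularity is available on open sets, so it is applied to the part of the preimage
  of E inside an open set of finite mass around C. The compact set found there is mapped forward by
  s -> -s + t.\<close>

lemma K_inner:
  assumes E: "open E" and e: "0 < (e::real)"
  obtains D where "compact D" "D \<subseteq> E" "measure (K t) E < measure (K t) D + e"
proof -
  have "emeasure \<mu> C < \<infinity>" using C_finite by (simp add: less_top)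
  then obtain U where U: "open U" "C \<subseteq> U" "emeasure \<mu> U < \<infinity>"
    using outer_open[OF C_borel] by metis
  let ?O = "{s. - s + t \<in> E} \<inter> U"
  have O: "open ?O" using open_shift_vimage(3)[OF E] U by auto
  have "emeasure \<mu> ?O < \<infinity>"
    using U emeasure_mono[of ?O U \<mu>] by (auto intro: le_less_trans)
  moreover have em: "e * m > 0" using e m_pos by simp
  ultimately obtain F where F: "compact F" "F \<subseteq> ?O" "emeasure \<mu> (?O - F) < ennreal (e * m)"
    using inner_compact_finite[OF O] by metis
  define D where "D = (\<lambda>s. - s + t) ` F"
  have D: "compact D" unfolding D_def by (rule compact_continuous_image[OF _ F(1)]) (auto intro!: continuous_intros)
  have DE: "D \<subseteq> E" using F(2) by (auto simp: D_def)
  have fm: "C \<inter> X \<in> fmeasurable \<mu>" if "X \<in> sets borel" for X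
    using C_fmeasurable that by (intro fmeasurable_Int_fmeasurable) auto
  have OF: "?O - F \<in> fmeasurable \<mu>" using O F by (auto simp: fmeasurable_def less_trans)
  have "measure \<mu> (C \<inter> {s. - s + t \<in> E}) \<le> measure \<mu> ((C \<inter> {s. - s + t \<in> D}) \<union> (?O - F))"
    using U(2) OF fm[OF vimage_borel(3), of D t] fm[OF vimage_borel(3), of E t] D E
    by (intro measure_mono_fmeasurable) (auto simp: D_def)
  also have "\<dots> \<le> measure \<mu> (C \<inter> {s. - s + t \<in> D}) + measure \<mu> (?O - F)"
    using OF fm[OF vimage_borel(3), of D t] D by (intro measure_Un_le) auto
  also have "measure \<mu> (?O - F) < e * m"
    using F(3) OF em by (simp add: emeasure_eq_measure2 ennreal_less_iff)
  finally have "measure \<mu> (C \<inter> {s. - s + t \<in> E}) < measure \<mu> (C \<inter> {s. - s + t \<in> D}) + e * m" by simp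
  then have "measure (K t) E < measure (K t) D + e"
    using m_pos D E by (simp add: measure_K field_simps)
  then show ?thesis using that D DE by blast
qed

text \<open>A compact set that almost exhausts E for \<open>K t\<close> still does so for nearby
  parameters, by \<open>continuous_K\<close>. Finitely many such neighbourhoods cover L, and the
  union of their compact sets serves all of L.\<close>

lemma K_integral_open_compact:
  assumes L: "compact L" and E: "open E"
  shows "(\<integral>\<^sup>+t. emeasure (K t) E * indicator L t \<partial>\<mu>) \<le> emeasure \<mu> E"
proof (rule ennreal_le_epsilon)
  fix e :: real assume e: "0 < e"
  define l where "l = measure \<mu> L"
  have l: "emeasure \<mu> L = ennreal l" "l \<ge> 0"
    using finite_compact[OF L] by (auto simp: l_def emeasure_eq_ennreal_measure)
  \<comment> \<open>The error e is spread over the mass l of L; the summand 1 covers the case that L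
    is null.\<close>
  define d where "d = e / (l + 1)"
  have d: "d > 0" "d * l \<le> e" using e l by (auto simp: d_def field_simps)
  have "\<exists>D. compact D \<and> D \<subseteq> E \<and> measure (K t) E < measure (K t) D + d" for t
    using K_inner[OF E d(1)] by metis
  then obtain D where D: "\<And>t. compact (D t)" "\<And>t. D t \<subseteq> E" "\<And>t. measure (K t) E < measure (K t) (D t) + d"
    by metis
  define N where "N t = {t'. measure (K t') E < measure (K t') (D t) + d}" for t
  have N: "open (N t)" for t
    unfolding N_def using D(1) E
    by (intro open_Collect_less continuous_on_add continuous_K continuous_on_const) auto
  obtain T where T: "finite T" "L \<subseteq> (\<Union>t\<in>T. N t)"
  proof (rule compactE_image[OF L, of L N])
    show "L \<subseteq> (\<Union>t\<in>L. N t)" using D(3) by (auto simp: N_def)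
  qed (use N in auto)
  let ?D = "\<Union>t\<in>T. D t"
  have Dc: "compact ?D" using T D by auto
  have DE: "?D \<subseteq> E" using D by auto
  have le: "emeasure (K t) E * indicator L t \<le> emeasure (K t) ?D * indicator L t + ennreal d * indicator L t" for t
  proof (cases "t \<in> L")
    case True
    then obtain t0 where t0: "t0 \<in> T" "measure (K t) E < measure (K t) (D t0) + d"
      using T by (auto simp: N_def)
    interpret prob_space "K t" by (rule prob_K)
    have "measure (K t) (D t0) \<le> measure (K t) ?D"
      using t0 Dc by (intro finite_measure_mono) auto
    then have "measure (K t) E \<le> measure (K t) ?D + d" using t0 by simp
    then show ?thesis using True d by (simp add: emeasure_K flip: ennreal_plus)
  qed simp
  have "(\<integral>\<^sup>+t. emeasure (K t) E * indicator L t \<partial>\<mu>) \<le>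
      (\<integral>\<^sup>+t. emeasure (K t) ?D * indicator L t + ennreal d * indicator L t \<partial>\<mu>)"
    by (intro nn_integral_mono le)
  also have "\<dots> = (\<integral>\<^sup>+t. emeasure (K t) ?D * indicator L t \<partial>\<mu>) + ennreal d * emeasure \<mu> L"
    using Dc L by (subst nn_integral_add) (auto simp: nn_integral_cmult_indicator)
  also have "\<dots> \<le> emeasure \<mu> E + ennreal e"
    using K_integral_compact[OF L Dc E DE] d l(2)
    by (intro add_mono) (auto simp: l(1) intro: ennreal_leI simp flip: ennreal_mult)
  finally show "(\<integral>\<^sup>+t. emeasure (K t) E * indicator L t \<partial>\<mu>) \<le> emeasure \<mu> E + ennreal e" .
qed

text \<open>The group need not be a countable union of compact sets. But Markov's inequality on
  compact sets shows that the open set where \<open>measure (K t) E\<close> exceeds 1/(k + 1) has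
  finite mass, so it is exhausted by countably many compact sets up to a null set, and monotone
  convergence applies.\<close>

lemma K_integral_open:
  assumes E: "open E"
  shows "(\<integral>\<^sup>+t. emeasure (K t) E \<partial>\<mu>) \<le> emeasure \<mu> E"
proof (cases "emeasure \<mu> E = \<infinity>")
  case True
  then show ?thesis by simp
next
  case False
  define U where "U k = {t. 1 / real (Suc k) < measure (K t) E}" for k :: nat
  have U: "open (U k)" for k
    unfolding U_def using E by (intro open_Collect_less continuous_K) auto
  have U_fin: "emeasure \<mu> (U k) \<le> ennreal (Suc k) * emeasure \<mu> E" for k
  proof -
    have "emeasure \<mu> L \<le> ennreal (Suc k) * emeasure \<mu> E" if L: "compact L" "L \<subseteq> U k" for L
    proof -
      have "emeasure \<mu> L = (\<integral>\<^sup>+t. indicator L t \<partial>\<mu>)" using L by simp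
      also have "\<dots> \<le> (\<integral>\<^sup>+t. ennreal (Suc k) * (emeasure (K t) E * indicator L t) \<partial>\<mu>)"
      proof (rule nn_integral_mono)
        fix t
        have "1 \<le> ennreal (Suc k) * emeasure (K t) E" if "t \<in> L"
        proof -
          have "1 / real (Suc k) < measure (K t) E" using that L by (auto simp: U_def)
          then have "1 \<le> real (Suc k) * measure (K t) E" by (simp add: field_simps)
          then show ?thesis by (simp add: emeasure_K del: of_nat_Suc flip: ennreal_mult)
        qed
        then show "indicator L t \<le> ennreal (Suc k) * (emeasure (K t) E * indicator L t)"
          by (auto split: split_indicator)
      qed
      also have "\<dots> = ennreal (Suc k) * (\<integral>\<^sup>+t. emeasure (K t) E * indicator L t \<partial>\<mu>)"
        using L E by (intro nn_integral_cmult) auto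
      also have "\<dots> \<le> ennreal (Suc k) * emeasure \<mu> E"
        by (intro mult_left_mono K_integral_open_compact L E) simp
      finally show ?thesis .
    qed
    then show ?thesis unfolding inner_regular[OF U] by (intro SUP_least) auto
  qed
  have "\<exists>L. compact L \<and> L \<subseteq> U k \<and> emeasure \<mu> (U k - L) < ennreal (1 / Suc j)" for k j
  proof (rule inner_compact_finite[OF U, of k "1 / Suc j"])
    show "emeasure \<mu> (U k) < \<infinity>"
      using U_fin[of k] False by (auto intro!: le_less_trans[OF U_fin] simp: ennreal_mult_less_top less_top simp del: of_nat_Suc)
  qed auto
  then obtain L where L: "\<And>k j. compact (L k j)" "\<And>k j. L k j \<subseteq> U k"
    "\<And>k j. emeasure \<mu> (U k - L k j) < ennreal (1 / Suc j)"
    by metis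
  define M where "M n = (\<Union>k\<le>n. \<Union>j\<le>n. L k j)" for n :: nat
  have Mc: "compact (M n)" for n unfolding M_def using L(1) by auto
  have Mb [measurable]: "M n \<in> sets borel" for n using Mc by simp
  have Minc: "incseq M" unfolding M_def by (rule incseq_SucI) (auto intro: le_SucI)
  have null: "emeasure \<mu> (U k - (\<Union>n. M n)) = 0" for k
  proof (rule ccontr)
    let ?r = "emeasure \<mu> (U k - (\<Union>n. M n))"
    assume "?r \<noteq> 0"
    have bound: "?r \<le> ennreal (1 / Suc j)" for j
    proof -
      have "L k j \<subseteq> M (max k j)"
        unfolding M_def by (intro subsetI UN_I[of k] UN_I[of j]) auto
      then have "?r \<le> emeasure \<mu> (U k - L k j)"
        using U[of k] L(1)[of k j] by (intro emeasure_mono) auto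
      then show ?thesis using L(3)[of k j] by simp
    qed
    have "?r \<le> 0"
    proof (rule ennreal_le_epsilon)
      fix e :: real assume "0 < e"
      then obtain j where "1 / Suc j < e" by (rule nat_approx_posE)
      then have "ennreal (1 / Suc j) \<le> ennreal e" by (intro ennreal_leI) simp
      from order_trans[OF bound[of j] this] show "?r \<le> 0 + ennreal e" by (simp only: add_0)
    qed
    then show False using \<open>?r \<noteq> 0\<close> by simp
  qed
  \<comment> \<open>Outside all U k the integrand is 0, so exhausting the U k up to a null set
    recovers the integrand almost everywhere.\<close>
  have "AE t in \<mu>. emeasure (K t) E = (SUP n. emeasure (K t) E * indicator (M n) t)"
  proof -
    have "AE t in \<mu>. \<forall>k. t \<notin> U k - (\<Union>n. M n)"
      using null U by (intro AE_all_countable[THEN iffD2] allI AE_not_in) (auto simp: null_sets_def)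
    then show ?thesis
    proof eventually_elim
      case (elim t)
      show ?case
      proof (cases "t \<in> (\<Union>n. M n)")
        case True
        then obtain n where "t \<in> M n" by blast
        then have "emeasure (K t) E \<le> (SUP n. emeasure (K t) E * indicator (M n) t)"
          by (intro SUP_upper2[of n]) auto
        then show ?thesis by (intro antisym SUP_least) (auto split: split_indicator)
      next
        case False
        then have "\<forall>k. t \<notin> U k" using elim by blast
        have "measure (K t) E \<le> 0"
        proof (rule ccontr)
          assume "\<not> measure (K t) E \<le> 0"
          then obtain k where "1 / real (Suc k) < measure (K t) E"
            using nat_approx_posE[of "measure (K t) E"] by (auto simp: not_le)
          then show False using \<open>\<forall>k. t \<notin> U k\<close> by (auto simp: U_def)
        qed
        then have "emeasure (K t) E = 0" by (simp add: emeasure_K ennreal_neg)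
        then show ?thesis by simp
      qed
    qed
  qed
  then have "(\<integral>\<^sup>+t. emeasure (K t) E \<partial>\<mu>) = (\<integral>\<^sup>+t. (SUP n. emeasure (K t) E * indicator (M n) t) \<partial>\<mu>)"
    by (rule nn_integral_cong_AE)
  also have "\<dots> = (SUP n. \<integral>\<^sup>+t. emeasure (K t) E * indicator (M n) t \<partial>\<mu>)"
  proof (rule nn_integral_monotone_convergence_SUP)
    show "incseq (\<lambda>n t. emeasure (K t) E * indicator (M n) t)"
    proof (intro incseq_SucI le_funI mult_left_mono)
      fix n t show "indicator (M n) t \<le> (indicator (M (Suc n)) t :: ennreal)"
        using incseq_SucD[OF Minc, of n] by (auto split: split_indicator)
    qed simp
  qed (use E in auto)
  also have "\<dots> \<le> emeasure \<mu> E"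
    by (intro SUP_least K_integral_open_compact Mc E)
  finally show ?thesis .
qed

lemma K_integral_le:
  assumes E: "E \<in> sets borel"
  shows "(\<integral>\<^sup>+t. emeasure (K t) E \<partial>\<mu>) \<le> emeasure \<mu> E"
  unfolding outer_regular[OF E]
proof (rule INF_greatest, clarify)
  fix U assume U: "open U" "E \<subseteq> U"
  have "(\<integral>\<^sup>+t. emeasure (K t) E \<partial>\<mu>) \<le> (\<integral>\<^sup>+t. emeasure (K t) U \<partial>\<mu>)"
    using U E by (intro nn_integral_mono emeasure_mono) auto
  also have "\<dots> \<le> emeasure \<mu> U" by (rule K_integral_open[OF U(1)])
  finally show "(\<integral>\<^sup>+t. emeasure (K t) E \<partial>\<mu>) \<le> emeasure \<mu> U" .
qed

text \<open>\<open>K_integral_le\<close> compares the measures \<open>\<mu> \<bind> K\<close> and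
  \<mu> on sets; the inequality for integrals of nonnegative functions follows.\<close>

lemma K_nn_integral_le:
  assumes "h \<in> borel_measurable borel"
  shows "(\<integral>\<^sup>+t. \<integral>\<^sup>+s. h s \<partial>K t \<partial>\<mu>) \<le> (\<integral>\<^sup>+t. h t \<partial>\<mu>)"
proof -
  let ?B = "\<mu> \<bind> K"
  have sets: "sets ?B = sets borel" by (rule sets_bind) auto
  have "?B \<le> \<mu>"
  proof (subst le_measure)
    show "sets ?B = sets \<mu>" using sets by simp
    show "\<forall>E\<in>sets ?B. emeasure ?B E \<le> emeasure \<mu> E"
    proof
      fix E assume "E \<in> sets ?B"
      then have "E \<in> sets borel" using sets by simp
      then show "emeasure ?B E \<le> emeasure \<mu> E"
        using K_integral_le emeasure_bind[OF _ measurable_K] by simp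
    qed
  qed
  then have "(\<integral>\<^sup>+t. h t \<partial>?B) \<le> (\<integral>\<^sup>+t. h t \<partial>\<mu>)"
    using sets by (intro nn_integral_mono_measure) auto
  then show ?thesis using nn_integral_bind[OF assms measurable_K] by simp
qed

end

section \<open>Convolution operators on a non-discrete group\<close>

locale haar_Lp = haar \<mu> + Lp_setting \<mu> p for \<mu> :: "'g::{topological_group_add, t2_space} measure" and p
begin

lemma left_regular_in_PF:
  assumes "integrable \<mu> f" "left_regular \<mu> p f \<in> carrier (bounded_operators LS LS)"
  shows "left_regular \<mu> p f \<in> PF \<mu> p"
proof -
  interpret B: normed_space "bounded_operators LS LS"
    by (rule normed_bounded_operators[OF LS.seminormed_space_axioms LS.normed_space_axioms])
  have minus: "x \<ominus>\<^bsub>operator_algebra LS\<^esub> x = x \<ominus>\<^bsub>bounded_operators LS LS\<^esub> x" for x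
    by (simp add: operator_algebra_simps a_minus_def a_inv_def m_inv_def)
  show ?thesis
    unfolding PF_def norm_closure_def
    using assms by (auto simp: operator_algebra_simps minus intro!: bexI[of _ "left_regular \<mu> p f"])
qed

lemma indicator_LF:
  assumes "V \<in> sets borel" "emeasure \<mu> V < \<infinity>"
  shows "(\<lambda>t. complex_of_real (indicator V t)) \<in> carrier LF"
    "nrm LF (\<lambda>t. complex_of_real (indicator V t)) = measure \<mu> V powr (1/p)"
    "(\<lambda>t. complex_of_real (indicator V t)) \<in> Lq"
    "nrm_q (\<lambda>t. complex_of_real (indicator V t)) = measure \<mu> V powr (1/q)"
proof -
  have eq: "indicator V t powr r = (indicator V t :: real)" if "r > 1" for r t
    using that by (auto split: split_indicator)
  have int: "integrable \<mu> (indicator V :: 'g \<Rightarrow> real)"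
    using assms by (intro integrable_real_indicator) auto
  have m: "(\<lambda>t. complex_of_real (indicator V t)) \<in> borel_measurable \<mu>" using assms(1) by measurable
  show "(\<lambda>t. complex_of_real (indicator V t)) \<in> carrier LF" "(\<lambda>t. complex_of_real (indicator V t)) \<in> Lq"
    using m int p_gt_1 q(1) by (simp_all add: Lp_functions_simps Lq_def eq)
  show "nrm LF (\<lambda>t. complex_of_real (indicator V t)) = measure \<mu> V powr (1/p)"
    "nrm_q (\<lambda>t. complex_of_real (indicator V t)) = measure \<mu> V powr (1/q)"
    using p_gt_1 q(1) assms by (simp_all add: Lp_functions_simps nrm_q_def eq)
qed

end

locale haar_kernel_Lp = haar_kernel \<mu> C + haar_Lp \<mu> p
  for \<mu> :: "'g::{topological_group_add, t2_space} measure" and C p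
begin

definition fC :: "'g \<Rightarrow> complex" where "fC s = complex_of_real (indicator C s / m)"

lemma integrable_fC: "integrable \<mu> fC"
  unfolding fC_def using C_finite by (auto simp: less_top intro!: integrable_real_indicator)

lemma convolution_fC:
  assumes [measurable]: "\<xi> \<in> borel_measurable borel"
  shows "convolution \<mu> fC \<xi> t = (\<integral>s. \<xi> s \<partial>K t)"
proof -
  have "uniform_measure \<mu> C = density \<mu> (\<lambda>s. ennreal (indicator C s / m))"
    unfolding uniform_measure_def
  proof (rule density_cong)
    have "emeasure \<mu> C = ennreal m" using C_finite by (simp add: emeasure_eq_ennreal_measure)
    then show "AE s in \<mu>. indicator C s / emeasure \<mu> C = ennreal (indicator C s / m)"
      using m_pos by (auto intro!: AE_I2 split: split_indicator simp: divide_ennreal simp flip: ennreal_1)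
  qed auto
  moreover have "(\<integral>s. \<xi> s \<partial>K t) = (\<integral>s. \<xi> (- s + t) \<partial>uniform_measure \<mu> C)"
    unfolding K_def by (rule integral_distr) auto
  moreover have "(\<integral>s. \<xi> (- s + t) \<partial>density \<mu> (\<lambda>s. ennreal (indicator C s / m))) =
      (\<integral>s. (indicator C s / m) *\<^sub>R \<xi> (- s + t) \<partial>\<mu>)"
    using m_pos by (intro integral_density) auto
  ultimately show ?thesis
    by (simp add: convolution_def fC_def scaleR_conv_of_real)
qed

text \<open>\<open>K t\<close> is a probability measure, so Hoelder's inequality against the
  constant 1 bounds the p-th power of the mean of \<xi> by the mean of its p-th power. Integrating
  over t costs nothing by \<open>K_nn_integral_le\<close>.\<close>

lemma convolution_fC_LF:
  assumes "\<xi> \<in> carrier LF"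
  shows "convolution \<mu> fC \<xi> \<in> carrier LF" "nrm LF (convolution \<mu> fC \<xi>) \<le> nrm LF \<xi>"
    "AE t in \<mu>. integrable (K t) \<xi>"
proof -
  have [measurable]: "\<xi> \<in> borel_measurable borel" using LF_D(1)[OF assms] by simp
  have g: "convolution \<mu> fC \<xi> t = (\<integral>s. \<xi> s \<partial>K t)" for t by (rule convolution_fC) simp
  have mg: "convolution \<mu> fC \<xi> \<in> borel_measurable \<mu>"
    unfolding g[abs_def] by (rule measurable_compose[OF measurable_K integral_measurable_subprob_algebra]) simp
  let ?N = "\<lambda>t. \<integral>\<^sup>+s. ennreal (cmod (\<xi> s) powr p) \<partial>K t"
  have N_le: "(\<integral>\<^sup>+t. ?N t \<partial>\<mu>) \<le> ennreal (\<integral>t. cmod (\<xi> t) powr p \<partial>\<mu>)"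
  proof -
    have "(\<integral>\<^sup>+t. ?N t \<partial>\<mu>) \<le> (\<integral>\<^sup>+t. ennreal (cmod (\<xi> t) powr p) \<partial>\<mu>)" by (rule K_nn_integral_le) simp
    also have "\<dots> = ennreal (\<integral>t. cmod (\<xi> t) powr p \<partial>\<mu>)"
      by (rule nn_integral_eq_integral[OF LF_D(2)[OF assms]]) simp
    finally show ?thesis .
  qed
  have mN: "?N \<in> borel_measurable \<mu>"
    by (rule measurable_compose[OF measurable_K nn_integral_measurable_subprob_algebra]) simp
  have "(\<integral>\<^sup>+t. ?N t \<partial>\<mu>) \<noteq> \<infinity>" using N_le by (auto simp: top_unique)
  then have fin: "AE t in \<mu>. ?N t \<noteq> \<infinity>" by (rule nn_integral_noteq_infinite[OF mN])
  have pt: "integrable (K t) \<xi> \<and> ennreal (cmod (convolution \<mu> fC \<xi> t) powr p) \<le> ?N t" if "?N t \<noteq> \<infinity>" for t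
  proof -
    interpret Kt: prob_space "K t" by (rule prob_K)
    have mK: "\<xi> \<in> borel_measurable (K t)" by simp
    have int: "integrable (K t) (\<lambda>s. cmod (\<xi> s) powr p)"
      using that by (intro integrableI_bounded) (auto simp: less_top)
    have one: "(\<lambda>_::'g. 1 :: complex) \<in> borel_measurable (K t)" "integrable (K t) (\<lambda>s. cmod 1 powr q)" by auto
    note H = holder[OF p_gt_1 q mK int one]
    have "cmod (convolution \<mu> fC \<xi> t) \<le> (\<integral>s. cmod (\<xi> s) \<partial>K t)" unfolding g by simp
    also have "\<dots> \<le> (\<integral>s. cmod (\<xi> s) powr p \<partial>K t) powr (1/p)" using H(2) Kt.prob_space by simp
    finally have "cmod (convolution \<mu> fC \<xi> t) powr p \<le> ((\<integral>s. cmod (\<xi> s) powr p \<partial>K t) powr (1/p)) powr p"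
      using p_gt_1 by (intro powr_mono2) auto
    then have "cmod (convolution \<mu> fC \<xi> t) powr p \<le> (\<integral>s. cmod (\<xi> s) powr p \<partial>K t)"
      using p_gt_1 by (simp add: powr_powr)
    then show ?thesis using H(1) nn_integral_eq_integral[OF int] by (simp add: ennreal_leI)
  qed
  show "AE t in \<mu>. integrable (K t) \<xi>" using fin pt by (auto elim: eventually_mono)
  have "(\<integral>\<^sup>+t. ennreal (cmod (convolution \<mu> fC \<xi> t) powr p) \<partial>\<mu>) \<le> (\<integral>\<^sup>+t. ?N t \<partial>\<mu>)"
    using fin pt by (intro nn_integral_mono_AE) (auto elim: eventually_mono)
  then have le: "(\<integral>\<^sup>+t. ennreal (cmod (convolution \<mu> fC \<xi> t) powr p) \<partial>\<mu>) \<le> ennreal (\<integral>t. cmod (\<xi> t) powr p \<partial>\<mu>)"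
    using N_le by (rule order_trans)
  have int: "integrable \<mu> (\<lambda>t. cmod (convolution \<mu> fC \<xi> t) powr p)"
    using mg le by (intro integrableI_bounded) (auto intro: le_less_trans)
  show LF: "convolution \<mu> fC \<xi> \<in> carrier LF" using mg int by (rule LF_I)
  have "(\<integral>t. cmod (convolution \<mu> fC \<xi> t) powr p \<partial>\<mu>) \<le> (\<integral>t. cmod (\<xi> t) powr p \<partial>\<mu>)"
    using le nn_integral_eq_integral[OF int] by simp
  then show "nrm LF (convolution \<mu> fC \<xi>) \<le> nrm LF \<xi>"
    using nrm_LF_powr[OF assms] by (intro nrm_LF_le[OF LF]) (auto simp: LF.nrm_nonneg assms)
qed

lemma convolution_fC_linear:
  assumes "\<xi> \<in> carrier LF" "\<zeta> \<in> carrier LF"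
  shows "AE t in \<mu>. convolution \<mu> fC (\<lambda>s. \<xi> s + c * \<zeta> s) t = convolution \<mu> fC \<xi> t + c * convolution \<mu> fC \<zeta> t"
  using convolution_fC_LF(3)[OF assms(1)] convolution_fC_LF(3)[OF assms(2)]
proof eventually_elim
  case (elim t)
  have [measurable]: "\<xi> \<in> borel_measurable borel" "\<zeta> \<in> borel_measurable borel"
    using LF_D(1) assms by auto
  show ?case using elim by (simp add: convolution_fC)
qed

abbreviation "T \<equiv> left_regular \<mu> p fC"

text \<open>\<open>left_regular\<close> works on a chosen representative; by contractivity a null
  function has a null convolution, so any representative may be used.\<close>

lemma T_cls:
  assumes "\<xi> \<in> carrier LF"
  shows "T (cls \<xi>) = cls (convolution \<mu> fC \<xi>)"
proof -
  let ?r = "repr (cls \<xi>)"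
  note r = repr_cls[OF assms]
  let ?d = "\<lambda>s. ?r s + (-1) * \<xi> s"
  have d: "?d \<in> carrier LF" using LF_add[OF r(1) LF_smult(1)[OF assms, of "-1"]] .
  have "nrm LF ?d = 0" using r(2) by (subst LF_nrm_eq_0_iff[OF d]) auto
  then have "nrm LF (convolution \<mu> fC ?d) = 0"
    using convolution_fC_LF(1,2)[OF d] LF.nrm_nonneg by force
  then have "AE t in \<mu>. convolution \<mu> fC ?d t = 0"
    using LF_nrm_eq_0_iff convolution_fC_LF(1)[OF d] by blast
  then have "AE t in \<mu>. convolution \<mu> fC ?r t = convolution \<mu> fC \<xi> t"
    using convolution_fC_linear[OF r(1) assms, of "-1"] by eventually_elim simp
  then show ?thesis
    using cls_eq_iff[OF convolution_fC_LF(1)[OF r(1)] convolution_fC_LF(1)[OF assms]] cls_closed[OF assms]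
    by (simp add: left_regular_def)
qed

lemma T_bounded: "bounded_map LS LS 1 T"
proof (rule bounded_mapI)
  fix x assume "x \<in> carrier LS"
  then obtain \<xi> where \<xi>: "\<xi> \<in> carrier LF" "x = cls \<xi>" unfolding LS_simps by blast
  note c = convolution_fC_LF[OF \<xi>(1)]
  show "T x \<in> carrier LS" "nrm LS (T x) \<le> 1 * nrm LS x"
    using c \<xi> by (simp_all add: T_cls LS_simps)
  \<comment> \<open>Additivity and homogeneity in one formula, used with a = 1 and with \<eta> =
    0.\<close>
  have *: "T (cls (\<lambda>t. \<eta> t + a * \<xi> t)) = cls (\<lambda>t. convolution \<mu> fC \<eta> t + a * convolution \<mu> fC \<xi> t)"
    if "\<eta> \<in> carrier LF" for \<eta> a
    using convolution_fC_linear[OF that \<xi>(1), of a] convolution_fC_LF(1) c(1) that \<xi>(1)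
      LF_add[OF that LF_smult(1)[OF \<xi>(1), of a]] LF_add[OF convolution_fC_LF(1)[OF that] LF_smult(1)[OF c(1), of a]]
    by (simp add: T_cls cls_eq_iff)
  have z: "(\<lambda>t. 0) \<in> carrier LF" "convolution \<mu> fC (\<lambda>t. 0) = (\<lambda>t. 0)"
    by (auto simp: Lp_functions_simps convolution_def)
  show "T (a \<odot>\<^bsub>LS\<^esub> x) = a \<odot>\<^bsub>LS\<^esub> T x" for a
  proof -
    have "a \<odot>\<^bsub>LS\<^esub> cls \<zeta> = cls (\<lambda>t. a * \<zeta> t)" if "\<zeta> \<in> carrier LF" for \<zeta>
      using LS_simps(4)[OF that, of a] by (simp add: Lp_functions_simps(4))
    then show ?thesis
      using *[OF z(1), of a] z(2) \<xi> c(1) T_cls[OF \<xi>(1)] by simp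
  qed
  fix y assume "y \<in> carrier LS"
  then obtain \<eta> where \<eta>: "\<eta> \<in> carrier LF" "y = cls \<eta>" unfolding LS_simps by blast
  show "T (x \<oplus>\<^bsub>LS\<^esub> y) = T x \<oplus>\<^bsub>LS\<^esub> T y"
  proof -
    have "cls \<zeta> \<oplus>\<^bsub>LS\<^esub> cls \<zeta>' = cls (\<lambda>t. \<zeta>' t + 1 * \<zeta> t)" if "\<zeta> \<in> carrier LF" "\<zeta>' \<in> carrier LF" for \<zeta> \<zeta>'
      using LS_simps(3)[OF that] by (simp add: Lp_functions_simps(3) add.commute)
    then show ?thesis
      using *[OF \<eta>(1), of 1] \<xi> \<eta> c(1) convolution_fC_LF(1)[OF \<eta>(1)] T_cls[OF \<xi>(1)] T_cls[OF \<eta>(1)]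
      by (simp only:)
  qed
qed

lemma T_operator: "T \<in> carrier (bounded_operators LS LS)"
  using T_bounded by (auto simp: bounded_operators_iff left_regular_def)

lemma T_in_PF: "T \<in> PF \<mu> p"
  by (rule left_regular_in_PF[OF integrable_fC T_operator])

lemma T_nrm: "nrm (bounded_operators LS LS) T \<le> 1"
  using bounded_mapD(4)[OF T_bounded]
  by (intro opnorm_bound[OF LS.seminormed_space_axioms LS.normed_space_axioms]) auto

text \<open>The probability that -s + t lies in V for independent s and t, uniform on C and on
  V.\<close>

definition average :: "'g set \<Rightarrow> real" where
  "average V = (\<integral>t. indicator V t * measure (K t) V \<partial>\<mu>) / measure \<mu> V"

lemma pairing_T:
  assumes "V \<in> sets borel" "emeasure \<mu> V < \<infinity>"
  shows "(1 / complex_of_real (measure \<mu> V)) * pairing (\<lambda>t. complex_of_real (indicator V t))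
      (T (cls (\<lambda>t. complex_of_real (indicator V t)))) = complex_of_real (average V)"
proof -
  note i = indicator_LF[OF assms]
  have conv: "convolution \<mu> fC (\<lambda>t. complex_of_real (indicator V t)) t = complex_of_real (measure (K t) V)" for t
    using assms(1) by (simp add: convolution_fC)
  have "pairing (\<lambda>t. complex_of_real (indicator V t)) (T (cls (\<lambda>t. complex_of_real (indicator V t)))) =
      (\<integral>t. complex_of_real (measure (K t) V) * complex_of_real (indicator V t) \<partial>\<mu>)"
    using pairing_cls[OF i(3) convolution_fC_LF(1)[OF i(1)]] by (simp add: T_cls[OF i(1)] conv)
  also have "\<dots> = (\<integral>t. complex_of_real (indicator V t * measure (K t) V) \<partial>\<mu>)" by (simp add: mult.commute)
  also have "\<dots> = complex_of_real (\<integral>t. indicator V t * measure (K t) V \<partial>\<mu>)" by (rule integral_complex_of_real)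
  finally show ?thesis by (simp add: average_def)
qed

lemma measure_K_le_1: "measure (K t) V \<le> 1"
  using prob_space.prob_le_1[OF prob_K] .

lemma integrable_average:
  assumes "V \<in> sets borel" "emeasure \<mu> V < \<infinity>"
  shows "integrable \<mu> (\<lambda>t. indicator V t * measure (K t) V)"
proof (rule Bochner_Integration.integrable_bound)
  show "integrable \<mu> (indicator V :: 'g \<Rightarrow> real)"
    using assms by (intro integrable_real_indicator) auto
  have "(\<lambda>t. measure (K t) V) \<in> borel_measurable borel"
    by (intro borel_measurable_continuous_onI continuous_K assms)
  then show "(\<lambda>t. indicator V t * measure (K t) V) \<in> borel_measurable \<mu>" using assms(1) by measurable
qed (use measure_K_le_1 in \<open>auto intro!: AE_I2 split: split_indicator\<close>)

text \<open>For symmetric V the condition on s reads -t + s in V, which confines s to a left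
  translate of V, of the same mass as V.\<close>

lemma average_le_symmetric:
  assumes V: "open V" "emeasure \<mu> V < \<infinity>" and sym: "\<And>v. v \<in> V \<Longrightarrow> - v \<in> V"
  shows "0 \<le> average V" "average V \<le> measure \<mu> V / m"
proof -
  have Vb: "V \<in> sets borel" using V by simp
  have le: "measure (K t) V \<le> measure \<mu> V / m" for t
  proof -
    have "{s. - s + t \<in> V} = {s. - t + s \<in> V}"
      using sym sym[of "- t + _"] by (force simp: group_add_class.minus_add)
    then have "measure \<mu> (C \<inter> {s. - s + t \<in> V}) \<le> measure \<mu> {s. - t + s \<in> V}"
      using V emeasure_shift[OF Vb, of "- t"] vimage_borel(1)[OF Vb, of "- t"]
      by (intro measure_mono_fmeasurable) (auto simp: fmeasurable_def)
    also have "\<dots> = measure \<mu> V" using emeasure_shift[OF Vb, of "- t"] by (simp add: measure_def)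
    finally show ?thesis using m_pos by (simp add: measure_K[OF Vb] divide_right_mono)
  qed
  show "0 \<le> average V" unfolding average_def by (intro divide_nonneg_nonneg integral_nonneg_AE) auto
  have "(\<integral>t. indicator V t * measure (K t) V \<partial>\<mu>) \<le> (\<integral>t. indicator V t * (measure \<mu> V / m) \<partial>\<mu>)"
    using le V by (intro integral_mono integrable_average mult_left_mono) auto
  also have "\<dots> = measure \<mu> V * (measure \<mu> V / m)" using V by simp
  finally have "average V \<le> measure \<mu> V * (measure \<mu> V / m) / measure \<mu> V"
    unfolding average_def by (rule divide_right_mono) simp
  then show "average V \<le> measure \<mu> V / m" using m_pos by (cases "measure \<mu> V = 0") auto
qed

text \<open>Elements of C are so small that they keep W inside V, hence the conditional probability
  is 1 for every t in W; only t in V - W can cause a loss.\<close>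

lemma average_ge:
  assumes V: "open V" "emeasure \<mu> V < \<infinity>" "measure \<mu> V > 0" and W: "compact W" "W \<subseteq> V"
    and CW: "\<And>s t. s \<in> C \<Longrightarrow> t \<in> W \<Longrightarrow> - s + t \<in> V"
  shows "average V \<le> 1" "1 - average V \<le> measure \<mu> (V - W) / measure \<mu> V"
proof -
  have Vb: "V \<in> sets borel" using V by simp
  have one: "measure (K t) V = 1" if "t \<in> W" for t
  proof -
    have "C \<inter> {s. - s + t \<in> V} = C" using CW that by auto
    then show ?thesis using m_pos by (simp add: measure_K[OF Vb])
  qed
  have Wfin: "emeasure \<mu> W < \<infinity>" by (rule finite_compact[OF W(1)])
  have "(\<integral>t. indicator V t * measure (K t) V \<partial>\<mu>) \<le> (\<integral>t. indicator V t \<partial>\<mu>)"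
    using measure_K_le_1 V by (intro integral_mono integrable_average) (auto split: split_indicator)
  then show "average V \<le> 1" using V by (simp add: average_def)
  have "measure \<mu> W = (\<integral>t. indicator W t \<partial>\<mu>)" using W(1) by simp
  also have "\<dots> \<le> (\<integral>t. indicator V t * measure (K t) V \<partial>\<mu>)"
    using one W V Wfin by (intro integral_mono integrable_average) (auto split: split_indicator)
  finally have "measure \<mu> W / measure \<mu> V \<le> average V"
    unfolding average_def using V by (intro divide_right_mono) auto
  moreover have "measure \<mu> (V - W) = measure \<mu> V - measure \<mu> W"
    using W V Wfin by (intro measure_Diff) auto
  ultimately show "1 - average V \<le> measure \<mu> (V - W) / measure \<mu> V"
    using V(3) by (simp add: diff_divide_distrib)
qed

end

text \<open>Sets with property P, directed by shrinking to the identity. The sets themselves are the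
  indices, so limits need no countable neighbourhood base.\<close>

definition small_sets :: "('g::topological_group_add set \<Rightarrow> bool) \<Rightarrow> 'g set filter" where
  "small_sets P = (INF U\<in>{U. open U \<and> 0 \<in> U}. principal {C. P C \<and> C \<subseteq> U})"

lemma eventually_small_sets:
  "eventually Q (small_sets P) \<longleftrightarrow> (\<exists>U. open U \<and> 0 \<in> U \<and> (\<forall>C. P C \<and> C \<subseteq> U \<longrightarrow> Q C))"
  unfolding small_sets_def
proof (subst eventually_INF_base)
  show "{U. open U \<and> (0::'a) \<in> U} \<noteq> {}" by (auto intro: exI[of _ UNIV])
  fix U V :: "'a set" assume "U \<in> {U. open U \<and> 0 \<in> U}" "V \<in> {U. open U \<and> 0 \<in> U}"
  then show "\<exists>x\<in>{U. open U \<and> 0 \<in> U}. principal {C. P C \<and> C \<subseteq> x} \<le>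
      inf (principal {C. P C \<and> C \<subseteq> U}) (principal {C. P C \<and> C \<subseteq> V})"
    by (intro bexI[of _ "U \<inter> V"]) auto
qed (auto simp: eventually_principal)

lemma small_sets_not_bot:
  assumes "\<And>U. open U \<Longrightarrow> 0 \<in> U \<Longrightarrow> \<exists>C. P C \<and> C \<subseteq> U"
  shows "small_sets P \<noteq> bot"
  unfolding trivial_limit_def eventually_small_sets using assms by blast

section \<open>The double limit on a non-discrete group\<close>

locale convolution_algebra = haar_Lp \<mu> p + operator_subalgebra "Lp \<mu> p" S A
  for \<mu> :: "'g::{topological_group_add, t2_space} measure" and p S A +
  assumes PF_S: "PF \<mu> p \<subseteq> S" and S_CV: "S \<subseteq> CV \<mu> p"
begin

definition avg_functional :: "'g set \<Rightarrow> (('g \<Rightarrow> complex) set \<Rightarrow> ('g \<Rightarrow> complex) set) \<Rightarrow> complex" where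
  "avg_functional V a = (1 / complex_of_real (measure \<mu> V)) * pairing (\<lambda>t. complex_of_real (indicator V t))
     (a (cls (\<lambda>t. complex_of_real (indicator V t))))"

lemma avg_functional_bounded:
  assumes V: "V \<in> sets borel" "emeasure \<mu> V < \<infinity>" "measure \<mu> V > 0"
  shows "bounded_map A complex_space 1 (avg_functional V)"
proof -
  let ?i = "\<lambda>t. complex_of_real (indicator V t)" and ?v = "measure \<mu> V"
  note i = indicator_LF[OF V(1,2)]
  have "bounded_map A complex_space (nrm_q ?i * nrm LS (cls ?i)) (\<lambda>a. pairing ?i (a (cls ?i)))"
    using i by (intro coefficient_functional pairing_bounded cls_closed) (auto simp: nrm_q_def)
  moreover have "nrm_q ?i * nrm LS (cls ?i) = ?v"
    using i V(3) q(2) by (simp add: LS_simps flip: powr_add) (simp add: add.commute)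
  ultimately have "bounded_map A complex_space (cmod (1 / complex_of_real ?v) * ?v) (avg_functional V)"
    unfolding avg_functional_def
    using bounded_map_smult[OF A.seminormed_space_axioms normed_complex_space, of ?v _ "1 / complex_of_real ?v"] by simp
  then show ?thesis using V(3) by (simp add: norm_divide)
qed

theorem nondiscrete_not_reflexive:
  assumes atom: "emeasure \<mu> {0} = 0"
  shows "\<not> reflexive A"
proof
  assume refl: "reflexive A"
  define goodC where "goodC C \<longleftrightarrow> compact C \<and> emeasure \<mu> C > 0" for C
  define goodV where "goodV V \<longleftrightarrow> open V \<and> 0 \<in> V \<and> emeasure \<mu> V < \<infinity> \<and> (\<forall>v\<in>V. - v \<in> V)" for V
  have exC: "\<exists>C. goodC C \<and> C \<subseteq> U" if "open U" "0 \<in> U" for U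
  proof -
    have "emeasure \<mu> U > 0" using emeasure_open_pos that by blast
    from inner_compact[OF that(1) this] show ?thesis unfolding goodC_def by metis
  qed
  have exV: "\<exists>V. goodV V \<and> V \<subseteq> U" if U: "open U" "0 \<in> U" for U
  proof -
    obtain O' L :: "'g set" where O: "open O'" "compact L" "0 \<in> O'" "O' \<subseteq> L" by (rule compact_nbhd_exists)
    obtain V where V: "open V" "0 \<in> V" "V \<subseteq> U \<inter> O'" "\<And>v. v \<in> V \<Longrightarrow> - v \<in> V"
      using symmetric_nbhd[of "U \<inter> O'"] U O by blast
    have "emeasure \<mu> V \<le> emeasure \<mu> L" using V O by (intro emeasure_mono) auto
    then have "emeasure \<mu> V < \<infinity>" using finite_compact[OF O(2)] by (rule le_less_trans)
    then show ?thesis using V unfolding goodV_def by blast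
  qed
  obtain C0 where C0: "goodC C0" using exC[of UNIV] by auto
  obtain V0 where V0: "goodV V0" using exV[of UNIV] by auto
  have ker: "haar_kernel_Lp \<mu> C p" if "goodC C" for C
    using that haar_axioms Lp_setting_axioms
    by (simp add: haar_kernel_Lp_def haar_kernel_def haar_kernel_axioms_def haar_Lp_def goodC_def)
  have posV: "measure \<mu> V > 0" if "goodV V" for V
    using that emeasure_open_pos[of V]
    by (auto simp: goodV_def measure_def enn2real_positive_iff)
  \<comment> \<open>The double limit criterion quantifies over all indices, so inadmissible sets are
    replaced by the fixed \<open>C0\<close> and \<open>V0\<close>.\<close>
  define x where "x C = left_regular \<mu> p (haar_kernel_Lp.fC \<mu> (if goodC C then C else C0))" for C
  define k where "k V = avg_functional (if goodV V then V else V0)" for V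
  have F: "small_sets goodC \<noteq> bot" and G: "small_sets goodV \<noteq> bot"
    by (rule small_sets_not_bot; use exC exV in blast)+
  have x: "x C \<in> carrier A" "nrm A (x C) \<le> 1" for C
  proof -
    have "goodC (if goodC C then C else C0)" using C0 by simp
    then interpret K: haar_kernel_Lp \<mu> "if goodC C then C else C0" p by (rule ker)
    show "x C \<in> carrier A" "nrm A (x C) \<le> 1"
      using K.T_in_PF PF_S K.T_nrm by (auto simp: x_def A_simps)
  qed
  have k: "bounded_map A complex_space 1 (k V)" for V
  proof -
    have "goodV (if goodV V then V else V0)" using V0 by simp
    then show ?thesis
      unfolding k_def using posV by (intro avg_functional_bounded) (auto simp: goodV_def)
  qed
  have val: "avg_functional V (left_regular \<mu> p (haar_kernel_Lp.fC \<mu> C)) =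
      complex_of_real (haar_kernel_Lp.average \<mu> C V)" if "goodV V" "goodC C" for V C
  proof -
    interpret K: haar_kernel_Lp \<mu> C p by (rule ker[OF that(2)])
    show ?thesis
      unfolding avg_functional_def using that(1) by (intro K.pairing_T) (auto simp: goodV_def)
  qed
  \<comment> \<open>With V fixed, a compact W carrying all but a fraction e of the mass of V stays
    in V when moved by -s, for s close to the identity. The neighbourhood U is reflected below
    because C acts through these inverses.\<close>
  have lim1: "((\<lambda>C. k V (x C)) \<longlongrightarrow> 1) (small_sets goodC)" for V
  proof -
    define V' where "V' = (if goodV V then V else V0)"
    have V': "goodV V'" using V0 by (simp add: V'_def)
    show ?thesis
      unfolding tendsto_iff
    proof (intro allI impI)
      fix e :: real assume e: "e > 0"
      have "0 < e * measure \<mu> V'" using e posV[OF V'] by simp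
      then obtain W where W: "compact W" "W \<subseteq> V'" "emeasure \<mu> (V' - W) < ennreal (e * measure \<mu> V')"
        using inner_compact_finite[of V' "e * measure \<mu> V'"] V' unfolding goodV_def by metis
      obtain U where U: "open U" "0 \<in> U" "\<And>v c. v \<in> U \<Longrightarrow> c \<in> W \<Longrightarrow> v + c \<in> V'"
        using compact_nbhd_left[OF W(1), of V'] W(2) V' unfolding goodV_def by blast
      have "dist (k V (x C)) 1 < e" if C: "goodC C" "C \<subseteq> {s. - s \<in> U}" for C
      proof -
        interpret K: haar_kernel_Lp \<mu> C p by (rule ker[OF C(1)])
        have a: "K.average V' \<le> 1" "1 - K.average V' \<le> measure \<mu> (V' - W) / measure \<mu> V'"
          by (rule K.average_ge[of V' W]; use V' posV[OF V'] W U(3) C(2) in \<open>auto simp: goodV_def\<close>)+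
        have "measure \<mu> (V' - W) < e * measure \<mu> V'"
        proof -
          have "emeasure \<mu> (V' - W) = ennreal (measure \<mu> (V' - W))"
            using W(3) by (intro emeasure_eq_ennreal_measure) auto
          then show ?thesis using W(3) by (simp add: ennreal_less_iff)
        qed
        then have "measure \<mu> (V' - W) / measure \<mu> V' < e" using posV[OF V'] by (simp add: pos_divide_less_eq)
        then have "\<bar>K.average V' - 1\<bar> < e" using a by simp
        moreover have eq: "k V (x C) - 1 = complex_of_real (K.average V' - 1)"
          using val[OF V' C(1)] C(1) by (simp add: k_def x_def V'_def)
        ultimately show ?thesis unfolding dist_norm eq norm_of_real by simp
      qed
      then show "\<forall>\<^sub>F C in small_sets goodC. dist (k V (x C)) 1 < e"
        unfolding eventually_small_sets using open_shift_vimage(5)[OF U(1)] U(2)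
        by (intro exI[of _ "{s. - s \<in> U}"]) auto
    qed
  qed
  \<comment> \<open>With C fixed, the average is at most the mass of V over the mass of C, and outer
    regularity at the null set {0} makes the mass of V small.\<close>
  have lim0: "((\<lambda>V. k V (x C)) \<longlongrightarrow> 0) (small_sets goodV)" for C
  proof -
    define C' where "C' = (if goodC C then C else C0)"
    have C': "goodC C'" using C0 by (simp add: C'_def)
    interpret K: haar_kernel_Lp \<mu> C' p by (rule ker[OF C'])
    show ?thesis
      unfolding tendsto_iff
    proof (intro allI impI)
      fix e :: real assume e: "e > 0"
      then have em: "0 < e * measure \<mu> C'" using K.m_pos by simp
      have "{0} \<in> sets (borel :: 'g measure)" by simp
      moreover have "emeasure \<mu> {0} < ennreal (e * measure \<mu> C')" using atom em by simp
      ultimately obtain U where U: "open U" "{0} \<subseteq> U" "emeasure \<mu> U < ennreal (e * measure \<mu> C')"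
        using outer_open by metis
      have "dist (k V (x C)) 0 < e" if V: "goodV V" "V \<subseteq> U" for V
      proof -
        have "emeasure \<mu> V < ennreal (e * measure \<mu> C')"
          using emeasure_mono[OF V(2), of \<mu>] U by (auto intro: le_less_trans)
        then have "ennreal (measure \<mu> V) < ennreal (e * measure \<mu> C')"
          using V(1) by (simp add: goodV_def emeasure_eq_ennreal_measure less_top)
        then have "measure \<mu> V < e * measure \<mu> C'" by (simp add: ennreal_less_iff)
        then have "measure \<mu> V / measure \<mu> C' < e" using K.m_pos by (simp add: pos_divide_less_eq)
        moreover have "0 \<le> K.average V" "K.average V \<le> measure \<mu> V / measure \<mu> C'"
          using V(1) by (auto simp: goodV_def intro!: K.average_le_symmetric)
        moreover have "k V (x C) = complex_of_real (K.average V)"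
          using val[OF V(1) C'] V(1) by (simp add: k_def x_def C'_def)
        ultimately show ?thesis by simp
      qed
      then show "\<forall>\<^sub>F V in small_sets goodV. dist (k V (x C)) 0 < e"
        unfolding eventually_small_sets using U(1,2) by blast
    qed
  qed
  have "(1::complex) = 0"
    by (rule reflexive_double_limit[OF A.normed_space_axioms refl F G, of x 1 1 k]) (use x k lim1 lim0 in auto)
  then show False by simp
qed

end

section \<open>Discrete groups\<close>

text \<open>A Reiter-type condition from an invariant functional, obtained by contraposition: if it fails,
  summation is a bounded functional of the differences $f(\cdot + g) - f$, and a Hahn--Banach
  extension of it shows that the constant $1$ is a sum of terms annihilated by $\Phi$.\<close>

definition finite_functions :: "('i \<Rightarrow> complex) nspace" where
  "finite_functions = \<lparr>carrier = {f. finite {i. f i \<noteq> 0}}, mult = undefined, one = undefined,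
     zero = (\<lambda>i. 0), add = (\<lambda>f g i. f i + g i), smult = (\<lambda>c f i. c * f i),
     nrm = (\<lambda>f. \<Sum>i | f i \<noteq> 0. cmod (f i))\<rparr>"

lemma finite_functions_simps:
  "carrier finite_functions = {f. finite {i. f i \<noteq> 0}}" "zero finite_functions = (\<lambda>i. 0)"
  "add finite_functions = (\<lambda>f g i. f i + g i)" "smult finite_functions = (\<lambda>c f i. c * f i)"
  by (simp_all add: finite_functions_def)

lemma finite_functions_nrm:
  assumes "finite I" "\<And>i. f i \<noteq> 0 \<Longrightarrow> i \<in> I"
  shows "nrm finite_functions f = (\<Sum>i\<in>I. cmod (f i))"
  unfolding finite_functions_def nspace.simps
  by (rule sum.mono_neutral_left) (use assms in auto)

lemma finite_support_add: "finite {i. f i \<noteq> (0::complex)} \<Longrightarrow> finite {i. g i \<noteq> 0} \<Longrightarrow> finite {i. f i + g i \<noteq> 0}"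
  by (rule finite_subset[of _ "{i. f i \<noteq> 0} \<union> {i. g i \<noteq> 0}"]) auto

lemma seminormed_finite_functions: "seminormed_space (finite_functions :: ('i \<Rightarrow> complex) nspace)"
proof (rule seminormed_spaceI)
  let ?X = "finite_functions :: ('i \<Rightarrow> complex) nspace"
  fix f g :: "'i \<Rightarrow> complex" and c assume f: "f \<in> carrier ?X"
  then have F: "finite {i. f i \<noteq> 0}" by (simp add: finite_functions_simps)
  show "0 \<le> nrm ?X f" using finite_functions_nrm[OF F] by (simp add: sum_nonneg)
  show "c \<odot>\<^bsub>?X\<^esub> f \<in> carrier ?X"
    using finite_subset[OF _ F, of "{i. c * f i \<noteq> 0}"] by (auto simp: finite_functions_simps)
  show "nrm ?X (c \<odot>\<^bsub>?X\<^esub> f) = cmod c * nrm ?X f"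
    using finite_functions_nrm[OF F, of f] finite_functions_nrm[OF F, of "c \<odot>\<^bsub>?X\<^esub> f"]
    by (simp add: finite_functions_simps norm_mult sum_distrib_left)
  assume g: "g \<in> carrier ?X"
  then have G: "finite {i. g i \<noteq> 0}" by (simp add: finite_functions_simps)
  show "f \<oplus>\<^bsub>?X\<^esub> g \<in> carrier ?X" using finite_support_add[OF F G] by (simp add: finite_functions_simps)
  let ?I = "{i. f i \<noteq> 0} \<union> {i. g i \<noteq> 0}"
  have I: "finite ?I" using F G by simp
  have "(\<Sum>i\<in>?I. cmod (f i + g i)) \<le> (\<Sum>i\<in>?I. cmod (f i)) + (\<Sum>i\<in>?I. cmod (g i))"
    by (simp add: norm_triangle_ineq sum_mono flip: sum.distrib)
  then show "nrm ?X (f \<oplus>\<^bsub>?X\<^esub> g) \<le> nrm ?X f + nrm ?X g"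
    using finite_functions_nrm[OF I, of f] finite_functions_nrm[OF I, of g]
      finite_functions_nrm[OF I, of "f \<oplus>\<^bsub>?X\<^esub> g"] by (force simp: finite_functions_simps)
qed (auto simp: finite_functions_simps algebra_simps)

lemma sum_support:
  fixes f :: "'i \<Rightarrow> complex"
  assumes "finite I" "{i. f i \<noteq> 0} \<subseteq> I"
  shows "(\<Sum>i | f i \<noteq> 0. f i) = sum f I"
  by (rule sum.mono_neutral_left) (use assms in auto)

lemma almost_invariant_functions:
  fixes \<Phi> :: "('g::group_add \<Rightarrow> complex) \<Rightarrow> complex" and F :: "'g set" and \<epsilon> :: real
  assumes add: "\<And>v w. bounded_fun v \<Longrightarrow> bounded_fun w \<Longrightarrow> \<Phi> (\<lambda>t. v t + w t) = \<Phi> v + \<Phi> w"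
    and cmult: "\<And>c v. bounded_fun v \<Longrightarrow> \<Phi> (\<lambda>t. c * v t) = c * \<Phi> v"
    and inv: "\<And>w g. bounded_fun w \<Longrightarrow> \<Phi> (\<lambda>t. w (t - g)) = \<Phi> w"
    and one: "\<Phi> (\<lambda>t. 1) = 1" and F: "finite F" and \<epsilon>: "0 < \<epsilon>"
  obtains f where "finite {t. f t \<noteq> 0}" "(\<Sum>t | f t \<noteq> 0. f t) = 1"
    "\<And>g I. g \<in> F \<Longrightarrow> finite I \<Longrightarrow> (\<Sum>t\<in>I. cmod (f (t + g) - f t)) \<le> \<epsilon>"
proof (rule ccontr)
  assume no: "\<not> thesis"
  note obtains_rule = that
  interpret X: seminormed_space "finite_functions :: ('g \<times> 'g \<Rightarrow> complex) nspace"
    by (rule seminormed_finite_functions)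
  let ?X = "finite_functions :: ('g \<times> 'g \<Rightarrow> complex) nspace"
  define fin where "fin f \<longleftrightarrow> finite {t. f t \<noteq> 0}" for f :: "'g \<Rightarrow> complex"
  define tot where "tot f = (\<Sum>t | f t \<noteq> 0. f t)" for f :: "'g \<Rightarrow> complex"
  \<comment> \<open>The differences f(t + g) - f(t) for all g in F are recorded at once, as one
    function on pairs; its norm adds up their absolute sums.\<close>
  define D where "D f = (\<lambda>(g, t). if g \<in> F then f (t + g) - f t else 0)" for f :: "'g \<Rightarrow> complex"
  have fin_add: "fin f \<Longrightarrow> fin g \<Longrightarrow> fin (\<lambda>t. f t + g t)" for f g
    unfolding fin_def by (rule finite_support_add)
  have fin_mult: "fin f \<Longrightarrow> fin (\<lambda>t. c * f t)" for f c
    unfolding fin_def by (erule finite_subset[rotated]) auto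
  have tot_sum: "tot f = sum f I" if "finite I" "{t. f t \<noteq> 0} \<subseteq> I" for f I
    unfolding tot_def by (rule sum_support[OF that])
  have tot_add: "tot (\<lambda>t. f t + g t) = tot f + tot g" if "fin f" "fin g" for f g
  proof -
    let ?I = "{i. f i \<noteq> 0} \<union> {i. g i \<noteq> 0}"
    have "finite ?I" using that by (simp add: fin_def)
    then show ?thesis using tot_sum[of ?I f] tot_sum[of ?I g] tot_sum[of ?I "\<lambda>t. f t + g t"]
      by (force simp: sum.distrib)
  qed
  have tot_mult: "tot (\<lambda>t. c * f t) = c * tot f" if "fin f" for f c
    using tot_sum[of "{t. f t \<noteq> 0}" "\<lambda>t. c * f t"] that by (auto simp: tot_def fin_def sum_distrib_left)
  have D_fin: "D f \<in> carrier ?X" if "fin f" for f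
  proof -
    have "{t. f (t + g) \<noteq> 0} = (\<lambda>t. t - g) ` {t. f t \<noteq> 0}" for g
      by (force simp: image_iff intro!: exI[of _ "_ + g"])
    then have "finite (SIGMA g:F. {t. f (t + g) \<noteq> 0} \<union> {t. f t \<noteq> 0})"
      using that F by (auto simp: fin_def)
    then have "finite {x. D f x \<noteq> 0}"
      by (rule finite_subset[rotated]) (auto simp: D_def split: if_splits)
    then show ?thesis by (simp add: finite_functions_simps)
  qed
  have D_add: "D (\<lambda>t. f t + g t) = D f \<oplus>\<^bsub>?X\<^esub> D g" for f g
    by (auto simp: D_def finite_functions_simps fun_eq_iff)
  have D_mult: "D (\<lambda>t. c * f t) = c \<odot>\<^bsub>?X\<^esub> D f" for f c
    by (auto simp: D_def finite_functions_simps fun_eq_iff algebra_simps)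
  \<comment> \<open>Dividing f by its total gives a candidate with total 1; as it must fail, one of
    its differences exceeds \<epsilon>.\<close>
  have key: "cmod (tot f) \<le> (1 / \<epsilon>) * nrm ?X (D f)" if f: "fin f" for f
  proof (cases "tot f = 0")
    case True
    then show ?thesis using X.nrm_nonneg[OF D_fin[OF f]] \<epsilon> by simp
  next
    case False
    define h where "h t = (1 / tot f) * f t" for t
    have h: "fin h" unfolding h_def[abs_def] by (rule fin_mult[OF f])
    have h1: "tot h = 1" unfolding h_def[abs_def] tot_mult[OF f] using False by simp
    have "\<exists>g I. g \<in> F \<and> finite I \<and> \<epsilon> < (\<Sum>t\<in>I. cmod (h (t + g) - h t))"
      using no obtains_rule[of h] h h1 unfolding fin_def tot_def by (meson not_le)
    then obtain g I where g: "g \<in> F" "finite I" "\<epsilon> < (\<Sum>t\<in>I. cmod (h (t + g) - h t))" by blast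
    let ?J = "{x. D h x \<noteq> 0} \<union> (Pair g ` I)"
    have J: "finite ?J" using D_fin[OF h] g(2) by (simp add: finite_functions_simps)
    have "(\<Sum>t\<in>I. cmod (h (t + g) - h t)) = (\<Sum>x\<in>Pair g ` I. cmod (D h x))"
      using g(1) by (subst sum.reindex) (auto simp: D_def inj_on_def)
    also have "\<dots> \<le> (\<Sum>x\<in>?J. cmod (D h x))" using J by (intro sum_mono2) auto
    also have "\<dots> = nrm ?X (D h)" using J by (intro finite_functions_nrm[symmetric]) auto
    also have "D h = (1 / tot f) \<odot>\<^bsub>?X\<^esub> D f" unfolding h_def[abs_def] by (rule D_mult)
    finally have "\<epsilon> < cmod (1 / tot f) * nrm ?X (D f)"
      using g(3) X.nrm_smult[OF D_fin[OF f]] by simp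
    then show ?thesis using False \<epsilon> by (simp add: norm_divide field_simps)
  qed
  let ?U = "D ` Collect fin"
  \<comment> \<open>By \<open>key\<close>, functions with the same differences have the same total,
    so the choice is harmless.\<close>
  define L where "L u = tot (SOME f. fin f \<and> u = D f)" for u
  have L: "L (D f) = tot f" if f: "fin f" for f
  proof -
    define f' where "f' = (SOME f'. fin f' \<and> D f = D f')"
    have f': "fin f'" "D f = D f'" unfolding f'_def using someI[of "\<lambda>f'. fin f' \<and> D f = D f'" f] f by auto
    have "fin (\<lambda>t. f t + (-1) * f' t)" by (intro fin_add f fin_mult f')
    moreover have "D (\<lambda>t. f t + (-1) * f' t) = \<zero>\<^bsub>?X\<^esub>"
      using f'(2) by (simp only: D_add D_mult) (auto simp: finite_functions_simps)
    ultimately have "tot (\<lambda>t. f t + (-1) * f' t) = 0" using key by fastforce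
    then have "tot f = tot f'" using tot_add[OF f fin_mult[OF f'(1), of "-1"]] tot_mult[OF f'(1), of "-1"] by simp
    then show ?thesis by (simp add: L_def f'_def)
  qed
  have U1: "u \<oplus>\<^bsub>?X\<^esub> v \<in> ?U \<and> L (u \<oplus>\<^bsub>?X\<^esub> v) = L u + L v" if uv: "u \<in> ?U" "v \<in> ?U" for u v
  proof -
    obtain f g where fg: "fin f" "fin g" "u = D f" "v = D g" using uv by blast
    have "u \<oplus>\<^bsub>?X\<^esub> v = D (\<lambda>t. f t + g t)" by (simp only: D_add fg)
    then show ?thesis using fg L fin_add[OF fg(1,2)] tot_add[OF fg(1,2)] by auto
  qed
  have U2: "c \<odot>\<^bsub>?X\<^esub> u \<in> ?U \<and> L (c \<odot>\<^bsub>?X\<^esub> u) = c * L u" if u: "u \<in> ?U" for u c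
  proof -
    obtain f where f: "fin f" "u = D f" using u by blast
    have "c \<odot>\<^bsub>?X\<^esub> u = D (\<lambda>t. c * f t)" by (simp only: D_mult f)
    then show ?thesis using f L fin_mult[OF f(1)] tot_mult[OF f(1)] by auto
  qed
  have "fin (\<lambda>t. 0)" by (simp add: fin_def)
  then have ne: "?U \<noteq> {}" by blast
  have "\<exists>H. bounded_map ?X complex_space (1 / \<epsilon>) H \<and> (\<forall>u\<in>?U. H u = L u)"
  proof (rule X.hahn_banach[of "1 / \<epsilon>" ?U L])
    show "0 \<le> 1 / \<epsilon>" using \<epsilon> by simp
    show "?U \<subseteq> carrier ?X" using D_fin by auto
    show "?U \<noteq> {}" by (rule ne)
    fix u assume u: "u \<in> ?U"
    show "c \<odot>\<^bsub>?X\<^esub> u \<in> ?U" "L (c \<odot>\<^bsub>?X\<^esub> u) = c * L u" for c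
      by (rule conjunct1[OF U2[OF u]], rule conjunct2[OF U2[OF u]])
    obtain f where f: "fin f" "u = D f" using u by blast
    show "cmod (L u) \<le> 1 / \<epsilon> * nrm ?X u" using key[OF f(1)] L[OF f(1)] f(2) by simp
    fix v assume v: "v \<in> ?U"
    show "u \<oplus>\<^bsub>?X\<^esub> v \<in> ?U" "L (u \<oplus>\<^bsub>?X\<^esub> v) = L u + L v"
      by (rule conjunct1[OF U1[OF u v]], rule conjunct2[OF U1[OF u v]])
  next
    fix H assume "bounded_map ?X complex_space (1 / \<epsilon>) H" "\<And>u. u \<in> ?U \<Longrightarrow> H u = L u"
    then show ?thesis by (intro exI[of _ H] conjI ballI)
  qed
  then obtain H where H: "bounded_map ?X complex_space (1 / \<epsilon>) H" and "\<forall>u\<in>?U. H u = L u"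
    by (elim exE conjE)
  from bspec[OF this(2)] have H2: "H u = L u" if "u \<in> ?U" for u using that .
  note HD = bounded_mapD[OF H]
  define \<delta> where "\<delta> x = (\<lambda>y. if y = x then 1 else 0 :: complex)" for x :: "'g \<times> 'g"
  have \<delta>: "\<delta> x \<in> carrier ?X" "nrm ?X (\<delta> x) = 1" for x
  proof -
    have supp: "\<delta> x y \<noteq> 0 \<longleftrightarrow> y = x" for y by (simp add: \<delta>_def)
    have "{y. \<delta> x y \<noteq> 0} = {x}" using supp by blast
    then show "\<delta> x \<in> carrier ?X" by (simp add: finite_functions_simps)
    have "nrm ?X (\<delta> x) = (\<Sum>y\<in>{x}. cmod (\<delta> x y))"
      by (rule finite_functions_nrm) (use supp in auto)
    then show "nrm ?X (\<delta> x) = 1" by (simp add: \<delta>_def)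
  qed
  \<comment> \<open>The extension is read off at point masses, which have norm 1; so each
    \<open>w g\<close> is a bounded function.\<close>
  define w where "w g t = H (\<delta> (g, t))" for g t
  have w: "bounded_fun (w g)" for g
    unfolding bounded_fun_def w_def using HD(4)[OF \<delta>(1)] \<delta>(2) by auto
  have wshift: "bounded_fun (\<lambda>t. w g (t - g'))" for g g' using w unfolding bounded_fun_def by metis
  have H_sum: "H (\<lambda>y. \<Sum>g\<in>F'. \<delta> (g, t - g) y - \<delta> (g, t) y) = (\<Sum>g\<in>F'. w g (t - g) - w g t)
      \<and> (\<lambda>y. \<Sum>g\<in>F'. \<delta> (g, t - g) y - \<delta> (g, t) y) \<in> carrier ?X" if "finite F'" for F' t
    using that
  proof (induction F')
    case empty
    show ?case
      using linear_map_zero[OF X.seminormed_space_axioms _ conjunct1[OF H[unfolded bounded_map_def]]]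
        normed_complex_space X.zero_closed by (simp add: finite_functions_simps normed_space_def)
  next
    case (insert g F')
    let ?d = "\<delta> (g, t - g) \<oplus>\<^bsub>?X\<^esub> (-1) \<odot>\<^bsub>?X\<^esub> \<delta> (g, t)"
    let ?s = "\<lambda>y. \<Sum>g\<in>F'. \<delta> (g, t - g) y - \<delta> (g, t) y"
    have d: "?d \<in> carrier ?X" "H ?d = w g (t - g) - w g t"
      using HD(2)[OF \<delta>(1) X.sm_closed[OF \<delta>(1)], of "(g, t - g)" "-1" "(g, t)"] HD(3)[OF \<delta>(1), of "-1"] \<delta>(1)
      by (auto simp: w_def)
    have eq: "(\<lambda>y. \<Sum>g\<in>insert g F'. \<delta> (g, t - g) y - \<delta> (g, t) y) = ?d \<oplus>\<^bsub>?X\<^esub> ?s"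
      using insert.hyps by (auto simp: finite_functions_simps fun_eq_iff)
    have s: "?s \<in> carrier ?X" "H ?s = (\<Sum>g\<in>F'. w g (t - g) - w g t)" using insert.IH by auto
    show ?case
      unfolding eq using HD(2)[OF d(1) s(1)] d s insert.hyps X.a_closed[OF d(1) s(1)] by simp
  qed
  \<comment> \<open>The point mass at t has total 1, and its difference for g is the point mass at t
    - g minus the one at t.\<close>
  have one_eq: "1 = (\<Sum>g\<in>F. w g (t - g) - w g t)" for t
  proof -
    let ?f = "\<lambda>s. if s = t then 1 else 0 :: complex"
    have f: "fin ?f" "tot ?f = 1" using tot_sum[of "{t}" ?f] by (auto simp: fin_def)
    have "D ?f = (\<lambda>y. \<Sum>g\<in>F. \<delta> (g, t - g) y - \<delta> (g, t) y)"
    proof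
      fix y :: "'g \<times> 'g"
      obtain a b where y: "y = (a, b)" by (cases y)
      have ab: "b + a = t \<longleftrightarrow> b = t - a" by (auto simp: algebra_simps)
      show "D ?f y = (\<Sum>g\<in>F. \<delta> (g, t - g) y - \<delta> (g, t) y)"
      proof (cases "a \<in> F")
        case True
        have "(\<Sum>g\<in>F. \<delta> (g, t - g) y - \<delta> (g, t) y) = (\<Sum>g\<in>{a}. \<delta> (g, t - g) y - \<delta> (g, t) y)"
          using F True by (intro sum.mono_neutral_right) (auto simp: \<delta>_def y)
        then show ?thesis using True ab by (auto simp: D_def \<delta>_def y)
      next
        case False
        then have "(\<Sum>g\<in>F. \<delta> (g, t - g) y - \<delta> (g, t) y) = (\<Sum>g\<in>F. 0)"
          by (intro sum.cong) (auto simp: \<delta>_def y)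
        then show ?thesis using False by (simp add: D_def y)
      qed
    qed
    then have "H (D ?f) = (\<Sum>g\<in>F. w g (t - g) - w g t)" using H_sum[OF F] by simp
    moreover have "H (D ?f) = 1" using H2[of "D ?f"] L[OF f(1)] f by simp
    ultimately show ?thesis by simp
  qed
  have \<Phi>_sum: "\<Phi> (\<lambda>t. \<Sum>g\<in>F'. w g (t - g) - w g t) = 0 \<and> bounded_fun (\<lambda>t. \<Sum>g\<in>F'. w g (t - g) - w g t)"
    if "finite F'" for F'
    using that
  proof (induction F')
    case empty
    show ?case using cmult[OF bounded_fun_const[of 1], of 0] bounded_fun_const[of 0] by simp
  next
    case (insert g F')
    have m: "bounded_fun (\<lambda>t. (-1) * w g t)" by (rule bounded_fun_mult[OF w])
    have d: "bounded_fun (\<lambda>t. w g (t - g) + (-1) * w g t)" by (rule bounded_fun_add[OF wshift m])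
    have "\<Phi> (\<lambda>t. w g (t - g) + (-1) * w g t) = 0"
      using add[OF wshift m, of g g] inv[OF w, of g g] cmult[OF w, of "-1" g] by simp
    then show ?case
      using add[OF d, of "\<lambda>t. \<Sum>g\<in>F'. w g (t - g) - w g t"] insert
        bounded_fun_add[OF d, of "\<lambda>t. \<Sum>g\<in>F'. w g (t - g) - w g t"] by simp
  qed
  \<comment> \<open>Each summand is a translate of \<open>w g\<close> minus \<open>w g\<close>, so
    \<Phi> sends the constant 1 to 0.\<close>
  have "(\<lambda>t. \<Sum>g\<in>F. w g (t - g) - w g t) = (\<lambda>t. 1)" using one_eq by auto
  then show False using \<Phi>_sum[OF F] one by simp
qed

text \<open>Discreteness enters as positive mass of the identity, the exact opposite of the
  hypothesis of \<open>nondiscrete_not_reflexive\<close>; its topological form is derived in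
  \<open>discrete\<close>.\<close>

locale discrete_algebra = convolution_algebra \<mu> p S A
  for \<mu> :: "'g::{topological_group_add, t2_space} measure" and p S A +
  assumes atom: "emeasure \<mu> {0} \<noteq> 0"
begin

section \<open>Functions, translations and coefficients on a discrete group\<close>

definition "c = measure \<mu> {0}"

lemma singleton: "emeasure \<mu> {t} = ennreal c"
proof -
  have "{s. - t + s \<in> {0}} = {t}"
    by (auto simp: eq_neg_iff_add_eq_0 add_eq_0_iff neg_eq_iff_add_eq_0)
  then have "emeasure \<mu> {t} = emeasure \<mu> {0}" using emeasure_shift[of "{0}" "- t"] by simp
  also have "\<dots> = ennreal c"
    unfolding c_def using finite_compact[of "{0}"] by (intro emeasure_eq_ennreal_measure) auto
  finally show ?thesis .
qed

lemma c_pos: "c > 0"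
  using singleton[of 0] atom by (cases "c > 0") (auto simp: ennreal_neg not_less)

lemma emeasure_finite: "finite F \<Longrightarrow> emeasure \<mu> F = ennreal (c * card F)"
  using emeasure_eq_sum_singleton[of F \<mu>] singleton c_pos
  by (simp add: ennreal_mult' mult.commute ennreal_of_nat_eq_real_of_nat)

text \<open>A compact neighbourhood has finite mass while each point weighs \<open>c\<close>, so it
  is finite; removing its other points leaves the identity open.\<close>

lemma discrete: "open (B :: 'g set)"
proof -
  obtain U K :: "'g set" where U: "open U" "compact K" "0 \<in> U" "U \<subseteq> K" by (rule compact_nbhd_exists)
  have "finite K"
  proof (rule ccontr)
    assume K: "infinite K"
    obtain r where r: "emeasure \<mu> K = ennreal r" "r \<ge> 0"
      using finite_compact[OF U(2)] by (cases "emeasure \<mu> K") auto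
    obtain n :: nat where n: "r / c < n" using reals_Archimedean2 by blast
    obtain F where F: "finite F" "card F = n" "F \<subseteq> K" using infinite_arbitrarily_large[OF K] by blast
    have "ennreal (c * n) \<le> ennreal r"
      using emeasure_mono[OF F(3), of \<mu>] emeasure_finite[OF F(1)] F(2) r U(2) by simp
    then have "c * n \<le> r" using r(2) by simp
    then show False using n c_pos by (simp add: field_simps)
  qed
  then have "finite (U - {0})" using U(4) finite_subset by blast
  then have "open (U - (U - {0}))" using U(1) by (intro open_Diff finite_imp_closed)
  moreover have "U - (U - {0}) = {0}" using U(3) by auto
  ultimately have 0: "open {0::'g}" by simp
  have "open {t}" for t :: 'g
  proof -
    have "{s. - t + s \<in> {0}} = {t}"
      by (auto simp: eq_neg_iff_add_eq_0 add_eq_0_iff neg_eq_iff_add_eq_0)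
    then show ?thesis using open_shift_vimage(4)[OF 0, of t] by simp
  qed
  then have "open (\<Union>t\<in>B. {t})" by blast
  then show ?thesis by simp
qed

lemma borel_all [simp]: "(B :: 'g set) \<in> sets borel"
  using discrete by simp

lemma measurable_all [simp]: "f \<in> borel_measurable \<mu>"
  by (simp add: measurable_def)

text \<open>A null set cannot contain a point. Hence a class in \<open>Lp\<close> has exactly one
  representative, and evaluation at a point makes sense on classes.\<close>

lemma AE_all: "(AE t in \<mu>. P t) \<longleftrightarrow> (\<forall>t. P t)"
proof
  assume "AE t in \<mu>. P t"
  then obtain N where N: "{t. \<not> P t} \<subseteq> N" "emeasure \<mu> N = 0" by (auto elim!: AE_E)
  show "\<forall>t. P t"
  proof (rule ccontr)
    assume "\<not> (\<forall>t. P t)"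
    then obtain t where "t \<in> N" using N(1) by blast
    then have "emeasure \<mu> {t} \<le> emeasure \<mu> N" by (intro emeasure_mono) auto
    then show False using N(2) singleton[of t] c_pos by simp
  qed
qed auto

text \<open>The measure is \<open>c\<close> times counting measure, so every bijection preserves it
  and no modular function appears.\<close>

lemma emeasure_right_shift: "emeasure \<mu> {s. s + g \<in> B} = emeasure \<mu> B"
proof -
  have eq: "{s. s + g \<in> B} = (\<lambda>s. s - g) ` B" by (force simp: image_iff)
  have inj: "inj_on (\<lambda>s. s - g) B" by (auto simp: inj_on_def)
  show ?thesis
  proof (cases "finite B")
    case True
    then show ?thesis using emeasure_finite card_image[OF inj] by (simp add: eq)
  next
    case False
    have top: "emeasure \<mu> B = \<infinity>" if B: "infinite B" for B
    proof (rule ccontr)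
      assume "emeasure \<mu> B \<noteq> \<infinity>"
      then obtain r where r: "emeasure \<mu> B = ennreal r" "r \<ge> 0" by (cases "emeasure \<mu> B") auto
      obtain n :: nat where n: "r / c < n" using reals_Archimedean2 by blast
      obtain F where F: "finite F" "card F = n" "F \<subseteq> B" using infinite_arbitrarily_large[OF B] by blast
      have "ennreal (c * n) \<le> ennreal r"
        using emeasure_mono[OF F(3), of \<mu>] emeasure_finite[OF F(1)] F(2) r by simp
      then have "c * n \<le> r" using r(2) by simp
      then show False using n c_pos by (simp add: field_simps)
    qed
    from top[OF False] top[of "(\<lambda>s. s - g) ` B"] show ?thesis
      using False finite_image_iff[OF inj] by (simp add: eq)
  qed
qed

lemma distr_right_shift: "distr \<mu> \<mu> (\<lambda>s. s + g) = \<mu>"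
  by (rule measure_eqI) (auto simp: emeasure_distr vimage_def emeasure_right_shift measurable_def)

lemma distr_left_shift: "distr \<mu> \<mu> (\<lambda>s. g + s) = \<mu>"
  by (rule measure_eqI) (auto simp: emeasure_distr vimage_def emeasure_shift measurable_def)

lemma integral_finite_support:
  fixes f :: "'g \<Rightarrow> complex"
  assumes "finite F" "\<And>t. f t \<noteq> 0 \<Longrightarrow> t \<in> F"
  shows "integrable \<mu> f" "(\<integral>t. f t \<partial>\<mu>) = complex_of_real c * (\<Sum>t\<in>F. f t)"
proof -
  have eq: "f = (\<lambda>s. \<Sum>t\<in>F. indicator {t} s *\<^sub>R f t)"
  proof
    fix s
    show "f s = (\<Sum>t\<in>F. indicator {t} s *\<^sub>R f t)"
    proof (cases "s \<in> F")
      case True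
      then have "(\<Sum>t\<in>F. indicator {t} s *\<^sub>R f t) = (\<Sum>t\<in>{s}. indicator {t} s *\<^sub>R f t)"
        using assms(1) by (intro sum.mono_neutral_right) auto
      then show ?thesis by simp
    next
      case False
      then have "(\<Sum>t\<in>F. indicator {t} s *\<^sub>R f t) = (\<Sum>t\<in>F. 0)"
        by (intro sum.cong) (auto split: split_indicator)
      then show ?thesis using False assms(2) by auto
    qed
  qed
  have i: "integrable \<mu> (\<lambda>s. indicator {t} s *\<^sub>R f t)" for t
    using singleton by (intro integrable_scaleR_left integrable_real_indicator) auto
  have m: "measure \<mu> {t} = c" for t using singleton c_pos by (simp add: measure_def)
  show "integrable \<mu> f" by (subst eq) (intro Bochner_Integration.integrable_sum i)
  have "(\<integral>t. f t \<partial>\<mu>) = (\<Sum>t\<in>F. \<integral>s. indicator {t} s *\<^sub>R f t \<partial>\<mu>)"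
    by (subst eq) (intro Bochner_Integration.integral_sum i)
  also have "\<dots> = (\<Sum>t\<in>F. complex_of_real c * f t)"
    by (rule sum.cong[OF refl]) (simp add: m scaleR_conv_of_real)
  finally show "(\<integral>t. f t \<partial>\<mu>) = complex_of_real c * (\<Sum>t\<in>F. f t)" by (simp add: sum_distrib_left)
qed

lemma integral_finite_support_real:
  fixes f :: "'g \<Rightarrow> real"
  assumes "finite F" "\<And>t. f t \<noteq> 0 \<Longrightarrow> t \<in> F"
  shows "integrable \<mu> f" "(\<integral>t. f t \<partial>\<mu>) = c * (\<Sum>t\<in>F. f t)"
proof -
  have F: "complex_of_real (f t) \<noteq> 0 \<Longrightarrow> t \<in> F" for t using assms(2) by simp
  note I = integral_finite_support[OF assms(1), of "\<lambda>t. complex_of_real (f t)", OF F]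
  show "integrable \<mu> f" using integrable_Re[OF I(1)] by simp
  have "complex_of_real (\<integral>t. f t \<partial>\<mu>) = complex_of_real (c * (\<Sum>t\<in>F. f t))"
    using I(2) integral_complex_of_real[of \<mu> f] by simp
  then show "(\<integral>t. f t \<partial>\<mu>) = c * (\<Sum>t\<in>F. f t)" by (simp only: of_real_eq_iff)
qed

lemma LF_finite_support:
  assumes "finite F" "\<And>t. f t \<noteq> 0 \<Longrightarrow> t \<in> F"
  shows "f \<in> carrier LF"
  using assms p_gt_1 by (intro LF_I integral_finite_support_real(1)[of F]) auto

lemma repr_cls_eq: "f \<in> carrier LF \<Longrightarrow> repr (cls f) = f"
  using repr_cls(2) by (auto simp: AE_all)

lemma LF_right_shift: "f \<in> carrier LF \<Longrightarrow> (\<lambda>t. f (t + g)) \<in> carrier LF"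
  using integrable_distr_eq[of "\<lambda>s. s + g" \<mu> \<mu> "\<lambda>t. cmod (f t) powr p"] distr_right_shift[of g]
  by (auto simp: Lp_functions_simps measurable_def)

lemma LF_left_shift:
  assumes "f \<in> carrier LF"
  shows "(\<lambda>t. f (g + t)) \<in> carrier LF" "nrm LF (\<lambda>t. f (g + t)) = nrm LF f"
  using assms integrable_distr_eq[of "\<lambda>s. g + s" \<mu> \<mu> "\<lambda>t. cmod (f t) powr p"] distr_left_shift[of g]
    integral_distr[of "\<lambda>s. g + s" \<mu> \<mu> "\<lambda>t. cmod (f t) powr p"]
  by (auto simp: Lp_functions_simps measurable_def)

lemma LF_point:
  assumes "f \<in> carrier LF"
  shows "c * cmod (f t) powr p \<le> nrm LF f powr p"
proof -
  have "(\<integral>s. indicator {t} s * cmod (f t) powr p \<partial>\<mu>) \<le> (\<integral>s. cmod (f s) powr p \<partial>\<mu>)"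
    using LF_D(2)[OF assms] singleton
    by (intro integral_mono) (auto split: split_indicator)
  moreover have "measure \<mu> {t} = c" using singleton c_pos by (simp add: measure_def)
  ultimately show ?thesis using nrm_LF_powr[OF assms] by simp
qed

definition ev :: "'g \<Rightarrow> ('g \<Rightarrow> complex) set \<Rightarrow> complex" where "ev t z = repr z t"

lemma ev_cls [simp]: "f \<in> carrier LF \<Longrightarrow> ev t (cls f) = f t"
  by (simp add: ev_def repr_cls_eq)

lemma LS_eq_iff: "x \<in> carrier LS \<Longrightarrow> y \<in> carrier LS \<Longrightarrow> x = y \<longleftrightarrow> (\<forall>t. ev t x = ev t y)"
  unfolding ev_def by (metis cls_repr ext)

lemma LS_cases:
  assumes "x \<in> carrier LS"
  obtains f where "f \<in> carrier LF" "x = cls f"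
  using assms unfolding LS_simps by blast

lemma cls_add: "f \<in> carrier LF \<Longrightarrow> g \<in> carrier LF \<Longrightarrow> cls f \<oplus>\<^bsub>LS\<^esub> cls g = cls (\<lambda>t. f t + g t)"
  and cls_smult: "f \<in> carrier LF \<Longrightarrow> a \<odot>\<^bsub>LS\<^esub> cls f = cls (\<lambda>t. a * f t)"
  using LS_simps(3,4)[of f] by (simp_all add: Lp_functions_simps(3,4))

lemma ev_bounded: "bounded_map LS complex_space ((1 / c) powr (1/p)) (ev t)"
proof (rule bounded_mapI)
  fix x assume "x \<in> carrier LS"
  then obtain f where f: "f \<in> carrier LF" "x = cls f" by (rule LS_cases)
  show "ev t (a \<odot>\<^bsub>LS\<^esub> x) = a \<odot>\<^bsub>complex_space\<^esub> ev t x" for a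
    using f LF_smult(1)[OF f(1)] by (simp add: cls_smult)
  have "cmod (f t) powr p \<le> (1 / c) * nrm LF f powr p"
    using LF_point[OF f(1), of t] c_pos by (simp add: field_simps)
  then have "(cmod (f t) powr p) powr (1/p) \<le> ((1 / c) * nrm LF f powr p) powr (1/p)"
    using p_gt_1 by (intro powr_mono2) auto
  then have "cmod (f t) \<le> (1 / c) powr (1/p) * nrm LF f"
    using p_gt_1 c_pos LF.nrm_nonneg[OF f(1)] by (simp add: powr_divide powr_powr)
  then show "nrm complex_space (ev t x) \<le> (1 / c) powr (1/p) * nrm LS x"
    using f by (simp add: LS_simps)
  fix y assume "y \<in> carrier LS"
  then obtain g where g: "g \<in> carrier LF" "y = cls g" by (rule LS_cases)
  show "ev t (x \<oplus>\<^bsub>LS\<^esub> y) = ev t x \<oplus>\<^bsub>complex_space\<^esub> ev t y"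
    using f g LF_add[OF f(1) g(1)] by (simp add: cls_add)
qed simp

definition \<delta> :: "'g \<Rightarrow> 'g \<Rightarrow> complex" where "\<delta> g = (\<lambda>t. if t = g then 1 else 0)"

lemma \<delta>_LF: "\<delta> g \<in> carrier LF"
  by (rule LF_finite_support[of "{g}"]) (auto simp: \<delta>_def split: if_splits)

text \<open>Left translation by g. The division by \<open>c\<close> cancels the mass of the point g
  in the convolution integral.\<close>

definition lam :: "'g \<Rightarrow> ('g \<Rightarrow> complex) set \<Rightarrow> ('g \<Rightarrow> complex) set" where
  "lam g = left_regular \<mu> p (\<lambda>t. \<delta> g t / complex_of_real c)"

lemma lam_cls:
  assumes "f \<in> carrier LF"
  shows "lam g (cls f) = cls (\<lambda>t. f (- g + t))"
proof -
  have "convolution \<mu> (\<lambda>t. \<delta> g t / complex_of_real c) f = (\<lambda>t. f (- g + t))"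
  proof
    fix t
    have "(\<integral>s. \<delta> g s / complex_of_real c * f (- s + t) \<partial>\<mu>) =
        complex_of_real c * (\<Sum>s\<in>{g}. \<delta> g s / complex_of_real c * f (- s + t))"
      by (rule integral_finite_support(2)) (simp_all add: \<delta>_def split: if_splits)
    then show "convolution \<mu> (\<lambda>t. \<delta> g t / complex_of_real c) f t = f (- g + t)"
      using c_pos by (simp add: convolution_def \<delta>_def)
  qed
  then show ?thesis using assms cls_closed[OF assms] by (simp add: lam_def left_regular_def repr_cls_eq[OF assms])
qed

lemma lam_bounded: "bounded_map LS LS 1 (lam g)"
proof (rule bounded_mapI)
  fix x assume "x \<in> carrier LS"
  then obtain f where f: "f \<in> carrier LF" "x = cls f" by (rule LS_cases)
  note s = LF_left_shift[OF f(1), of "- g"]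
  show "lam g x \<in> carrier LS" "nrm LS (lam g x) \<le> 1 * nrm LS x"
    using f s by (simp_all add: lam_cls cls_closed LS_simps)
  show "lam g (a \<odot>\<^bsub>LS\<^esub> x) = a \<odot>\<^bsub>LS\<^esub> lam g x" for a
    using f s LF_smult(1)[OF f(1)] by (simp add: cls_smult lam_cls)
  fix y assume "y \<in> carrier LS"
  then obtain h where h: "h \<in> carrier LF" "y = cls h" by (rule LS_cases)
  show "lam g (x \<oplus>\<^bsub>LS\<^esub> y) = lam g x \<oplus>\<^bsub>LS\<^esub> lam g y"
    using f h s LF_left_shift[OF h(1), of "- g"] LF_add[OF f(1) h(1)] by (simp add: cls_add lam_cls)
qed

lemma lam_S: "lam g \<in> S" and lam_nrm: "nrm A (lam g) \<le> 1"
proof -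
  have "lam g \<in> carrier (bounded_operators LS LS)"
    using lam_bounded by (auto simp: bounded_operators_iff lam_def left_regular_def)
  moreover have "integrable \<mu> (\<lambda>t. \<delta> g t / complex_of_real c)"
    by (rule integral_finite_support(1)[of "{g}"]) (auto simp: \<delta>_def split: if_splits)
  ultimately show "lam g \<in> S" using left_regular_in_PF PF_S unfolding lam_def by blast
  show "nrm A (lam g) \<le> 1"
    unfolding A_simps using bounded_mapD(4)[OF lam_bounded]
    by (intro opnorm_bound[OF LS.seminormed_space_axioms LS.normed_space_axioms]) auto
qed

lemma lam_mult: "lam g \<otimes>\<^bsub>A\<^esub> lam h = lam (g + h)"
proof (rule A_eqI)
  show "lam g \<otimes>\<^bsub>A\<^esub> lam h \<in> S" using S_closed(5)[OF lam_S lam_S] by (simp add: A_simps)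
  fix x assume x: "x \<in> carrier LS"
  then obtain f where f: "f \<in> carrier LF" "x = cls f" by (rule LS_cases)
  have "- (g + h) + t = - h + (- g + t)" for t
    by (metis add.assoc group_add_class.minus_add)
  then show "(lam g \<otimes>\<^bsub>A\<^esub> lam h) x = lam (g + h) x"
    using A_apply(3)[OF x, of "lam g" "lam h"]
    unfolding f(2) lam_cls[OF f(1)] lam_cls[OF LF_left_shift(1)[OF f(1)]] by simp
qed (rule lam_S)

lemma lam_zero: "a \<in> S \<Longrightarrow> lam 0 \<otimes>\<^bsub>A\<^esub> a = a" "a \<in> S \<Longrightarrow> a \<otimes>\<^bsub>A\<^esub> lam 0 = a"
proof -
  have id: "lam 0 x = x" if "x \<in> carrier LS" for x
    using that by (auto elim!: LS_cases simp: lam_cls)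
  assume a: "a \<in> S"
  have S: "lam 0 \<otimes>\<^bsub>A\<^esub> a \<in> S" "a \<otimes>\<^bsub>A\<^esub> lam 0 \<in> S" using S_closed(5) lam_S a by (simp_all add: A_simps)
  show "lam 0 \<otimes>\<^bsub>A\<^esub> a = a"
    by (rule A_eqI[OF S(1) a]) (use a OA_apply_le(1) in \<open>simp add: A_apply id\<close>)
  show "a \<otimes>\<^bsub>A\<^esub> lam 0 = a"
    by (rule A_eqI[OF S(2) a]) (simp add: A_apply id)
qed

definition rho :: "'g \<Rightarrow> ('g \<Rightarrow> complex) set \<Rightarrow> ('g \<Rightarrow> complex) set" where "rho = right_translation \<mu> p"

lemma rho_cls: "f \<in> carrier LF \<Longrightarrow> rho g (cls f) = cls (\<lambda>t. f (t + g))"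
  using cls_closed by (simp add: rho_def right_translation_def repr_cls_eq)

lemma rho_closed: "x \<in> carrier LS \<Longrightarrow> rho g x \<in> carrier LS"
  by (auto elim!: LS_cases simp: rho_cls cls_closed LF_right_shift)

lemma S_rho:
  assumes "a \<in> S" "x \<in> carrier LS"
  shows "a (rho g x) = rho g (a x)"
proof -
  have "compose (carrier LS) a (rho g) = compose (carrier LS) (rho g) a"
    using assms(1) S_CV by (auto simp: CV_def rho_def operator_algebra_simps)
  from fun_cong[OF this, of x] show ?thesis using assms(2) by (simp add: compose_def)
qed

lemma ev_rho: "x \<in> carrier LS \<Longrightarrow> ev t (rho g x) = ev (t + g) x"
  by (auto elim!: LS_cases simp: rho_cls LF_right_shift)

lemma ev_lam: "x \<in> carrier LS \<Longrightarrow> ev t (lam g x) = ev (- g + t) x"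
  by (auto elim!: LS_cases simp: lam_cls LF_left_shift)

text \<open>The entry of the matrix of a in row g and column 0. Commutation with right translations
  makes the other columns translates of this one.\<close>

definition coeff :: "'g \<Rightarrow> (('g \<Rightarrow> complex) set \<Rightarrow> ('g \<Rightarrow> complex) set) \<Rightarrow> complex" where
  "coeff g a = ev g (a (cls (\<delta> 0)))"

lemma coeff_bounded: "\<exists>K. bounded_map A complex_space K (coeff g)"
  unfolding coeff_def[abs_def]
  using coefficient_functional[OF ev_bounded _ cls_closed[OF \<delta>_LF]] c_pos by (intro exI) simp

lemma coeff_lam: "coeff g (lam h) = \<delta> h g"
proof -
  have "coeff g (lam h) = \<delta> 0 (- h + g)"
    unfolding coeff_def lam_cls[OF \<delta>_LF] by (rule ev_cls[OF LF_left_shift(1)[OF \<delta>_LF]])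
  moreover have "- h + g = 0 \<longleftrightarrow> g = h" by (metis add.right_neutral add_minus_cancel left_minus)
  ultimately show ?thesis by (simp only: \<delta>_def)
qed

text \<open>The coefficients of a are the values of a p-integrable function, and all points have the
  same mass, so they can reach e only finitely often.\<close>

lemma coeff_vanish:
  assumes "a \<in> S" "e > 0"
  shows "finite {g. e \<le> cmod (coeff g a)}"
proof (rule ccontr)
  assume inf: "infinite {g. e \<le> cmod (coeff g a)}"
  have ax: "a (cls (\<delta> 0)) \<in> carrier LS" using OA_apply_le(1)[OF assms(1)] cls_closed[OF \<delta>_LF] by blast
  then obtain f where f: "f \<in> carrier LF" "a (cls (\<delta> 0)) = cls f" by (rule LS_cases)
  have cf: "coeff g a = f g" for g using f by (simp add: coeff_def)
  define I where "I = (\<integral>t. cmod (f t) powr p \<partial>\<mu>)"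
  obtain n :: nat where n: "I / (c * e powr p) < n" using reals_Archimedean2 by blast
  obtain F where F: "finite F" "card F = n" "F \<subseteq> {g. e \<le> cmod (coeff g a)}"
    using infinite_arbitrarily_large[OF inf] by blast
  have le: "(\<integral>t. indicator F t * e powr p \<partial>\<mu>) \<le> I"
    unfolding I_def
  proof (rule integral_mono)
    show "integrable \<mu> (\<lambda>t. indicator F t * e powr p)"
      by (rule integral_finite_support_real(1)[OF F(1)]) (auto simp: indicator_def split: if_splits)
    show "integrable \<mu> (\<lambda>t. cmod (f t) powr p)" by (rule LF_D(2)[OF f(1)])
    show "indicator F t * e powr p \<le> cmod (f t) powr p" for t
      using F(3) assms(2) p_gt_1 cf by (auto split: split_indicator intro!: powr_mono2)
  qed
  have I1: "(\<integral>t. indicator F t * e powr p \<partial>\<mu>) = c * (\<Sum>t\<in>F. indicator F t * e powr p)"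
    by (rule integral_finite_support_real(2)[OF F(1)]) (auto simp: indicator_def split: if_splits)
  have I2: "(\<Sum>t\<in>F. indicator F t * e powr p) = n * e powr p"
    using F(2) by (subst sum.cong[of F F _ "\<lambda>t. e powr p"]) auto
  have "c * (n * e powr p) \<le> I" using le unfolding I1 I2 .
  moreover have "c * e powr p > 0" using c_pos assms(2) by simp
  ultimately show False using n by (simp add: pos_divide_less_eq) (simp add: algebra_simps)
qed

theorem finite_dimensional_imp_finite:
  assumes "finite_dimensional A"
  shows "finite (UNIV :: 'g set)"
proof (rule ccontr)
  assume inf: "infinite (UNIV :: 'g set)"
  obtain n :: nat and b k where bk: "\<And>i. i < n \<Longrightarrow> b i \<in> carrier A" "\<And>i. i < n \<Longrightarrow> k i \<in> carrier (dual A)"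
    and ex: "\<And>x. x \<in> carrier A \<Longrightarrow> x = (\<Oplus>\<^bsub>A\<^esub>i\<in>{..<n}. k i x \<odot>\<^bsub>A\<^esub> b i)"
    by (rule finite_dimensional_expansion[OF A.normed_space_axioms assms]) blast
  define N where "N = (\<Sum>i<n. nrm (dual A) (k i))"
  have N: "N \<ge> 0" unfolding N_def using dual_nrm_nonneg[OF A.seminormed_space_axioms bk(2)] by (intro sum_nonneg) auto
  \<comment> \<open>Chosen so that N e < 1. Since every \<open>lam g\<close> has norm at most 1, N
    bounds the sum of the moduli of its coordinates.\<close>
  define e where "e = 1 / (N + 1)"
  have e: "e > 0" using N by (simp add: e_def)
  have "finite (\<Union>i<n. {g. e \<le> cmod (coeff g (b i))})"
    using coeff_vanish[OF _ e] bk(1) by (auto simp: A_simps)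
  \<comment> \<open>As G is infinite, some g avoids the large coefficients of all b i at
    once.\<close>
  from ex_new_if_finite[OF inf this] obtain g where "g \<notin> (\<Union>i<n. {g. e \<le> cmod (coeff g (b i))})" ..
  then have g: "cmod (coeff g (b i)) < e" if "i < n" for i using that by (simp add: not_le)
  obtain K where K: "bounded_map A complex_space K (coeff g)" using coeff_bounded by blast
  have lg: "lam g \<in> carrier A" using lam_S by (simp add: A_simps)
  have "coeff g (lam g) = (\<Sum>i<n. coeff g (k i (lam g) \<odot>\<^bsub>A\<^esub> b i))"
    using linear_map_finsum[OF A.seminormed_space_axioms _ conjunct1[OF K[unfolded bounded_map_def]],
        of "{..<n}" "\<lambda>i. k i (lam g) \<odot>\<^bsub>A\<^esub> b i"] bk(1) ex[OF lg] normed_complex_space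
    by (simp add: normed_space_def)
  also have "\<dots> = (\<Sum>i<n. k i (lam g) * coeff g (b i))"
    using bounded_mapD(3)[OF K bk(1)] by simp
  finally have "1 = cmod (\<Sum>i<n. k i (lam g) * coeff g (b i))" by (simp add: coeff_lam \<delta>_def)
  also have "\<dots> \<le> (\<Sum>i<n. nrm (dual A) (k i) * e)"
  proof (rule sum_norm_le)
    fix i assume "i \<in> {..<n}"
    then have i: "i < n" by simp
    have "cmod (k i (lam g)) \<le> nrm (dual A) (k i) * nrm A (lam g)"
      by (rule dualD(3)[OF A.seminormed_space_axioms bk(2)[OF i] lg])
    also have "\<dots> \<le> nrm (dual A) (k i) * 1"
      by (intro mult_left_mono lam_nrm dual_nrm_nonneg[OF A.seminormed_space_axioms bk(2)[OF i]])
    finally show "cmod (k i (lam g) * coeff g (b i)) \<le> nrm (dual A) (k i) * e"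
      using g[OF i] dual_nrm_nonneg[OF A.seminormed_space_axioms bk(2)[OF i]]
      unfolding norm_mult by (intro mult_mono) auto
  qed
  also have "\<dots> = N * e" by (simp add: N_def sum_distrib_right)
  also have "\<dots> < 1" using N by (simp add: e_def)
  finally show False by simp
qed

end

text \<open>The weighted geometric mean lies between x and y. This transfers an estimate for h in
  the sum norm to the product of a translate of h^(1/p) with h^(1/q).\<close>

lemma geometric_mean_between:
  fixes x y a b :: real
  assumes "0 \<le> x" "0 \<le> y" "0 < a" "0 < b" "a + b = 1"
  shows "\<bar>x - y powr a * x powr b\<bar> \<le> \<bar>x - y\<bar>"
proof -
  have sp: "z powr a * z powr b = z" if "0 \<le> z" for z :: real
    using that assms by (cases "z = 0") (simp_all flip: powr_add)
  show ?thesis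
  proof (cases "x \<le> y")
    case True
    have "x powr a * x powr b \<le> y powr a * x powr b" "y powr a * x powr b \<le> y powr a * y powr b"
      using True assms by (auto intro!: mult_right_mono mult_left_mono powr_mono2)
    then show ?thesis using True sp assms by simp
  next
    case False
    then have "y powr a * x powr b \<le> x powr a * x powr b" "y powr a * y powr b \<le> y powr a * x powr b"
      using assms by (auto intro!: mult_right_mono mult_left_mono powr_mono2)
    then show ?thesis using False sp assms by simp
  qed
qed

section \<open>From a virtual diagonal to an invariant functional\<close>

context discrete_algebra
begin

definition mul :: "('g \<Rightarrow> complex) \<Rightarrow> ('g \<Rightarrow> complex) set \<Rightarrow> ('g \<Rightarrow> complex) set" where
  "mul w x = cls (\<lambda>t. w t * repr x t)"

lemma mul_LF:
  assumes w: "\<And>t. cmod (w t) \<le> K" and f: "f \<in> carrier LF"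
  shows "(\<lambda>t. w t * f t) \<in> carrier LF" "nrm LF (\<lambda>t. w t * f t) \<le> K * nrm LF f"
proof -
  have K: "0 \<le> K" using w[of undefined] norm_ge_zero order_trans by blast
  have le: "cmod (w t * f t) powr p \<le> cmod (complex_of_real K * f t) powr p" for t
    using w[of t] K p_gt_1 by (auto simp: norm_mult intro!: powr_mono2 mult_right_mono)
  note kf = LF_smult[OF f, of "complex_of_real K"]
  have int: "integrable \<mu> (\<lambda>t. cmod (w t * f t) powr p)"
    by (rule Bochner_Integration.integrable_bound[OF LF_D(2)[OF kf(1)]]) (use le in auto)
  then show LF: "(\<lambda>t. w t * f t) \<in> carrier LF" by (intro LF_I) simp_all
  have "(\<integral>t. cmod (w t * f t) powr p \<partial>\<mu>) \<le> (\<integral>t. cmod (complex_of_real K * f t) powr p \<partial>\<mu>)"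
    using int LF_D(2)[OF kf(1)] le by (rule integral_mono)
  then show "nrm LF (\<lambda>t. w t * f t) \<le> K * nrm LF f"
    using nrm_LF_powr[OF kf(1)] kf(2) K LF.nrm_nonneg[OF f] by (intro nrm_LF_le[OF LF]) auto
qed

lemma mul_cls: "f \<in> carrier LF \<Longrightarrow> mul w (cls f) = cls (\<lambda>t. w t * f t)"
  by (simp add: mul_def repr_cls_eq)

lemma mul_bounded:
  assumes w: "\<And>t. cmod (w t) \<le> K"
  shows "bounded_map LS LS K (mul w)"
proof (rule bounded_mapI)
  fix x assume "x \<in> carrier LS"
  then obtain f where f: "f \<in> carrier LF" "x = cls f" by (rule LS_cases)
  note m = mul_LF[OF w]
  show "mul w x \<in> carrier LS" "nrm LS (mul w x) \<le> K * nrm LS x"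
    using f m[OF f(1)] by (simp_all add: mul_cls cls_closed LS_simps)
  show "mul w (a \<odot>\<^bsub>LS\<^esub> x) = a \<odot>\<^bsub>LS\<^esub> mul w x" for a
    using f m(1)[OF f(1)] LF_smult(1)[OF f(1)] by (simp add: cls_smult mul_cls mult.left_commute)
  fix y assume "y \<in> carrier LS"
  then obtain h where h: "h \<in> carrier LF" "y = cls h" by (rule LS_cases)
  show "mul w (x \<oplus>\<^bsub>LS\<^esub> y) = mul w x \<oplus>\<^bsub>LS\<^esub> mul w y"
    using f h m(1)[OF f(1)] m(1)[OF h(1)] LF_add[OF f(1) h(1)] by (simp add: cls_add mul_cls distrib_left)
qed

lemma ev_mul: "bounded_fun w \<Longrightarrow> x \<in> carrier LS \<Longrightarrow> ev t (mul w x) = w t * ev t x"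
  by (auto elim!: LS_cases simp: mul_cls bounded_fun_def intro!: ev_cls mul_LF(1))

lemma mul_closed: "bounded_fun w \<Longrightarrow> x \<in> carrier LS \<Longrightarrow> mul w x \<in> carrier LS"
  using mul_bounded bounded_mapD(1) unfolding bounded_fun_def by metis

text \<open>In terms of coefficients, this is $\sum_s w(s)\, x(s)\, y(s^{-1})$.\<close>

definition trace_form :: "('g \<Rightarrow> complex) \<Rightarrow> (('g \<Rightarrow> complex) set \<Rightarrow> ('g \<Rightarrow> complex) set) \<Rightarrow>
    (('g \<Rightarrow> complex) set \<Rightarrow> ('g \<Rightarrow> complex) set) \<Rightarrow> complex" where
  "trace_form w x y = ev 0 (x (mul w (y (cls (\<delta> 0)))))"

lemma bilinear_trace_form:
  assumes "bounded_fun w"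
  shows "\<exists>K. bilinear_map A A complex_space K (trace_form w)"
proof -
  obtain K where K: "\<And>t. cmod (w t) \<le> K" using assms by (auto simp: bounded_fun_def)
  then have K0: "0 \<le> K" using norm_ge_zero order_trans by blast
  let ?e = "cls (\<delta> 0)" and ?c = "(1 / c) powr (1/p)"
  note e = cls_closed[OF \<delta>_LF[of 0]] and ev = bounded_mapD[OF ev_bounded[of 0]] and m = bounded_mapD[OF mul_bounded[OF K]]
  note a = OA_apply_le and lin = S_linear
  have "bilinear_map A A complex_space (?c * K * nrm LS ?e) (trace_form w)"
  proof (rule bilinear_mapI)
    fix x y assume "x \<in> carrier A" "y \<in> carrier A"
    then have xy: "x \<in> S" "y \<in> S" by (simp_all add: A_simps)
    have ye: "y ?e \<in> carrier LS" "nrm LS (y ?e) \<le> nrm A y * nrm LS ?e" using a[OF xy(2) e] by auto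
    have nx: "0 \<le> nrm A x" "0 \<le> nrm A y" using xy A.nrm_nonneg by (auto simp: A_simps)
    have "cmod (trace_form w x y) \<le> ?c * nrm LS (x (mul w (y ?e)))"
      unfolding trace_form_def using ev(4)[OF a(1)[OF xy(1) m(1)[OF ye(1)]]] by simp
    also have "\<dots> \<le> ?c * (nrm A x * (K * (nrm A y * nrm LS ?e)))"
    proof (rule mult_left_mono)
      have "nrm LS (x (mul w (y ?e))) \<le> nrm A x * nrm LS (mul w (y ?e))"
        by (rule a(2)[OF xy(1) m(1)[OF ye(1)]])
      also have "\<dots> \<le> nrm A x * (K * nrm LS (y ?e))" using m(4)[OF ye(1)] nx by (intro mult_left_mono)
      also have "\<dots> \<le> nrm A x * (K * (nrm A y * nrm LS ?e))" using ye(2) nx K0 by (intro mult_left_mono)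
      finally show "nrm LS (x (mul w (y ?e))) \<le> nrm A x * (K * (nrm A y * nrm LS ?e))" .
    qed simp
    finally show "nrm complex_space (trace_form w x y) \<le> ?c * K * nrm LS ?e * nrm A x * nrm A y"
      by (simp add: mult_ac)
    note z = m(1)[OF ye(1)]
    show "trace_form w (r \<odot>\<^bsub>A\<^esub> x) y = r \<odot>\<^bsub>complex_space\<^esub> trace_form w x y"
      "trace_form w x (r \<odot>\<^bsub>A\<^esub> y) = r \<odot>\<^bsub>complex_space\<^esub> trace_form w x y" for r
      using ev(3)[OF a(1)[OF xy(1) z]] m(3)[OF ye(1)] lin(2)[OF xy(1) z]
      by (simp_all add: trace_form_def A_apply z e)
    show "trace_form w (x \<oplus>\<^bsub>A\<^esub> x') y = trace_form w x y \<oplus>\<^bsub>complex_space\<^esub> trace_form w x' y" if "x' \<in> carrier A" for x'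
    proof -
      have "x' \<in> S" using that by (simp add: A_simps)
      then show ?thesis using ev(2)[OF a(1)[OF xy(1) z] a(1)[OF _ z]] by (simp add: trace_form_def A_apply z)
    qed
    show "trace_form w x (y \<oplus>\<^bsub>A\<^esub> y') = trace_form w x y \<oplus>\<^bsub>complex_space\<^esub> trace_form w x y'" if "y' \<in> carrier A" for y'
    proof -
      have y': "y' \<in> S" using that by (simp add: A_simps)
      note ye' = a(1)[OF y' e]
      note z' = m(1)[OF ye']
      show ?thesis
        using m(2)[OF ye(1) ye'] lin(1)[OF xy(1) z z'] ev(2)[OF a(1)[OF xy(1) z] a(1)[OF xy(1) z']]
        by (simp add: trace_form_def A_apply e)
    qed
  qed simp
  then show ?thesis by blast
qed

text \<open>On the point mass at 0, \<open>lam (- g)\<close> acts as the right translation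
  \<open>rho g\<close>. The latter commutes with y and x and is pushed outward, shifting w when it
  passes \<open>mul w\<close>; in the end \<open>lam g\<close> and \<open>rho g\<close> compensate
  each other under evaluation at 0.\<close>

lemma trace_form_shift:
  assumes w: "bounded_fun w" and xy: "x \<in> S" "y \<in> S"
  shows "trace_form w (lam g \<otimes>\<^bsub>A\<^esub> x) (y \<otimes>\<^bsub>A\<^esub> lam (- g)) = trace_form (\<lambda>t. w (t - g)) x y"
proof -
  let ?e = "cls (\<delta> 0)" and ?w = "\<lambda>t. w (t - g)"
  have w': "bounded_fun ?w" using w unfolding bounded_fun_def by blast
  have e: "?e \<in> carrier LS" by (rule cls_closed[OF \<delta>_LF])
  have "lam (- g) ?e = rho g ?e"
  proof -
    have "g + t = 0 \<longleftrightarrow> t + g = 0" for t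
      unfolding add_eq_0_iff[of g t] add_eq_0_iff2[of t g] ..
    then have "(\<lambda>t. \<delta> 0 (- (- g) + t)) = (\<lambda>t. \<delta> 0 (t + g))" by (simp add: \<delta>_def)
    then show ?thesis unfolding lam_cls[OF \<delta>_LF] rho_cls[OF \<delta>_LF] by (rule arg_cong)
  qed
  then have y: "(y \<otimes>\<^bsub>A\<^esub> lam (- g)) ?e = rho g (y ?e)"
    using A_apply(3)[OF e] S_rho[OF xy(2) e] by simp
  have ye: "y ?e \<in> carrier LS" by (rule OA_apply_le(1)[OF xy(2) e])
  have "mul w (rho g (y ?e)) = rho g (mul ?w (y ?e))"
    using ye w w' by (subst LS_eq_iff) (auto simp: ev_mul ev_rho rho_closed mul_closed)
  moreover have m: "mul ?w (y ?e) \<in> carrier LS" by (rule mul_closed[OF w' ye])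
  ultimately have "trace_form w (lam g \<otimes>\<^bsub>A\<^esub> x) (y \<otimes>\<^bsub>A\<^esub> lam (- g)) = ev 0 (lam g (rho g (x (mul ?w (y ?e)))))"
    unfolding trace_form_def y using A_apply(3)[OF rho_closed[OF m]] S_rho[OF xy(1) m] by simp
  then show ?thesis
    using OA_apply_le(1)[OF xy(1) m] by (simp add: trace_form_def ev_lam ev_rho rho_closed)
qed

lemma amenable_invariant_functional:
  assumes "complete_space A" "amenable A"
  obtains \<Phi> :: "('g \<Rightarrow> complex) \<Rightarrow> complex" where
    "\<And>v w. bounded_fun v \<Longrightarrow> bounded_fun w \<Longrightarrow> \<Phi> (\<lambda>t. v t + w t) = \<Phi> v + \<Phi> w"
    "\<And>a v. bounded_fun v \<Longrightarrow> \<Phi> (\<lambda>t. a * v t) = a * \<Phi> v"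
    "\<And>w g. bounded_fun w \<Longrightarrow> \<Phi> (\<lambda>t. w (t - g)) = \<Phi> w"
    "\<Phi> (\<lambda>t. 1) = 1"
proof -
  obtain M where M_cong: "\<And>B B' K. bilinear_map A A complex_space K B \<Longrightarrow>
      (\<And>x y. x \<in> carrier A \<Longrightarrow> y \<in> carrier A \<Longrightarrow> B x y = B' x y) \<Longrightarrow> M B = M B'"
    and M_add: "\<And>B B' K L. bilinear_map A A complex_space K B \<Longrightarrow> bilinear_map A A complex_space L B' \<Longrightarrow>
      M (\<lambda>x y. B x y + B' x y) = M B + M B'"
    and M_mult: "\<And>B K a. bilinear_map A A complex_space K B \<Longrightarrow> M (\<lambda>x y. a * B x y) = a * M B"
    and M_inv: "\<And>B K a. bilinear_map A A complex_space K B \<Longrightarrow> a \<in> carrier A \<Longrightarrow>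
      M (\<lambda>x y. B (a \<otimes>\<^bsub>A\<^esub> x) y) = M (\<lambda>x y. B x (y \<otimes>\<^bsub>A\<^esub> a))"
    and M_id: "\<And>\<kappa> a. \<kappa> \<in> carrier (dual A) \<Longrightarrow> a \<in> carrier A \<Longrightarrow> M (\<lambda>x y. \<kappa> ((x \<otimes>\<^bsub>A\<^esub> y) \<otimes>\<^bsub>A\<^esub> a)) = \<kappa> a"
    by (rule A.virtual_diagonal_form[OF assms]) blast
  have e: "cls (\<delta> 0) \<in> carrier LS" by (rule cls_closed[OF \<delta>_LF])
  have lam: "lam g \<in> carrier A" for g using lam_S by (simp add: A_simps)
  have bf1: "bounded_fun (\<lambda>t::'g. 1)" by (rule bounded_fun_const)
  have add: "M (trace_form (\<lambda>t. v t + w t)) = M (trace_form v) + M (trace_form w)"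
    if vw: "bounded_fun v" "bounded_fun w" for v w
  proof -
    from bilinear_trace_form[OF vw(1)] bilinear_trace_form[OF vw(2)] bilinear_trace_form[OF bounded_fun_add[OF vw]]
    obtain K L N where B: "bilinear_map A A complex_space K (trace_form v)"
      "bilinear_map A A complex_space L (trace_form w)" "bilinear_map A A complex_space N (trace_form (\<lambda>t. v t + w t))"
      by (elim exE)
    have "trace_form (\<lambda>t. v t + w t) x y = trace_form v x y + trace_form w x y"
      if "x \<in> carrier A" "y \<in> carrier A" for x y
    proof -
      have xy: "x \<in> S" "y \<in> S" using that by (simp_all add: A_simps)
      note ye = OA_apply_le(1)[OF xy(2) e]
      note m = mul_closed[OF vw(1) ye] mul_closed[OF vw(2) ye]
      have "mul (\<lambda>t. v t + w t) (y (cls (\<delta> 0))) = mul v (y (cls (\<delta> 0))) \<oplus>\<^bsub>LS\<^esub> mul w (y (cls (\<delta> 0)))"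
        using bounded_mapD(2)[OF ev_bounded m] vw m ye mul_closed[OF bounded_fun_add[OF vw] ye]
        by (subst LS_eq_iff) (auto simp: ev_mul bounded_fun_add distrib_right)
      then show ?thesis
        using S_linear(1)[OF xy(1) m] bounded_mapD(2)[OF ev_bounded OA_apply_le(1)[OF xy(1) m(1)] OA_apply_le(1)[OF xy(1) m(2)]]
        by (simp add: trace_form_def)
    qed
    from M_cong[OF B(3) this] show ?thesis using M_add[OF B(1,2)] by simp
  qed
  have mult: "M (trace_form (\<lambda>t. a * v t)) = a * M (trace_form v)" if v: "bounded_fun v" for v a
  proof -
    from bilinear_trace_form[OF v] bilinear_trace_form[OF bounded_fun_mult[OF v, of a]]
    obtain K N where B: "bilinear_map A A complex_space K (trace_form v)"
      "bilinear_map A A complex_space N (trace_form (\<lambda>t. a * v t))" by (elim exE)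
    have "trace_form (\<lambda>t. a * v t) x y = a * trace_form v x y" if "x \<in> carrier A" "y \<in> carrier A" for x y
    proof -
      have xy: "x \<in> S" "y \<in> S" using that by (simp_all add: A_simps)
      note ye = OA_apply_le(1)[OF xy(2) e]
      note m = mul_closed[OF v ye]
      have "mul (\<lambda>t. a * v t) (y (cls (\<delta> 0))) = a \<odot>\<^bsub>LS\<^esub> mul v (y (cls (\<delta> 0)))"
        using bounded_mapD(3)[OF ev_bounded m] v m ye mul_closed[OF bounded_fun_mult[OF v] ye]
        by (subst LS_eq_iff) (auto simp: ev_mul bounded_fun_mult)
      then show ?thesis
        using S_linear(2)[OF xy(1) m] bounded_mapD(3)[OF ev_bounded OA_apply_le(1)[OF xy(1) m]]
        by (simp add: trace_form_def)
    qed
    from M_cong[OF B(2) this] show ?thesis using M_mult[OF B(1)] by simp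
  qed
  have inv: "M (trace_form (\<lambda>t. w (t - g))) = M (trace_form w)" if w: "bounded_fun w" for w g
  proof -
    have w': "bounded_fun (\<lambda>t. w (t - g))" using w unfolding bounded_fun_def by blast
    from bilinear_trace_form[OF w] bilinear_trace_form[OF w']
    obtain K K' where K: "bilinear_map A A complex_space K (trace_form w)"
      "bilinear_map A A complex_space K' (trace_form (\<lambda>t. w (t - g)))" by (elim exE)
    \<comment> \<open>Chosen so that replacing x by \<open>lam g\<close> x gives the shifted trace
      form, while moving \<open>lam g\<close> to the other side under M cancels
      \<open>lam (- g)\<close>.\<close>
    let ?B = "\<lambda>x y. trace_form w x (y \<otimes>\<^bsub>A\<^esub> lam (- g))"
    note BD = bilinear_mapD[OF K(1)] and mult = bilinear_mapD[OF A.bilinear_mult]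
    have B: "bilinear_map A A complex_space (\<bar>K\<bar> * nrm A (lam (- g))) ?B"
    proof (rule bilinear_mapI)
      fix x y assume xy: "x \<in> carrier A" "y \<in> carrier A"
      have yl: "y \<otimes>\<^bsub>A\<^esub> lam (- g) \<in> carrier A" by (rule mult(1)[OF xy(2) lam])
      have "cmod (?B x y) \<le> K * nrm A x * nrm A (y \<otimes>\<^bsub>A\<^esub> lam (- g))" using BD(2)[OF xy(1) yl] by simp
      also have "\<dots> \<le> \<bar>K\<bar> * nrm A x * (nrm A y * nrm A (lam (- g)))"
        using mult(2)[OF xy(2) lam, of "- g"] A.nrm_nonneg xy yl by (intro mult_mono) auto
      finally show "nrm complex_space (?B x y) \<le> \<bar>K\<bar> * nrm A (lam (- g)) * nrm A x * nrm A y" by (simp add: mult_ac)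
    qed (use BD mult lam in auto)
    have "M (trace_form (\<lambda>t. w (t - g))) = M (\<lambda>x y. ?B (lam g \<otimes>\<^bsub>A\<^esub> x) y)"
      by (rule M_cong[OF K(2)]) (use trace_form_shift[OF w] in \<open>simp add: A_simps\<close>)
    also have "\<dots> = M (\<lambda>x y. ?B x (y \<otimes>\<^bsub>A\<^esub> lam g))" by (rule M_inv[OF B lam])
    also have "\<dots> = M (trace_form w)"
    proof (rule M_cong[OF K(1), symmetric])
      fix x y assume "x \<in> carrier A" "y \<in> carrier A"
      then have y: "y \<in> S" by (simp add: A_simps)
      have "(y \<otimes>\<^bsub>A\<^esub> lam g) \<otimes>\<^bsub>A\<^esub> lam (- g) = y \<otimes>\<^bsub>A\<^esub> (lam g \<otimes>\<^bsub>A\<^esub> lam (- g))"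
        using lam_bounded bounded_mapD(1)[OF lam_bounded] by (auto simp: A_simps compose_def fun_eq_iff)
      then show "trace_form w x y = trace_form w x ((y \<otimes>\<^bsub>A\<^esub> lam g) \<otimes>\<^bsub>A\<^esub> lam (- g))"
        using lam_mult[of g "- g"] lam_zero(2)[OF y] by simp
    qed
    finally show ?thesis .
  qed
  have one: "M (trace_form (\<lambda>t. 1)) = 1"
  proof -
    obtain K where K: "bilinear_map A A complex_space K (trace_form (\<lambda>t. 1))" using bilinear_trace_form[OF bf1] by blast
    obtain K' where K': "bounded_map A complex_space K' (coeff 0)" using coeff_bounded by blast
    let ?\<kappa> = "restrict (coeff 0) (carrier A)"
    have \<kappa>: "?\<kappa> \<in> carrier (dual A)" by (rule restrict_dual[OF A.seminormed_space_axioms K'])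
    \<comment> \<open>With w = 1 the trace form is the coefficient at 0 of the product of x and y,
      so the second property of a virtual diagonal applies, with the unit \<open>lam 0\<close> as
      a.\<close>
    have "M (trace_form (\<lambda>t. 1)) = M (\<lambda>x y. ?\<kappa> ((x \<otimes>\<^bsub>A\<^esub> y) \<otimes>\<^bsub>A\<^esub> lam 0))"
    proof (rule M_cong[OF K])
      fix x y assume xyA: "x \<in> carrier A" "y \<in> carrier A"
      then have xy: "x \<in> S" "y \<in> S" by (simp_all add: A_simps)
      have m: "x \<otimes>\<^bsub>A\<^esub> y \<in> carrier A" by (rule bilinear_mapD(1)[OF A.bilinear_mult xyA])
      have ye: "y (cls (\<delta> 0)) \<in> carrier LS" by (rule OA_apply_le(1)[OF xy(2) e])
      have "mul (\<lambda>t. 1) (y (cls (\<delta> 0))) = y (cls (\<delta> 0))" by (simp add: mul_def cls_repr[OF ye])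
      then show "trace_form (\<lambda>t. 1) x y = ?\<kappa> ((x \<otimes>\<^bsub>A\<^esub> y) \<otimes>\<^bsub>A\<^esub> lam 0)"
        using lam_zero(2)[of "x \<otimes>\<^bsub>A\<^esub> y"] m A_apply(3)[OF e] by (simp add: A_simps(1) trace_form_def coeff_def)
    qed
    also have "\<dots> = ?\<kappa> (lam 0)" by (rule M_id[OF \<kappa> lam])
    also have "\<dots> = 1" using lam coeff_lam[of 0 0] by (simp add: \<delta>_def)
    finally show ?thesis .
  qed
  show ?thesis by (rule that[of "\<lambda>w. M (trace_form w)"]) (use add mult inv one in auto)
qed

section \<open>Vector states of almost invariant functions and the conclusion for infinite
  groups\<close>

definition vector_state :: "('g \<Rightarrow> real) \<Rightarrow> (('g \<Rightarrow> complex) set \<Rightarrow> ('g \<Rightarrow> complex) set) \<Rightarrow> complex" where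
  "vector_state h a = (1 / complex_of_real (c * (\<Sum>t | h t \<noteq> 0. h t))) *
     pairing (\<lambda>t. complex_of_real (h t powr (1/q))) (a (cls (\<lambda>t. complex_of_real (h t powr (1/p)))))"

text \<open>The norms of h^(1/p) and h^(1/q) multiply to the integral of h because 1/p + 1/q = 1.
  That integral is the normalizing denominator; its factor \<open>c\<close> is the mass of a
  point.\<close>

lemma vector_state_props:
  assumes h: "finite {t. h t \<noteq> 0}" "\<And>t. 0 \<le> h t" and N: "1 \<le> (\<Sum>t | h t \<noteq> 0. h t)"
  shows "bounded_map A complex_space 1 (vector_state h)"
    and "vector_state h (lam g) =
      complex_of_real ((\<Sum>t | h t \<noteq> 0. h (- g + t) powr (1/p) * h t powr (1/q)) / (\<Sum>t | h t \<noteq> 0. h t))"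
proof -
  let ?F = "{t. h t \<noteq> 0}" and ?N = "\<Sum>t | h t \<noteq> 0. h t"
  let ?f = "\<lambda>t. complex_of_real (h t powr (1/p))" and ?h = "\<lambda>t. complex_of_real (h t powr (1/q))"
  have N0: "c * ?N > 0" using c_pos N by simp
  have fLF: "?f \<in> carrier LF" by (rule LF_finite_support[OF h(1)]) auto
  have pw: "cmod (complex_of_real (h t powr (1/r))) powr r = h t" if "r > 1" for r t
    using that h(2)[of t] by (simp add: powr_powr)
  have ih: "integrable \<mu> h" "(\<integral>t. h t \<partial>\<mu>) = c * ?N"
    by (rule integral_finite_support_real[OF h(1)]; simp)+
  have hLq: "?h \<in> Lq" using pw[OF q(1)] ih(1) by (simp add: Lq_def)
  have nf: "nrm LS (cls ?f) = (c * ?N) powr (1/p)"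
    using fLF pw[OF p_gt_1] ih(2) by (simp add: LS_simps) (simp add: Lp_functions_simps)
  have nh: "nrm_q ?h = (c * ?N) powr (1/q)" using pw[OF q(1)] ih(2) by (simp add: nrm_q_def)
  have "bounded_map A complex_space (nrm_q ?h * nrm LS (cls ?f)) (\<lambda>a. pairing ?h (a (cls ?f)))"
    by (intro coefficient_functional pairing_bounded hLq cls_closed fLF) (simp add: nrm_q_def)
  moreover have "nrm_q ?h * nrm LS (cls ?f) = c * ?N"
    using N0 q(2) by (simp add: nf nh add.commute flip: powr_add)
  ultimately have "bounded_map A complex_space (cmod (1 / complex_of_real (c * ?N)) * (c * ?N)) (vector_state h)"
    unfolding vector_state_def
    using bounded_map_smult[OF A.seminormed_space_axioms normed_complex_space, of "c * ?N" _ "1 / complex_of_real (c * ?N)"] by simp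
  moreover have "cmod (1 / complex_of_real (c * ?N)) * (c * ?N) = 1"
    unfolding norm_divide norm_of_real using c_pos N by auto
  ultimately show "bounded_map A complex_space 1 (vector_state h)" by simp
  have "pairing ?h (lam g (cls ?f)) = (\<integral>t. ?f (- g + t) * ?h t \<partial>\<mu>)"
    unfolding lam_cls[OF fLF] by (rule pairing_cls[OF hLq LF_left_shift(1)[OF fLF]])
  also have "\<dots> = complex_of_real c * (\<Sum>t | h t \<noteq> 0. ?f (- g + t) * ?h t)"
    by (rule integral_finite_support(2)[OF h(1)]) auto
  also have "\<dots> = complex_of_real (c * (\<Sum>t | h t \<noteq> 0. h (- g + t) powr (1/p) * h t powr (1/q)))" by simp
  finally have eq: "pairing ?h (lam g (cls ?f)) = complex_of_real (c * (\<Sum>t | h t \<noteq> 0. h (- g + t) powr (1/p) * h t powr (1/q)))" .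
  show "vector_state h (lam g) = complex_of_real ((\<Sum>t | h t \<noteq> 0. h (- g + t) powr (1/p) * h t powr (1/q)) / ?N)"
    unfolding vector_state_def eq using c_pos by simp
qed

lemma vector_state_almost_invariant:
  assumes h: "finite {t. h t \<noteq> 0}" "\<And>t. 0 \<le> h t" and N: "1 \<le> (\<Sum>t | h t \<noteq> 0. h t)"
    and inv: "\<And>I. finite I \<Longrightarrow> (\<Sum>t\<in>I. \<bar>h (- g + t) - h t\<bar>) \<le> \<epsilon>"
  shows "cmod (vector_state h (lam g) - 1) \<le> \<epsilon>"
proof -
  let ?F = "{t. h t \<noteq> 0}" and ?N = "\<Sum>t | h t \<noteq> 0. h t"
  let ?g = "\<lambda>t. h (- g + t) powr (1/p) * h t powr (1/q)"
  have "\<bar>(\<Sum>t\<in>?F. ?g t) - ?N\<bar> \<le> (\<Sum>t\<in>?F. \<bar>?g t - h t\<bar>)"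
    unfolding sum_subtractf[symmetric] by (rule sum_abs)
  also have "\<dots> \<le> (\<Sum>t\<in>?F. \<bar>h (- g + t) - h t\<bar>)"
  proof (rule sum_mono)
    fix t show "\<bar>?g t - h t\<bar> \<le> \<bar>h (- g + t) - h t\<bar>"
      using geometric_mean_between[of "h t" "h (- g + t)" "1/p" "1/q"] h(2) p_gt_1 q by (simp add: abs_minus_commute)
  qed
  also have "\<dots> \<le> \<epsilon>" by (rule inv[OF h(1)])
  finally have *: "\<bar>(\<Sum>t\<in>?F. ?g t) - ?N\<bar> \<le> \<epsilon>" .
  have "vector_state h (lam g) - 1 = complex_of_real ((\<Sum>t\<in>?F. ?g t) / ?N - 1)"
    unfolding vector_state_props(2)[OF h N] by simp
  then have "cmod (vector_state h (lam g) - 1) = \<bar>(\<Sum>t\<in>?F. ?g t) / ?N - 1\<bar>"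
    by (simp only: norm_of_real)
  also have "(\<Sum>t\<in>?F. ?g t) / ?N - 1 = ((\<Sum>t\<in>?F. ?g t) - ?N) / ?N"
    using N by (simp add: diff_divide_distrib)
  \<comment> \<open>The total is at least 1, so dividing by it does not increase the error.\<close>
  also have "\<bar>((\<Sum>t\<in>?F. ?g t) - ?N) / ?N\<bar> \<le> \<bar>(\<Sum>t\<in>?F. ?g t) - ?N\<bar> / 1"
    using N by (simp add: abs_divide) (smt (verit) div_by_1 frac_le)
  finally show ?thesis using * by simp
qed

theorem reflexive_amenable_imp_finite:
  assumes refl: "reflexive A" and am: "amenable A"
  shows "finite (UNIV :: 'g set)"
proof (rule ccontr)
  assume inf: "infinite (UNIV :: 'g set)"
  obtain \<Phi> :: "('g \<Rightarrow> complex) \<Rightarrow> complex" where \<Phi>: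
    "\<And>v w. bounded_fun v \<Longrightarrow> bounded_fun w \<Longrightarrow> \<Phi> (\<lambda>t. v t + w t) = \<Phi> v + \<Phi> w"
    "\<And>a v. bounded_fun v \<Longrightarrow> \<Phi> (\<lambda>t. a * v t) = a * \<Phi> v"
    "\<And>w g. bounded_fun w \<Longrightarrow> \<Phi> (\<lambda>t. w (t - g)) = \<Phi> w"
    "\<Phi> (\<lambda>t. 1) = 1"
    by (rule amenable_invariant_functional[OF reflexive_imp_complete[OF A.normed_space_axioms refl] am]) blast
  \<comment> \<open>The tolerance depends on F alone, so that finite sets by themselves index the
    states; it tends to 0 along them because G is infinite.\<close>
  define \<epsilon> where "\<epsilon> F = 1 / real (card F + 1)" for F :: "'g set"
  have \<epsilon>: "\<epsilon> F > 0" for F by (simp add: \<epsilon>_def)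
  define P where "P F h \<longleftrightarrow> finite {t. h t \<noteq> 0} \<and> (\<forall>t. 0 \<le> h t) \<and> 1 \<le> (\<Sum>t | h t \<noteq> 0. h t) \<and>
      (\<forall>g\<in>F. \<forall>I. finite I \<longrightarrow> (\<Sum>t\<in>I. \<bar>h (- g + t) - h t\<bar>) \<le> \<epsilon> F)" for F :: "'g set" and h :: "'g \<Rightarrow> real"
  have "\<forall>F\<in>Collect finite. \<exists>h. P F h"
  proof
    fix F :: "'g set" assume "F \<in> Collect finite"
    then have F: "finite F" by simp
    obtain f where f: "finite {t. f t \<noteq> 0}" "(\<Sum>t | f t \<noteq> 0. f t) = 1"
      "\<And>g I. g \<in> F \<Longrightarrow> finite I \<Longrightarrow> (\<Sum>t\<in>I. cmod (f (t + g) - f t)) \<le> \<epsilon> F"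
      by (rule almost_invariant_functions[OF \<Phi> F \<epsilon>]) blast+
    \<comment> \<open>The modulus gives a nonnegative function and keeps the total at least 1; the
      reflection turns f(t + g) into h(-g + t), the form produced by \<open>lam g\<close>.\<close>
    define h where "h t = cmod (f (- t))" for t
    have supp: "{t. h t \<noteq> 0} = uminus ` {t. f t \<noteq> 0}"
      by (force simp: h_def image_iff)
    have "1 = cmod (\<Sum>t | f t \<noteq> 0. f t)" using f(2) by simp
    also have "\<dots> \<le> (\<Sum>t | f t \<noteq> 0. cmod (f t))" by (rule norm_sum)
    also have "\<dots> = (\<Sum>t | h t \<noteq> 0. h t)"
      unfolding supp by (subst sum.reindex) (auto simp: h_def)
    finally have "1 \<le> (\<Sum>t | h t \<noteq> 0. h t)" .
    moreover have "(\<Sum>t\<in>I. \<bar>h (- g + t) - h t\<bar>) \<le> \<epsilon> F" if "g \<in> F" "finite I" for g I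
    proof -
      have "(\<Sum>t\<in>I. \<bar>h (- g + t) - h t\<bar>) \<le> (\<Sum>t\<in>I. cmod (f (- t + g) - f (- t)))"
        by (rule sum_mono) (simp add: h_def group_add_class.minus_add norm_triangle_ineq3)
      also have "\<dots> = (\<Sum>t\<in>uminus ` I. cmod (f (t + g) - f t))"
        by (subst sum.reindex) auto
      also have "\<dots> \<le> \<epsilon> F" using f(3)[OF that(1)] that(2) by blast
      finally show ?thesis .
    qed
    moreover have "finite {t. h t \<noteq> 0}" unfolding supp using f(1) by simp
    ultimately show "\<exists>h. P F h" by (intro exI[of _ h]) (auto simp: P_def h_def)
  qed
  from bchoice[OF this] obtain h where "\<forall>F\<in>Collect finite. P F (h F)" ..
  then have h: "\<And>F. finite F \<Longrightarrow> finite {t. h F t \<noteq> 0}" "\<And>F t. finite F \<Longrightarrow> 0 \<le> h F t"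
    "\<And>F. finite F \<Longrightarrow> 1 \<le> (\<Sum>t | h F t \<noteq> 0. h F t)"
    "\<And>F g I. finite F \<Longrightarrow> g \<in> F \<Longrightarrow> finite I \<Longrightarrow> (\<Sum>t\<in>I. \<bar>h F (- g + t) - h F t\<bar>) \<le> \<epsilon> F"
    by (auto simp: P_def)
  \<comment> \<open>The double limit criterion asks for a functional at every index, so infinite
    sets get the state of the empty set.\<close>
  define k where "k F = vector_state (h (if finite F then F else {}))" for F :: "'g set"
  have kF: "finite (if finite F then F else {})" for F :: "'g set" by simp
  have "(0::complex) = 1"
  proof (rule reflexive_double_limit[OF A.normed_space_axioms refl, of cofinite "finite_subsets_at_top UNIV" lam 1 1 k])
    show "cofinite \<noteq> (bot :: 'g filter)" using inf by simp
    show "finite_subsets_at_top (UNIV :: 'g set) \<noteq> bot" by simp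
    show "lam g \<in> carrier A" "nrm A (lam g) \<le> 1" for g using lam_S lam_nrm by (simp_all add: A_simps(1))
    show "bounded_map A complex_space 1 (k F)" for F
      unfolding k_def by (rule vector_state_props(1)[OF h(1)[OF kF] h(2)[OF kF] h(3)[OF kF]])
    show "((\<lambda>g. k F (lam g)) \<longlongrightarrow> 0) cofinite" for F
    proof (rule tendsto_eventually)
      define h' where "h' = h (if finite F then F else {})"
      have h': "finite {t. h' t \<noteq> 0}" "\<And>t. 0 \<le> h' t" "1 \<le> (\<Sum>t | h' t \<noteq> 0. h' t)"
        using h(1-3)[OF kF] by (auto simp: h'_def)
      \<comment> \<open>The state can be nonzero at \<open>lam g\<close> only if the support meets
        its translate by g, and then g is a difference of two points of the support.\<close>
      have "k F (lam g) = 0" if g: "g \<notin> (\<lambda>(t, s). t - s) ` ({t. h' t \<noteq> 0} \<times> {t. h' t \<noteq> 0})" for g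
      proof -
        have "h' (- g + t) = 0" if t: "h' t \<noteq> 0" for t
        proof (rule ccontr)
          assume "h' (- g + t) \<noteq> 0"
          moreover have "g = t - (- g + t)" by (simp add: diff_conv_add_uminus group_add_class.minus_add add.assoc[symmetric] del: add_uminus_conv_diff)
          ultimately show False using g t by (force simp: image_iff)
        qed
        then have "(\<Sum>t | h' t \<noteq> 0. h' (- g + t) powr (1/p) * h' t powr (1/q)) = 0" by (intro sum.neutral) auto
        then show ?thesis
          unfolding k_def h'_def[symmetric] vector_state_props(2)[OF h'] by simp
      qed
      then have "{g. k F (lam g) \<noteq> 0} \<subseteq> (\<lambda>(t, s). t - s) ` ({t. h' t \<noteq> 0} \<times> {t. h' t \<noteq> 0})" by blast
      moreover have "finite ((\<lambda>(t, s). t - s) ` ({t. h' t \<noteq> 0} \<times> {t. h' t \<noteq> 0}))" using h'(1) by simp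
      ultimately show "\<forall>\<^sub>F g in cofinite. k F (lam g) = 0"
        unfolding eventually_cofinite by (rule finite_subset)
    qed
    show "((\<lambda>F. k F (lam g)) \<longlongrightarrow> 1) (finite_subsets_at_top UNIV)" for g
      unfolding tendsto_iff
    proof (intro allI impI)
      fix e :: real assume e: "e > 0"
      obtain n :: nat where n: "1 / e < n" using reals_Archimedean2 by blast
      \<comment> \<open>Any set with at least n > 1/e points has tolerance below e.\<close>
      obtain X :: "'g set" where X: "finite X" "card X = n" using infinite_arbitrarily_large[OF inf] by blast
      show "\<forall>\<^sub>F F in finite_subsets_at_top UNIV. dist (k F (lam g)) 1 < e"
        unfolding eventually_finite_subsets_at_top
      proof (intro exI[of _ "insert g X"] conjI allI impI)
        fix F :: "'g set" assume F: "finite F \<and> insert g X \<subseteq> F \<and> F \<subseteq> UNIV"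
        then have "n \<le> card F" using X(2) card_mono[of F X] by auto
        then have "1 / e < real (card F + 1)" using n by linarith
        then have "\<epsilon> F < e" using e by (simp add: \<epsilon>_def field_simps)
        moreover have "cmod (k F (lam g) - 1) \<le> \<epsilon> F"
          unfolding k_def using F h[of F] by (auto intro!: vector_state_almost_invariant)
        ultimately show "dist (k F (lam g)) 1 < e" by (simp add: dist_norm)
      qed (use X in auto)
    qed
  qed
  then show False by simp
qed

section \<open>Finite groups\<close>

context
  assumes finite_UNIV: "finite (UNIV :: 'g set)"
begin

text \<open>The point masses span \<open>LS\<close>, and each is a right translate of the one at 0.
  As a commutes with right translations, its value there determines a and displays the
  coefficients.\<close>

lemma finite_expansion:
  assumes a: "a \<in> S"
  shows "a = (\<Oplus>\<^bsub>A\<^esub>g\<in>UNIV. coeff g a \<odot>\<^bsub>A\<^esub> lam g)"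
proof -
  let ?s = "\<Oplus>\<^bsub>A\<^esub>g\<in>UNIV. coeff g a \<odot>\<^bsub>A\<^esub> lam g"
  have lamA: "lam g \<in> carrier A" for g using lam_S by (simp add: A_simps)
  have s: "?s \<in> S" using A.finsum_closed[of "\<lambda>g. coeff g a \<odot>\<^bsub>A\<^esub> lam g" UNIV] A.sm_closed[OF lamA]
    by (auto simp: A_simps(1))
  show ?thesis
  proof (rule A_eqI[OF a s])
    fix x assume x: "x \<in> carrier LS"
    obtain f where f: "f \<in> carrier LF" "x = cls f" using LS_cases[OF x] by metis
    have dLS: "cls (\<delta> t) \<in> carrier LS" for t by (rule cls_closed[OF \<delta>_LF])
    have xs: "x = (\<Oplus>\<^bsub>LS\<^esub>t\<in>UNIV. f t \<odot>\<^bsub>LS\<^esub> cls (\<delta> t))"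
    proof (subst LS_eq_iff[OF x])
      show "(\<Oplus>\<^bsub>LS\<^esub>t\<in>UNIV. f t \<odot>\<^bsub>LS\<^esub> cls (\<delta> t)) \<in> carrier LS" using dLS by (intro LS.finsum_closed) auto
      show "\<forall>r. ev r x = ev r (\<Oplus>\<^bsub>LS\<^esub>t\<in>UNIV. f t \<odot>\<^bsub>LS\<^esub> cls (\<delta> t))"
      proof
        fix r
        have "ev r (\<Oplus>\<^bsub>LS\<^esub>t\<in>UNIV. f t \<odot>\<^bsub>LS\<^esub> cls (\<delta> t)) = (\<Sum>t\<in>UNIV. ev r (f t \<odot>\<^bsub>LS\<^esub> cls (\<delta> t)))"
          using linear_map_finsum[OF LS.seminormed_space_axioms _ conjunct1[OF ev_bounded[unfolded bounded_map_def]] finite_UNIV]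
            normed_complex_space dLS finite_UNIV by (simp add: normed_space_def)
        also have "\<dots> = (\<Sum>t\<in>UNIV. f t * \<delta> t r)"
          using bounded_mapD(3)[OF ev_bounded dLS] \<delta>_LF by simp
        also have "\<dots> = (\<Sum>t\<in>{r}. f t * \<delta> t r)"
          using finite_UNIV by (intro sum.mono_neutral_right) (auto simp: \<delta>_def)
        finally show "ev r x = ev r (\<Oplus>\<^bsub>LS\<^esub>t\<in>UNIV. f t \<odot>\<^bsub>LS\<^esub> cls (\<delta> t))" using f by (simp add: \<delta>_def)
      qed
    qed
    have aS: "bounded_map LS LS (nrm A a) a"
      using a OA_apply_le[OF a] S_linear[OF a] by (intro bounded_mapI) auto
    have ev_a: "ev r (a x) = (\<Sum>t\<in>UNIV. f t * coeff (r - t) a)" for r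
    proof -
      have d: "a (cls (\<delta> t)) = rho (- t) (a (cls (\<delta> 0)))" for t
      proof -
        have "cls (\<delta> t) = rho (- t) (cls (\<delta> 0))"
          unfolding rho_cls[OF \<delta>_LF] by (rule arg_cong[of _ _ cls]) (simp add: \<delta>_def)
        then show ?thesis using S_rho[OF a dLS[of 0]] by simp
      qed
      have ac: "a (cls (\<delta> t)) \<in> carrier LS" for t by (rule OA_apply_le(1)[OF a dLS])
      have "a x = (\<Oplus>\<^bsub>LS\<^esub>t\<in>UNIV. a (f t \<odot>\<^bsub>LS\<^esub> cls (\<delta> t)))"
        by (subst xs) (rule linear_map_finsum[OF LS.seminormed_space_axioms LS.seminormed_space_axioms
            conjunct1[OF aS[unfolded bounded_map_def]] finite_UNIV]; use dLS in auto)
      then have "ev r (a x) = (\<Sum>t\<in>UNIV. ev r (a (f t \<odot>\<^bsub>LS\<^esub> cls (\<delta> t))))"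
        using linear_map_finsum[OF LS.seminormed_space_axioms _ conjunct1[OF ev_bounded[unfolded bounded_map_def]] finite_UNIV,
            of "\<lambda>t. a (f t \<odot>\<^bsub>LS\<^esub> cls (\<delta> t))"]
          normed_complex_space ac S_linear(2)[OF a dLS] finite_UNIV by (simp add: normed_space_def)
      also have "\<dots> = (\<Sum>t\<in>UNIV. f t * coeff (r - t) a)"
      proof (rule sum.cong[OF refl])
        fix t
        have "ev r (a (f t \<odot>\<^bsub>LS\<^esub> cls (\<delta> t))) = f t * ev r (a (cls (\<delta> t)))"
          using S_linear(2)[OF a dLS] bounded_mapD(3)[OF ev_bounded ac] by simp
        also have "ev r (a (cls (\<delta> t))) = coeff (r - t) a"
          unfolding d[of t] ev_rho[OF ac[of 0]] coeff_def by simp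
        finally show "ev r (a (f t \<odot>\<^bsub>LS\<^esub> cls (\<delta> t))) = f t * coeff (r - t) a" .
      qed
      finally show ?thesis .
    qed
    have ev_s: "ev r (?s x) = (\<Sum>g\<in>UNIV. coeff g a * f (- g + r))" for r
    proof -
      have b: "bounded_map A complex_space ((1 / c) powr (1/p) * nrm LS x) (\<lambda>a. ev r (a x))"
        by (rule coefficient_functional[OF ev_bounded _ x]) simp
      have "ev r (?s x) = (\<Sum>g\<in>UNIV. ev r ((coeff g a \<odot>\<^bsub>A\<^esub> lam g) x))"
        using linear_map_finsum[OF A.seminormed_space_axioms _ conjunct1[OF b[unfolded bounded_map_def]] finite_UNIV,
            of "\<lambda>g. coeff g a \<odot>\<^bsub>A\<^esub> lam g"] normed_complex_space lamA finite_UNIV by (simp add: normed_space_def)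
      also have "\<dots> = (\<Sum>g\<in>UNIV. coeff g a * f (- g + r))"
        using bounded_mapD(3)[OF b lamA] ev_lam[OF x] f by simp
      finally show ?thesis .
    qed
    have "ev r (a x) = ev r (?s x)" for r
    proof -
      \<comment> \<open>Both sides are the same convolution, matched by g = r - t.\<close>
      have "(\<Sum>t\<in>UNIV. f t * coeff (r - t) a) = (\<Sum>g\<in>UNIV. coeff g a * f (- g + r))"
        by (rule sum.reindex_bij_witness[of _ "\<lambda>g. - g + r" "\<lambda>t. r - t"])
          (auto simp: diff_conv_add_uminus group_add_class.minus_add add.assoc simp del: add_uminus_conv_diff)
      then show ?thesis using ev_a ev_s by simp
    qed
    then show "a x = ?s x" using LS_eq_iff[OF OA_apply_le(1)[OF a x] OA_apply_le(1)[OF s x]] by blast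
  qed
qed

lemma finite_dimensional_A: "finite_dimensional A"
proof -
  have inj: "inj_on lam UNIV"
  proof (rule inj_onI)
    fix g h assume "lam g = lam h"
    then have "\<delta> g g = \<delta> h g" using coeff_lam[of g g] coeff_lam[of g h] by simp
    then show "g = h" by (simp add: \<delta>_def split: if_splits)
  qed
  have lamA: "lam g \<in> carrier A" for g using lam_S by (simp add: A_simps)
  show ?thesis
    unfolding finite_dimensional_def
  proof (intro exI[of _ "range lam"] conjI ballI)
    show "finite (range lam)" using finite_UNIV by simp
    show "range lam \<subseteq> carrier A" using lamA by auto
    fix a assume "a \<in> carrier A"
    then have "a \<in> S" by (simp add: A_simps)
    then have "a = (\<Oplus>\<^bsub>A\<^esub>g\<in>UNIV. coeff g a \<odot>\<^bsub>A\<^esub> lam g)" by (rule finite_expansion)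
    \<comment> \<open>\<open>finite_dimensional\<close> indexes coefficients by the spanning
      elements, so g has to be recovered from \<open>lam g\<close>.\<close>
    also have "\<dots> = (\<Oplus>\<^bsub>A\<^esub>g\<in>UNIV. coeff (inv_into UNIV lam (lam g)) a \<odot>\<^bsub>A\<^esub> lam g)"
      using lamA inj by (intro A.finsum_cong') auto
    also have "\<dots> = (\<Oplus>\<^bsub>A\<^esub>s\<in>range lam. coeff (inv_into UNIV lam s) a \<odot>\<^bsub>A\<^esub> s)"
      using inj lamA by (intro A.finsum_reindex[symmetric]) auto
    finally show "\<exists>k. a = (\<Oplus>\<^bsub>A\<^esub>s\<in>range lam. k s \<odot>\<^bsub>A\<^esub> s)"
      by (rule exI[of _ "\<lambda>s. coeff (inv_into UNIV lam s) a"])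
  qed
qed

lemma reflexive_A: "reflexive A"
  by (rule finite_dimensional_imp_reflexive[OF A.normed_space_axioms finite_dimensional_A])

lemma amenable_A: "amenable A"
proof -
  have lamA: "lam g \<in> carrier A" for g using lam_S by (simp add: A_simps)
  have assoc: "(lam g \<otimes>\<^bsub>A\<^esub> lam h) \<otimes>\<^bsub>A\<^esub> a = a" if "g + h = 0" "a \<in> carrier A" for g h a
    using that lam_mult lam_zero(1) by (simp add: A_simps(1))
  show ?thesis
  proof (rule A.amenable_if_finite_diagonal[OF reflexive_imp_complete[OF A.normed_space_axioms reflexive_A],
        of "UNIV :: 'g set" lam "\<lambda>g. lam (- g)" "1 / complex_of_nat (card (UNIV :: 'g set))"])
    show "finite (UNIV :: 'g set)" by (rule finite_UNIV)
    show "lam g \<in> carrier A" "lam (- g) \<in> carrier A" for g by (rule lamA)+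
    show "1 / complex_of_nat (card (UNIV :: 'g set)) * (\<Sum>g\<in>UNIV. \<kappa> ((lam g \<otimes>\<^bsub>A\<^esub> lam (- g)) \<otimes>\<^bsub>A\<^esub> a)) = \<kappa> a"
      if "\<kappa> \<in> carrier (dual A)" "a \<in> carrier A" for \<kappa> a
      using that(2) finite_UNIV by (simp add: assoc)
    fix B K a assume B: "bilinear_map A A complex_space K B" and a: "a \<in> carrier A"
    note BD = bilinear_mapD[OF B] and mult = bilinear_mapD[OF A.bilinear_mult]
    let ?P = "\<lambda>a. \<Sum>g\<in>UNIV. B (a \<otimes>\<^bsub>A\<^esub> lam g) (lam (- g))"
    let ?Q = "\<lambda>a. \<Sum>g\<in>UNIV. B (lam g) (lam (- g) \<otimes>\<^bsub>A\<^esub> a)"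
    have lin: "linear_map A complex_space ?P" "linear_map A complex_space ?Q"
      unfolding linear_map_def
      using BD(3-6) mult(1,3-6) lamA by (auto simp: sum.distrib sum_distrib_left)
    \<comment> \<open>For a = \<open>lam h\<close> invariance is the substitution g -> h + g in the
      sum. General a follow because both sides are linear in a and the \<open>lam h\<close> span
      \<open>A\<close>.\<close>
    have PQ: "?P (lam h) = ?Q (lam h)" for h
    proof -
      have "(\<Sum>g\<in>UNIV. B (lam (h + g)) (lam (- g))) = (\<Sum>g\<in>UNIV. B (lam g) (lam (- g + h)))"
        by (rule sum.reindex_bij_witness[of _ "\<lambda>g. - h + g" "\<lambda>g. h + g"])
          (auto simp: group_add_class.minus_add add.assoc simp del: add_uminus_conv_diff)
      then show ?thesis by (simp add: lam_mult)
    qed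
    have ex: "T a = (\<Sum>g\<in>UNIV. coeff g a * T (lam g))" if T: "linear_map A complex_space T" for T
    proof -
      have "T a = T (\<Oplus>\<^bsub>A\<^esub>g\<in>UNIV. coeff g a \<odot>\<^bsub>A\<^esub> lam g)"
        using finite_expansion[of a] a by (simp add: A_simps(1))
      also have "\<dots> = (\<Sum>g\<in>UNIV. T (coeff g a \<odot>\<^bsub>A\<^esub> lam g))"
        using linear_map_finsum[OF A.seminormed_space_axioms _ T finite_UNIV, of "\<lambda>g. coeff g a \<odot>\<^bsub>A\<^esub> lam g"]
          normed_complex_space lamA finite_UNIV by (simp add: normed_space_def)
      finally show ?thesis using T lamA by (simp add: linear_map_def)
    qed
    show "?P a = ?Q a" unfolding ex[OF lin(1)] ex[OF lin(2)] PQ ..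
  qed
qed

end

end

section \<open>The equivalence\<close>

context haar
begin

lemma finite_imp_atom:
  assumes "finite (UNIV :: 'g set)"
  shows "emeasure \<mu> {0} \<noteq> 0"
proof
  assume z: "emeasure \<mu> {0} = 0"
  have "emeasure \<mu> {t} = 0" for t
    using left_invariant[of "{0}" t] z by simp
  then have "emeasure \<mu> UNIV = 0"
    using emeasure_eq_sum_singleton[OF assms, of \<mu>] by simp
  then show False using nontrivial by simp
qed

end

theorem theoremC:
  fixes \<mu> :: "'g::{topological_group_add, t2_space} measure"
    and p :: real
    and A :: "(('g \<Rightarrow> complex) set \<Rightarrow> ('g \<Rightarrow> complex) set) nspace"
    and S :: "(('g \<Rightarrow> complex) set \<Rightarrow> ('g \<Rightarrow> complex) set) set"
  assumes "locally_compact_space (euclidean :: 'g topology)"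
    and "left_haar_measure \<mu>"
    and "1 < p"
    and "closed_subalgebra S (operator_algebra (Lp \<mu> p))"
    and "PF \<mu> p \<subseteq> S" and "S \<subseteq> CV \<mu> p"
    and "A = (operator_algebra (Lp \<mu> p))\<lparr>carrier := S\<rparr>"
  shows "(reflexive A \<and> amenable A \<longleftrightarrow> finite_dimensional A) \<and>
         (finite_dimensional A \<longleftrightarrow> finite (UNIV :: 'g set)) \<and>
         (reflexive A \<and> amenable A \<longrightarrow> finite (UNIV :: 'g set))"
proof -
  interpret haar \<mu> using assms(1,2) by (rule haar.intro)
  interpret Lp_setting \<mu> p using assms(3) by (rule Lp_setting.intro)
  interpret haar_Lp \<mu> p ..
  interpret convolution_algebra \<mu> p S A
    by unfold_locales (use assms in auto)
  \<comment> \<open>Each of the conditions forces an atom at the identity, so every implication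
    takes place on a discrete group.\<close>
  have atomic: "emeasure \<mu> {0} \<noteq> 0" if "reflexive A \<or> finite_dimensional A \<or> finite (UNIV :: 'g set)"
    using that nondiscrete_not_reflexive finite_dimensional_imp_reflexive[OF A.normed_space_axioms]
      finite_imp_atom by blast
  have discrete: "discrete_algebra \<mu> p S A" if "emeasure \<mu> {0} \<noteq> 0"
    using that by unfold_locales
  have 1: "finite (UNIV :: 'g set)" if "reflexive A" "amenable A"
    using discrete_algebra.reflexive_amenable_imp_finite[OF discrete] atomic that by blast
  have 2: "finite (UNIV :: 'g set)" if "finite_dimensional A"
    using discrete_algebra.finite_dimensional_imp_finite[OF discrete] atomic that by blast
  have 3: "reflexive A" "amenable A" "finite_dimensional A" if "finite (UNIV :: 'g set)"
    using discrete_algebra.reflexive_A[OF discrete] discrete_algebra.amenable_A[OF discrete]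
      discrete_algebra.finite_dimensional_A[OF discrete] atomic that by blast+
  show ?thesis using 1 2 3 by blast
qed

end
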